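(* Let $\mathbf k$ be an algebraically closed field of characteristic $p\geq 0$, and let $\mathcal C$ be a symmetric fusion category over $\mathbf k$ of rank $4$ with exactly $2$ self-dual simple objects (up to isomorphism). Then $\mathcal C$ is integral.
   Context: A fusion category over $\mathbf{k}$ is a $\mathbf{k}$-linear abelian rigid monoidal category with finite-dimensional Hom-spaces and $\operatorname{End}(\mathbf 1)\cong\mathbf k$, which is semisimple with finitely many isomorphism classes of simple objects; its rank is the number of these classes. It is symmetric if it is equipped with a braiding satisfying $c_{Y,X}c_{X,Y}=\operatorname{id}_{X\otimes Y}$ for all $X,Y$. An object $X$ is self-dual if $X\cong X^*$. A fusion category is integral if the Frobenius-Perron dimension of every simple object is an integer, where $\operatorname{FPdim}:\mathcal K(\mathcal C)\to\mathbb R$ is the unique ring homomorphism on the Grothendieck ring with $\operatorname{FPdim}(X)\ge 1$ for every nonzero object $X$. *)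

theory Defs
  imports "HOL-Algebra.Algebra" "HOL-Algebra.Algebraic_Closure_Type"
begin

text \<open>HOL-Algebra reserves \<open>X\<close> for the polynomial variable.\<close>

no_notation var (\<open>X\<index>\<close>)

text \<open>Conventions for tensor categories follow Etingof, Gelaki, Nikshych, Ostrik,
  \<^emph>\<open>Tensor Categories\<close>. Objects and morphisms are carrier-based, in the style of HOL-Algebra.\<close>

definition has_characteristic :: "('k, 'e) ring_scheme \<Rightarrow> nat \<Rightarrow> bool" where
  "has_characteristic K p \<longleftrightarrow>
    (\<forall>n::nat. add_pow K n \<one>\<^bsub>K\<^esub> = \<zero>\<^bsub>K\<^esub> \<longleftrightarrow> p dvd n)"


section \<open>Linear categories\<close>

text \<open>\<open>Hom C X Y\<close> is the Hom-space as a \<open>K\<close>-vector space; the ring multiplication and unit that the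
  record type \<^type>\<open>module\<close> carries along are not used. Hom-sets of different pairs of objects need
  not be disjoint, so notions about a morphism mention its source and target.
  Composition is written in the usual order: \<open>g \<cdot> f\<close> is \<open>g\<close> after \<open>f\<close>.\<close>

record ('k, 'o, 'm) linear_cat =
  Obj :: "'o set"
  Hom :: "'o \<Rightarrow> 'o \<Rightarrow> ('k, 'm) module"
  Comp :: "'m \<Rightarrow> 'm \<Rightarrow> 'm"  (infixl \<open>\<cdot>\<index>\<close> 70)
  Id :: "'o \<Rightarrow> 'm"

abbreviation arrows :: "('k, 'o, 'm, 'z) linear_cat_scheme \<Rightarrow> 'o \<Rightarrow> 'o \<Rightarrow> 'm set" where
  "arrows C X Y \<equiv> carrier (Hom C X Y)"

locale linear_category = field K for K :: "('k, 'e) ring_scheme" +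
  fixes C :: "('k, 'o, 'm, 'z) linear_cat_scheme" (structure)
  assumes Hom_module: "\<lbrakk>X \<in> Obj C; Y \<in> Obj C\<rbrakk> \<Longrightarrow> module K (Hom C X Y)"
    and Id_closed: "X \<in> Obj C \<Longrightarrow> Id C X \<in> arrows C X X"
    and Comp_closed:
      "\<lbrakk>X \<in> Obj C; Y \<in> Obj C; Z \<in> Obj C; f \<in> arrows C X Y; g \<in> arrows C Y Z\<rbrakk>
        \<Longrightarrow> g \<cdot> f \<in> arrows C X Z"
    and Comp_Id_right: "\<lbrakk>X \<in> Obj C; Y \<in> Obj C; f \<in> arrows C X Y\<rbrakk> \<Longrightarrow> f \<cdot> Id C X = f"
    and Comp_Id_left: "\<lbrakk>X \<in> Obj C; Y \<in> Obj C; f \<in> arrows C X Y\<rbrakk> \<Longrightarrow> Id C Y \<cdot> f = f"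
    and Comp_assoc:
      "\<lbrakk>W \<in> Obj C; X \<in> Obj C; Y \<in> Obj C; Z \<in> Obj C;
        f \<in> arrows C W X; g \<in> arrows C X Y; h \<in> arrows C Y Z\<rbrakk>
        \<Longrightarrow> (h \<cdot> g) \<cdot> f = h \<cdot> (g \<cdot> f)"
    and Comp_add_right:
      "\<lbrakk>X \<in> Obj C; Y \<in> Obj C; Z \<in> Obj C;
        f \<in> arrows C X Y; f' \<in> arrows C X Y; g \<in> arrows C Y Z\<rbrakk>
        \<Longrightarrow> g \<cdot> (f \<oplus>\<^bsub>Hom C X Y\<^esub> f') = (g \<cdot> f) \<oplus>\<^bsub>Hom C X Z\<^esub> (g \<cdot> f')"
    and Comp_add_left:
      "\<lbrakk>X \<in> Obj C; Y \<in> Obj C; Z \<in> Obj C;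
        f \<in> arrows C X Y; g \<in> arrows C Y Z; g' \<in> arrows C Y Z\<rbrakk>
        \<Longrightarrow> (g \<oplus>\<^bsub>Hom C Y Z\<^esub> g') \<cdot> f = (g \<cdot> f) \<oplus>\<^bsub>Hom C X Z\<^esub> (g' \<cdot> f)"
    and Comp_smult_right:
      "\<lbrakk>X \<in> Obj C; Y \<in> Obj C; Z \<in> Obj C;
        f \<in> arrows C X Y; g \<in> arrows C Y Z; c \<in> carrier K\<rbrakk>
        \<Longrightarrow> g \<cdot> (c \<odot>\<^bsub>Hom C X Y\<^esub> f) = c \<odot>\<^bsub>Hom C X Z\<^esub> (g \<cdot> f)"
    and Comp_smult_left:
      "\<lbrakk>X \<in> Obj C; Y \<in> Obj C; Z \<in> Obj C;
        f \<in> arrows C X Y; g \<in> arrows C Y Z; c \<in> carrier K\<rbrakk>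
        \<Longrightarrow> (c \<odot>\<^bsub>Hom C Y Z\<^esub> g) \<cdot> f = c \<odot>\<^bsub>Hom C X Z\<^esub> (g \<cdot> f)"

definition inverse_arrows ::
    "('k, 'o, 'm, 'z) linear_cat_scheme \<Rightarrow> 'o \<Rightarrow> 'o \<Rightarrow> 'm \<Rightarrow> 'm \<Rightarrow> bool" where
  "inverse_arrows C X Y f g \<longleftrightarrow>
    f \<in> arrows C X Y \<and> g \<in> arrows C Y X \<and> g \<cdot>\<^bsub>C\<^esub> f = Id C X \<and> f \<cdot>\<^bsub>C\<^esub> g = Id C Y"

definition is_iso :: "('k, 'o, 'm, 'z) linear_cat_scheme \<Rightarrow> 'o \<Rightarrow> 'o \<Rightarrow> 'm \<Rightarrow> bool" where
  "is_iso C X Y f \<longleftrightarrow> (\<exists>g. inverse_arrows C X Y f g)"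

definition inv_arrow :: "('k, 'o, 'm, 'z) linear_cat_scheme \<Rightarrow> 'o \<Rightarrow> 'o \<Rightarrow> 'm \<Rightarrow> 'm" where
  "inv_arrow C X Y f = (THE g. inverse_arrows C X Y f g)"

definition isomorphic :: "('k, 'o, 'm, 'z) linear_cat_scheme \<Rightarrow> 'o \<Rightarrow> 'o \<Rightarrow> bool" where
  "isomorphic C X Y \<longleftrightarrow> (\<exists>f. is_iso C X Y f)"

definition iso_class :: "('k, 'o, 'm, 'z) linear_cat_scheme \<Rightarrow> 'o \<Rightarrow> 'o set" where
  "iso_class C X = {Y \<in> Obj C. isomorphic C X Y}"

definition iso_classes :: "('k, 'o, 'm, 'z) linear_cat_scheme \<Rightarrow> 'o set set" where
  "iso_classes C = iso_class C ` Obj C"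


section \<open>Abelian and semisimple categories\<close>

definition zero_object :: "('k, 'o, 'm, 'z) linear_cat_scheme \<Rightarrow> 'o \<Rightarrow> bool" where
  "zero_object C Z \<longleftrightarrow> Z \<in> Obj C \<and>
    (\<forall>X\<in>Obj C. arrows C Z X = {\<zero>\<^bsub>Hom C Z X\<^esub>} \<and> arrows C X Z = {\<zero>\<^bsub>Hom C X Z\<^esub>})"

definition monic :: "('k, 'o, 'm, 'z) linear_cat_scheme \<Rightarrow> 'o \<Rightarrow> 'o \<Rightarrow> 'm \<Rightarrow> bool" where
  "monic C X Y f \<longleftrightarrow> f \<in> arrows C X Y \<and>
    (\<forall>W\<in>Obj C. \<forall>g\<in>arrows C W X. \<forall>h\<in>arrows C W X. f \<cdot>\<^bsub>C\<^esub> g = f \<cdot>\<^bsub>C\<^esub> h \<longrightarrow> g = h)"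

definition epic :: "('k, 'o, 'm, 'z) linear_cat_scheme \<Rightarrow> 'o \<Rightarrow> 'o \<Rightarrow> 'm \<Rightarrow> bool" where
  "epic C X Y f \<longleftrightarrow> f \<in> arrows C X Y \<and>
    (\<forall>Z\<in>Obj C. \<forall>g\<in>arrows C Y Z. \<forall>h\<in>arrows C Y Z. g \<cdot>\<^bsub>C\<^esub> f = h \<cdot>\<^bsub>C\<^esub> f \<longrightarrow> g = h)"

text \<open>\<open>k : A \<rightarrow> X\<close> is a kernel of \<open>f : X \<rightarrow> Y\<close>; \<open>q : Y \<rightarrow> B\<close> is a cokernel of \<open>f : X \<rightarrow> Y\<close>.\<close>

definition is_kernel ::
    "('k, 'o, 'm, 'z) linear_cat_scheme \<Rightarrow> 'o \<Rightarrow> 'o \<Rightarrow> 'o \<Rightarrow> 'm \<Rightarrow> 'm \<Rightarrow> bool" where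
  "is_kernel C A X Y k f \<longleftrightarrow>
    k \<in> arrows C A X \<and> f \<in> arrows C X Y \<and> f \<cdot>\<^bsub>C\<^esub> k = \<zero>\<^bsub>Hom C A Y\<^esub> \<and>
    (\<forall>W\<in>Obj C. \<forall>g\<in>arrows C W X. f \<cdot>\<^bsub>C\<^esub> g = \<zero>\<^bsub>Hom C W Y\<^esub> \<longrightarrow>
      (\<exists>!u. u \<in> arrows C W A \<and> k \<cdot>\<^bsub>C\<^esub> u = g))"

definition is_cokernel ::
    "('k, 'o, 'm, 'z) linear_cat_scheme \<Rightarrow> 'o \<Rightarrow> 'o \<Rightarrow> 'o \<Rightarrow> 'm \<Rightarrow> 'm \<Rightarrow> bool" where
  "is_cokernel C X Y B f q \<longleftrightarrow>
    f \<in> arrows C X Y \<and> q \<in> arrows C Y B \<and> q \<cdot>\<^bsub>C\<^esub> f = \<zero>\<^bsub>Hom C X B\<^esub> \<and>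
    (\<forall>Z\<in>Obj C. \<forall>g\<in>arrows C Y Z. g \<cdot>\<^bsub>C\<^esub> f = \<zero>\<^bsub>Hom C X Z\<^esub> \<longrightarrow>
      (\<exists>!u. u \<in> arrows C B Z \<and> u \<cdot>\<^bsub>C\<^esub> q = g))"

definition short_exact ::
    "('k, 'o, 'm, 'z) linear_cat_scheme \<Rightarrow> 'o \<Rightarrow> 'o \<Rightarrow> 'o \<Rightarrow> 'm \<Rightarrow> 'm \<Rightarrow> bool" where
  "short_exact C X Y Z f g \<longleftrightarrow> is_kernel C X Y Z f g \<and> is_cokernel C X Y Z f g"

definition is_direct_sum ::
    "('k, 'o, 'm, 'z) linear_cat_scheme \<Rightarrow> nat \<Rightarrow> (nat \<Rightarrow> 'o) \<Rightarrow> 'o \<Rightarrow> bool" where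
  "is_direct_sum C n S X \<longleftrightarrow> X \<in> Obj C \<and> (\<forall>i<n. S i \<in> Obj C) \<and>
    (\<exists>inj prj.
      (\<forall>i<n. inj i \<in> arrows C (S i) X \<and> prj i \<in> arrows C X (S i)) \<and>
      (\<forall>i<n. \<forall>j<n. prj i \<cdot>\<^bsub>C\<^esub> inj j = (if i = j then Id C (S i) else \<zero>\<^bsub>Hom C (S j) (S i)\<^esub>)) \<and>
      (\<Oplus>\<^bsub>Hom C X X\<^esub>i\<in>{..<n}. inj i \<cdot>\<^bsub>C\<^esub> prj i) = Id C X)"

locale abelian_linear_category = linear_category +
  assumes zero_object_exists: "\<exists>Z. zero_object C Z"
    and direct_sum_exists:
      "\<lbrakk>X \<in> Obj C; Y \<in> Obj C\<rbrakk> \<Longrightarrow> \<exists>S. is_direct_sum C 2 (\<lambda>i. if i = 0 then X else Y) S"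
    and kernel_exists:
      "\<lbrakk>X \<in> Obj C; Y \<in> Obj C; f \<in> arrows C X Y\<rbrakk> \<Longrightarrow> \<exists>A\<in>Obj C. \<exists>k. is_kernel C A X Y k f"
    and cokernel_exists:
      "\<lbrakk>X \<in> Obj C; Y \<in> Obj C; f \<in> arrows C X Y\<rbrakk> \<Longrightarrow> \<exists>B\<in>Obj C. \<exists>q. is_cokernel C X Y B f q"
    and monic_is_kernel:
      "\<lbrakk>X \<in> Obj C; Y \<in> Obj C; monic C X Y f\<rbrakk> \<Longrightarrow> \<exists>Z\<in>Obj C. \<exists>g. is_kernel C X Y Z f g"
    and epic_is_cokernel:
      "\<lbrakk>X \<in> Obj C; Y \<in> Obj C; epic C X Y f\<rbrakk> \<Longrightarrow> \<exists>W\<in>Obj C. \<exists>g. is_cokernel C W X Y g f"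

definition simple_object :: "('k, 'o, 'm, 'z) linear_cat_scheme \<Rightarrow> 'o \<Rightarrow> bool" where
  "simple_object C X \<longleftrightarrow> X \<in> Obj C \<and> \<not> zero_object C X \<and>
    (\<forall>A\<in>Obj C. \<forall>i. monic C A X i \<longrightarrow> zero_object C A \<or> is_iso C A X i)"

definition semisimple :: "('k, 'o, 'm, 'z) linear_cat_scheme \<Rightarrow> bool" where
  "semisimple C \<longleftrightarrow>
    (\<forall>X\<in>Obj C. \<exists>n S. (\<forall>i<n. simple_object C (S i)) \<and> is_direct_sum C n S X)"

definition simple_classes :: "('k, 'o, 'm, 'z) linear_cat_scheme \<Rightarrow> 'o set set" where
  "simple_classes C = iso_class C ` {X. simple_object C X}"

definition cat_rank :: "('k, 'o, 'm, 'z) linear_cat_scheme \<Rightarrow> nat" where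
  "cat_rank C = card (simple_classes C)"

definition finite_dimensional :: "('k, 'e) ring_scheme \<Rightarrow> ('k, 'm) module \<Rightarrow> bool" where
  "finite_dimensional K M \<longleftrightarrow> (\<exists>B. finite B \<and> B \<subseteq> carrier M \<and>
    (\<forall>v\<in>carrier M. \<exists>c\<in>B \<rightarrow> carrier K. v = (\<Oplus>\<^bsub>M\<^esub>b\<in>B. c b \<odot>\<^bsub>M\<^esub> b)))"

definition End_algebra :: "('k, 'o, 'm, 'z) linear_cat_scheme \<Rightarrow> 'o \<Rightarrow> ('k, 'm) module" where
  "End_algebra C X = (Hom C X X)\<lparr>monoid.mult := Comp C, monoid.one := Id C X\<rparr>"


section \<open>Monoidal categories\<close>

record ('k, 'o, 'm) monoidal_cat = "('k, 'o, 'm) linear_cat" +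
  TensorO :: "'o \<Rightarrow> 'o \<Rightarrow> 'o"  (infixr \<open>\<boxtimes>\<index>\<close> 75)
  TensorM :: "'m \<Rightarrow> 'm \<Rightarrow> 'm"  (infixr \<open>\<boxdot>\<index>\<close> 75)
  Unit :: "'o"  (\<open>\<bbbI>\<index>\<close>)
  Assoc :: "'o \<Rightarrow> 'o \<Rightarrow> 'o \<Rightarrow> 'm"
  LUnit :: "'o \<Rightarrow> 'm"
  RUnit :: "'o \<Rightarrow> 'm"

text \<open>The structure morphisms are \<open>Assoc C X Y Z : (X \<otimes> Y) \<otimes> Z \<rightarrow> X \<otimes> (Y \<otimes> Z)\<close>,
  \<open>LUnit C X : 1 \<otimes> X \<rightarrow> X\<close> and \<open>RUnit C X : X \<otimes> 1 \<rightarrow> X\<close>. As usual for \<open>K\<close>-linear monoidal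
  categories, the tensor product is \<open>K\<close>-bilinear on morphisms.\<close>

locale linear_monoidal_category = linear_category K C
  for K :: "('k, 'e) ring_scheme" and C :: "('k, 'o, 'm, 'z) monoidal_cat_scheme" (structure) +
  assumes TensorO_closed: "\<lbrakk>X \<in> Obj C; Y \<in> Obj C\<rbrakk> \<Longrightarrow> X \<boxtimes> Y \<in> Obj C"
    and Unit_closed: "\<bbbI> \<in> Obj C"
    and TensorM_closed:
      "\<lbrakk>X \<in> Obj C; X' \<in> Obj C; Y \<in> Obj C; Y' \<in> Obj C; f \<in> arrows C X X'; g \<in> arrows C Y Y'\<rbrakk>
        \<Longrightarrow> f \<boxdot> g \<in> arrows C (X \<boxtimes> Y) (X' \<boxtimes> Y')"
    and TensorM_Id: "\<lbrakk>X \<in> Obj C; Y \<in> Obj C\<rbrakk> \<Longrightarrow> Id C X \<boxdot> Id C Y = Id C (X \<boxtimes> Y)"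
    and TensorM_Comp:
      "\<lbrakk>X \<in> Obj C; X' \<in> Obj C; X'' \<in> Obj C; Y \<in> Obj C; Y' \<in> Obj C; Y'' \<in> Obj C;
        f \<in> arrows C X X'; f' \<in> arrows C X' X''; g \<in> arrows C Y Y'; g' \<in> arrows C Y' Y''\<rbrakk>
        \<Longrightarrow> (f' \<cdot> f) \<boxdot> (g' \<cdot> g) = (f' \<boxdot> g') \<cdot> (f \<boxdot> g)"
    and TensorM_add_left:
      "\<lbrakk>X \<in> Obj C; X' \<in> Obj C; Y \<in> Obj C; Y' \<in> Obj C;
        f \<in> arrows C X X'; f' \<in> arrows C X X'; g \<in> arrows C Y Y'\<rbrakk>
        \<Longrightarrow> (f \<oplus>\<^bsub>Hom C X X'\<^esub> f') \<boxdot> g = (f \<boxdot> g) \<oplus>\<^bsub>Hom C (X \<boxtimes> Y) (X' \<boxtimes> Y')\<^esub> (f' \<boxdot> g)"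
    and TensorM_add_right:
      "\<lbrakk>X \<in> Obj C; X' \<in> Obj C; Y \<in> Obj C; Y' \<in> Obj C;
        f \<in> arrows C X X'; g \<in> arrows C Y Y'; g' \<in> arrows C Y Y'\<rbrakk>
        \<Longrightarrow> f \<boxdot> (g \<oplus>\<^bsub>Hom C Y Y'\<^esub> g') = (f \<boxdot> g) \<oplus>\<^bsub>Hom C (X \<boxtimes> Y) (X' \<boxtimes> Y')\<^esub> (f \<boxdot> g')"
    and TensorM_smult_left:
      "\<lbrakk>X \<in> Obj C; X' \<in> Obj C; Y \<in> Obj C; Y' \<in> Obj C;
        f \<in> arrows C X X'; g \<in> arrows C Y Y'; c \<in> carrier K\<rbrakk>
        \<Longrightarrow> (c \<odot>\<^bsub>Hom C X X'\<^esub> f) \<boxdot> g = c \<odot>\<^bsub>Hom C (X \<boxtimes> Y) (X' \<boxtimes> Y')\<^esub> (f \<boxdot> g)"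
    and TensorM_smult_right:
      "\<lbrakk>X \<in> Obj C; X' \<in> Obj C; Y \<in> Obj C; Y' \<in> Obj C;
        f \<in> arrows C X X'; g \<in> arrows C Y Y'; c \<in> carrier K\<rbrakk>
        \<Longrightarrow> f \<boxdot> (c \<odot>\<^bsub>Hom C Y Y'\<^esub> g) = c \<odot>\<^bsub>Hom C (X \<boxtimes> Y) (X' \<boxtimes> Y')\<^esub> (f \<boxdot> g)"
    and Assoc_iso:
      "\<lbrakk>X \<in> Obj C; Y \<in> Obj C; Z \<in> Obj C\<rbrakk>
        \<Longrightarrow> is_iso C ((X \<boxtimes> Y) \<boxtimes> Z) (X \<boxtimes> (Y \<boxtimes> Z)) (Assoc C X Y Z)"
    and Assoc_natural:
      "\<lbrakk>X \<in> Obj C; X' \<in> Obj C; Y \<in> Obj C; Y' \<in> Obj C; Z \<in> Obj C; Z' \<in> Obj C;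
        f \<in> arrows C X X'; g \<in> arrows C Y Y'; h \<in> arrows C Z Z'\<rbrakk>
        \<Longrightarrow> Assoc C X' Y' Z' \<cdot> ((f \<boxdot> g) \<boxdot> h) = (f \<boxdot> (g \<boxdot> h)) \<cdot> Assoc C X Y Z"
    and LUnit_iso: "X \<in> Obj C \<Longrightarrow> is_iso C (\<bbbI> \<boxtimes> X) X (LUnit C X)"
    and LUnit_natural:
      "\<lbrakk>X \<in> Obj C; Y \<in> Obj C; f \<in> arrows C X Y\<rbrakk>
        \<Longrightarrow> LUnit C Y \<cdot> (Id C \<bbbI> \<boxdot> f) = f \<cdot> LUnit C X"
    and RUnit_iso: "X \<in> Obj C \<Longrightarrow> is_iso C (X \<boxtimes> \<bbbI>) X (RUnit C X)"
    and RUnit_natural: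
      "\<lbrakk>X \<in> Obj C; Y \<in> Obj C; f \<in> arrows C X Y\<rbrakk>
        \<Longrightarrow> RUnit C Y \<cdot> (f \<boxdot> Id C \<bbbI>) = f \<cdot> RUnit C X"
    and pentagon:
      "\<lbrakk>W \<in> Obj C; X \<in> Obj C; Y \<in> Obj C; Z \<in> Obj C\<rbrakk>
        \<Longrightarrow> Assoc C W X (Y \<boxtimes> Z) \<cdot> Assoc C (W \<boxtimes> X) Y Z =
          (Id C W \<boxdot> Assoc C X Y Z) \<cdot> Assoc C W (X \<boxtimes> Y) Z \<cdot> (Assoc C W X Y \<boxdot> Id C Z)"
    and triangle:
      "\<lbrakk>X \<in> Obj C; Y \<in> Obj C\<rbrakk>
        \<Longrightarrow> (Id C X \<boxdot> LUnit C Y) \<cdot> Assoc C X \<bbbI> Y = RUnit C X \<boxdot> Id C Y"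

text \<open>\<open>is_left_dual C X D\<close>: \<open>D\<close> is a left dual \<open>X\<^sup>*\<close> of \<open>X\<close>; equivalently \<open>X\<close> is a right dual of
  \<open>D\<close>. Left duals are unique up to isomorphism.\<close>

definition is_left_dual :: "('k, 'o, 'm, 'z) monoidal_cat_scheme \<Rightarrow> 'o \<Rightarrow> 'o \<Rightarrow> bool" where
  "is_left_dual C X D \<longleftrightarrow> X \<in> Obj C \<and> D \<in> Obj C \<and>
    (\<exists>ev \<in> arrows C (D \<boxtimes>\<^bsub>C\<^esub> X) \<bbbI>\<^bsub>C\<^esub>. \<exists>coev \<in> arrows C \<bbbI>\<^bsub>C\<^esub> (X \<boxtimes>\<^bsub>C\<^esub> D).
      RUnit C X \<cdot>\<^bsub>C\<^esub> (Id C X \<boxdot>\<^bsub>C\<^esub> ev) \<cdot>\<^bsub>C\<^esub> Assoc C X D X \<cdot>\<^bsub>C\<^esub> (coev \<boxdot>\<^bsub>C\<^esub> Id C X)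
        \<cdot>\<^bsub>C\<^esub> inv_arrow C (\<bbbI>\<^bsub>C\<^esub> \<boxtimes>\<^bsub>C\<^esub> X) X (LUnit C X) = Id C X \<and>
      LUnit C D \<cdot>\<^bsub>C\<^esub> (ev \<boxdot>\<^bsub>C\<^esub> Id C D)
        \<cdot>\<^bsub>C\<^esub> inv_arrow C ((D \<boxtimes>\<^bsub>C\<^esub> X) \<boxtimes>\<^bsub>C\<^esub> D) (D \<boxtimes>\<^bsub>C\<^esub> (X \<boxtimes>\<^bsub>C\<^esub> D)) (Assoc C D X D)
        \<cdot>\<^bsub>C\<^esub> (Id C D \<boxdot>\<^bsub>C\<^esub> coev) \<cdot>\<^bsub>C\<^esub> inv_arrow C (D \<boxtimes>\<^bsub>C\<^esub> \<bbbI>\<^bsub>C\<^esub>) D (RUnit C D) = Id C D)"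

definition rigid :: "('k, 'o, 'm, 'z) monoidal_cat_scheme \<Rightarrow> bool" where
  "rigid C \<longleftrightarrow> (\<forall>X\<in>Obj C. (\<exists>D. is_left_dual C X D) \<and> (\<exists>D. is_left_dual C D X))"

definition self_dual :: "('k, 'o, 'm, 'z) monoidal_cat_scheme \<Rightarrow> 'o \<Rightarrow> bool" where
  "self_dual C X \<longleftrightarrow> (\<exists>D. is_left_dual C X D \<and> isomorphic C X D)"


section \<open>Symmetric fusion categories\<close>

text \<open>An isomorphism of \<open>K\<close>-algebras from \<open>K\<close> to \<open>End(1)\<close> is necessarily \<open>c \<mapsto> c \<cdot> id\<close>, which is how
  \<open>End(1) \<cong> K\<close> is expressed.\<close>

locale fusion_category =
  linear_monoidal_category K C + abelian_linear_category K C
  for K :: "('k, 'e) ring_scheme" and C :: "('k, 'o, 'm, 'z) monoidal_cat_scheme" (structure) +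
  assumes rigid: "rigid C"
    and Hom_finite_dimensional:
      "\<lbrakk>X \<in> Obj C; Y \<in> Obj C\<rbrakk> \<Longrightarrow> finite_dimensional K (Hom C X Y)"
    and End_Unit: "(\<lambda>c. c \<odot>\<^bsub>Hom C \<bbbI> \<bbbI>\<^esub> Id C \<bbbI>) \<in> ring_iso K (End_algebra C \<bbbI>)"
    and semisimple: "semisimple C"
    and finite_simple_classes: "finite (simple_classes C)"

record ('k, 'o, 'm) braided_cat = "('k, 'o, 'm) monoidal_cat" +
  Braid :: "'o \<Rightarrow> 'o \<Rightarrow> 'm"

text \<open>\<open>Braid C X Y : X \<otimes> Y \<rightarrow> Y \<otimes> X\<close>.\<close>

locale symmetric_fusion_category = fusion_category K C
  for K :: "('k, 'e) ring_scheme" and C :: "('k, 'o, 'm, 'z) braided_cat_scheme" (structure) +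
  assumes Braid_iso: "\<lbrakk>X \<in> Obj C; Y \<in> Obj C\<rbrakk> \<Longrightarrow> is_iso C (X \<boxtimes> Y) (Y \<boxtimes> X) (Braid C X Y)"
    and Braid_natural:
      "\<lbrakk>X \<in> Obj C; X' \<in> Obj C; Y \<in> Obj C; Y' \<in> Obj C; f \<in> arrows C X X'; g \<in> arrows C Y Y'\<rbrakk>
        \<Longrightarrow> Braid C X' Y' \<cdot> (f \<boxdot> g) = (g \<boxdot> f) \<cdot> Braid C X Y"
    and hexagon1:
      "\<lbrakk>X \<in> Obj C; Y \<in> Obj C; Z \<in> Obj C\<rbrakk>
        \<Longrightarrow> Assoc C Y Z X \<cdot> Braid C X (Y \<boxtimes> Z) \<cdot> Assoc C X Y Z =
          (Id C Y \<boxdot> Braid C X Z) \<cdot> Assoc C Y X Z \<cdot> (Braid C X Y \<boxdot> Id C Z)"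
    and hexagon2:
      "\<lbrakk>X \<in> Obj C; Y \<in> Obj C; Z \<in> Obj C\<rbrakk>
        \<Longrightarrow> inv_arrow C ((Z \<boxtimes> X) \<boxtimes> Y) (Z \<boxtimes> (X \<boxtimes> Y)) (Assoc C Z X Y) \<cdot> Braid C (X \<boxtimes> Y) Z
            \<cdot> inv_arrow C ((X \<boxtimes> Y) \<boxtimes> Z) (X \<boxtimes> (Y \<boxtimes> Z)) (Assoc C X Y Z) =
          (Braid C X Z \<boxdot> Id C Y)
            \<cdot> inv_arrow C ((X \<boxtimes> Z) \<boxtimes> Y) (X \<boxtimes> (Z \<boxtimes> Y)) (Assoc C X Z Y) \<cdot> (Id C X \<boxdot> Braid C Y Z)"
    and symmetric:
      "\<lbrakk>X \<in> Obj C; Y \<in> Obj C\<rbrakk> \<Longrightarrow> Braid C Y X \<cdot> Braid C X Y = Id C (X \<boxtimes> Y)"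


section \<open>Grothendieck ring and Frobenius-Perron dimension\<close>

text \<open>Tensor product of isomorphism classes: \<open>[X] [Y] = [X \<otimes> Y]\<close>.\<close>

definition class_tensor ::
    "('k, 'o, 'm, 'z) monoidal_cat_scheme \<Rightarrow> 'o set \<Rightarrow> 'o set \<Rightarrow> 'o set" where
  "class_tensor C P Q = {Z \<in> Obj C. \<exists>X\<in>P. \<exists>Y\<in>Q. isomorphic C (X \<boxtimes>\<^bsub>C\<^esub> Y) Z}"

text \<open>The monoid ring over \<open>\<int>\<close> of the monoid of isomorphism classes of objects; its additive group
  is \<^const>\<open>free_Abelian_group\<close> on these classes. The Grothendieck ring is its quotient by the relations
  \<open>[Y] = [X] + [Z]\<close> for short exact sequences \<open>0 \<rightarrow> X \<rightarrow> Y \<rightarrow> Z \<rightarrow> 0\<close>. As the tensor product is exact,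
  the ideal generated by these relations is also the additive subgroup they generate.\<close>

definition class_ring :: "('k, 'o, 'm, 'z) monoidal_cat_scheme \<Rightarrow> ('o set \<Rightarrow>\<^sub>0 int) ring" where
  "class_ring C = \<lparr>
    carrier = carrier (free_Abelian_group (iso_classes C)),
    monoid.mult = (\<lambda>a b. \<Sum>P\<in>Poly_Mapping.keys a. \<Sum>Q\<in>Poly_Mapping.keys b.
      Poly_Mapping.single (class_tensor C P Q) (Poly_Mapping.lookup a P * Poly_Mapping.lookup b Q)),
    monoid.one = Poly_Mapping.single (iso_class C \<bbbI>\<^bsub>C\<^esub>) 1,
    ring.zero = 0,
    ring.add = (+)\<rparr>"

abbreviation obj_gen :: "('k, 'o, 'm, 'z) monoidal_cat_scheme \<Rightarrow> 'o \<Rightarrow> 'o set \<Rightarrow>\<^sub>0 int" where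
  "obj_gen C X \<equiv> Poly_Mapping.single (iso_class C X) 1"

definition exact_relations ::
    "('k, 'o, 'm, 'z) monoidal_cat_scheme \<Rightarrow> ('o set \<Rightarrow>\<^sub>0 int) set" where
  "exact_relations C = {obj_gen C Y - obj_gen C X - obj_gen C Z | X Y Z.
    X \<in> Obj C \<and> Y \<in> Obj C \<and> Z \<in> Obj C \<and> (\<exists>f g. short_exact C X Y Z f g)}"

definition grothendieck_ideal ::
    "('k, 'o, 'm, 'z) monoidal_cat_scheme \<Rightarrow> ('o set \<Rightarrow>\<^sub>0 int) set" where
  "grothendieck_ideal C = Idl\<^bsub>class_ring C\<^esub> (exact_relations C)"

definition grothendieck_ring ::
    "('k, 'o, 'm, 'z) monoidal_cat_scheme \<Rightarrow> ('o set \<Rightarrow>\<^sub>0 int) set ring" where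
  "grothendieck_ring C = class_ring C Quot grothendieck_ideal C"

definition obj_class ::
    "('k, 'o, 'm, 'z) monoidal_cat_scheme \<Rightarrow> 'o \<Rightarrow> ('o set \<Rightarrow>\<^sub>0 int) set" where
  "obj_class C X = grothendieck_ideal C +>\<^bsub>class_ring C\<^esub> obj_gen C X"

text \<open>Extensionality only pins down the values outside the carrier, so that the description operator
  refers to uniqueness as a function on the Grothendieck ring.\<close>

definition FPdim ::
    "('k, 'o, 'm, 'z) monoidal_cat_scheme \<Rightarrow> ('o set \<Rightarrow>\<^sub>0 int) set \<Rightarrow> real" where
  "FPdim C = (THE d.
    d \<in> ring_hom (grothendieck_ring C) (ring_of_type_algebra :: real ring) \<and>
    d \<in> extensional (carrier (grothendieck_ring C)) \<and>
    (\<forall>X\<in>Obj C. \<not> zero_object C X \<longrightarrow> d (obj_class C X) \<ge> 1))"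

definition integral_category :: "('k, 'o, 'm, 'z) monoidal_cat_scheme \<Rightarrow> bool" where
  "integral_category C \<longleftrightarrow> (\<forall>X. simple_object C X \<longrightarrow> FPdim C (obj_class C X) \<in> \<int>)"

end

theory Submission
  imports Defs
    "Jordan_Normal_Form.Missing_VectorSpace"
    "HOL-Analysis.Brouwer_Fixpoint"
    "HOL-Analysis.Cartesian_Euclidean_Space"
    "HOL-Computational_Algebra.Polynomial"
begin

text \<open>Write the simple objects as \<open>1, Y, X, X\<^sup>*\<close>. The trace of the symmetry on \<open>Hom(Z, S \<otimes> S)\<close>, counted as
  twice the dimension of the fixed space minus the whole dimension so that characteristic 2 is allowed, gives a ring
  endomorphism \<open>\<psi>\<close> of the Grothendieck ring, a second Adams operation. If the Frobenius-Perron character were not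
  integral, it would be real quadratic, whereas the two characters separating \<open>X\<close> from \<open>X\<^sup>*\<close> are imaginary
  quadratic, so \<open>\<psi>\<close> cannot mix the two kinds. Comparing coefficients leaves only the near-group rules \<open>XY = Y\<close>,
  \<open>X\<^sup>2 = X\<^sup>*\<close>, \<open>Y\<^sup>2 = 1 + X + X\<^sup>* + 3Y\<close>.

  To exclude them, fix \<open>\<phi> : X \<otimes> Y \<cong> Y\<close>. Conjugation by \<open>\<phi>\<close> acts on \<open>Hom(Y \<otimes> N, Y)\<close>, and the dimensions of its
  eigenspaces are additive in \<open>N\<close>. For \<open>N = Y \<otimes> Y\<^sup>*\<close> the adjunction turns them into eigenspaces on \<open>End(Y \<otimes> Y)\<close>,
  which are bounded from above by triangularizing the action on the three-dimensional space \<open>Hom(Y \<otimes> Y, Y)\<close>. The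
  resulting inequalities between the multiplicities of the three eigenvalues are inconsistent.

  Existence and uniqueness of the Frobenius-Perron dimension follow from the Perron theorem for the matrix of
  multiplication by the sum of all simple objects.\<close>


text \<open>In characteristic zero a symmetric fusion category is integral because it has a super
  fibre functor. In characteristic p this fails: the Fibonacci fusion rules occur in characteristic
  5. So integrality must come from the rank and the count of self-dual objects, with the second
  Adams operation as the part of the symmetry visible in the fusion ring.

  Numbers alone do not suffice. In the ring that survives, the Perron value satisfies
  \<open>y * y = 3 + 3 * y\<close>, and \<open>\<psi>\<close> may send \<open>Y\<close> to
  \<open>1 - Y + X + X'\<close>, whose value is \<open>3 - y\<close>: it acts as Galois conjugation
  and violates nothing. This case is excluded by morphisms.

  Three facts decide it: \<open>Y \<otimes> Y\<close> contains \<open>Y\<close> three times, which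
  gives three diagonal entries; the unit and \<open>X' = X \<otimes> X\<close> both contribute to
  eigenvalue 1, the second because the braiding of \<open>X\<close> with itself is a sign; on the
  rest of \<open>Y \<otimes> Y\<close> an eigenvalue is a cube root of unity. As
  \<open>\<phi>\<close> is not normalized and conjugation by it is not known to be diagonalizable,
  eigenspaces are bounded instead of computing traces.\<close>

abbreviation (input) add_sub ("(_ \<oplus>\<^sub>_/ _)" [65, 1000, 66] 65) where "add_sub x G y == x \<oplus>\<^bsub>G\<^esub> y"
abbreviation (input) mult_sub ("(_ \<otimes>\<^sub>_/ _)" [70, 1000, 71] 70) where "mult_sub x G y == x \<otimes>\<^bsub>G\<^esub> y"
abbreviation (input) smult_sub ("(_ \<odot>\<^sub>_/ _)" [70, 1000, 71] 70) where "smult_sub x G y == x \<odot>\<^bsub>G\<^esub> y"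
abbreviation (input) minus_sub ("(\<ominus>\<^sub>_/ _)" [1000, 81] 80) where "minus_sub G x == \<ominus>\<^bsub>G\<^esub> x"
abbreviation (input) zero_sub ("\<zero>\<^sub>_" [1000] 1000) where "zero_sub G == \<zero>\<^bsub>G\<^esub>"
abbreviation (input) one_sub ("\<one>\<^sub>_" [1000] 1000) where "one_sub G == \<one>\<^bsub>G\<^esub>"
notation TensorO (infixr "><\<index>" 75)

section \<open>Dimensions of subspaces\<close>

definition subdim :: "('k, 'e) ring_scheme => ('k, 'm, 'z) module_scheme => 'm set => nat" where
 "subdim K V W = vectorspace.dim K (V\<lparr>carrier := W\<rparr>)"

definition linear_on ::
 "('k, 'e) ring_scheme => ('k, 'm, 'y) module_scheme => ('k, 'n, 'z) module_scheme => 'm set => ('m => 'n) => bool" where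
 "linear_on K V V' W T \<longleftrightarrow> T ` W \<subseteq> carrier V' &
  (ALL x:W. ALL y:W. T (x \<oplus>\<^sub>V y) = T x \<oplus>\<^sub>V' T y) &
  (ALL c:carrier K. ALL x:W. T (c \<odot>\<^sub>V x) = c \<odot>\<^sub>V' T x)"

context vectorspace begin

text \<open>An independent subset of \<open>W\<close> of largest size exists because sizes are
  bounded by the dimension of \<open>V\<close>; by maximality it spans \<open>W\<close>.\<close>

lemma subspace_fin_dim:
 assumes fd: "fin_dim" and W: "submodule K W V"
 shows "vectorspace.fin_dim K (V\<lparr>carrier := W\<rparr>)"
proof -
 have sW: "VectorSpace.subspace K W V" using W vectorspace_axioms by (simp add: VectorSpace.subspace_def)
 interpret w: vectorspace K "V\<lparr>carrier := W\<rparr>" by (rule subspace_is_vs[OF sW])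
 have WV: "W \<subseteq> carrier V" using W by (simp add: submodule_def)
 define P where "P A \<longleftrightarrow> finite A & A \<subseteq> W & lin_indpt A" for A
 have bound: "card A <= dim" if "P A" for A
  using that li_le_dim[OF fd, of A] WV unfolding P_def by blast
 have P0: "P {}" unfolding P_def by (simp add: finite_lin_indpt2)
 obtain A where A: "P A" "!!B. P B ==> card B <= card A"
  using ex_has_greatest_nat[of P "{}" card "Suc dim"] P0 bound by (metis less_Suc_eq_le)
 have fA: "finite A" and AW: "A \<subseteq> W" and lA: "lin_indpt A" using A(1) by (auto simp: P_def)
 have "W \<subseteq> span A"
 proof
  fix x assume x: "x : W"
  show "x : span A"
  proof (rule ccontr)
   assume n: "x \<notin> span A"
   have xA: "x \<notin> A" using n in_own_span[of A] AW WV by blast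
   have "lin_indpt (A \<union> {x})"
    using lin_dep_iff_in_span[of A x] AW WV lA x xA n by blast
   hence "P (A \<union> {x})" using fA AW x by (auto simp: P_def)
   thus False using A(2)[of "A \<union> {x}"] xA fA by simp
  qed
 qed
 moreover have "w.span A = span A" using span_li_not_depend(1)[OF AW W] by simp
 moreover have "w.span A \<subseteq> W" using w.span_is_subset2[of A] AW by simp
 ultimately have "w.gen_set A" by auto
 thus ?thesis unfolding w.fin_dim_def using fA AW by auto
qed

end

lemma linear_on_zero:
 assumes "vectorspace K V" "vectorspace K V'" "submodule K W V" "linear_on K V V' W T"
 shows "T \<zero>\<^sub>V = \<zero>\<^sub>V'"
proof -
 interpret v: vectorspace K V by fact
 interpret v': vectorspace K V' by fact
 have z: "\<zero>\<^sub>V : W" using assms(3) by (simp add: submodule_def)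
 have "T (\<zero>\<^bsub>K\<^esub> \<odot>\<^sub>V \<zero>\<^sub>V) = \<zero>\<^sub>K \<odot>\<^sub>V' T \<zero>\<^sub>V"
  using assms(4) z v.zero_closed unfolding linear_on_def by blast
 moreover have "T \<zero>\<^sub>V : carrier V'" using assms(4) z by (auto simp: linear_on_def)
 ultimately show ?thesis by simp
qed

text \<open>Stated for maps that are known to be linear on \<open>W\<close> only, because
  projections of a subspace along another one have no meaning elsewhere. \<open>W\<close> becomes a
  space of its own and the usual theorem applies.\<close>

lemma rank_nullity_on:
 assumes V: "vectorspace K V" "vectorspace.fin_dim K V" and V': "vectorspace K V'"
  and W: "submodule K W V" and T: "linear_on K V V' W T"
 shows "subdim K V W = subdim K V' (T ` W) + subdim K V {w : W. T w = \<zero>\<^sub>V'}"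
  and "submodule K (T ` W) V'"
  and "submodule K {w : W. T w = \<zero>\<^sub>V'} V"
proof -
 interpret v: vectorspace K V by fact
 interpret v': vectorspace K V' by fact
 have sW: "VectorSpace.subspace K W V" using W v.vectorspace_axioms by (simp add: VectorSpace.subspace_def)
 interpret w: vectorspace K "V\<lparr>carrier := W\<rparr>" by (rule v.subspace_is_vs[OF sW])
 have fd: "w.fin_dim" by (rule v.subspace_fin_dim[OF V(2) W])
 interpret t: linear_map K "V\<lparr>carrier := W\<rparr>" V' T
  by unfold_locales (use T in "auto simp: linear_on_def module_hom_def")
 have im: "t.im = T ` W" by (auto simp: t.im_def)
 have ker: "t.ker = {w : W. T w = \<zero>\<^sub>V'}" by (auto simp: t.ker_def)
 show "subdim K V W = subdim K V' (T ` W) + subdim K V {w : W. T w = \<zero>\<^sub>V'}"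
  using t.rank_nullity[OF fd] by (simp add: subdim_def im ker)
 show "submodule K (T ` W) V'" using t.im_is_submodule im by simp
 have s: "submodule K t.ker (V\<lparr>carrier := W\<rparr>)" by (rule t.ker_is_submodule)
 have "W \<subseteq> carrier V" using W by (simp add: submodule_def)
 thus "submodule K {w : W. T w = \<zero>\<^sub>V'} V"
  using s V(1) unfolding ker submodule_def vectorspace_def by auto
qed

context vectorspace begin

lemma submoduleI':
 assumes "W \<subseteq> carrier V" "\<zero>\<^sub>V : W"
  and "!!v w. v : W ==> w : W ==> v \<oplus>\<^sub>V w : W"
  and "!!c v. c : carrier K ==> v : W ==> c \<odot>\<^sub>V v : W"
 shows "submodule K W V"
proof -
 have "\<ominus>\<^sub>V x : W" if x: "x : W" for x
  using x assms(1) smult_minus_1[of x] assms(4)[of "\<ominus>\<^sub>K \<one>\<^sub>K" x] by auto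
 thus ?thesis using assms module_axioms unfolding submodule_def
  by (auto intro!: bexI M.r_neg)
qed

lemma subdim_zero: "subdim K V {\<zero>\<^sub>V} = 0"
proof -
 have sm: "submodule K {\<zero>\<^sub>V} V" by (intro submoduleI') auto
 interpret w: vectorspace K "V\<lparr>carrier := {\<zero>\<^sub>V}\<rparr>"
  by (rule subspace_is_vs) (simp add: VectorSpace.subspace_def sm vectorspace_axioms)
 show ?thesis unfolding subdim_def
  by (rule w.dim0I) (use w.span_zero w.in_own_span[of "{\<zero>\<^sub>V}"] w.span_is_subset2[of "{\<zero>\<^sub>V}"] in auto)
qed

lemma subdim_eq_0:
 assumes "fin_dim" "submodule K W V" "subdim K V W = 0"
 shows "W = {\<zero>\<^sub>V}"
proof -
 interpret w: vectorspace K "V\<lparr>carrier := W\<rparr>"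
  by (rule subspace_is_vs) (simp add: VectorSpace.subspace_def assms vectorspace_axioms)
 have fd: "w.fin_dim" by (rule subspace_fin_dim[OF assms(1,2)])
 obtain B where B: "finite B" "w.basis B" using w.finite_basis_exists[OF fd] by blast
 have "card B = 0" using w.dim_basis[OF B] assms(3) by (simp add: subdim_def)
 hence "B = {}" using B by simp
 hence "w.span {} = W" using B by (simp add: w.basis_def)
 thus ?thesis by (simp add: w.span_empty)
qed

lemma submodule_line:
 assumes "v : carrier V"
 shows "submodule K {c \<odot>\<^sub>V v |c. c : carrier K} V" (is "submodule K ?W V")
proof (rule submoduleI')
 show "?W \<subseteq> carrier V" using assms by auto
 have "\<zero>\<^sub>V = \<zero>\<^sub>K \<odot>\<^sub>V v" using assms by simp
 thus "\<zero>\<^sub>V : ?W" by blast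
 fix x y assume "x : ?W" "y : ?W"
 then obtain a b where "x = a \<odot>\<^sub>V v" "y = b \<odot>\<^sub>V v" "a : carrier K" "b : carrier K" by blast
 hence "x \<oplus>\<^sub>V y = (a \<oplus>\<^sub>K b) \<odot>\<^sub>V v" "a \<oplus>\<^sub>K b : carrier K"
  using assms by (simp_all add: smult_l_distr)
 thus "x \<oplus>\<^sub>V y : ?W" by blast
next
 fix c x assume c: "c : carrier K" and "x : ?W"
 then obtain a where "x = a \<odot>\<^sub>V v" "a : carrier K" by blast
 hence "c \<odot>\<^sub>V x = (c \<otimes>\<^sub>K a) \<odot>\<^sub>V v" "c \<otimes>\<^sub>K a : carrier K"
  using assms c by (simp_all add: smult_assoc1)
 thus "c \<odot>\<^sub>V x : ?W" by blast
qed

lemma subdim_line: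
 assumes v: "v : carrier V" "v ~= \<zero>\<^sub>V"
 shows "subdim K V {c \<odot>\<^sub>V v |c. c : carrier K} = 1" (is "subdim K V ?W = 1")
proof -
 interpret w: vectorspace K "V\<lparr>carrier := ?W\<rparr>"
  by (rule subspace_is_vs) (simp add: VectorSpace.subspace_def submodule_line v vectorspace_axioms)
 have "v = \<one>\<^sub>K \<odot>\<^sub>V v" using v by simp
 hence vW: "v : ?W" by blast
 have sp: "submodule K (w.span {v}) (V\<lparr>carrier := ?W\<rparr>)" by (rule w.span_is_submodule) (use vW in auto)
 have "v : w.span {v}" using w.in_own_span[of "{v}"] vW by auto
 hence "?W \<subseteq> w.span {v}" using sp by (auto simp: submodule_def)
 moreover have "w.span {v} \<subseteq> ?W" using w.span_is_subset2[of "{v}"] vW by auto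
 ultimately have "w.gen_set {v}" by auto
 thus ?thesis unfolding subdim_def using w.dim1I[of v] v vW by simp
qed

end

lemma subdim_bij:
 assumes V: "vectorspace K V" "vectorspace.fin_dim K V" and V': "vectorspace K V'"
  and W: "submodule K W V" and T: "linear_on K V V' W T" and "inj_on T W"
 shows "subdim K V W = subdim K V' (T ` W)"
proof -
 have z: "\<zero>\<^sub>V : W" using W by (simp add: submodule_def)
 have "T \<zero>\<^sub>V = \<zero>\<^sub>V'" by (rule linear_on_zero[OF V(1) V' W T])
 hence T0: "w = \<zero>\<^sub>V" if "w : W" "T w = \<zero>\<^sub>V'" for w
  using inj_onD[OF assms(6) _ that(1) z] that(2) by metis
 have "{w : W. T w = \<zero>\<^sub>V'} = {\<zero>\<^sub>V}" using z T0 \<open>T \<zero>\<^sub>V = \<zero>\<^sub>V'\<close> by blast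
 thus ?thesis
  using rank_nullity_on(1)[OF assms(1-5)] vectorspace.subdim_zero[OF V(1)] by simp
qed

lemma subdim_mono:
 assumes V: "vectorspace K V" "vectorspace.fin_dim K V"
  and W: "submodule K W V" "submodule K W' V" "W \<subseteq> W'"
 shows "subdim K V W <= subdim K V W'"
proof -
 interpret v: vectorspace K V by fact
 have sW: "VectorSpace.subspace K W' V" using W V by (simp add: VectorSpace.subspace_def)
 interpret w: vectorspace K "V\<lparr>carrier := W'\<rparr>" by (rule v.subspace_is_vs[OF sW])
 have sW: "VectorSpace.subspace K W V" using W V by (simp add: VectorSpace.subspace_def)
 interpret w': vectorspace K "V\<lparr>carrier := W\<rparr>" by (rule v.subspace_is_vs[OF sW])
 have fd: "w.fin_dim" "w'.fin_dim" using v.subspace_fin_dim V W by auto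
 obtain B where B: "finite B" "w'.basis B" using w'.finite_basis_exists[OF fd(2)] by blast
 have BW: "B \<subseteq> W" "w'.lin_indpt B" using B(2) by (auto simp: w'.basis_def)
 have "v.lin_indpt B" using v.span_li_not_depend(2)[OF BW(1) W(1)] BW(2) by simp
 hence "w.lin_indpt B" using v.span_li_not_depend(2)[of B W'] BW W by auto
 hence "card B <= w.dim" using w.li_le_dim(2)[OF fd(1)] BW W by auto
 thus ?thesis using w'.dim_basis[OF B] by (simp add: subdim_def)
qed

text \<open>Induction over \<open>J\<close>: the section \<open>q j\<close> makes \<open>p j\<close>
  map \<open>W\<close> onto \<open>S j\<close>, and the kernel of \<open>p j\<close> satisfies the
  hypotheses for the remaining indices. The \<open>q j\<close> are plain functions that witness
  surjectivity, so they may mix several summands.\<close>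

lemma subdim_decompose:
 assumes "finite J" and V: "vectorspace K V" "vectorspace.fin_dim K V"
  and W: "submodule K W V"
  and U: "!!j. j : J ==> vectorspace K (U j)"
  and p: "!!j. j : J ==> linear_on K V (U j) W (p j)"
  and pS: "!!j w. j : J ==> w : W ==> p j w : S j"
  and q: "!!j s. j : J ==> s : S j ==> q j s : W"
  and pq: "!!j s. j : J ==> s : S j ==> p j (q j s) = s"
  and pq0: "!!i j s. i : J ==> j : J ==> i ~= j ==> s : S j ==> p i (q j s) = \<zero>\<^bsub>U i\<^esub>"
  and joint: "!!w. w : W ==> (!!j. j : J ==> p j w = \<zero>\<^bsub>U j\<^esub>) ==> w = \<zero>\<^sub>V"
 shows "subdim K V W = (\<Sum>j\<in>J. subdim K (U j) (S j))"
 using assms(1) W U p pS q pq pq0 joint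
proof (induction J arbitrary: W rule: finite_induct)
 case empty
 interpret vectorspace K V by fact
 have "W = {\<zero>\<^sub>V}" using empty by (auto simp: submodule_def)
 thus ?case using subdim_zero by simp
next
 case (insert j J)
 define W' where "W' = {w : W. p j w = \<zero>\<^bsub>U j\<^esub>}"
 note ins = insert.prems
 have vj: "vectorspace K (U j)" and lj: "linear_on K V (U j) W (p j)" using ins by auto
 have im: "p j ` W = S j"
 proof (intro equalityI subsetI)
  fix s assume "s : S j"
  thus "s : p j ` W" using ins(5)[of j s] ins(6)[of j s] by (metis imageI insertI1)
 qed (use ins(4) in auto)
 have d: "subdim K V W = subdim K (U j) (S j) + subdim K V W'"
  using rank_nullity_on(1)[OF V vj ins(1) lj] im by (simp add: W'_def)
 have sW': "submodule K W' V" using rank_nullity_on(3)[OF V vj ins(1) lj] by (simp add: W'_def)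
 have "subdim K V W' = (\<Sum>i\<in>J. subdim K (U i) (S i))"
 proof (rule insert.IH[OF sW'])
  show "vectorspace K (U i)" if "i : J" for i using ins(2) that by simp
  show "linear_on K V (U i) W' (p i)" if "i : J" for i
   using ins(3)[of i] that unfolding linear_on_def W'_def by auto
  show "p i w : S i" if "i : J" "w : W'" for i w using ins(4) that by (auto simp: W'_def)
  show "q i s : W'" if "i : J" "s : S i" for i s
   using ins(5)[of i s] ins(7)[of j i s] that insert.hyps by (auto simp: W'_def)
  show "p i (q i s) = s" if "i : J" "s : S i" for i s using ins(6) that by auto
  show "p i (q k s) = \<zero>\<^bsub>U i\<^esub>" if "i : J" "k : J" "i ~= k" "s : S k" for i k s
   using ins(7) that by auto
  show "w = \<zero>\<^sub>V" if "w : W'" "!!i. i : J ==> p i w = \<zero>\<^bsub>U i\<^esub>" for w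
   using ins(8)[of w] that by (auto simp: W'_def)
 qed
 thus ?case using d insert.hyps by simp
qed

section \<open>Arrows with source and target\<close>

text \<open>Hom-sets of different pairs of objects may overlap, so an arrow is represented by a triple
 (source, morphism, target); the side conditions of the category axioms then become equations
 between sources and targets.\<close>

definition src :: "'o * 'm * 'o => 'o" where "src t = fst t"
definition mor :: "'o * 'm * 'o => 'm" where "mor t = fst (snd t)"
definition tgt :: "'o * 'm * 'o => 'o" where "tgt t = snd (snd t)"

definition arr :: "('k, 'o, 'm, 'z) linear_cat_scheme => 'o * 'm * 'o => bool" where
 "arr C t \<longleftrightarrow> src t : Obj C & tgt t : Obj C & mor t : arrows C (src t) (tgt t)"

definition hom :: "('k, 'o, 'm, 'z) linear_cat_scheme => 'o => 'o => ('o * 'm * 'o) set" where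
 "hom C X Y = {t. arr C t & src t = X & tgt t = Y}"

definition cmp :: "('k, 'o, 'm, 'z) linear_cat_scheme => 'o * 'm * 'o => 'o * 'm * 'o => 'o * 'm * 'o"
  (infixr \<open>*.\<index>\<close> 70) where
 "g *.\<^bsub>C\<^esub> f = (src f, mor g \<cdot>\<^bsub>C\<^esub> mor f, tgt g)"

definition ide :: "('k, 'o, 'm, 'z) linear_cat_scheme => 'o => 'o * 'm * 'o" where
 "ide C X = (X, Id C X, X)"

definition HomV :: "('k, 'o, 'm, 'z) linear_cat_scheme => 'o => 'o => ('k, 'o * 'm * 'o) module" where
 "HomV C X Y = \<lparr>carrier = hom C X Y, monoid.mult = (%f g. f), monoid.one = (X, \<zero>\<^bsub>Hom C X Y\<^esub>, Y),
   ring.zero = (X, \<zero>\<^bsub>Hom C X Y\<^esub>, Y), ring.add = (%f g. (X, mor f \<oplus>\<^bsub>Hom C X Y\<^esub> mor g, Y)),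
   module.smult = (%c f. (X, c \<odot>\<^bsub>Hom C X Y\<^esub> mor f, Y))\<rparr>"

definition plus_arr :: "('k, 'o, 'm, 'z) linear_cat_scheme => 'o * 'm * 'o => 'o * 'm * 'o => 'o * 'm * 'o"
  (infixl \<open>+.\<index>\<close> 65) where
 "f +.\<^bsub>C\<^esub> g = f \<oplus>\<^bsub>HomV C (src f) (tgt f)\<^esub> g"

definition scale_arr :: "('k, 'o, 'm, 'z) linear_cat_scheme => 'k => 'o * 'm * 'o => 'o * 'm * 'o"
  (infixr \<open>|>\<index>\<close> 75) where
 "c |>\<^bsub>C\<^esub> f = c \<odot>\<^bsub>HomV C (src f) (tgt f)\<^esub> f"

definition nul :: "('k, 'o, 'm, 'z) linear_cat_scheme => 'o => 'o => 'o * 'm * 'o" where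
 "nul C X Y = \<zero>\<^bsub>HomV C X Y\<^esub>"

definition inv_arr :: "('k, 'o, 'm, 'z) linear_cat_scheme => 'o * 'm * 'o => 'o * 'm * 'o" where
 "inv_arr C f = (tgt f, inv_arrow C (src f) (tgt f) (mor f), src f)"

definition iso_arr :: "('k, 'o, 'm, 'z) linear_cat_scheme => 'o * 'm * 'o => bool" where
 "iso_arr C f \<longleftrightarrow> arr C f & is_iso C (src f) (tgt f) (mor f)"

lemma triple_simps [simp]: "src (X, f, Y) = X" "mor (X, f, Y) = f" "tgt (X, f, Y) = Y"
 by (auto simp: src_def mor_def tgt_def)

lemma arrow_eqI: "src f = src g ==> mor f = mor g ==> tgt f = tgt g ==> f = g"
 by (auto simp: src_def mor_def tgt_def prod_eq_iff)

lemma arrow_triple: "f = (src f, mor f, tgt f)"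
 by (simp add: src_def mor_def tgt_def)

lemma hom_iff: "f : hom C X Y \<longleftrightarrow> arr C f & src f = X & tgt f = Y"
 by (simp add: hom_def)

lemma HomV_simps [simp]:
 "carrier (HomV C X Y) = hom C X Y"
 "f \<oplus>\<^bsub>HomV C X Y\<^esub> g = (X, mor f \<oplus>\<^bsub>Hom C X Y\<^esub> mor g, Y)"
 "c \<odot>\<^bsub>HomV C X Y\<^esub> f = (X, c \<odot>\<^bsub>Hom C X Y\<^esub> mor f, Y)"
 "\<zero>\<^bsub>HomV C X Y\<^esub> = (X, \<zero>\<^bsub>Hom C X Y\<^esub>, Y)"
 by (auto simp: HomV_def)

declare HomV_simps(2,3,4) [simp del]

lemma src_tgt_simps [simp]:
 "src (g *.\<^bsub>C\<^esub> f) = src f" "tgt (g *.\<^bsub>C\<^esub> f) = tgt g"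
 "src (ide C X) = X" "tgt (ide C X) = X"
 "src (f +.\<^bsub>C\<^esub> g) = src f" "tgt (f +.\<^bsub>C\<^esub> g) = tgt f"
 "src (c |>\<^bsub>C\<^esub> f) = src f" "tgt (c |>\<^bsub>C\<^esub> f) = tgt f"
 "src (nul C X Y) = X" "tgt (nul C X Y) = Y"
 "src (inv_arr C f) = tgt f" "tgt (inv_arr C f) = src f"
 by (auto simp: cmp_def ide_def plus_arr_def scale_arr_def nul_def inv_arr_def HomV_simps)

context linear_category begin

abbreviation "ii == ide C"
abbreviation "ar == arr C"
abbreviation "nl == nul C"
abbreviation "iv == inv_arr C"
abbreviation "hm == hom C"
abbreviation "isom == isomorphic C"
abbreviation "smp == simple_object C"
abbreviation "icl == iso_class C"
abbreviation "isa == iso_arr C"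
abbreviation "Ob == Obj C"
abbreviation "sd == subdim K"

lemma arr_obj: "ar f ==> src f : Ob" "ar f ==> tgt f : Ob"
 by (auto simp: arr_def)

lemma arr_cmp [simp]: "ar g ==> ar f ==> src g = tgt f ==> ar (g *. f)"
 using Comp_closed[of "src f" "tgt f" "tgt g" "mor f" "mor g"] by (simp add: arr_def cmp_def)

lemma arr_ide [simp]: "ar (ii X) \<longleftrightarrow> X : Ob"
 using Id_closed by (auto simp: arr_def ide_def)

lemma cmp_assoc [simp]:
 "ar h ==> ar g ==> ar f ==> src h = tgt g ==> src g = tgt f ==> (h *. g) *. f = h *. g *. f"
 using Comp_assoc[of "src f" "tgt f" "tgt g" "tgt h" "mor f" "mor g" "mor h"] by (simp add: arr_def cmp_def)

lemma cmp_ide_left [simp]: "ar f ==> tgt f = X ==> ii X *. f = f"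
 by (rule arrow_eqI) (auto simp: arr_def cmp_def ide_def Comp_Id_left)

lemma cmp_ide_right [simp]: "ar f ==> src f = X ==> f *. ii X = f"
 by (rule arrow_eqI) (auto simp: arr_def cmp_def ide_def Comp_Id_right)

lemma vectorspace_HomV: "X : Ob ==> Y : Ob ==> vectorspace K (HomV C X Y)"
proof -
 assume XY: "X : Ob" "Y : Ob"
 interpret h: module K "Hom C X Y" by (rule Hom_module[OF XY])
 have t: "f = (X, mor f, Y)" "mor f : carrier (Hom C X Y)" if "f : hm X Y" for f
  using that arrow_triple[of f] by (auto simp: hom_iff arr_def)
 have c: "(X, m, Y) : hm X Y" if "m : carrier (Hom C X Y)" for m
  using that XY by (auto simp: hom_iff arr_def)
 show ?thesis
 proof (rule vs_criteria)
  show "field K" by (rule field_axioms)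
  show "ALL v:carrier (HomV C X Y). EX neg_v:carrier (HomV C X Y). v \<oplus>\<^bsub>HomV C X Y\<^esub> neg_v = \<zero>\<^bsub>HomV C X Y\<^esub>"
  proof
   fix v assume "v : carrier (HomV C X Y)"
   thus "EX neg_v:carrier (HomV C X Y). v \<oplus>\<^bsub>HomV C X Y\<^esub> neg_v = \<zero>\<^bsub>HomV C X Y\<^esub>"
    using t c by (intro bexI[of _ "(X, \<ominus>\<^bsub>Hom C X Y\<^esub> mor v, Y)"]) (auto simp: HomV_simps h.M.r_neg)
  qed
  show "ALL v:carrier (HomV C X Y). v \<oplus>\<^bsub>HomV C X Y\<^esub> \<zero>\<^bsub>HomV C X Y\<^esub> = v"
   using t by (auto simp: HomV_simps)
  show "ALL v:carrier (HomV C X Y). \<one>\<^sub>K \<odot>\<^bsub>HomV C X Y\<^esub> v = v"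
   using t by (auto simp: HomV_simps)
 qed (use t c in "auto simp: HomV_simps h.M.a_ac h.smult_assoc1 h.smult_l_distr h.smult_r_distr")
qed

lemma arr_plus [simp]: "ar f ==> ar g ==> src f = src g ==> tgt f = tgt g ==> ar (f +. g)"
proof -
 assume a: "ar f" "ar g" "src f = src g" "tgt f = tgt g"
 interpret h: vectorspace K "HomV C (src f) (tgt f)" by (rule vectorspace_HomV) (use a arr_obj in auto)
 show ?thesis using h.M.a_closed[of f g] a by (auto simp: hom_iff plus_arr_def)
qed

lemma arr_scale [simp]: "ar f ==> c : carrier K ==> ar (c |> f)"
proof -
 assume a: "ar f" "c : carrier K"
 interpret h: vectorspace K "HomV C (src f) (tgt f)" by (rule vectorspace_HomV) (use a arr_obj in auto)
 show ?thesis using h.smult_closed[of c f] a by (auto simp: hom_iff scale_arr_def)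
qed

lemma arr_nul [simp]: "ar (nl X Y) \<longleftrightarrow> X : Ob & Y : Ob"
proof
 assume "X : Ob & Y : Ob"
 then interpret h: vectorspace K "HomV C X Y" by (intro vectorspace_HomV) auto
 show "ar (nl X Y)" using h.M.zero_closed by (auto simp: hom_iff nul_def)
qed (auto simp: arr_def)

lemma cmp_plus_right [simp]:
 "ar f ==> ar f' ==> ar g ==> src f = src f' ==> tgt f = tgt f' ==> src g = tgt f
  ==> g *. (f +. f') = g *. f +. g *. f'"
 by (auto simp: arr_def cmp_def plus_arr_def HomV_simps Comp_add_right)

lemma cmp_plus_left [simp]:
 "ar f ==> ar g ==> ar g' ==> src g = src g' ==> tgt g = tgt g' ==> src g = tgt f
  ==> (g +. g') *. f = g *. f +. g' *. f"
 by (auto simp: arr_def cmp_def plus_arr_def HomV_simps Comp_add_left)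

lemma cmp_scale_right [simp]:
 "ar f ==> ar g ==> src g = tgt f ==> c : carrier K ==> g *. (c |> f) = c |> (g *. f)"
 by (auto simp: arr_def cmp_def scale_arr_def HomV_simps Comp_smult_right)

lemma cmp_scale_left [simp]:
 "ar f ==> ar g ==> src g = tgt f ==> c : carrier K ==> (c |> g) *. f = c |> (g *. f)"
 by (auto simp: arr_def cmp_def scale_arr_def HomV_simps Comp_smult_left)

declare arr_obj [simp]

lemma scale_zero [simp]: "ar f ==> \<zero>\<^sub>K |> f = nl (src f) (tgt f)"
proof -
 assume a: "ar f"
 interpret h: vectorspace K "HomV C (src f) (tgt f)" by (rule vectorspace_HomV) (use a arr_obj in auto)
 show ?thesis using h.lmult_0[of f] a by (auto simp: hom_iff scale_arr_def nul_def)
qed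

lemma scale_one [simp]: "ar f ==> \<one>\<^sub>K |> f = f"
proof -
 assume a: "ar f"
 interpret h: vectorspace K "HomV C (src f) (tgt f)" by (rule vectorspace_HomV) (use a arr_obj in auto)
 show ?thesis using h.smult_one[of f] a by (auto simp: hom_iff scale_arr_def nul_def)
qed

lemma scale_scale [simp]:
 "ar f ==> c : carrier K ==> d : carrier K ==> c |> d |> f = (c \<otimes>\<^sub>K d) |> f"
proof -
 assume a: "ar f" "c : carrier K" "d : carrier K"
 interpret h: vectorspace K "HomV C (src f) (tgt f)" by (rule vectorspace_HomV) (use a arr_obj in auto)
 show ?thesis using h.smult_assoc1[of c d f] a by (auto simp: hom_iff scale_arr_def HomV_simps)
qed

lemma cmp_nul_right [simp]: "ar g ==> src g = Y ==> X : Ob ==> g *. nl X Y = nl X (tgt g)"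
 using cmp_scale_right[of "nl X Y" g "\<zero>\<^sub>K"] scale_zero[of "nl X Y"] scale_zero[of "g *. nl X Y"] arr_obj(1)[of g] by auto

lemma cmp_nul_left [simp]: "ar f ==> tgt f = X ==> Y : Ob ==> nl X Y *. f = nl (src f) Y"
 using cmp_scale_left[of f "nl X Y" "\<zero>\<^sub>K"] scale_zero[of "nl X Y"] scale_zero[of "nl X Y *. f"] arr_obj(2)[of f] by auto

lemma inverse_arrows_iff:
 "X : Ob ==> Y : Ob ==> inverse_arrows C X Y f g \<longleftrightarrow>
  ar (X, f, Y) & ar (Y, g, X) & (Y, g, X) *. (X, f, Y) = ii X & (X, f, Y) *. (Y, g, X) = ii Y"
 by (auto simp: inverse_arrows_def arr_def cmp_def ide_def simp del: arr_obj)

lemma iso_arrI: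
 assumes "ar f" "ar g" "src f = tgt g" "tgt f = src g" "g *. f = ii (src f)" "f *. g = ii (tgt f)"
 shows "isa f" "iv f = g"
proof -
 have ia: "inverse_arrows C (src f) (tgt f) (mor f) (mor g)"
  using assms arrow_triple[of f] arrow_triple[of g] by (subst inverse_arrows_iff) auto
 thus "isa f" using assms by (auto simp: iso_arr_def is_iso_def)
 have "h = mor g" if "inverse_arrows C (src f) (tgt f) (mor f) h" for h
 proof -
  have h: "ar (tgt f, h, src f)" "(tgt f, h, src f) *. f = ii (src f)"
   using that arrow_triple[of f] assms(1) by (auto simp: inverse_arrows_iff)
  have "(tgt f, h, src f) = (tgt f, h, src f) *. f *. g" using h(1) assms by simp
  also have "... = ((tgt f, h, src f) *. f) *. g" using h(1) assms by (subst cmp_assoc) auto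
  also have "... = g" using h(2) assms by simp
  finally show ?thesis by (metis triple_simps(2))
 qed
 hence "inv_arrow C (src f) (tgt f) (mor f) = mor g" unfolding inv_arrow_def using ia by blast
 thus "iv f = g" using assms by (intro arrow_eqI) (auto simp: inv_arr_def)
qed

lemma iso_arrE:
 assumes "isa f"
 obtains g where "ar f" "ar g" "src f = tgt g" "tgt f = src g" "g *. f = ii (src f)" "f *. g = ii (tgt f)" "iv f = g"
proof -
 have f: "ar f" "is_iso C (src f) (tgt f) (mor f)" using assms by (auto simp: iso_arr_def)
 then obtain h where "inverse_arrows C (src f) (tgt f) (mor f) h" by (auto simp: is_iso_def)
 hence h: "ar (tgt f, h, src f)" "(tgt f, h, src f) *. f = ii (src f)" "f *. (tgt f, h, src f) = ii (tgt f)"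
  using arrow_triple[of f] f(1) by (auto simp: inverse_arrows_iff)
 show ?thesis using that[of "(tgt f, h, src f)"] iso_arrI(2)[OF f(1) h(1)] h f by simp
qed

lemma arr_inv [simp]: "isa f ==> ar (iv f)"
 by (auto elim: iso_arrE)

lemma iso_arr_arr [simp]: "isa f ==> ar f"
 by (auto simp: iso_arr_def)

lemma inv_cmp [simp]: "isa f ==> iv f *. f = ii (src f)"
 by (auto elim: iso_arrE)

lemma cmp_inv [simp]: "isa f ==> f *. iv f = ii (tgt f)"
 by (auto elim: iso_arrE)

lemma inv_cmp' [simp]: "isa f ==> ar g ==> tgt g = src f ==> iv f *. f *. g = g"
 by (subst cmp_assoc[symmetric]) auto

lemma cmp_inv' [simp]: "isa f ==> ar g ==> tgt g = tgt f ==> f *. iv f *. g = g"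
 by (subst cmp_assoc[symmetric]) auto

lemma iso_inv [simp]: "isa f ==> isa (iv f)" "isa f ==> iv (iv f) = f"
 using iso_arrI[of "iv f" f] by auto

lemma iso_ide [simp]: "X : Ob ==> isa (ii X)"
 using iso_arrI[of "ii X" "ii X"] by auto

lemma iso_cmp [simp]: "isa g ==> isa f ==> src g = tgt f ==> isa (g *. f)"
 by (rule iso_arrI(1)[of _ "iv f *. iv g"]) auto

lemma isomorphic_iff:
 "X : Ob ==> Y : Ob ==> isom X Y \<longleftrightarrow> (EX f. isa f & src f = X & tgt f = Y)"
proof
 assume XY: "X : Ob" "Y : Ob" and "isom X Y"
 then obtain f where f: "is_iso C X Y f" by (auto simp: isomorphic_def)
 hence "isa (X, f, Y)" using XY by (auto simp: iso_arr_def arr_def is_iso_def inverse_arrows_def simp del: arr_obj)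
 thus "EX f. isa f & src f = X & tgt f = Y" by force
qed (auto simp: isomorphic_def iso_arr_def)

lemma iso_refl: "X : Ob ==> isom X X"
 using isomorphic_iff iso_ide src_tgt_simps(3,4) by metis

lemma iso_sym: "X : Ob ==> Y : Ob ==> isom X Y ==> isom Y X"
 using isomorphic_iff iso_inv(1) src_tgt_simps(11,12) by metis

lemma iso_trans:
 "X : Ob ==> Y : Ob ==> Z : Ob ==> isom X Y ==> isom Y Z ==> isom X Z"
 by (metis isomorphic_iff iso_cmp src_tgt_simps(1,2))

lemma iso_class_eq_iff:
 assumes "X : Ob" "Y : Ob"
 shows "icl X = icl Y \<longleftrightarrow> isom X Y"
 unfolding iso_class_def using assms iso_refl iso_sym iso_trans by blast

lemma HomV_ops:
 "f : hm X Y ==> f \<oplus>\<^bsub>HomV C X Y\<^esub> g = f +. g"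
 "f : hm X Y ==> c \<odot>\<^bsub>HomV C X Y\<^esub> f = c |> f"
 "\<zero>\<^bsub>HomV C X Y\<^esub> = nl X Y"
 by (auto simp: hom_iff plus_arr_def scale_arr_def nul_def)

lemma finsum_hom:
 assumes "X : Ob" "Y : Ob" "!!j. j : J ==> F j : hm X Y"
 shows "finsum (HomV C X Y) F J : hm X Y"
proof -
 interpret v: vectorspace K "HomV C X Y" by (rule vectorspace_HomV) fact+
 show ?thesis using v.M.finsum_closed[of F J] assms(3) by auto
qed

lemma finsum_cmp_left:
 assumes "finite J" "ar g" "src g = Y" "X : Ob" "!!j. j : J ==> F j : hm X Y"
 shows "g *. finsum (HomV C X Y) F J = finsum (HomV C X (tgt g)) (%j. g *. F j) J"
 using assms
proof (induction J rule: finite_induct)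
 have Y: "Y : Ob" "tgt g : Ob" using assms by auto
 interpret v: vectorspace K "HomV C X Y" by (rule vectorspace_HomV) fact+
 interpret w: vectorspace K "HomV C X (tgt g)" by (rule vectorspace_HomV) fact+
 case empty
 thus ?case by (simp add: HomV_ops)
next
 have Y: "Y : Ob" "tgt g : Ob" using assms by auto
 interpret v: vectorspace K "HomV C X Y" by (rule vectorspace_HomV) fact+
 interpret w: vectorspace K "HomV C X (tgt g)" by (rule vectorspace_HomV) fact+
 case (insert j J)
 have c: "F j : hm X Y" "F : J \<rightarrow> hm X Y" "g *. F j : hm X (tgt g)"
  "(%j. g *. F j) : J \<rightarrow> hm X (tgt g)"
  using insert.prems by (auto simp: hom_iff)
 have s: "finsum (HomV C X Y) F J : hm X Y" by (rule finsum_hom) (use insert.prems Y in auto)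
 show ?case
  using insert c s Y by (simp add: HomV_ops) (simp add: hom_iff)
qed

lemma finsum_cmp_right:
 assumes "finite J" "ar f" "tgt f = X" "Y : Ob" "!!j. j : J ==> F j : hm X Y"
 shows "finsum (HomV C X Y) F J *. f = finsum (HomV C (src f) Y) (%j. F j *. f) J"
 using assms
proof (induction J rule: finite_induct)
 have Y: "X : Ob" "src f : Ob" using assms by auto
 interpret v: vectorspace K "HomV C X Y" by (rule vectorspace_HomV) fact+
 interpret w: vectorspace K "HomV C (src f) Y" by (rule vectorspace_HomV) fact+
 case empty
 thus ?case by (simp add: HomV_ops)
next
 have Y: "X : Ob" "src f : Ob" using assms by auto
 interpret v: vectorspace K "HomV C X Y" by (rule vectorspace_HomV) fact+
 interpret w: vectorspace K "HomV C (src f) Y" by (rule vectorspace_HomV) fact+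
 case (insert j J)
 have c: "F j : hm X Y" "F : J \<rightarrow> hm X Y" "F j *. f : hm (src f) Y"
  "(%j. F j *. f) : J \<rightarrow> hm (src f) Y"
  using insert.prems by (auto simp: hom_iff)
 have s: "finsum (HomV C X Y) F J : hm X Y" by (rule finsum_hom) (use insert.prems Y in auto)
 show ?case
  using insert c s Y by (simp add: HomV_ops) (simp add: hom_iff)
qed

lemma submodule_homI:
 assumes "X : Ob" "Y : Ob" "W \<subseteq> hm X Y" "nl X Y : W"
  "!!f g. f : W ==> g : W ==> f +. g : W" "!!c f. c : carrier K ==> f : W ==> c |> f : W"
 shows "submodule K W (HomV C X Y)"
proof (rule submodule.intro)
 show "module K (HomV C X Y)" using vectorspace_HomV[OF assms(1,2)] by (simp add: vectorspace_def)
qed (use assms in "auto simp: HomV_ops subset_iff")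

lemma linear_on_homI:
 assumes "W \<subseteq> hm X Y" "!!f. f : W ==> T f : hm X' Y'"
  "!!f g. f : W ==> g : W ==> T (f +. g) = T f +. T g"
  "!!c f. c : carrier K ==> f : W ==> T (c |> f) = c |> T f"
 shows "linear_on K (HomV C X Y) (HomV C X' Y') W T"
 using assms unfolding linear_on_def by (auto simp: HomV_ops subset_iff)

end

section \<open>Direct sums\<close>

text \<open>The index set is an arbitrary finite set rather than an initial segment of the naturals,
  so that \<open>J \<times> J'\<close> can index a tensor product of two decompositions and
  \<open>bool\<close> a splitting in two.\<close>

definition biproduct ::
  "('k, 'o, 'm, 'z) linear_cat_scheme => 'j set => ('j => 'o) => 'o => ('j => 'o * 'm * 'o) => ('j => 'o * 'm * 'o) => bool" where
 "biproduct C J M X i p \<longleftrightarrow> finite J & X : Obj C &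
  (ALL j:J. i j : hom C (M j) X & p j : hom C X (M j)) &
  (ALL j:J. ALL k:J. p j *.\<^bsub>C\<^esub> i k = (if j = k then ide C (M j) else nul C (M k) (M j))) &
  finsum (HomV C X X) (%j. i j *.\<^bsub>C\<^esub> p j) J = ide C X"

context linear_category begin

lemma biproductD:
 assumes "biproduct C J M X i p"
 shows "finite J" "X : Ob" "j : J ==> ar (i j)" "j : J ==> src (i j) = M j" "j : J ==> tgt (i j) = X"
  "j : J ==> ar (p j)" "j : J ==> tgt (p j) = M j" "j : J ==> src (p j) = X"
  "j : J ==> p j *. i j = ii (M j)" "j : J ==> k : J ==> j ~= k ==> p j *. i k = nl (M k) (M j)"
  "j : J ==> M j : Ob"
 using assms arr_obj(1)[of "i j"] unfolding biproduct_def hom_iff by auto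

lemma biproduct_sum_in:
 assumes b: "biproduct C J M X i p" and f: "f : hm Z X"
 shows "f = finsum (HomV C Z X) (%j. i j *. p j *. f) J"
proof -
 note b' = biproductD[OF b]
 have "f = finsum (HomV C X X) (%j. i j *. p j) J *. f"
  using b f by (simp add: biproduct_def hom_iff)
 also have "... = finsum (HomV C Z X) (%j. (i j *. p j) *. f) J"
  using finsum_cmp_right[of J f X X "%j. i j *. p j"] f b' by (simp add: hom_iff)
 also have "... = finsum (HomV C Z X) (%j. i j *. p j *. f) J"
 proof -
  have Z: "Z : Ob" using f by (auto simp: hom_iff)
  interpret v: vectorspace K "HomV C Z X" by (rule vectorspace_HomV) fact+
  show ?thesis by (rule v.M.finsum_cong') (use f b' in "auto simp: hom_iff")
 qed
 finally show ?thesis .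
qed

lemma biproduct_sum_out:
 assumes b: "biproduct C J M X i p" and f: "f : hm X Z"
 shows "f = finsum (HomV C X Z) (%j. f *. i j *. p j) J"
proof -
 note b' = biproductD[OF b]
 have "f = f *. finsum (HomV C X X) (%j. i j *. p j) J"
  using b f by (simp add: biproduct_def hom_iff)
 also have "... = finsum (HomV C X Z) (%j. f *. i j *. p j) J"
  using finsum_cmp_left[of J f X X "%j. i j *. p j"] f b' by (simp add: hom_iff)
 finally show ?thesis .
qed

lemma biproduct_jointly_monic:
 assumes b: "biproduct C J M X i p" and f: "f : hm Z X" "g : hm Z X"
  and eq: "!!j. j : J ==> p j *. f = p j *. g"
 shows "f = g"
proof -
 note b' = biproductD[OF b]
 have Z: "Z : Ob" using f by (auto simp: hom_iff)
 interpret v: vectorspace K "HomV C Z X" by (rule vectorspace_HomV) fact+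
 have "finsum (HomV C Z X) (%j. i j *. p j *. f) J = finsum (HomV C Z X) (%j. i j *. p j *. g) J"
  by (rule v.M.finsum_cong') (use f b' eq in "auto simp: hom_iff")
 thus ?thesis
  by (rule trans[OF biproduct_sum_in[OF b f(1)] trans[OF _ biproduct_sum_in[OF b f(2), symmetric]]])
qed

lemma biproduct_jointly_epic:
 assumes b: "biproduct C J M X i p" and f: "f : hm X Z" "g : hm X Z"
  and eq: "!!j. j : J ==> f *. i j = g *. i j"
 shows "f = g"
proof -
 note b' = biproductD[OF b]
 have Z: "Z : Ob" using f by (auto simp: hom_iff)
 interpret v: vectorspace K "HomV C X Z" by (rule vectorspace_HomV) fact+
 have *: "f *. i j *. p j = g *. i j *. p j" if "j : J" for j
  using eq[OF that] b' that f by (metis cmp_assoc hom_iff)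
 have "finsum (HomV C X Z) (%j. f *. i j *. p j) J = finsum (HomV C X Z) (%j. g *. i j *. p j) J"
  by (rule v.M.finsum_cong') (use f b' * in "auto simp: hom_iff")
 thus ?thesis
  by (rule trans[OF biproduct_sum_out[OF b f(1)] trans[OF _ biproduct_sum_out[OF b f(2), symmetric]]])
qed

end

section \<open>Triangularization over an algebraically closed field\<close>

definition horner :: "('k, 'e) ring_scheme => 'k => 'k list => 'k" where
 "horner K a p = foldl (%x c. (a \<otimes>\<^sub>K x) \<oplus>\<^sub>K c) \<zero>\<^sub>K p"

lemma horner_simps [simp]:
 "horner K a [] = \<zero>\<^sub>K" "horner K a (p @ [c]) = (a \<otimes>\<^sub>K horner K a p) \<oplus>\<^sub>K c"
 by (simp_all add: horner_def)

lemma (in field) horner_closed: "a : carrier R ==> set p \<subseteq> carrier R ==> horner R a p : carrier R"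
 by (induction p rule: rev_induct) auto

lemma (in field) horner_eval: "a : carrier R ==> set p \<subseteq> carrier R ==> horner R a p = eval p a"
proof (induction p rule: rev_induct)
 case (snoc c p)
 have "eval (p @ [c]) a = eval p a \<otimes> a \<oplus> c" using eval_append_aux[of p c a] snoc.prems by auto
 thus ?case using snoc horner_closed[of a p] by (simp add: m_comm)
qed simp

lemma (in algebraically_closed) exists_root:
 assumes "set (c # r) \<subseteq> carrier L" "c ~= \<zero>" "r ~= []"
 shows "EX a:carrier L. horner L a (c # r) = \<zero>"
proof -
 have p: "c # r : carrier (poly_ring L)" using assms by (auto simp: univ_poly_def polynomial_def)
 have "splitted (c # r)" by (rule roots_over_carrier[OF p])
 hence "size (roots (c # r)) = length r" unfolding splitted_def by simp
 hence "roots (c # r) ~= {#}" using assms(3) by auto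
 then obtain a where "a \<in># roots (c # r)" by blast
 hence "is_root (c # r) a" using roots_mem_iff_is_root[OF p] by simp
 thus ?thesis using horner_eval[of a "c # r"] assms by (auto simp: is_root_def)
qed

locale triangularization = ac: algebraically_closed K + linear_map K V V T for K V T +
 assumes fin_dim: "V.fin_dim"
begin

text \<open>This is \<open>p(T) u\<close> by Horner's scheme, leading coefficient first: appending a
  coefficient costs one application of \<open>T\<close> and one addition.\<close>

definition act :: "'a list => 'c => 'c" where
 "act p u = foldl (%w c. T w \<oplus>\<^sub>V c \<odot>\<^sub>V u) \<zero>\<^sub>V p"

lemma act_simps [simp]:
 "act [] u = \<zero>\<^sub>V" "act (p @ [c]) u = T (act p u) \<oplus>\<^sub>V c \<odot>\<^sub>V u"
 by (simp_all add: act_def)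

lemma act_closed [simp]: "set p \<subseteq> carrier K ==> u : carrier V ==> act p u : carrier V"
 by (induction p rule: rev_induct) (auto intro: f_im)

lemma act_zero_Cons: "u : carrier V ==> act (\<zero>\<^bsub>K\<^esub> # p) u = act p u"
 by (simp add: act_def)

text \<open>Synthetic division by \<open>x - a\<close>: \<open>p(T) u\<close> equals
  \<open>q(T)\<close> applied to \<open>(T - a) u\<close> plus \<open>p(a) u\<close>. The quotient
  is padded to the length of \<open>p\<close> by a zero in front, so the leading coefficient of
  \<open>p\<close> reappears at position 1.\<close>

lemma act_division:
 assumes "a : carrier K" "u : carrier V" "set p \<subseteq> carrier K"
 shows "EX q. length q = length p & set q \<subseteq> carrier K &
   (p ~= [] --> hd q = \<zero>\<^sub>K) & (length p \<ge> 2 --> q ! 1 = hd p) &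
   act p u = act q (T u \<ominus>\<^bsub>V\<^esub> a \<odot>\<^sub>V u) \<oplus>\<^sub>V horner K a p \<odot>\<^sub>V u"
 using assms(3)
proof (induction p rule: rev_induct)
 case Nil
 thus ?case using assms by (intro exI[of _ "[]"]) simp
next
 case (snoc c p)
 then obtain q where q: "length q = length p" "set q \<subseteq> carrier K" "p ~= [] --> hd q = \<zero>\<^sub>K"
  "length p \<ge> 2 --> q ! 1 = hd p"
  "act p u = act q (T u \<ominus>\<^bsub>V\<^esub> a \<odot>\<^sub>V u) \<oplus>\<^sub>V horner K a p \<odot>\<^sub>V u" by auto
 define u' where "u' = T u \<ominus>\<^bsub>V\<^esub> a \<odot>\<^sub>V u"
 define h where "h = horner K a p"
 have c: "c : carrier K" "set p \<subseteq> carrier K" using snoc.prems by auto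
 have h: "h : carrier K" unfolding h_def by (rule ac.horner_closed) (use assms c in auto)
 have Tu: "T u : carrier V" using assms by (auto intro: f_im)
 have u': "u' : carrier V" unfolding u'_def using assms Tu by simp
 have aq: "act q u' : carrier V" "T (act q u') : carrier V" using q u' by (auto intro: f_im)
 have q5: "act p u = act q u' \<oplus>\<^sub>V h \<odot>\<^sub>V u" using q(5) unfolding u'_def h_def .
 have "T u = u' \<oplus>\<^sub>V a \<odot>\<^sub>V u" unfolding u'_def using assms Tu
  by (simp add: V.module.M.minus_eq V.module.M.a_assoc V.module.M.l_neg)
 hence "act (p @ [c]) u = (T (act q u') \<oplus>\<^sub>V h \<odot>\<^sub>V (u' \<oplus>\<^sub>V a \<odot>\<^sub>V u)) \<oplus>\<^sub>V c \<odot>\<^sub>V u"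
  using q5 aq h assms u' by (simp add: f_add f_smult)
 also have "... = act (q @ [h]) u' \<oplus>\<^sub>V ((a \<otimes>\<^sub>K h) \<oplus>\<^sub>K c) \<odot>\<^sub>V u"
 proof -
  have y: "((a \<otimes>\<^sub>K h) \<oplus>\<^sub>K c) \<odot>\<^sub>V u = h \<odot>\<^sub>V (a \<odot>\<^sub>V u) \<oplus>\<^sub>V c \<odot>\<^sub>V u"
   using h assms c ac.m_comm[of a h] by (simp add: V.module.smult_l_distr V.module.smult_assoc1)
  have x: "h \<odot>\<^sub>V (u' \<oplus>\<^sub>V a \<odot>\<^sub>V u) = h \<odot>\<^sub>V u' \<oplus>\<^sub>V h \<odot>\<^sub>V (a \<odot>\<^sub>V u)"
   by (rule V.module.smult_r_distr) (use h assms u' in auto)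
  define A x1 y1 z1 where "A = T (act q u')" "x1 = h \<odot>\<^sub>V u'" "y1 = h \<odot>\<^sub>V (a \<odot>\<^sub>V u)" "z1 = c \<odot>\<^sub>V u"
  have cl: "A : carrier V" "x1 : carrier V" "y1 : carrier V" "z1 : carrier V"
   using aq h assms u' c by (auto simp: A_x1_y1_z1_def)
  have "(A \<oplus>\<^sub>V (x1 \<oplus>\<^sub>V y1)) \<oplus>\<^sub>V z1 = (A \<oplus>\<^sub>V x1) \<oplus>\<^sub>V (y1 \<oplus>\<^sub>V z1)"
   using cl by (simp add: V.module.M.a_assoc)
  thus ?thesis unfolding x y act_simps(2) A_x1_y1_z1_def .
 qed
 finally have "act (p @ [c]) u = act (q @ [h]) u' \<oplus>\<^sub>V horner K a (p @ [c]) \<odot>\<^sub>V u"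
  by (simp add: h_def)
 moreover have "hd (q @ [h]) = \<zero>\<^sub>K"
 proof (cases "p = []")
  case True
  hence "q = []" using q(1) by simp
  thus ?thesis using True by (simp add: h_def)
 next
  case False
  hence "q ~= []" using q(1) by auto
  thus ?thesis using False q(3) by simp
 qed
 moreover have "length (p @ [c]) \<ge> 2 --> (q @ [h]) ! 1 = hd (p @ [c])"
 proof
  assume "length (p @ [c]) \<ge> 2"
  then consider "length p = 1" | "length p \<ge> 2" by fastforce
  thus "(q @ [h]) ! 1 = hd (p @ [c])"
  proof cases
   case 1
   then obtain b where b: "p = [b]" by (auto simp: length_Suc_conv)
   have "b : carrier K" using c b by simp
   hence "h = b" using b assms by (simp add: h_def horner_def)
   moreover have "(q @ [h]) ! 1 = h" using q(1) 1 by (simp add: nth_append)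
   ultimately show ?thesis using b by simp
  next
   case 2
   hence "(q @ [h]) ! 1 = q ! 1" using q(1) by (simp add: nth_append)
   moreover have "p ~= []" using 2 by auto
   ultimately show ?thesis using q(4) 2 by simp
  qed
 qed
 ultimately show ?case using q(1,2) h unfolding u'_def by (intro exI[of _ "q @ [h]"]) simp
qed

text \<open>Linear factors are split off one at a time. As long as \<open>(T - a) u\<close> lies
  outside \<open>W\<close> for the chosen root \<open>a\<close>, it replaces \<open>u\<close> and
  the degree drops. The process must stop, since at degree zero \<open>c u\<close> in
  \<open>W\<close> would put \<open>u\<close> into \<open>W\<close>; the vector where it stops is
  the desired one.\<close>

lemma act_reduction:
 assumes W: "submodule K W V" and c: "c ~= \<zero>\<^sub>K"
 shows "set (c # r) \<subseteq> carrier K ==> u : carrier V ==> u \<notin> W ==> act (c # r) u : W ==>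
  EX v:carrier V. v \<notin> W & (EX a:carrier K. T v \<ominus>\<^bsub>V\<^esub> a \<odot>\<^sub>V v : W)"
proof (induction "length r" arbitrary: r u)
 case 0
 hence "c \<odot>\<^sub>V u : W" by (simp add: act_def)
 hence "inv\<^bsub>K\<^esub> c \<odot>\<^sub>V (c \<odot>\<^sub>V u) : W"
  using W c 0 ac.inverse_exists[of c] by (auto simp: submodule_def)
 hence "u : W" using 0 c ac.inverse_exists[of c] ac.field_Units ac.Units_l_inv[of c] by (simp add: V.module.smult_assoc1[symmetric])
 thus ?case using 0 by simp
next
 case (Suc n)
 hence "r ~= []" by auto
 then obtain a where a: "a : carrier K" "horner K a (c # r) = \<zero>\<^sub>K"
  using ac.exists_root[of c r] Suc.prems c by auto
 obtain q where q: "length q = length (c # r)" "set q \<subseteq> carrier K" "hd q = \<zero>\<^sub>K"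
  "length (c # r) \<ge> 2 --> q ! 1 = c"
  "act (c # r) u = act q (T u \<ominus>\<^bsub>V\<^esub> a \<odot>\<^sub>V u) \<oplus>\<^sub>V horner K a (c # r) \<odot>\<^sub>V u"
  using act_division[OF a(1) Suc.prems(2,1)] by auto
 define u' where "u' = T u \<ominus>\<^bsub>V\<^esub> a \<odot>\<^sub>V u"
 have u': "u' : carrier V" unfolding u'_def using Suc.prems a by (auto intro: f_im)
 have "length q \<ge> 2" using q(1) Suc(2) by simp
 then obtain x y r' where q': "q = x # y # r'" by (metis One_nat_def Suc_1 Suc_le_length_iff)
 have xy: "x = \<zero>\<^sub>K" "y = c" using q q' Suc(2) by auto
 have "act (c # r) u = act (c # r') u'"
  using q(2,5) a u' Suc.prems q' xy act_zero_Cons[of u' "c # r'"] by (simp add: u'_def)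
 hence "act (c # r') u' : W" using Suc.prems by simp
 moreover have "n = length r'" using q(1) q' Suc(2) by simp
 moreover have "set (c # r') \<subseteq> carrier K" using q(2) q' xy by auto
 ultimately show ?case using Suc(1)[of r' u'] u' Suc.prems a by (cases "u' : W") (auto simp: u'_def)
qed

lemma T_finsum:
 "finite A ==> g : A \<rightarrow> carrier V ==> T (\<Oplus>\<^bsub>V\<^esub>i\<in>A. g i) = (\<Oplus>\<^bsub>V\<^esub>i\<in>A. T (g i))"
proof (induction A rule: finite_induct)
 case (insert a A)
 hence "g a : carrier V" "g : A \<rightarrow> carrier V" "(%i. T (g i)) : A \<rightarrow> carrier V" "T (g a) : carrier V"
  by (auto intro: f_im)
 thus ?case using insert by (simp add: f_add)
qed simp

lemma finsum_power_act:
 assumes "u : carrier V" "c : {..<n} \<rightarrow> carrier K"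
 shows "EX p. length p = n & set p \<subseteq> carrier K & act p u = (\<Oplus>\<^bsub>V\<^esub>i\<in>{..<n}. c i \<odot>\<^sub>V (T ^^ i) u)"
 using assms(2)
proof (induction n arbitrary: c)
 case 0
 thus ?case by (intro exI[of _ "[]"]) simp
next
 case (Suc n)
 have pw: "(T ^^ i) u : carrier V" for i using assms by (induction i) (auto intro: f_im)
 have "(%i. c (Suc i)) : {..<n} \<rightarrow> carrier K" using Suc.prems by auto
 then obtain p where p: "length p = n" "set p \<subseteq> carrier K" "act p u = (\<Oplus>\<^bsub>V\<^esub>i\<in>{..<n}. c (Suc i) \<odot>\<^sub>V (T ^^ i) u)"
  using Suc.IH by blast
 have c: "c i : carrier K" if "i < Suc n" for i using Suc.prems that by auto
 have "T (act p u) = (\<Oplus>\<^bsub>V\<^esub>i\<in>{..<n}. T (c (Suc i) \<odot>\<^sub>V (T ^^ i) u))"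
  unfolding p(3) by (rule T_finsum) (use c pw in auto)
 also have "... = (\<Oplus>\<^bsub>V\<^esub>i\<in>{..<n}. c (Suc i) \<odot>\<^sub>V (T ^^ Suc i) u)"
  by (rule V.module.M.finsum_cong') (use c pw in "auto intro: f_im simp: f_smult")
 also have "... = (\<Oplus>\<^bsub>V\<^esub>i\<in>Suc ` {..<n}. c i \<odot>\<^sub>V (T ^^ i) u)"
  by (subst V.module.M.finsum_reindex) (use c pw in "auto intro: f_im")
 finally have ta: "T (act p u) = (\<Oplus>\<^bsub>V\<^esub>i\<in>Suc ` {..<n}. c i \<odot>\<^sub>V (T ^^ i) u)" .
 have "T (act p u) \<oplus>\<^sub>V c 0 \<odot>\<^sub>V u = (\<Oplus>\<^bsub>V\<^esub>i\<in>insert 0 (Suc ` {..<n}). c i \<odot>\<^sub>V (T ^^ i) u)"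
 proof -
  have s: "(%i. c i \<odot>\<^sub>V (T ^^ i) u) : Suc ` {..<n} \<rightarrow> carrier V" "c 0 \<odot>\<^sub>V u : carrier V"
   using c[of 0] c pw assms by (auto intro!: V.module.smult_closed simp del: funpow.simps)
  have "(\<Oplus>\<^bsub>V\<^esub>i\<in>insert 0 (Suc ` {..<n}). c i \<odot>\<^sub>V (T ^^ i) u)
   = c 0 \<odot>\<^sub>V u \<oplus>\<^sub>V (\<Oplus>\<^bsub>V\<^esub>i\<in>Suc ` {..<n}. c i \<odot>\<^sub>V (T ^^ i) u)"
   using s by (subst V.module.M.finsum_insert) auto
  thus ?thesis unfolding ta using V.module.M.finsum_closed[OF s(1)] s(2) by (simp only: V.module.M.a_comm)
 qed
 thus ?case using p c
  by (intro exI[of _ "p @ [c 0]"]) (auto simp: lessThan_Suc_eq_insert_0)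
qed

text \<open>By finite dimension some power \<open>T^n u\<close> depends on the earlier ones, so a
  monic polynomial in \<open>T\<close> kills \<open>u\<close> and \<open>act_reduction\<close>
  applies. For an invariant \<open>W\<close> the result is an eigenvector modulo \<open>W\<close>;
  for \<open>W\<close> zero it is an eigenvector.\<close>

lemma triangular_step:
 assumes W: "submodule K W V" and u: "u : carrier V" "u \<notin> W"
 shows "EX v:carrier V. v \<notin> W & (EX a:carrier K. T v \<ominus>\<^bsub>V\<^esub> a \<odot>\<^sub>V v : W)"
proof -
 define A where "A n = (%i. (T ^^ i) u) ` {..<n}" for n
 have pw: "(T ^^ i) u : carrier V" for i using u by (induction i) (auto intro: f_im)
 have AV: "A n \<subseteq> carrier V" "finite (A n)" for n using pw by (auto simp: A_def)
 have "EX n. (T ^^ n) u : V.module.span (A n)"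
 proof (rule ccontr)
  assume n: "\<nexists>n. (T ^^ n) u : V.module.span (A n)"
  have "V.module.lin_indpt (A n) & card (A n) = n" for n
  proof (induction n)
   case 0
   thus ?case by (simp add: A_def V.module.finite_lin_indpt2)
  next
   case (Suc n)
   have s: "(T ^^ n) u \<notin> V.module.span (A n)" using n by auto
   hence na: "(T ^^ n) u \<notin> A n" using V.module.in_own_span[OF AV(1)] by blast
   have "A (Suc n) = A n \<union> {(T ^^ n) u}" by (auto simp: A_def lessThan_Suc)
   thus ?case using Suc na s V.lin_dep_iff_in_span[of "A n" "(T ^^ n) u"] AV pw by auto
  qed
  hence "V.module.lin_indpt (A (Suc V.dim))" "card (A (Suc V.dim)) = Suc V.dim" by auto
  thus False using V.li_le_dim(2)[OF fin_dim AV(1)[of "Suc V.dim"]] by simp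
 qed
 then obtain n0 where n0: "(T ^^ n0) u : V.module.span (A n0)" by blast
 \<comment> \<open>The least exponent makes the earlier powers pairwise distinct, so a combination
   of vectors can be rewritten as a sum over exponents.\<close>
 define n where "n = (LEAST n. (T ^^ n) u : V.module.span (A n))"
 have n1: "(T ^^ n) u : V.module.span (A n)"
  unfolding n_def by (rule LeastI[of "%n. (T ^^ n) u : V.module.span (A n)", OF n0])
 have n2: "(T ^^ m) u \<notin> V.module.span (A m)" if "m < n" for m
  using not_less_Least[of m "%n. (T ^^ n) u : V.module.span (A n)"] that unfolding n_def by blast
 note n = n1 n2
 have inj: "inj_on (%i. (T ^^ i) u) {..<n}"
 proof (rule linorder_inj_onI)
  fix i j assume "i < j" "i : {..<n}" "j : {..<n}"
  hence "(T ^^ i) u : A j" "(T ^^ j) u \<notin> V.module.span (A j)"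
   unfolding A_def using n(2)[of j, unfolded A_def] by blast+
  thus "(T ^^ i) u ~= (T ^^ j) u" using V.module.in_own_span[OF AV(1)[of j]] by (metis subsetD)
 qed auto
 obtain b where b: "b : A n \<rightarrow> carrier K" "V.module.lincomb b (A n) = (T ^^ n) u"
  using V.module.finite_in_span[OF AV(2,1) n(1)] by blast
 have bb: "b ((T ^^ i) u) : carrier K" if "i < n" for i using b that by (auto simp: A_def)
 have e: "(T ^^ n) u = (\<Oplus>\<^bsub>V\<^esub>i\<in>{..<n}. b ((T ^^ i) u) \<odot>\<^sub>V (T ^^ i) u)"
  unfolding b(2)[symmetric] V.module.lincomb_def A_def
  by (subst V.module.M.finsum_reindex[OF _ inj]) (use bb pw in auto)
 obtain p where p: "length p = n" "set p \<subseteq> carrier K"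
  "act p u = (\<Oplus>\<^bsub>V\<^esub>i\<in>{..<n}. (\<ominus>\<^sub>K b ((T ^^ i) u)) \<odot>\<^sub>V (T ^^ i) u)"
  using finsum_power_act[of u "%i. \<ominus>\<^bsub>K\<^esub> b ((T ^^ i) u)" n] u bb by auto
 have W0: "\<zero>\<^sub>V : W" using W by (simp add: submodule_def)
 have lead: "act (d # p) u = d \<odot>\<^sub>V (T ^^ length p) u \<oplus>\<^sub>V act p u"
  if "set p \<subseteq> carrier K" "d : carrier K" for d p
  using that(1)
 proof (induction p rule: rev_induct)
  case Nil
  thus ?case using u that by (simp add: act_def)
 next
  case (snoc c p)
  have "act (d # p @ [c]) u = T (d \<odot>\<^sub>V (T ^^ length p) u \<oplus>\<^sub>V act p u) \<oplus>\<^sub>V c \<odot>\<^sub>V u"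
   using snoc act_simps(2)[of "d # p" c u] by simp
  thus ?case using snoc.prems u pw[of "length p"] pw[of "Suc (length p)"] that act_closed[of p u] f_im[of "act p u"]
   by (simp add: f_add f_smult V.module.M.a_assoc)
 qed
 have "(\<Oplus>\<^bsub>V\<^esub>i\<in>{..<n}. (\<ominus>\<^sub>K b ((T ^^ i) u)) \<odot>\<^sub>V (T ^^ i) u)
   = (\<Oplus>\<^bsub>V\<^esub>i\<in>{..<n}. (\<ominus>\<^sub>K \<one>\<^sub>K) \<odot>\<^sub>V (b ((T ^^ i) u) \<odot>\<^sub>V (T ^^ i) u))"
  by (rule V.module.M.finsum_cong')
   (use bb pw in "auto simp: V.module.smult_assoc1[symmetric] ac.l_minus")
 also have "... = (\<ominus>\<^sub>K \<one>\<^sub>K) \<odot>\<^sub>V (T ^^ n) u"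
  unfolding e by (rule V.module.finsum_smult[symmetric]) (use bb pw in auto)
 finally have "act p u = (\<ominus>\<^sub>K \<one>\<^sub>K) \<odot>\<^sub>V (T ^^ n) u" using p(3) by simp
 hence "act (\<one>\<^bsub>K\<^esub> # p) u = \<zero>\<^sub>V"
  using lead[OF p(2), of "\<one>\<^sub>K"] p(1) pw[of n] V.module.smult_minus_1[of "(T ^^ n) u"]
  by (simp add: V.module.M.r_neg)
 thus ?thesis using act_reduction[OF W, of "\<one>\<^sub>K" p u] p u W0 by auto
qed

end

section \<open>Schur's lemma and multiplicities\<close>

definition hdim :: "('k, 'e) ring_scheme => ('k, 'o, 'm, 'z) linear_cat_scheme => 'o => 'o => nat" where
 "hdim K C X Y = subdim K (HomV C X Y) (hom C X Y)"

context linear_category begin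

abbreviation "dm == hdim K C"

lemma hom_submodule: "X : Ob ==> Y : Ob ==> submodule K (hm X Y) (HomV C X Y)"
 by (rule submodule_homI) (auto simp: hom_iff)

lemma diff_eq_nul:
 assumes "ar f" "ar g" "src f = src g" "tgt f = tgt g"
  "f +. (\<ominus>\<^sub>K \<one>\<^sub>K) |> g = nl (src f) (tgt f)"
 shows "f = g"
proof -
 interpret v: vectorspace K "HomV C (src f) (tgt f)" by (rule vectorspace_HomV) (use assms in auto)
 have h: "f : hm (src f) (tgt f)" "g : hm (src f) (tgt f)" using assms by (auto simp: hom_iff)
 have "f \<oplus>\<^bsub>HomV C (src f) (tgt f)\<^esub> (\<ominus>\<^sub>K \<one>\<^sub>K) \<odot>\<^bsub>HomV C (src f) (tgt f)\<^esub> g = \<zero>\<^bsub>HomV C (src f) (tgt f)\<^esub>"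
  using h assms(5) by (simp add: HomV_ops)
 hence "f \<ominus>\<^bsub>HomV C (src f) (tgt f)\<^esub> g = \<zero>\<^bsub>HomV C (src f) (tgt f)\<^esub>"
  using v.smult_minus_1[of g] h by (simp add: v.M.minus_eq)
 thus ?thesis using h by (simp add: v.M.minus_other_side)
qed

lemma diff_self [simp]: "ar f ==> f +. (\<ominus>\<^sub>K \<one>\<^sub>K) |> f = nl (src f) (tgt f)"
proof -
 assume a: "ar f"
 interpret v: vectorspace K "HomV C (src f) (tgt f)" by (rule vectorspace_HomV) (use a in auto)
 have h: "f : hm (src f) (tgt f)" using a by (auto simp: hom_iff)
 show ?thesis using v.smult_minus_1[of f] h v.M.r_neg[of f] a
  by (simp add: HomV_ops)
qed

lemma plus_nul [simp]: "ar f ==> src f = X ==> tgt f = Y ==> f +. nl X Y = f"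
 "ar f ==> src f = X ==> tgt f = Y ==> nl X Y +. f = f"
proof -
 assume a: "ar f" "src f = X" "tgt f = Y"
 interpret v: vectorspace K "HomV C X Y" by (rule vectorspace_HomV) (use a in auto)
 have h: "f : hm X Y" "nl X Y : hm X Y" using a by (auto simp: hom_iff)
 show "f +. nl X Y = f" "nl X Y +. f = f"
  using h v.M.r_zero[of f] v.M.l_zero[of f] by (auto simp: HomV_ops[symmetric] HomV_ops(1)[symmetric])
qed

lemma scale_nul [simp]:
 assumes "X : Ob" "Y : Ob" "c : carrier K"
 shows "c |> nl X Y = nl X Y"
proof -
 interpret v: vectorspace K "HomV C X Y" by (rule vectorspace_HomV) fact+
 have "nl X Y : hm X Y" using assms by (simp add: hom_iff)
 thus ?thesis using v.smult_r_null[OF assms(3)] HomV_ops(2)[of "nl X Y" X Y c] by (simp add: HomV_ops(3))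
qed

lemma plus_comm: "ar f ==> ar g ==> src f = src g ==> tgt f = tgt g ==> f +. g = g +. f"
proof -
 assume a: "ar f" "ar g" "src f = src g" "tgt f = tgt g"
 interpret v: vectorspace K "HomV C (src f) (tgt f)" by (rule vectorspace_HomV) (use a in auto)
 show ?thesis using v.M.a_comm[of f g] a by (simp add: plus_arr_def hom_iff)
qed

lemma plus_assoc [simp]:
 "ar f ==> ar g ==> ar h ==> src f = src g ==> tgt f = tgt g ==> src h = src g ==> tgt h = tgt g
  ==> (f +. g) +. h = f +. (g +. h)"
proof -
 assume a: "ar f" "ar g" "ar h" "src f = src g" "tgt f = tgt g" "src h = src g" "tgt h = tgt g"
 interpret v: vectorspace K "HomV C (src f) (tgt f)" by (rule vectorspace_HomV) (use a in auto)
 show ?thesis using v.M.a_assoc[of f g h] a by (simp add: plus_arr_def hom_iff HomV_simps)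
qed

lemma scale_plus [simp]:
 "ar f ==> ar g ==> src f = src g ==> tgt f = tgt g ==> c : carrier K ==> c |> (f +. g) = c |> f +. c |> g"
proof -
 assume a: "ar f" "ar g" "src f = src g" "tgt f = tgt g" "c : carrier K"
 interpret v: vectorspace K "HomV C (src f) (tgt f)" by (rule vectorspace_HomV) (use a in auto)
 show ?thesis using v.smult_r_distr[of c f g] a by (simp add: plus_arr_def scale_arr_def hom_iff HomV_simps)
qed

lemma plus_scale:
 "ar f ==> c : carrier K ==> d : carrier K ==> c |> f +. d |> f = (c \<oplus>\<^sub>K d) |> f"
proof -
 assume a: "ar f" "c : carrier K" "d : carrier K"
 interpret v: vectorspace K "HomV C (src f) (tgt f)" by (rule vectorspace_HomV) (use a in auto)
 show ?thesis using v.smult_l_distr[of c d f] a by (simp add: plus_arr_def scale_arr_def hom_iff HomV_simps)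
qed

lemma diff_cancel_left [simp]:
 "ar f ==> ar g ==> src f = src g ==> tgt f = tgt g ==> f +. ((\<ominus>\<^sub>K \<one>\<^sub>K) |> f +. g) = g"
 "ar f ==> ar g ==> src f = src g ==> tgt f = tgt g ==> (\<ominus>\<^sub>K \<one>\<^sub>K) |> f +. (f +. g) = g"
 "ar f ==> (\<ominus>\<^sub>K \<one>\<^sub>K) |> f +. f = nl (src f) (tgt f)"
proof -
 assume a: "ar f"
 show n: "(\<ominus>\<^sub>K \<one>\<^sub>K) |> f +. f = nl (src f) (tgt f)"
  by (rule trans[OF plus_comm diff_self]) (use a in auto)
 assume g: "ar g" "src f = src g" "tgt f = tgt g"
 have 1: "f +. ((\<ominus>\<^sub>K \<one>\<^sub>K) |> f +. g) = (f +. (\<ominus>\<^sub>K \<one>\<^sub>K) |> f) +. g"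
  by (rule sym, rule plus_assoc) (use a g in auto)
 show "f +. ((\<ominus>\<^sub>K \<one>\<^sub>K) |> f +. g) = g" unfolding 1 diff_self[OF a] using g by simp
 have 2: "(\<ominus>\<^sub>K \<one>\<^sub>K) |> f +. (f +. g) = ((\<ominus>\<^sub>K \<one>\<^sub>K) |> f +. f) +. g"
  by (rule sym, rule plus_assoc) (use a g in auto)
 show "(\<ominus>\<^sub>K \<one>\<^sub>K) |> f +. (f +. g) = g" unfolding 2 n using g by simp
qed

lemma zero_object_iff: "zero_object C Z \<longleftrightarrow> Z : Ob & ii Z = nl Z Z"
proof
 assume "zero_object C Z"
 thus "Z : Ob & ii Z = nl Z Z"
  using Id_closed[of Z] by (auto simp: zero_object_def ide_def nul_def HomV_simps)
next
 assume z: "Z : Ob & ii Z = nl Z Z"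
 have "(Z, f, X) = nl Z X" if "X : Ob" "f : arrows C Z X" for X f
  using cmp_ide_right[of "(Z, f, X)" Z] cmp_nul_right[of "(Z, f, X)" Z Z] that z by (auto simp: arr_def simp del: arr_obj)
 moreover have "(X, f, Z) = nl X Z" if "X : Ob" "f : arrows C X Z" for X f
  using cmp_ide_left[of "(X, f, Z)" Z] cmp_nul_left[of "(X, f, Z)" Z Z] that z by (auto simp: arr_def simp del: arr_obj)
 moreover have "\<zero>\<^bsub>Hom C X Y\<^esub> : arrows C X Y" if "X : Ob" "Y : Ob" for X Y
  using Hom_module[OF that] by (simp add: module_def abelian_group_def abelian_monoid.zero_closed)
 ultimately show "zero_object C Z" using z
  by (fastforce simp: zero_object_def nul_def HomV_simps)
qed

lemma zero_object_arr:
 "zero_object C Z ==> ar f ==> src f = Z ==> f = nl Z (tgt f)"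
 "zero_object C Z ==> ar f ==> tgt f = Z ==> f = nl (src f) Z"
 using cmp_ide_right[of f Z] cmp_nul_right[of f Z Z] cmp_ide_left[of f Z] cmp_nul_left[of f Z Z]
 by (auto simp: zero_object_iff)

lemma monic_iff:
 "X : Ob ==> Y : Ob ==> monic C X Y m \<longleftrightarrow> ar (X, m, Y) &
  (ALL g h. ar g --> ar h --> src g = src h --> tgt g = X --> tgt h = X -->
   (X, m, Y) *. g = (X, m, Y) *. h --> g = h)" (is "_ ==> _ ==> _ \<longleftrightarrow> ?R")
proof -
 assume XY: "X : Ob" "Y : Ob"
 show ?thesis
 proof
  assume m: "monic C X Y m"
  show ?R
  proof (intro conjI allI impI)
   show "ar (X, m, Y)" using m XY by (auto simp: monic_def arr_def)
   fix g h assume *: "ar g" "ar h" "src g = src h" "tgt g = X" "tgt h = X" "(X, m, Y) *. g = (X, m, Y) *. h"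
   hence "mor g = mor h" using m by (auto simp: monic_def arr_def cmp_def simp del: arr_obj)
   thus "g = h" using * by (intro arrow_eqI) auto
  qed
 next
  assume r: ?R
  show "monic C X Y m" unfolding monic_def
  proof (intro conjI ballI impI)
   show "m : arrows C X Y" using r by (auto simp: arr_def simp del: arr_obj)
   fix W g h assume *: "W : Ob" "g : arrows C W X" "h : arrows C W X" "m \<cdot> g = m \<cdot> h"
   hence "(W, g, X) = (W, h, X)" using r XY
    by (elim conjE allE[of _ "(W, g, X)"] allE[of _ "(W, h, X)"]) (auto simp: arr_def cmp_def simp del: arr_obj)
   thus "g = h" by simp
  qed
 qed
qed

lemma kernelE:
 assumes "is_kernel C A X Y k f" "A : Ob" "X : Ob" "Y : Ob"
 shows "ar (A, k, X)" "ar (X, f, Y)" "(X, f, Y) *. (A, k, X) = nl A Y"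
  and "!!g. ar g ==> tgt g = X ==> (X, f, Y) *. g = nl (src g) Y ==>
   EX u. ar u & src u = src g & tgt u = A & (A, k, X) *. u = g"
  and "!!g h. ar g ==> ar h ==> src g = src h ==> tgt g = A ==> tgt h = A ==>
   (A, k, X) *. g = (A, k, X) *. h ==> g = h"
proof -
 note k = assms(1)[unfolded is_kernel_def]
 show a1: "ar (A, k, X)" and a2: "ar (X, f, Y)" using k assms by (auto simp: arr_def simp del: arr_obj)
 show z: "(X, f, Y) *. (A, k, X) = nl A Y" using k by (auto simp: cmp_def nul_def HomV_simps)
 have uni: "EX! u. u : arrows C W A & k \<cdot> u = g" if "W : Ob" "g : arrows C W X" "f \<cdot> g = \<zero>\<^bsub>Hom C W Y\<^esub>" for W g
  using k that by auto
 show "EX u. ar u & src u = src g & tgt u = A & (A, k, X) *. u = g"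
  if g: "ar g" "tgt g = X" "(X, f, Y) *. g = nl (src g) Y" for g
 proof -
  have "EX! u. u : arrows C (src g) A & k \<cdot> u = mor g"
   by (rule uni) (use g in "auto simp: arr_def cmp_def nul_def HomV_simps simp del: arr_obj")
  then obtain u where "u : arrows C (src g) A" "k \<cdot> u = mor g" by auto
  thus ?thesis using g assms arr_obj[OF g(1)]
   by (intro exI[of _ "(src g, u, A)"]) (auto simp: arr_def cmp_def intro: arrow_eqI simp del: arr_obj)
 qed
 show "g = h" if g: "ar g" "ar h" "src g = src h" "tgt g = A" "tgt h = A" "(A, k, X) *. g = (A, k, X) *. h" for g h
 proof -
  have kg: "ar ((A, k, X) *. g)" using g a1 by simp
  have "(X, f, Y) *. (A, k, X) *. g = ((X, f, Y) *. (A, k, X)) *. g"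
   using a1 a2 g by simp
  also have "... = nl (src g) Y" unfolding z using g assms by simp
  finally have "f \<cdot> (k \<cdot> mor g) = \<zero>\<^bsub>Hom C (src g) Y\<^esub>" by (auto simp: cmp_def nul_def HomV_simps)
  moreover have "k \<cdot> mor g : arrows C (src g) X" using kg by (auto simp: arr_def cmp_def simp del: arr_obj)
  ultimately have "EX! u. u : arrows C (src g) A & k \<cdot> u = k \<cdot> mor g" using uni g arr_obj by blast
  moreover have "mor g : arrows C (src g) A" "mor h : arrows C (src g) A" "k \<cdot> mor h = k \<cdot> mor g"
   using g by (auto simp: arr_def cmp_def simp del: arr_obj)
  ultimately have "mor g = mor h" by blast
  thus ?thesis using g by (intro arrow_eqI) auto
 qed
qed

lemma finsum_HomV_triple:
 assumes "finite J" "X : Ob" "Y : Ob" "F : J \<rightarrow> arrows C X Y"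
 shows "finsum (HomV C X Y) (%j. (X, F j, Y)) J = (X, finsum (Hom C X Y) F J, Y)"
 using assms(1,4)
proof (induction J rule: finite_induct)
 interpret v: vectorspace K "HomV C X Y" by (rule vectorspace_HomV) fact+
 interpret w: module K "Hom C X Y" by (rule Hom_module) fact+
 {
  case empty
  thus ?case by (simp add: HomV_simps)
 next
  case (insert j J)
  have "(%j. (X, F j, Y)) : insert j J \<rightarrow> carrier (HomV C X Y)"
   using insert.prems assms by (auto simp: hom_iff arr_def simp del: arr_obj)
  thus ?case using insert by (simp add: HomV_simps Pi_iff)
 }
qed

lemma direct_sum_biproduct:
 assumes "is_direct_sum C n S X"
 obtains i p where "biproduct C {..<n} S X i p"
proof -
 obtain a b where ab: "X : Ob" "ALL j<n. S j : Ob" "ALL i<n. a i : arrows C (S i) X & b i : arrows C X (S i)"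
  "ALL i<n. ALL j<n. b i \<cdot> a j = (if i = j then Id C (S i) else \<zero>\<^bsub>Hom C (S j) (S i)\<^esub>)"
  "(\<Oplus>\<^bsub>Hom C X X\<^esub>i\<in>{..<n}. a i \<cdot> b i) = Id C X"
  using assms unfolding is_direct_sum_def by auto
 define i where "i j = (S j, a j, X)" for j
 define p where "p j = (X, b j, S j)" for j
 have "finsum (HomV C X X) (%j. i j *. p j) {..<n} = finsum (HomV C X X) (%j. (X, a j \<cdot> b j, X)) {..<n}"
  by (simp add: i_def p_def cmp_def)
 also have "... = ii X"
  using ab by (subst finsum_HomV_triple) (auto simp: ide_def intro!: Comp_closed[of X "S _" X])
 finally show ?thesis using ab that[of i p]
  by (auto simp: biproduct_def i_def p_def hom_iff arr_def cmp_def ide_def nul_def HomV_simps simp del: arr_obj)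
qed

end

locale ac_fusion = fusion_category +
 assumes ac: "algebraically_closed K"
begin

lemma fd_hom:
 assumes "X : Ob" "Y : Ob"
 shows "vectorspace.fin_dim K (HomV C X Y)"
proof -
 interpret w: module K "Hom C X Y" by (rule Hom_module[OF assms])
 interpret w: vectorspace K "Hom C X Y" by unfold_locales
 interpret v: vectorspace K "HomV C X Y" by (rule vectorspace_HomV[OF assms])
 obtain B where B: "finite B" "B \<subseteq> arrows C X Y"
  "!!v. v : arrows C X Y ==> EX c:B \<rightarrow> carrier K. v = (\<Oplus>\<^bsub>Hom C X Y\<^esub>b\<in>B. c b \<odot>\<^bsub>Hom C X Y\<^esub> b)"
  using Hom_finite_dimensional[OF assms] unfolding finite_dimensional_def by auto
 have "arrows C X Y \<subseteq> w.span B"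
 proof
  fix v assume "v : arrows C X Y"
  then obtain c where "c : B \<rightarrow> carrier K" "v = w.lincomb c B" using B(3) unfolding w.lincomb_def by blast
  thus "v : w.span B" using B w.finite_span[OF B(1,2)] by auto
 qed
 hence fd: "w.fin_dim" unfolding w.fin_dim_def using B w.span_is_subset2[OF B(2)] by blast
 interpret t: linear_map K "Hom C X Y" "HomV C X Y" "%m. (X, m, Y)"
  by unfold_locales (use assms in "auto simp: module_hom_def HomV_simps hom_iff arr_def simp del: arr_obj")
 have "(%m. (X, m, Y)) ` arrows C X Y = hm X Y"
 proof (intro equalityI subsetI)
  fix f assume "f : hm X Y"
  hence "f = (X, mor f, Y)" "mor f : arrows C X Y" using arrow_triple[of f] by (auto simp: hom_iff arr_def simp del: arr_obj)
  thus "f : (%m. (X, m, Y)) ` arrows C X Y" by blast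
 qed (use assms in "auto simp: hom_iff arr_def simp del: arr_obj")
 thus ?thesis using t.surj_fin_dim[OF fd] by simp
qed

lemma simple_obj: "smp S ==> S : Ob"
 by (simp add: simple_object_def)

lemma simple_nonzero: "smp S ==> ii S ~= nl S S"
 using zero_object_iff by (auto simp: simple_object_def)

text \<open>Simplicity is defined by monomorphisms into the object. Applied to \<open>S\<close> it
  shows that the kernel of a non-zero \<open>f\<close> is zero, so \<open>f\<close> is monic;
  applied to \<open>T\<close> it then makes \<open>f\<close> invertible.\<close>

lemma simple_arr_iso:
 assumes S: "smp S" and T: "smp T" and f: "ar f" "src f = S" "tgt f = T" "f ~= nl S T"
 shows "isa f"
proof -
 note ST = simple_obj[OF S] simple_obj[OF T]
 have fm: "f = (S, mor f, T)" using f arrow_triple[of f] by simp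
 obtain A k where A: "A : Ob" "is_kernel C A S T k (mor f)"
  using kernel_exists[of S T "mor f"] ST f by (auto simp: arr_def simp del: arr_obj)
 note k = kernelE[OF A(2,1) ST, folded fm]
 have "monic C A S k" using monic_iff[of A S k] A(1) ST k(1,5) by blast
 hence "zero_object C A \<or> is_iso C A S k" using S A(1) by (auto simp: simple_object_def)
 moreover have False if "is_iso C A S k"
 proof -
  have i: "isa (A, k, S)" using that k(1) by (simp add: iso_arr_def)
  have "f = f *. (A, k, S) *. iv (A, k, S)" using i f by simp
  also have "... = (f *. (A, k, S)) *. iv (A, k, S)" using i f by simp
  also have "... = nl S T" unfolding k(3) using i ST by simp
  finally show False using f(4) by simp
 qed
 ultimately have z: "zero_object C A" by blast
 have "monic C S T (mor f)"
 proof (subst monic_iff[OF ST], fold fm, intro conjI allI impI)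
  show "ar f" by fact
  fix g h assume g: "ar g" "ar h" "src g = src h" "tgt g = S" "tgt h = S" "f *. g = f *. h"
  define d where "d = g +. (\<ominus>\<^sub>K \<one>\<^sub>K) |> h"
  have d: "ar d" "tgt d = S" "src d = src g" using g by (auto simp: d_def)
  have "f *. d = nl (src d) T" using g f diff_self[of "f *. h"] by (simp add: d_def)
  then obtain u where u: "ar u" "src u = src d" "tgt u = A" "(A, k, S) *. u = d"
   using k(4)[of d] d by auto
  have "u = nl (src u) A" using zero_object_arr(2)[OF z u(1,3)] .
  hence "d = nl (src d) S" using u k(1) by (metis cmp_nul_right arr_obj(1) triple_simps(1,3))
  thus "g = h" using diff_eq_nul[of g h] g d by (simp add: d_def)
 qed
 hence "zero_object C S \<or> is_iso C S T (mor f)" using T ST by (auto simp: simple_object_def)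
 thus ?thesis using S f by (auto simp: simple_object_def iso_arr_def)
qed

text \<open>Composition with \<open>f\<close> is a linear map of the finite-dimensional space
  \<open>End(S)\<close> and has an eigenvector \<open>g\<close> over an algebraically closed field.
  As \<open>g\<close> is invertible, it cancels from \<open>f g = a g\<close>.\<close>

lemma schur_End:
 assumes S: "smp S" and f: "ar f" "src f = S" "tgt f = S"
 shows "EX a:carrier K. f = a |> ii S"
proof -
 note SO = simple_obj[OF S]
 interpret v: vectorspace K "HomV C S S" by (rule vectorspace_HomV) fact+
 interpret a: algebraically_closed K by (rule ac)
 interpret t: triangularization K "HomV C S S" "%g. f *. g"
 proof unfold_locales
  show "(%g. f *. g) : module_hom K (HomV C S S) (HomV C S S)"
   using f by (auto simp: module_hom_def hom_iff HomV_ops)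
  show "v.fin_dim" by (rule fd_hom[OF SO SO])
 qed
 have "submodule K {\<zero>\<^bsub>HomV C S S\<^esub>} (HomV C S S)"
  by (rule submodule_homI) (use SO in "auto simp: HomV_ops hom_iff")
 from t.triangular_step[OF this, of "ii S"]
 obtain g a where g: "g : hm S S" "g ~= nl S S" "a : carrier K"
  "(f *. g) \<ominus>\<^bsub>HomV C S S\<^esub> (a \<odot>\<^bsub>HomV C S S\<^esub> g) = \<zero>\<^bsub>HomV C S S\<^esub>"
  using SO simple_nonzero[OF S] by (auto simp: hom_iff HomV_ops)
 have i: "isa g" by (rule simple_arr_iso[OF S S]) (use g in "auto simp: hom_iff")
 have gh: "ar g" "src g = S" "tgt g = S" using g by (auto simp: hom_iff)
 have "f *. g : hm S S" "a \<odot>\<^bsub>HomV C S S\<^esub> g : hm S S" using f gh g by (auto simp: hom_iff HomV_ops)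
 hence fg: "f *. g = a |> g" using g(1,4) v.M.minus_other_side[of "f *. g" "a \<odot>\<^bsub>HomV C S S\<^esub> g"] by (simp add: HomV_ops)
 have "f = (f *. g) *. iv g" using i f gh by simp
 also have "... = a |> ii S" unfolding fg using i gh g(3) by simp
 finally show ?thesis using g(3) by blast
qed

lemma hdim_simple:
 assumes S: "smp S" and T: "smp T"
 shows "dm S T = (if isom S T then 1 else 0)"
proof -
 note ST = simple_obj[OF S] simple_obj[OF T]
 interpret v: vectorspace K "HomV C S T" by (rule vectorspace_HomV) fact+
 show ?thesis
 proof (cases "isom S T")
  case True
  then obtain u where u: "isa u" "src u = S" "tgt u = T" using isomorphic_iff ST by auto
  have n: "u ~= nl S T"
  proof
   assume "u = nl S T"
   hence "iv u *. nl S T = ii S" using inv_cmp[OF u(1)] u by simp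
   thus False using u ST simple_nonzero[OF S] by simp
  qed
  have "hm S T = {c \<odot>\<^bsub>HomV C S T\<^esub> u |c. c : carrier K}"
  proof (intro equalityI subsetI)
   fix f assume f: "f : hm S T"
   then obtain c where c: "c : carrier K" "iv u *. f = c |> ii S"
    using schur_End[OF S, of "iv u *. f"] u by (auto simp: hom_iff)
   have "f = u *. iv u *. f" using u f by (simp add: hom_iff)
   also have "... = c |> u" unfolding c(2) using u c(1) ST by simp
   finally show "f : {c \<odot>\<^bsub>HomV C S T\<^esub> u |c. c : carrier K}" using c(1) u
    by (auto simp: HomV_ops hom_iff)
  qed (use u in "auto simp: HomV_ops hom_iff")
  moreover have "u : carrier (HomV C S T)" "u ~= \<zero>\<^bsub>HomV C S T\<^esub>" using n u by (auto simp: hom_iff HomV_ops)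
  ultimately show ?thesis using v.subdim_line[of u] True by (simp add: hdim_def)
 next
  case False
  have "hm S T = {\<zero>\<^bsub>HomV C S T\<^esub>}"
  proof (intro equalityI subsetI)
   fix f assume "f : hm S T"
   hence f: "ar f" "src f = S" "tgt f = T" by (auto simp: hom_iff)
   have "f = nl S T"
   proof (rule ccontr)
    assume "f ~= nl S T"
    hence "isa f" by (rule simple_arr_iso[OF S T f])
    thus False using False f isomorphic_iff[OF ST] by blast
   qed
   thus "f : {\<zero>\<^bsub>HomV C S T\<^esub>}" by (simp add: HomV_ops)
  qed (use ST in "auto simp: hom_iff HomV_ops")
  thus ?thesis using v.subdim_zero False by (simp add: hdim_def)
 qed
qed

lemma hdim_iso_right:
 assumes "X : Ob" "Y : Ob" "Y' : Ob" "isom Y Y'"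
 shows "dm X Y = dm X Y'"
proof -
 obtain u where u: "isa u" "src u = Y" "tgt u = Y'" using isomorphic_iff assms by auto
 have "(%f. u *. f) ` hm X Y = hm X Y'"
 proof (intro equalityI subsetI)
  fix f assume "f : hm X Y'"
  hence "f = u *. (iv u *. f)" "iv u *. f : hm X Y" using u by (auto simp: hom_iff)
  thus "f : (%f. u *. f) ` hm X Y" by blast
 qed (use u in "auto simp: hom_iff")
 moreover have "inj_on (%f. u *. f) (hm X Y)"
  by (rule inj_on_inverseI[of _ "%f. iv u *. f"]) (use u in "auto simp: hom_iff")
 moreover have "linear_on K (HomV C X Y) (HomV C X Y') (hm X Y) (%f. u *. f)"
  by (rule linear_on_homI) (use u in "auto simp: hom_iff")
 ultimately show ?thesis unfolding hdim_def
  using subdim_bij[OF vectorspace_HomV fd_hom vectorspace_HomV hom_submodule] assms by metis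
qed

lemma hdim_iso_left:
 assumes "X : Ob" "X' : Ob" "Y : Ob" "isom X X'"
 shows "dm X Y = dm X' Y"
proof -
 obtain u where u: "isa u" "src u = X'" "tgt u = X" using isomorphic_iff iso_sym assms by metis
 have "(%f. f *. u) ` hm X Y = hm X' Y"
 proof (intro equalityI subsetI)
  fix f assume "f : hm X' Y"
  hence "f = (f *. iv u) *. u" "f *. iv u : hm X Y" using u by (auto simp: hom_iff)
  thus "f : (%f. f *. u) ` hm X Y" by blast
 qed (use u in "auto simp: hom_iff")
 moreover have "inj_on (%f. f *. u) (hm X Y)"
  by (rule inj_on_inverseI[of _ "%f. f *. iv u"]) (use u in "auto simp: hom_iff")
 moreover have "linear_on K (HomV C X Y) (HomV C X' Y) (hm X Y) (%f. f *. u)"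
  by (rule linear_on_homI) (use u in "auto simp: hom_iff")
 ultimately show ?thesis unfolding hdim_def
  using subdim_bij[OF vectorspace_HomV fd_hom vectorspace_HomV hom_submodule] assms by metis
qed

lemma hdim_biproduct_right:
 assumes b: "biproduct C J M X i p" and Z: "Z : Ob"
 shows "dm Z X = (\<Sum>j\<in>J. dm Z (M j))"
 unfolding hdim_def
proof (rule subdim_decompose[where p = "%j f. p j *. f" and q = "%j f. i j *. f"])
 note b' = biproductD[OF b]
 show "finite J" by (rule b')
 show "vectorspace K (HomV C Z X)" "vectorspace.fin_dim K (HomV C Z X)" "submodule K (hm Z X) (HomV C Z X)"
  using vectorspace_HomV fd_hom hom_submodule Z b'(2) by auto
 show "vectorspace K (HomV C Z (M j))" if "j : J" for j using vectorspace_HomV Z b'(11)[OF that] by auto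
 show "linear_on K (HomV C Z X) (HomV C Z (M j)) (hm Z X) (%f. p j *. f)" if "j : J" for j
  by (rule linear_on_homI) (use b' that in "auto simp: hom_iff")
 show "p j *. (i j *. f) = f" if "j : J" "f : hm Z (M j)" for j f
  using that b' cmp_assoc[of "p j" "i j" f] by (simp add: hom_iff)
 show "p k *. (i j *. f) = \<zero>\<^bsub>HomV C Z (M k)\<^esub>" if "k : J" "j : J" "k ~= j" "f : hm Z (M j)" for j k f
  using that b' cmp_assoc[of "p k" "i j" f] by (simp add: hom_iff HomV_ops)
 show "f = \<zero>\<^bsub>HomV C Z X\<^esub>" if "f : hm Z X" "!!j. j : J ==> p j *. f = \<zero>\<^bsub>HomV C Z (M j)\<^esub>" for f
  by (rule biproduct_jointly_monic[OF b]) (use that b' Z in "auto simp: hom_iff HomV_ops")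
qed (use biproductD[OF b] in "auto simp: hom_iff")

lemma hdim_biproduct_left:
 assumes b: "biproduct C J M X i p" and Z: "Z : Ob"
 shows "dm X Z = (\<Sum>j\<in>J. dm (M j) Z)"
 unfolding hdim_def
proof (rule subdim_decompose[where p = "%j f. f *. i j" and q = "%j f. f *. p j"])
 note b' = biproductD[OF b]
 show "finite J" by (rule b')
 show "vectorspace K (HomV C X Z)" "vectorspace.fin_dim K (HomV C X Z)" "submodule K (hm X Z) (HomV C X Z)"
  using vectorspace_HomV fd_hom hom_submodule Z b'(2) by auto
 show "vectorspace K (HomV C (M j) Z)" if "j : J" for j using vectorspace_HomV Z b'(11)[OF that] by auto
 show "linear_on K (HomV C X Z) (HomV C (M j) Z) (hm X Z) (%f. f *. i j)" if "j : J" for j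
  by (rule linear_on_homI) (use b' that in "auto simp: hom_iff")
 show "(f *. p j) *. i j = f" if "j : J" "f : hm (M j) Z" for j f
  using that b' by (simp add: hom_iff)
 show "(f *. p j) *. i k = \<zero>\<^bsub>HomV C (M k) Z\<^esub>" if "k : J" "j : J" "k ~= j" "f : hm (M j) Z" for j k f
  using that b' by (simp add: hom_iff HomV_ops)
 show "f = \<zero>\<^bsub>HomV C X Z\<^esub>" if "f : hm X Z" "!!j. j : J ==> f *. i j = \<zero>\<^bsub>HomV C (M j) Z\<^esub>" for f
  by (rule biproduct_jointly_epic[OF b]) (use that b' Z in "auto simp: hom_iff HomV_ops")
qed (use biproductD[OF b] in "auto simp: hom_iff")

lemma semisimple_biproduct:
 assumes "X : Ob"
 obtains n S i p where "!!j. j < n ==> smp (S j)" "biproduct C {..<n::nat} S X i p"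
 using semisimple assms direct_sum_biproduct unfolding semisimple_def by metis

text \<open>After decomposing \<open>X\<close> only simple objects remain, where both dimensions are
  1 or 0 together.\<close>

lemma hdim_sym:
 assumes Z: "smp Z" and X: "X : Ob"
 shows "dm Z X = dm X Z"
proof -
 obtain n S i p where S: "!!j. j < n ==> smp (S j)" and b: "biproduct C {..<n::nat} S X i p"
  using semisimple_biproduct[OF X] by metis
 have "dm Z (S j) = dm (S j) Z" if "j < n" for j
  using hdim_simple[OF Z S[OF that]] hdim_simple[OF S[OF that] Z] iso_sym simple_obj Z S[OF that] by metis
 thus ?thesis using hdim_biproduct_right[OF b simple_obj[OF Z]] hdim_biproduct_left[OF b simple_obj[OF Z]] by simp
qed

end

section \<open>Splitting monomorphisms\<close>

definition split_pair ::
  "('k, 'o, 'm, 'z) linear_cat_scheme => 'o => 'o => 'o * 'm * 'o => 'o * 'm * 'o => 'o => 'o * 'm * 'o => 'o * 'm * 'o => bool" where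
 "split_pair C Y A f r B k q \<longleftrightarrow>
  f : hom C A Y & r : hom C Y A & k : hom C B Y & q : hom C Y B &
  r *.\<^bsub>C\<^esub> f = ide C A & q *.\<^bsub>C\<^esub> k = ide C B & r *.\<^bsub>C\<^esub> k = nul C B A & q *.\<^bsub>C\<^esub> f = nul C A B &
  f *.\<^bsub>C\<^esub> r +.\<^bsub>C\<^esub> k *.\<^bsub>C\<^esub> q = ide C Y"

context linear_category begin

lemma split_pairD:
 assumes "split_pair C Y A f r B k q"
 shows "ar f" "src f = A" "tgt f = Y" "ar r" "src r = Y" "tgt r = A"
  "ar k" "src k = B" "tgt k = Y" "ar q" "src q = Y" "tgt q = B"
  "r *. f = ii A" "q *. k = ii B" "r *. k = nl B A" "q *. f = nl A B"
  "A : Ob" "B : Ob" "Y : Ob"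
 using assms arr_obj[of f] arr_obj[of k] by (auto simp: split_pair_def hom_iff)

lemma split_pair_sum:
 assumes s: "split_pair C Y A f r B k q" and g: "ar g"
 shows "tgt g = Y ==> g = f *. r *. g +. k *. q *. g" "src g = Y ==> g = g *. f *. r +. g *. k *. q"
proof -
 note d = split_pairD[OF s]
 have e: "ii Y = f *. r +. k *. q" using s by (simp add: split_pair_def)
 show "g = f *. r *. g +. k *. q *. g" if t: "tgt g = Y"
 proof -
  have "g = ii Y *. g" using g t by simp
  also have "... = f *. r *. g +. k *. q *. g" unfolding e using d g t by simp
  finally show ?thesis .
 qed
 show "g = g *. f *. r +. g *. k *. q" if t: "src g = Y"
 proof -
  have "g = g *. ii Y" using g t by simp
  also have "... = g *. f *. r +. g *. k *. q" unfolding e using d g t by simp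
  finally show ?thesis .
 qed
qed

lemma split_pair_epic:
 assumes s: "split_pair C Y A f r B k q" and g: "ar g" "ar h" "src g = Y" "src h = Y"
  and e: "g *. f = h *. f" "g *. k = h *. k"
 shows "g = h"
proof -
 note d = split_pairD[OF s]
 have "g *. f *. r = h *. f *. r" "g *. k *. q = h *. k *. q"
  using e d g cmp_assoc[of g f r] cmp_assoc[of h f r] cmp_assoc[of g k q] cmp_assoc[of h k q] by auto
 thus ?thesis using split_pair_sum(2)[OF s g(1,3)] split_pair_sum(2)[OF s g(2,4)] by simp
qed

lemma split_pair_biproduct:
 assumes s: "split_pair C Y A f r B k q"
 shows "biproduct C (UNIV :: bool set) (%b. if b then A else B) Y (%b. if b then f else k) (%b. if b then r else q)"
proof -
 note d = split_pairD[OF s]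
 interpret v: vectorspace K "HomV C Y Y" by (rule vectorspace_HomV) (use d in auto)
 have "finsum (HomV C Y Y) (%b. (if b then f else k) *. (if b then r else q)) {True, False} = f *. r +. k *. q"
  using d by (subst v.M.finsum_insert) (auto simp: hom_iff HomV_ops)
 moreover have "(UNIV :: bool set) = {True, False}" by auto
 ultimately show ?thesis using s d by (auto simp: biproduct_def hom_iff split_pair_def)
qed

end

context ac_fusion begin

text \<open>The complement is the kernel of the retraction \<open>r\<close>; the idempotent
  \<open>1 - f r\<close> factors through it, and this factor is \<open>q\<close>.\<close>

lemma idempotent_complement:
 assumes f: "ar f" "src f = A" "tgt f = Y" and r: "ar r" "src r = Y" "tgt r = A" and rf: "r *. f = ii A"
 obtains B k q where "split_pair C Y A f r B k q"
proof -
 have O: "A : Ob" "Y : Ob" using f by auto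
 obtain B k' where B: "B : Ob" "is_kernel C B Y A k' (mor r)"
  using kernel_exists[of Y A "mor r"] O r by (auto simp: arr_def simp del: arr_obj)
 define k where "k = (B, k', Y)"
 have rr: "(Y, mor r, A) = r" using arrow_triple[of r] r by simp
 note ker = kernelE[OF B(2,1) O(2,1), folded k_def, unfolded rr]
 define e where "e = ii Y +. (\<ominus>\<^sub>K \<one>\<^sub>K) |> (f *. r)"
 have e: "ar e" "src e = Y" "tgt e = Y" using f r O by (auto simp: e_def)
 have rfr: "r *. f *. r = r" using f r rf cmp_assoc[of r f r] by simp
 have re: "r *. e = nl (src e) A" using f r O e rfr by (simp add: e_def)
 obtain q where q: "ar q" "src q = Y" "tgt q = B" "k *. q = e" using ker(4)[OF e(1,3) re] e by auto
 have k: "ar k" "src k = B" "tgt k = Y" using ker(1) by (auto simp: k_def)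
 have "k *. q *. k = k *. ii B"
 proof -
  have "k *. q *. k = e *. k" using q k cmp_assoc[of k q k] by simp
  also have "... = k" using k f r O B(1) ker(3) by (simp add: e_def)
  finally show ?thesis using k by simp
 qed
 hence qk: "q *. k = ii B" using ker(5)[of "q *. k" "ii B"] q k B(1) by simp
 have "k *. q *. f = k *. nl A B"
 proof -
  have "k *. q *. f = e *. f" using q k f cmp_assoc[of k q f] by simp
  also have "... = nl A Y" using k f r O rf by (simp add: e_def)
  finally show ?thesis using k O by simp
 qed
 hence qf: "q *. f = nl A B" using ker(5)[of "q *. f" "nl A B"] q k f B(1) O by simp
 have "f *. r +. k *. q = ii Y"
 proof -
  have "f *. r +. k *. q = f *. r +. ((\<ominus>\<^sub>K \<one>\<^sub>K) |> (f *. r) +. ii Y)"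
   unfolding q(4) e_def using f r O by (subst plus_comm[of "ii Y"]) auto
  thus ?thesis using f r O by simp
 qed
 thus ?thesis using that[of B k q] f r k q rf qk qf ker(3) by (auto simp: split_pair_def hom_iff)
qed

lemma split_pair_hdim:
 assumes "split_pair C Y A f r B k q" "Z : Ob"
 shows "dm Z Y = dm Z A + dm Z B" "dm Y Z = dm A Z + dm B Z"
 using hdim_biproduct_right[OF split_pair_biproduct[OF assms(1)] assms(2)]
  hdim_biproduct_left[OF split_pair_biproduct[OF assms(1)] assms(2)]
 by (simp_all add: UNIV_bool)

text \<open>Some component of \<open>f\<close> in a decomposition of \<open>Y\<close> is non-zero
  and hence an isomorphism; its inverse after the projection is a retraction.\<close>

lemma simple_mono_split:
 assumes W: "smp W" and f: "ar f" "src f = W" "tgt f = Y" "f ~= nl W Y"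
 obtains r where "ar r" "src r = Y" "tgt r = W" "r *. f = ii W"
proof -
 have O: "W : Ob" "Y : Ob" using f by auto
 obtain n S i p where S: "!!j. j < n ==> smp (S j)" and b: "biproduct C {..<n::nat} S Y i p"
  by (rule semisimple_biproduct[OF O(2)]) blast
 note b' = biproductD[OF b]
 have "EX j<n. p j *. f ~= nl W (S j)"
 proof (rule ccontr)
  assume n: "\<not> ?thesis"
  have "f = nl W Y"
   by (rule biproduct_jointly_monic[OF b]) (use n f b' O in "auto simp: hom_iff")
  thus False using f by simp
 qed
 then obtain j where j: "j < n" "p j *. f ~= nl W (S j)" by blast
 have i: "isa (p j *. f)" by (rule simple_arr_iso[OF W S[OF j(1)]]) (use f b' j in auto)
 show ?thesis by (rule that[of "iv (p j *. f) *. p j"]) (use i b' j f inv_cmp[OF i] in auto)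
qed

lemma nonzero_simple_summand:
 assumes X: "X : Ob" "ii X ~= nl X X"
 obtains W i p where "smp W" "ar i" "src i = W" "tgt i = X" "ar p" "src p = X" "tgt p = W" "p *. i = ii W"
proof -
 obtain n S i p where S: "!!j. j < n ==> smp (S j)" and b: "biproduct C {..<n::nat} S X i p"
  by (rule semisimple_biproduct[OF X(1)]) blast
 note b' = biproductD[OF b]
 have "n ~= 0"
 proof
  assume n: "n = 0"
  have "ii X = nl X X"
   by (rule biproduct_jointly_monic[OF b]) (use n X in "auto simp: hom_iff")
  thus False using X by simp
 qed
 hence "0 < n" by simp
 thus ?thesis using that[of "S 0" "i 0" "p 0"] S[of 0] b' by auto
qed

text \<open>Induction on \<open>dim End(X)\<close>. A simple summand \<open>W\<close> of
  \<open>X\<close> embeds in \<open>Y\<close> and splits off there; on the complements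
  \<open>f\<close> induces a map that is again a monomorphism, and the retraction of this map is
  corrected to one of \<open>f\<close>.\<close>

lemma mono_split:
 assumes f: "ar f" "src f = X" "tgt f = Y"
  and mono: "!!g. ar g ==> tgt g = X ==> f *. g = nl (src g) Y ==> g = nl (src g) X"
 obtains r where "ar r" "src r = Y" "tgt r = X" "r *. f = ii X"
proof -
 have "EX r. ar r & src r = Y & tgt r = X & r *. f = ii X"
  using assms
 proof (induction "dm X X" arbitrary: f X Y rule: less_induct)
  case less
  have O: "X : Ob" "Y : Ob" using less.prems by auto
  note f = less.prems(1-3) and mono = less.prems(4)
  show ?case
  proof (cases "ii X = nl X X")
   case True
   thus ?thesis using f O by (intro exI[of _ "nl Y X"]) simp
  next
   case False
   obtain W i p where W: "smp W" and i: "ar i" "src i = W" "tgt i = X"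
    and p: "ar p" "src p = X" "tgt p = W" and pi: "p *. i = ii W"
    using nonzero_simple_summand[OF O(1) False] by metis
   have WO: "W : Ob" using simple_obj[OF W] .
   obtain X' k q where X': "split_pair C X W i p X' k q"
    using idempotent_complement[OF i p pi] .
   note x = split_pairD[OF X']
   have "f *. i ~= nl W Y"
   proof
    assume "f *. i = nl W Y"
    hence "i = nl W X" using mono[of i] i by simp
    hence "ii W = nl W W" using pi p WO O by simp
    thus False using simple_nonzero[OF W] by simp
   qed
   then obtain r0 where r0: "ar r0" "src r0 = Y" "tgt r0 = W" "r0 *. f *. i = ii W"
    using simple_mono_split[OF W, of "f *. i" Y] f i by auto
   obtain Y' k' q' where Y': "split_pair C Y W (f *. i) r0 Y' k' q'"
    by (rule idempotent_complement[OF _ _ _ r0(1,2,3,4)]) (use f i in auto)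
   note y = split_pairD[OF Y']
   define f' where "f' = q' *. f *. k"
   have f': "ar f'" "src f' = X'" "tgt f' = Y'" using x y f by (auto simp: f'_def)
   have mono': "g = nl (src g) X'" if g: "ar g" "tgt g = X'" "f' *. g = nl (src g) Y'" for g
   proof -
    have "f *. k *. g = (f *. i) *. r0 *. f *. k *. g +. k' *. q' *. f *. k *. g"
     using split_pair_sum(1)[OF Y', of "f *. k *. g"] f x g by simp
    also have "q' *. f *. k *. g = nl (src g) Y'" using g(3) f x y g by (simp add: f'_def)
    finally have e: "f *. k *. g = f *. i *. r0 *. f *. k *. g" using f x y r0 g i by simp
    \<comment> \<open>By construction \<open>f d = 0\<close>, so \<open>d = 0\<close>, that is
      \<open>k g = i r0 f k g\<close>. Applying \<open>p\<close> kills the left side and leaves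
      \<open>r0 f k g = 0\<close>.\<close>
    define d where "d = k *. g +. (\<ominus>\<^sub>K \<one>\<^sub>K) |> (i *. r0 *. f *. k *. g)"
    have d: "ar d" "tgt d = X" "src d = src g" using f x y r0 g i by (auto simp: d_def)
    have "f *. d = f *. k *. g +. (\<ominus>\<^sub>K \<one>\<^sub>K) |> (f *. i *. r0 *. f *. k *. g)"
     using f x y r0 g i by (simp add: d_def)
    also have "... = nl (src d) Y" unfolding e[symmetric] using d f x g by simp
    finally have dn: "d = nl (src d) X" using mono[OF d(1,2)] by simp
    have kg: "k *. g = i *. r0 *. f *. k *. g"
     by (rule diff_eq_nul) (use f x y r0 g i d dn in "auto simp: d_def")
    have "nl (src g) W = p *. k *. g" using x g cmp_assoc[of p k g] by simp
    also have "... = p *. i *. r0 *. f *. k *. g" by (subst kg) simp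
    also have "... = r0 *. f *. k *. g" using x g f r0 cmp_assoc[of p i "r0 *. f *. k *. g"] by simp
    finally have z: "r0 *. f *. k *. g = nl (src g) W" by simp
    have "k *. g = nl (src g) X" by (subst kg, subst z) (use i g in simp)
    hence "q *. k *. g = nl (src g) X'" using x g by simp
    thus "g = nl (src g) X'" using x g cmp_assoc[of q k g] by simp
   qed
   have "dm X X = dm W X + dm X' X" using split_pair_hdim(2)[OF X' O(1)] .
   moreover have "dm X' X = dm X' W + dm X' X'" using split_pair_hdim(1)[OF X' x(18)] .
   moreover have "dm W X = dm W W + dm W X'" using split_pair_hdim(1)[OF X' x(17)] .
   moreover have "dm W W = 1" using hdim_simple[OF W W] iso_refl[OF WO] by simp
   ultimately have "dm X' X' < dm X X" by simp
   then obtain r' where r': "ar r'" "src r' = Y'" "tgt r' = X'" "r' *. f' = ii X'"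
    using less.hyps[OF _ f' mono'] by blast
   \<comment> \<open>The retraction \<open>r0\<close> need not vanish on the image of the complement
     \<open>X'\<close>. The subtracted term compensates for this: with it,
     \<open>r f k = i r0 f k + c = k\<close>.\<close>
   define c where "c = k +. (\<ominus>\<^sub>K \<one>\<^sub>K) |> (i *. r0 *. f *. k)"
   have c: "ar c" "src c = X'" "tgt c = X" using f x r0 by (auto simp: c_def)
   define r where "r = i *. r0 +. c *. r' *. q'"
   have r: "ar r" "src r = Y" "tgt r = X" using c r' y r0 i by (auto simp: r_def)
   have "r *. f = ii X"
   proof (rule split_pair_epic[OF X'])
    have "(r *. f) *. i = i *. r0 *. f *. i +. c *. r' *. q' *. f *. i"
     using c r' y r0 i f by (simp add: r_def)
    thus "(r *. f) *. i = ii X *. i" using c r' y(16) r0 i f WO O by simp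
    have "(r *. f) *. k = i *. r0 *. f *. k +. c *. r' *. f'"
     using c r' y r0 i f x by (simp add: r_def f'_def)
    also have "... = i *. r0 *. f *. k +. c" using r' c by simp
    also have "... = i *. r0 *. f *. k +. ((\<ominus>\<^sub>K \<one>\<^sub>K) |> (i *. r0 *. f *. k) +. k)"
     unfolding c_def using f x r0 by (subst plus_comm[of k]) auto
    also have "... = ii X *. k" using f x r0 by simp
    finally show "(r *. f) *. k = ii X *. k" .
   qed (use r f O in auto)
   thus ?thesis using r by blast
  qed
 qed
 thus ?thesis using that by blast
qed

text \<open>The kernel map has a retraction by \<open>mono_split\<close>. Its complement
  \<open>B\<close> and the given \<open>Z\<close> are both cokernels of \<open>f\<close>, hence
  isomorphic by \<open>U\<close>, and \<open>s U\<close> is a section of \<open>g\<close>.\<close>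

lemma short_exact_split:
 assumes e: "short_exact C X Y Z f g" and O: "X : Ob" "Y : Ob" "Z : Ob"
 obtains F r s G where "split_pair C Y X F r Z s G"
proof -
 define F where "F = (X, f, Y)"
 define G where "G = (Y, g, Z)"
 have k: "is_kernel C X Y Z f g" and c: "is_cokernel C X Y Z f g" using e by (auto simp: short_exact_def)
 note ker = kernelE[OF k O, folded F_def G_def]
 have FG: "src F = X" "tgt F = Y" "src G = Y" "tgt G = Z" by (auto simp: F_def G_def)
 have cok: "EX! u. u : arrows C Z W & u \<cdot> g = h" if "W : Ob" "h : arrows C Y W" "h \<cdot> f = \<zero>\<^bsub>Hom C X W\<^esub>" for W h
  using c that by (auto simp: is_cokernel_def)
 obtain r where r: "ar r" "src r = Y" "tgt r = X" "r *. F = ii X"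
 proof (rule mono_split[OF ker(1) FG(1,2)])
  fix h assume "ar h" "tgt h = X" "F *. h = nl (src h) Y"
  thus "h = nl (src h) X" using ker(5)[of h "nl (src h) X"] ker(1) FG O by simp
 qed
 obtain B s q where S: "split_pair C Y X F r B s q" using idempotent_complement[OF ker(1) FG(1,2) r] .
 note d = split_pairD[OF S]
 have "mor q \<cdot> f = \<zero>\<^bsub>Hom C X B\<^esub>" using d(16) by (auto simp: cmp_def nul_def HomV_simps F_def)
 moreover have "mor q : arrows C Y B" using d by (auto simp: arr_def simp del: arr_obj)
 ultimately have "EX! u. u : arrows C Z B & u \<cdot> g = mor q" by (intro cok) (use d in auto)
 then obtain u where u: "u : arrows C Z B" "u \<cdot> g = mor q" by auto
 define U where "U = (Z, u, B)"
 have U: "ar U" "src U = Z" "tgt U = B" using u O d by (auto simp: U_def arr_def simp del: arr_obj)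
 have UG: "U *. G = q" using u d by (intro arrow_eqI) (auto simp: U_def G_def cmp_def)
 have GG: "G = G *. s *. q"
 proof -
  have z: "G *. F *. r = nl Y Z"
   using ker(2,3) FG d r O cmp_assoc[of G F r, symmetric] by (simp only: cmp_nul_left)
  have "G = G *. F *. r +. G *. s *. q" by (rule split_pair_sum(2)[OF S ker(2) FG(3)])
  thus ?thesis unfolding z using ker(2) FG d by simp
 qed
 have uni: "a = b" if ab: "ar a" "ar b" "src a = Z" "src b = Z" "tgt a = tgt b" "a *. G = b *. G" for a b
 proof -
  have "ar (a *. G)" using ab ker(2) FG by simp
  hence h: "mor (a *. G) : arrows C Y (tgt a)" using FG by (simp add: arr_def del: arr_obj arr_cmp)
  have "(a *. G) *. F = nl X (tgt a)" using ab ker FG O by simp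
  hence "mor (a *. G) \<cdot> f = \<zero>\<^bsub>Hom C X (tgt a)\<^esub>" by (auto simp: cmp_def nul_def HomV_simps F_def)
  hence ex: "EX! u. u : arrows C Z (tgt a) & u \<cdot> g = mor (a *. G)" using cok h ab by auto
  have "mor a : arrows C Z (tgt a)" "mor b : arrows C Z (tgt a)" "mor a \<cdot> g = mor (a *. G)" "mor b \<cdot> g = mor (a *. G)"
   using ab by (auto simp: arr_def cmp_def G_def simp del: arr_obj)
  hence "mor a = mor b" using ex by blast
  thus ?thesis using ab by (intro arrow_eqI) auto
 qed
 have gs: "(G *. s) *. U = ii Z"
 proof (rule uni)
  have "((G *. s) *. U) *. G = G *. s *. q" using ker(2) FG d U UG by simp
  thus "((G *. s) *. U) *. G = ii Z *. G" using GG ker(2) FG by simp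
 qed (use ker(2) FG d U O in auto)
 have us: "U *. G *. s = ii B" using UG d U ker(2) FG cmp_assoc[of U G s] by simp
 have "split_pair C Y X F r Z (s *. U) G"
  unfolding split_pair_def hom_iff
 proof (intro conjI)
  show "r *. s *. U = nl Z X" using d U r cmp_assoc[of r s U] by simp
  show "G *. F = nl X Z" by (rule ker(3))
  show "G *. s *. U = ii Z" using gs ker(2) FG d U by simp
  show "F *. r +. (s *. U) *. G = ii Y" using S UG d U ker(2) FG by (simp add: split_pair_def)
  show "ar F" "src F = X" "tgt F = Y" "ar r" "src r = Y" "tgt r = X" "r *. F = ii X"
   "ar G" "src G = Y" "tgt G = Z"
   using ker(1,2) FG r by simp_all
  show "ar (s *. U)" "src (s *. U) = Z" "tgt (s *. U) = Y" using d(7,8,9) U by simp_all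
 qed
 thus ?thesis by (rule that)
qed

end

section \<open>Involutions\<close>

text \<open>For a vector space with an involution, \<open>2 dim V\<^sup>\<sigma> - dim V\<close> is the difference of the
 dimensions of the two eigenspaces if the characteristic is not 2, and the dimension of the Tate
 cohomology otherwise. In both cases it is additive and multiplicative and vanishes on free
 representations, which makes the second Adams operation a ring homomorphism in every
 characteristic.\<close>

definition sdim :: "('k, 'e) ring_scheme => ('k, 'o, 'm, 'z) linear_cat_scheme => 'o => 'o => 'o * 'm * 'o => int" where
 "sdim K C Z M s = 2 * int (subdim K (HomV C Z M) {f : hom C Z M. s *.\<^bsub>C\<^esub> f = f}) - int (hdim K C Z M)"

text \<open>An injection into the naturals labels the elements; \<open>P\<close> takes from each
  two-element orbit the member with the smaller label.\<close>

lemma involution_orbits: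
 assumes "finite J" "!!j. j : J ==> \<pi> j : J & \<pi> (\<pi> j) = j"
 obtains P where "P \<subseteq> J" "!!j. j : P ==> \<pi> j ~= j" "P \<inter> \<pi> ` P = {}"
  "J = {j : J. \<pi> j = j} \<union> P \<union> \<pi> ` P" "inj_on \<pi> P"
proof -
 obtain \<nu> :: "'a => nat" where nu: "inj_on \<nu> J" using assms(1) finite_imp_inj_to_nat_seg by metis
 define P where "P = {j : J. \<nu> j < \<nu> (\<pi> j)}"
 have "j : {j : J. \<pi> j = j} \<union> P \<union> \<pi> ` P" if j: "j : J" for j
 proof -
  consider "\<nu> j < \<nu> (\<pi> j)" | "\<nu> j = \<nu> (\<pi> j)" | "\<nu> (\<pi> j) < \<nu> j" by linarith
  thus ?thesis
  proof cases
   case 2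
   thus ?thesis using inj_onD[OF nu 2] assms(2)[OF j] j by simp
  next
   case 3
   hence "\<pi> j : P" using assms(2)[OF j] by (simp add: P_def)
   hence "\<pi> (\<pi> j) : \<pi> ` P" by blast
   thus ?thesis using assms(2)[OF j] by simp
  qed (use j in "simp add: P_def")
 qed
 moreover have "P \<inter> \<pi> ` P = {}" using assms(2) by (fastforce simp: P_def)
 moreover have "inj_on \<pi> P" using assms(2) by (metis (mono_tags, lifting) P_def inj_onI mem_Collect_eq)
 moreover have "P \<subseteq> J" "\<pi> ` P \<subseteq> J" "!!j. j : P ==> \<pi> j ~= j" using assms(2) by (auto simp: P_def)
 ultimately show ?thesis by (intro that[of P]) auto
qed

context ac_fusion begin

lemma fixed_submodule:
 assumes "s : hm M M" "Z : Ob"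
 shows "submodule K {f : hm Z M. s *. f = f} (HomV C Z M)"
 by (rule submodule_homI) (use assms arr_obj[of s] in "auto simp: hom_iff")

text \<open>A pair of exchanged summands contributes \<open>dim Hom(Z, M j)\<close> to the fixed
  vectors and twice this number to the whole space, so it cancels in \<open>sdim\<close>. Only the
  summands kept in place remain.\<close>

lemma sdim_orbits:
 assumes b: "biproduct C J M X i p" and s: "s : hm X X" and Z: "Z : Ob"
  and \<pi>: "!!j. j : J ==> \<pi> j : J & \<pi> (\<pi> j) = j"
  and t: "!!j. j : J ==> t j : hm (M j) (M (\<pi> j))"
  and si: "!!j. j : J ==> s *. i j = i (\<pi> j) *. t j"
  and tt: "!!j. j : J ==> t (\<pi> j) *. t j = ii (M j)"
 shows "sdim K C Z X s = (\<Sum>j\<in>{j : J. \<pi> j = j}. sdim K C Z (M j) (t j))"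
proof -
 note b' = biproductD[OF b]
 obtain P where P: "P \<subseteq> J" "!!j. j : P ==> \<pi> j ~= j" "P \<inter> \<pi> ` P = {}"
  "J = {j : J. \<pi> j = j} \<union> P \<union> \<pi> ` P" "inj_on \<pi> P"
  using involution_orbits[of J \<pi>, OF b'(1) \<pi>] by blast
 define F where "F = {j : J. \<pi> j = j}"
 have fin: "finite F" "finite P" using b'(1) P(1) by (auto simp: F_def intro: finite_subset)
 have FP: "F \<inter> P = {}" "F \<inter> \<pi> ` P = {}" using P(1,2) \<pi> by (force simp: F_def)+
 have sh: "ar s" "src s = X" "tgt s = X" using s by (auto simp: hom_iff)
 have th: "ar (t j)" "src (t j) = M j" "tgt (t j) = M (\<pi> j)" if "j : J" for j using t[OF that] by (auto simp: hom_iff)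
 have \<pi>': "\<pi> j : J" "\<pi> (\<pi> j) = j" if "j : J" for j using \<pi>[OF that] by auto
 \<comment> \<open>The counterpart of \<open>si\<close> for projections, obtained by testing on all
   inclusions.\<close>
 have ps: "p (\<pi> j) *. s = t j *. p j" if j: "j : J" for j
 proof (rule biproduct_jointly_epic[OF b])
  show "p (\<pi> j) *. s : hm X (M (\<pi> j))" "t j *. p j : hm X (M (\<pi> j))"
   using b' j sh th \<pi>' by (auto simp: hom_iff)
  fix k assume k: "k : J"
  have "(p (\<pi> j) *. s) *. i k = p (\<pi> j) *. i (\<pi> k) *. t k"
   using b' j sh th \<pi>' k si[OF k] by simp
  also have "... = (p (\<pi> j) *. i (\<pi> k)) *. t k"
   using b' j sh th \<pi>' k by simp
  also have "... = (if j = k then t j else nl (M k) (M (\<pi> j)))"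
  proof (cases "j = k")
   case True
   thus ?thesis using b'(9)[OF \<pi>'(1)[OF j]] th[OF j] by simp
  next
   case False
   hence "\<pi> j ~= \<pi> k" using \<pi>'(2) j k by metis
   thus ?thesis using b'(10)[OF \<pi>'(1)[OF j] \<pi>'(1)[OF k]] th[OF k] False b'(11)[OF \<pi>'(1)[OF j]] by simp
  qed
  also have "... = t j *. p j *. i k"
   using b'(9,10)[OF j] k th[OF j] b'(11)[OF k] by (cases "j = k") auto
  finally show "(p (\<pi> j) *. s) *. i k = (t j *. p j) *. i k" using b' j th k by simp
 qed
 define S where "S j = (if \<pi> j = j then {g : hm Z (M j). t j *. g = g} else hm Z (M j))" for j
 \<comment> \<open>On a two-element orbit a fixed vector is determined by its component
   \<open>g\<close> in one summand; the component in the other one must be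
   \<open>t j g\<close>.\<close>
 define q where "q j g = (if \<pi> j = j then i j *. g else i j *. g +. i (\<pi> j) *. t j *. g)" for j g
 have pj: "p j *. i k *. g = (if j = k then g else nl Z (M j))"
  if "j : J" "k : J" "g : hm Z (M k)" for j k g
 proof -
  have "p j *. i k *. g = (p j *. i k) *. g"
   by (rule sym, rule cmp_assoc) (use that b' in "auto simp: hom_iff")
  thus ?thesis using that b'(9)[of j] b'(10)[of j k] b'(11)[of j] by (auto simp: hom_iff)
 qed
 have fixd: "sd (HomV C Z X) {f : hm Z X. s *. f = f} = (\<Sum>j\<in>F \<union> P. sd (HomV C Z (M j)) (S j))"
 proof (rule subdim_decompose[where p = "%j f. p j *. f" and q = q])
  show "finite (F \<union> P)" using fin by simp
  show "vectorspace K (HomV C Z X)" "vectorspace.fin_dim K (HomV C Z X)"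
   using vectorspace_HomV fd_hom Z b'(2) by auto
  show "submodule K {f : hm Z X. s *. f = f} (HomV C Z X)" by (rule fixed_submodule[OF s Z])
  fix j assume "j : F \<union> P"
  hence j: "j : J" using P(1) by (auto simp: F_def)
  show "vectorspace K (HomV C Z (M j))" using vectorspace_HomV Z b'(11)[OF j] by auto
  show "linear_on K (HomV C Z X) (HomV C Z (M j)) {f : hm Z X. s *. f = f} (%f. p j *. f)"
   by (rule linear_on_homI) (use b' j in "auto simp: hom_iff")
  show "p j *. f : S j" if f: "f : {f : hm Z X. s *. f = f}" for f
  proof -
   have fh: "ar f" "src f = Z" "tgt f = X" "s *. f = f" using f by (auto simp: hom_iff)
   have "t j *. p j *. f = p (\<pi> j) *. s *. f"
    using ps[OF j] b' j th fh sh \<pi>' cmp_assoc[of "t j" "p j" f] cmp_assoc[of "p (\<pi> j)" s f] by simp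
   thus ?thesis using fh b' j by (simp add: S_def hom_iff)
  qed
  fix g assume g: "g : S j"
  hence gh: "ar g" "src g = Z" "tgt g = M j" "g : hm Z (M j)" by (auto simp: S_def hom_iff split: if_splits)
  show "q j g : {f : hm Z X. s *. f = f}"
  proof (cases "\<pi> j = j")
   case True
   have "s *. i j *. g = (s *. i j) *. g" using sh b' j gh by simp
   also have "... = i j *. t j *. g" unfolding si[OF j] using True b' th j gh by simp
   finally show ?thesis using g True b' j gh sh by (auto simp: S_def q_def hom_iff)
  next
   case False
   have 1: "s *. i j *. g = i (\<pi> j) *. t j *. g"
    using si[OF j] cmp_assoc[of s "i j" g] sh b' j gh th \<pi>' by simp
   have "s *. i (\<pi> j) *. t j *. g = (s *. i (\<pi> j)) *. t j *. g"
    using sh b' j gh th \<pi>' by simp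
   also have "... = i j *. (t (\<pi> j) *. t j) *. g"
    unfolding si[OF \<pi>'(1)[OF j]] using sh b' j gh th[OF j] th[OF \<pi>'(1)[OF j]] \<pi>'[OF j] by simp
   also have "... = i j *. g" unfolding tt[OF j] using gh by simp
   finally have 2: "s *. i (\<pi> j) *. t j *. g = i j *. g" .
   have c: "ar (i j *. g)" "ar (i (\<pi> j) *. t j *. g)" "src (i j) = M j" "tgt (i j) = X" "src (i (\<pi> j)) = M (\<pi> j)" "tgt (i (\<pi> j)) = X" "ar (i j)" "ar (i (\<pi> j))"
    using b'(3,4,5)[OF j] b'(3,4,5)[OF \<pi>'(1)[OF j]] gh th[OF j] by simp_all
   have "s *. q j g = i (\<pi> j) *. t j *. g +. i j *. g"
    using False 1 2 sh c by (simp add: q_def)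
   also have "... = q j g" using False c gh th[OF j] by (simp add: q_def plus_comm)
   finally show ?thesis using False c gh th[OF j] by (simp add: q_def hom_iff)
  qed
  have pq: "p l *. q j g = (if l = j then g else nl Z (M l))" if l: "l : F \<union> P" for l
  proof -
   have lJ: "l : J" using l P(1) by (auto simp: F_def)
   show ?thesis
   proof (cases "\<pi> j = j")
    case True
    thus ?thesis using pj[OF lJ j gh(4)] by (simp add: q_def)
   next
    case False
    hence "j : P" using \<open>j : F \<union> P\<close> by (auto simp: F_def)
    hence "l ~= \<pi> j" using l FP P(3) by auto
    moreover have "t j *. g : hm Z (M (\<pi> j))" using gh th[OF j] by (auto simp: hom_iff)
    ultimately have "p l *. i (\<pi> j) *. t j *. g = nl Z (M l)" using pj[OF lJ \<pi>'(1)[OF j]] by simp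
    moreover have "p l *. q j g = p l *. i j *. g +. p l *. i (\<pi> j) *. t j *. g"
     using False b'(3,4,5)[OF j] b'(3,4,5)[OF \<pi>'(1)[OF j]] gh th[OF j] b'(6,8)[OF lJ] by (simp add: q_def)
    ultimately show ?thesis using pj[OF lJ j gh(4)] b'(11)[OF lJ] gh Z by simp
   qed
  qed
  show "p j *. q j g = g" using pq[OF \<open>j : F \<union> P\<close>] by simp
  show "p l *. q j g = \<zero>\<^bsub>HomV C Z (M l)\<^esub>" if "l : F \<union> P" "l ~= j" for l
   using pq[OF that(1)] that(2) by (simp add: HomV_ops)
 next
  fix f assume f: "f : {f : hm Z X. s *. f = f}" and z: "!!j. j : F \<union> P ==> p j *. f = \<zero>\<^bsub>HomV C Z (M j)\<^esub>"
  have fh: "ar f" "src f = Z" "tgt f = X" "s *. f = f" using f by (auto simp: hom_iff)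
  have nz: "nl Z X : hm Z X" using Z b'(2) by (simp add: hom_iff)
  have "f = nl Z X"
  proof (rule biproduct_jointly_monic[OF b _ nz])
   show "f : hm Z X" using fh by (simp add: hom_iff)
   fix j assume j: "j : J"
   have "p j *. f = nl Z (M j)"
   proof (cases "j : F \<union> P")
    case True
    thus ?thesis using z by (simp add: HomV_ops)
   next
    case False
    hence "j : \<pi> ` P" using j P(4) by (auto simp: F_def)
    then obtain k where k: "k : P" "j = \<pi> k" "k : J" using P(1) by auto
    have "p (\<pi> k) *. f = (p (\<pi> k) *. s) *. f" using fh sh b'(6,8)[OF \<pi>'(1)[OF k(3)]] by simp
    also have "... = t k *. p k *. f" unfolding ps[OF k(3)] using fh b'(6,7,8)[OF k(3)] th[OF k(3)] by simp
    also have "p k *. f = nl Z (M k)" using z[of k] k by (simp add: HomV_ops)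
    finally show ?thesis using th[OF k(3)] Z k(2) by simp
   qed
   thus "p j *. f = p j *. nl Z X" using b'(6,7,8)[OF j] Z by simp
  qed
  thus "f = \<zero>\<^bsub>HomV C Z X\<^esub>" by (simp add: HomV_ops)
 qed
 have tot: "dm Z X = (\<Sum>j\<in>F. dm Z (M j)) + 2 * (\<Sum>j\<in>P. dm Z (M j))"
 proof -
  have iso: "dm Z (M (\<pi> j)) = dm Z (M j)" if "j : P" for j
  proof -
   have j: "j : J" using that P(1) by auto
   have "isa (t j)"
    by (rule iso_arrI(1)[of _ "t (\<pi> j)"]) (use th[OF j] th[OF \<pi>'(1)[OF j]] \<pi>'[OF j] tt[OF j] tt[OF \<pi>'(1)[OF j]] in auto)
   hence "isom (M j) (M (\<pi> j))" using isomorphic_iff[OF b'(11)[OF j] b'(11)[OF \<pi>'(1)[OF j]]] th[OF j] by blast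
   thus ?thesis using hdim_iso_right[OF Z b'(11)[OF j] b'(11)[OF \<pi>'(1)[OF j]]] by simp
  qed
  have "dm Z X = (\<Sum>j\<in>F \<union> P \<union> \<pi> ` P. dm Z (M j))"
   using hdim_biproduct_right[OF b Z] P(4) by (simp add: F_def)
  also have "... = (\<Sum>j\<in>F \<union> P. dm Z (M j)) + (\<Sum>j\<in>\<pi> ` P. dm Z (M j))"
   by (rule sum.union_disjoint) (use fin FP P(3) in auto)
  also have "(\<Sum>j\<in>F \<union> P. dm Z (M j)) = (\<Sum>j\<in>F. dm Z (M j)) + (\<Sum>j\<in>P. dm Z (M j))"
   by (rule sum.union_disjoint) (use fin FP in auto)
  also have "(\<Sum>j\<in>\<pi> ` P. dm Z (M j)) = (\<Sum>j\<in>P. dm Z (M j))"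
   using iso by (simp add: sum.reindex[OF P(5)])
  finally show ?thesis by simp
 qed
 have "(\<Sum>j\<in>F \<union> P. sd (HomV C Z (M j)) (S j)) =
   (\<Sum>j\<in>F. sd (HomV C Z (M j)) (S j)) + (\<Sum>j\<in>P. sd (HomV C Z (M j)) (S j))"
  by (rule sum.union_disjoint) (use fin FP in auto)
 also have "(\<Sum>j\<in>P. sd (HomV C Z (M j)) (S j)) = (\<Sum>j\<in>P. dm Z (M j))"
  using P(2) by (intro sum.cong) (auto simp: S_def hdim_def)
 also have "(\<Sum>j\<in>F. sd (HomV C Z (M j)) (S j)) = (\<Sum>j\<in>F. sd (HomV C Z (M j)) {g : hm Z (M j). t j *. g = g})"
  by (intro sum.cong) (auto simp: S_def F_def)
 finally show ?thesis
  unfolding sdim_def fixd tot F_def[symmetric] by (simp add: sum_subtractf sum_distrib_left)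
qed

lemma sdim_conj:
 assumes u: "isa u" "src u = M" "tgt u = N" and s: "s : hm M M" and t: "t : hm N N"
  and us: "u *. s = t *. u" and Z: "Z : Ob"
 shows "sdim K C Z M s = sdim K C Z N t"
proof -
 have O: "M : Ob" "N : Ob" using u arr_obj[of u] by auto
 have sh: "ar s" "src s = M" "tgt s = M" "ar t" "src t = N" "tgt t = N" using s t by (auto simp: hom_iff)
 have us': "iv u *. t = s *. iv u"
 proof -
  have "iv u *. t = iv u *. (t *. u) *. iv u" using u sh by simp
  also have "... = s *. iv u" unfolding us[symmetric] using u sh by simp
  finally show ?thesis .
 qed
 have "(%f. u *. f) ` {f : hm Z M. s *. f = f} = {f : hm Z N. t *. f = f}"
 proof (intro equalityI subsetI)
  fix g assume g: "g : (%f. u *. f) ` {f : hm Z M. s *. f = f}"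
  then obtain f where f: "g = u *. f" "ar f" "src f = Z" "tgt f = M" "s *. f = f" by (auto simp: hom_iff)
  have "t *. u *. f = (u *. s) *. f" unfolding us using u sh f by simp
  thus "g : {f : hm Z N. t *. f = f}" using f u sh by (simp add: hom_iff)
 next
  fix g assume g: "g : {f : hm Z N. t *. f = f}"
  hence gh: "ar g" "src g = Z" "tgt g = N" "t *. g = g" by (auto simp: hom_iff)
  have "s *. iv u *. g = (iv u *. t) *. g" unfolding us' using u sh gh by simp
  hence "iv u *. g : {f : hm Z M. s *. f = f}" using u sh gh by (simp add: hom_iff)
  moreover have "g = u *. iv u *. g" using u gh by simp
  ultimately show "g : (%f. u *. f) ` {f : hm Z M. s *. f = f}" by blast
 qed
 moreover have "inj_on (%f. u *. f) {f : hm Z M. s *. f = f}"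
  by (rule inj_on_inverseI[of _ "%f. iv u *. f"]) (use u in "auto simp: hom_iff")
 moreover have "linear_on K (HomV C Z M) (HomV C Z N) {f : hm Z M. s *. f = f} (%f. u *. f)"
  by (rule linear_on_homI) (use u in "auto simp: hom_iff")
 ultimately have "sd (HomV C Z M) {f : hm Z M. s *. f = f} = sd (HomV C Z N) {f : hm Z N. t *. f = f}"
  using subdim_bij[OF vectorspace_HomV[OF Z O(1)] fd_hom[OF Z O(1)] vectorspace_HomV[OF Z O(2)] fixed_submodule[OF s Z], of "%f. u *. f"] by simp
 moreover have "dm Z M = dm Z N"
  by (rule hdim_iso_right[OF Z O]) (use u O isomorphic_iff in blast)
 ultimately show ?thesis by (simp add: sdim_def)
qed

lemma sdim_ide: "M : Ob ==> Z : Ob ==> sdim K C Z M (ii M) = int (dm Z M)"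
proof -
 assume "M : Ob" "Z : Ob"
 hence "{f : hm Z M. ii M *. f = f} = hm Z M" by (auto simp: hom_iff)
 thus ?thesis by (simp add: sdim_def hdim_def)
qed

lemma sdim_minus_ide:
 assumes M: "M : Ob" "Z : Ob" and two: "\<one>\<^sub>K \<oplus>\<^sub>K \<one>\<^sub>K ~= \<zero>\<^sub>K"
 shows "sdim K C Z M ((\<ominus>\<^sub>K \<one>\<^sub>K) |> ii M) = - int (dm Z M)"
proof -
 interpret v: vectorspace K "HomV C Z M" by (rule vectorspace_HomV) fact+
 have "f = nl Z M" if f: "ar f" "src f = Z" "tgt f = M" "(\<ominus>\<^sub>K \<one>\<^sub>K) |> f = f" for f
 proof -
  define d where "d = \<one>\<^sub>K \<oplus>\<^sub>K \<one>\<^sub>K"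
  have d: "d : carrier K" "d ~= \<zero>\<^sub>K" using two by (auto simp: d_def)
  have "d |> f = f +. (\<ominus>\<^sub>K \<one>\<^sub>K) |> f" using f plus_scale[of f "\<one>\<^sub>K" "\<one>\<^sub>K"] by (simp add: d_def)
  hence "d |> f = nl Z M" using diff_self[OF f(1)] f by simp
  hence "inv\<^bsub>K\<^esub> d |> d |> f = nl Z M" using M d inverse_exists[of d] by simp
  thus ?thesis using f d inverse_exists[of d] Units_l_inv[of d] field_Units by simp
 qed
 hence "{f : hm Z M. ((\<ominus>\<^sub>K \<one>\<^sub>K) |> ii M) *. f = f} = {\<zero>\<^bsub>HomV C Z M\<^esub>}"
  using M by (auto simp: hom_iff HomV_ops)
 thus ?thesis using v.subdim_zero by (simp add: sdim_def)
qed

end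

section \<open>Trivial, sign and free parts of an object with involution\<close>

lemma (in linear_category) biproduct4I:
 assumes O: "X : Obj C" and i: "i0 : hom C M0 X" "i1 : hom C M1 X" "i2 : hom C M2 X" "i3 : hom C M3 X"
  and p: "p0 : hom C X M0" "p1 : hom C X M1" "p2 : hom C X M2" "p3 : hom C X M3"
  and d: "p0 *. i0 = ide C M0" "p1 *. i1 = ide C M1" "p2 *. i2 = ide C M2" "p3 *. i3 = ide C M3"
  and o: "p0 *. i1 = nul C M1 M0" "p0 *. i2 = nul C M2 M0" "p0 *. i3 = nul C M3 M0"
   "p1 *. i0 = nul C M0 M1" "p1 *. i2 = nul C M2 M1" "p1 *. i3 = nul C M3 M1"
   "p2 *. i0 = nul C M0 M2" "p2 *. i1 = nul C M1 M2" "p2 *. i3 = nul C M3 M2"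
   "p3 *. i0 = nul C M0 M3" "p3 *. i1 = nul C M1 M3" "p3 *. i2 = nul C M2 M3"
  and s: "i0 *. p0 +. (i1 *. p1 +. (i2 *. p2 +. i3 *. p3)) = ide C X"
 shows "biproduct C {..<4::nat} (%j. [M0, M1, M2, M3] ! j) X (%j. [i0, i1, i2, i3] ! j) (%j. [p0, p1, p2, p3] ! j)"
proof -
 have e: "{..<4::nat} = {0, 1, 2, 3}" by auto
 interpret v: vectorspace K "HomV C X X" by (rule vectorspace_HomV) fact+
 have "finsum (HomV C X X) (%j. [i0, i1, i2, i3] ! j *. [p0, p1, p2, p3] ! j) {0, 1, 2, 3 :: nat} = ide C X"
  using i p s by (simp add: nth_Cons' hom_iff HomV_ops v.M.finsum_insert)
 thus ?thesis unfolding biproduct_def e using O i p d o by (simp add: nth_Cons')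
qed

context ac_fusion begin

lemma kernel_arrE:
 assumes f: "ar f" "src f = X" "tgt f = Y"
 obtains A k where "A : Ob" "ar k" "src k = A" "tgt k = X" "f *. k = nl A Y"
  "!!g. ar g ==> tgt g = X ==> f *. g = nl (src g) Y ==> EX u. ar u & src u = src g & tgt u = A & k *. u = g"
  "!!g h. ar g ==> ar h ==> src g = src h ==> tgt g = A ==> tgt h = A ==> k *. g = k *. h ==> g = h"
proof -
 have O: "X : Ob" "Y : Ob" using f by auto
 obtain A k' where A: "A : Ob" "is_kernel C A X Y k' (mor f)"
  using kernel_exists[of X Y "mor f"] O f by (auto simp: arr_def simp del: arr_obj)
 have fm: "(X, mor f, Y) = f" using arrow_triple[of f] f by simp
 note k = kernelE[OF A(2,1) O, unfolded fm]
 show ?thesis by (rule that[of A "(A, k', X)"]) (use A k in auto)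
qed

definition flip23 :: "nat => nat" where "flip23 j = (if j = 2 then 3 else if j = 3 then 2 else j)"

definition sign1 :: "nat => 'a" where "sign1 j = (if j = 1 then \<ominus>\<^bsub>K\<^esub> \<one>\<^sub>K else \<one>\<^sub>K)"

text \<open>Summand 0 carries the trivial involution and summand 1 the sign; summands 2 and 3 are
  two copies of one object exchanged by \<open>s\<close>. In characteristic 2 the sign is trivial,
  and summand 1 has to vanish because it will be counted negatively.\<close>

definition involution_split where
 "involution_split X s M i p \<longleftrightarrow> biproduct C {..<4} M X i p & M 2 = M 3 &
  (ALL j<4. s *. i j = i (flip23 j) *. (sign1 j |> ii (M j))) &
  (\<one>\<^bsub>K\<^esub> \<oplus>\<^sub>K \<one>\<^sub>K = \<zero>\<^sub>K --> zero_object C (M 1))"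

lemma all_less_4: "(ALL j<4::nat. P j) \<longleftrightarrow> P 0 & P 1 & P 2 & P 3"
 by (auto simp: numeral_eq_Suc less_Suc_eq)

lemma involution_split4I:
 assumes b: "biproduct C {..<4::nat} (%j. [A, B, U, U] ! j) X (%j. [i0, i1, i2, i3] ! j) p"
  and i: "i0 : hm A X" "i1 : hm B X" "i2 : hm U X" "i3 : hm U X"
  and s: "s *. i0 = i0" "s *. i1 = (\<ominus>\<^sub>K \<one>\<^sub>K) |> i1" "s *. i2 = i3" "s *. i3 = i2"
  and z: "\<one>\<^sub>K \<oplus>\<^sub>K \<one>\<^sub>K = \<zero>\<^sub>K ==> zero_object C B"
 shows "EX M i p. involution_split X s M i p"
proof -
 have O: "A : Ob" "B : Ob" "U : Ob" using i arr_obj(1) by (metis hom_iff)+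
 have "ALL j<4. s *. [i0, i1, i2, i3] ! j = [i0, i1, i2, i3] ! flip23 j *. (sign1 j |> ii ([A, B, U, U] ! j))"
  unfolding all_less_4 flip23_def sign1_def using i s O by (simp add: nth_Cons' hom_iff)
 thus ?thesis using b z
  by (intro exI[of _ "%j. [A, B, U, U] ! j"] exI[of _ "%j. [i0, i1, i2, i3] ! j"] exI[of _ p])
   (simp add: involution_split_def)
qed

text \<open>With 2 invertible, \<open>(1 + s)/2\<close> and \<open>(1 - s)/2\<close> are
  complementary idempotents with images the kernels of \<open>1 - s\<close> and
  \<open>1 + s\<close>. The free part is taken to be a zero object.\<close>

lemma involution_split_odd:
 assumes two: "\<one>\<^sub>K \<oplus>\<^sub>K \<one>\<^sub>K ~= \<zero>\<^sub>K"
  and s: "ar s" "src s = X" "tgt s = X" "s *. s = ii X"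
 shows "EX M i p. involution_split X s M i p"
proof -
 have O: "X : Ob" using s by auto
 let ?m = "\<ominus>\<^sub>K \<one>\<^sub>K"
 define d where "d = \<one>\<^sub>K \<oplus>\<^sub>K \<one>\<^sub>K"
 define h where "h = inv\<^bsub>K\<^esub> d"
 have d: "d : carrier K" "d ~= \<zero>\<^sub>K" using two by (auto simp: d_def)
 have h: "h : carrier K" "h \<otimes>\<^sub>K d = \<one>\<^sub>K" using d inverse_exists[of d] Units_l_inv[of d] field_Units by (auto simp: h_def)
 have half: "h |> f +. h |> f = f" if "ar f" for f
 proof -
  have "h \<oplus>\<^sub>K h = h \<otimes>\<^sub>K d" using h(1) by (simp add: d_def r_distr)
  thus ?thesis using plus_scale[OF that h(1) h(1)] h that by simp
 qed
 have em: "ar (ii X +. ?m |> s)" "src (ii X +. ?m |> s) = X" "tgt (ii X +. ?m |> s) = X"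
  and ep: "ar (ii X +. s)" "src (ii X +. s) = X" "tgt (ii X +. s) = X"
  using s O by auto
 obtain A k where k: "A : Ob" "ar k" "src k = A" "tgt k = X" "(ii X +. ?m |> s) *. k = nl A X"
  and ku: "!!g. ar g ==> tgt g = X ==> (ii X +. ?m |> s) *. g = nl (src g) X ==> EX u. ar u & src u = src g & tgt u = A & k *. u = g"
  and km: "!!g h. ar g ==> ar h ==> src g = src h ==> tgt g = A ==> tgt h = A ==> k *. g = k *. h ==> g = h"
  by (rule kernel_arrE[OF em]) blast
 obtain B l where l: "B : Ob" "ar l" "src l = B" "tgt l = X" "(ii X +. s) *. l = nl B X"
  and lu: "!!g. ar g ==> tgt g = X ==> (ii X +. s) *. g = nl (src g) X ==> EX u. ar u & src u = src g & tgt u = B & l *. u = g"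
  and lm: "!!g h. ar g ==> ar h ==> src g = src h ==> tgt g = B ==> tgt h = B ==> l *. g = l *. h ==> g = h"
  by (rule kernel_arrE[OF ep]) blast
 have sk: "s *. k = k"
  by (rule sym, rule diff_eq_nul) (use k s O in auto)
 have sl: "s *. l = ?m |> l"
 proof -
  have "l +. s *. l = nl B X" using l s O by simp
  hence "?m |> l +. (l +. s *. l) = ?m |> l" using l s by simp
  thus ?thesis using l s by simp
 qed
 define e where "e = h |> (ii X +. s)"
 define e' where "e' = h |> (ii X +. ?m |> s)"
 have e: "ar e" "src e = X" "tgt e = X" "ar e'" "src e' = X" "tgt e' = X"
  using s O h by (auto simp: e_def e'_def)
 have "(ii X +. ?m |> s) *. e = h |> ((ii X +. ?m |> s) *. (ii X +. s))"
  unfolding e_def by (rule cmp_scale_right) (use s O h in auto)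
 also have "(ii X +. ?m |> s) *. (ii X +. s) = nl X X" using s O by simp
 also have "h |> nl X X = nl X X" using O h by simp
 finally obtain q where q: "ar q" "src q = X" "tgt q = A" "k *. q = e" using ku[of e] e by auto
 have "(ii X +. s) *. e' = h |> ((ii X +. s) *. (ii X +. ?m |> s))"
  unfolding e'_def by (rule cmp_scale_right) (use s O h in auto)
 also have "(ii X +. s) *. (ii X +. ?m |> s) = nl X X" using s O by simp
 also have "h |> nl X X = nl X X" using O h by simp
 finally obtain r where r: "ar r" "src r = X" "tgt r = B" "l *. r = e'" using lu[of e'] e by auto
 have qk: "q *. k = ii A"
 proof (rule km)
  have "k *. q *. k = (k *. q) *. k" using q(1,2,3) k(2,3,4) l(2,3,4) by simp
  also have "... = k" unfolding q(4) e_def using k s O h sk half[of k] by simp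
  finally show "k *. q *. k = k *. ii A" using k by simp
 qed (use q k in auto)
 have ql: "q *. l = nl B A"
 proof (rule km)
  have "k *. q *. l = (k *. q) *. l" using q(1,2,3) k(2,3,4) l(2,3,4) by simp
  also have "... = h |> ((ii X +. s) *. l)" unfolding q(4) e_def by (rule cmp_scale_left) (use l s O h in auto)
  also have "... = nl B X" unfolding l(5) using l(1) O h by simp
  finally show "k *. q *. l = k *. nl B A" using k l by simp
 qed (use q k l in auto)
 have rl: "r *. l = ii B"
 proof (rule lm)
  have "l *. r *. l = (l *. r) *. l" using q(1,2,3) r(1,2,3) k(2,3,4) l(2,3,4) by simp
  also have "... = l" unfolding r(4) e'_def using l s O h sl half[of l] by (simp add: r_minus l_minus)
  finally show "l *. r *. l = l *. ii B" using l by simp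
 qed (use r l in auto)
 have rk: "r *. k = nl A B"
 proof (rule lm)
  have "l *. r *. k = (l *. r) *. k" using q(1,2,3) r(1,2,3) k(2,3,4) l(2,3,4) by simp
  also have "... = h |> ((ii X +. ?m |> s) *. k)" unfolding r(4) e'_def by (rule cmp_scale_left) (use k s O h in auto)
  also have "... = nl A X" unfolding k(5) using k(1) O h by simp
  finally show "l *. r *. k = l *. nl A B" using k l by simp
 qed (use r k l in auto)
 have ee: "e +. e' = ii X"
 proof -
  have "e +. e' = h |> (ii X +. (s +. (ii X +. ?m |> s)))" using s O h by (simp add: e_def e'_def)
  also have "s +. (ii X +. ?m |> s) = s +. (?m |> s +. ii X)" using s O by (subst plus_comm[of "ii X"]) auto
  also have "h |> (ii X +. (s +. (?m |> s +. ii X))) = ii X" using s O h half[of "ii X"] by simp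
  finally show ?thesis .
 qed
 obtain Z where Z: "zero_object C Z" using zero_object_exists by blast
 hence ZO: "Z : Ob" "ii Z = nl Z Z" by (auto simp: zero_object_iff)
 have "biproduct C {..<4::nat} (%j. [A, B, Z, Z] ! j) X (%j. [k, l, nl Z X, nl Z X] ! j) (%j. [q, r, nl X Z, nl X Z] ! j)"
  by (rule biproduct4I) (use O k l q r ZO qk ql rl rk ee e in "auto simp: hom_iff")
 thus ?thesis
  by (rule involution_split4I) (use sk sl k l s ZO O two in "simp_all add: hom_iff")
qed

text \<open>In characteristic 2 the map \<open>N = 1 + s\<close> has square zero. Let
  \<open>A\<close> be its kernel and \<open>U\<close> a complement of \<open>A\<close>. Then
  \<open>N\<close> embeds \<open>U\<close> into \<open>A\<close>, and a complement \<open>H\<close>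
  of the image in \<open>A\<close> is the trivial part: \<open>X = H + U + s U\<close>, since
  \<open>s u = u + N u\<close>.\<close>

lemma involution_split_even:
 assumes two: "\<one>\<^sub>K \<oplus>\<^sub>K \<one>\<^sub>K = \<zero>\<^sub>K"
  and s: "ar s" "src s = X" "tgt s = X" "s *. s = ii X"
 shows "EX M i p. involution_split X s M i p"
proof -
 have O: "X : Ob" using s by auto
 have dbl: "f +. f = nl (src f) (tgt f)" if "ar f" for f
  using plus_scale[OF that, of "\<one>\<^sub>K" "\<one>\<^sub>K"] that two by simp
 have dbl': "f +. (f +. g) = g" if "ar f" "ar g" "src f = src g" "tgt f = tgt g" for f g
 proof -
  have "f +. (f +. g) = (f +. f) +. g" by (rule sym, rule plus_assoc) (use that in auto)
  thus ?thesis using that dbl by simp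
 qed
 define N where "N = ii X +. s"
 have N: "ar N" "src N = X" "tgt N = X" using s O by (auto simp: N_def)
 have NN: "N *. N = nl X X"
 proof -
  have "N *. N = ii X +. (s +. (s +. ii X))" using s O by (simp add: N_def)
  thus ?thesis using s O dbl'[of s "ii X"] dbl[of "ii X"] by simp
 qed
 have sN: "s = ii X +. N" using s O dbl'[of "ii X" s] by (simp add: N_def)
 obtain A k where k: "A : Ob" "ar k" "src k = A" "tgt k = X" "N *. k = nl A X"
  and ku: "!!g. ar g ==> tgt g = X ==> N *. g = nl (src g) X ==> EX u. ar u & src u = src g & tgt u = A & k *. u = g"
  and km: "!!g h. ar g ==> ar h ==> src g = src h ==> tgt g = A ==> tgt h = A ==> k *. g = k *. h ==> g = h"
  by (rule kernel_arrE[OF N]) blast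
 obtain r where r: "ar r" "src r = X" "tgt r = A" "r *. k = ii A"
 proof (rule mono_split[OF k(2,3,4)])
  fix g assume g: "ar g" "tgt g = A" "k *. g = nl (src g) X"
  show "g = nl (src g) A" by (rule km) (use g k in auto)
 qed
 obtain U u q where S: "split_pair C X A k r U u q" using idempotent_complement[OF k(2,3,4) r] .
 note x = split_pairD[OF S]
 have "N *. N *. u = nl U X" using NN N x O cmp_assoc[of N N u] by simp
 then obtain h where h: "ar h" "src h = U" "tgt h = A" "k *. h = N *. u" using ku[of "N *. u"] N x by auto
 obtain t where t: "ar t" "src t = A" "tgt t = U" "t *. h = ii U"
 proof (rule mono_split[OF h(1,2,3)])
  fix g assume g: "ar g" "tgt g = U" "h *. g = nl (src g) A"
  have "N *. u *. g = (k *. h) *. g" unfolding h(4) using N x g by simp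
  also have "... = nl (src g) X" using k(2,3,4) h(1,2,3) g by simp
  finally obtain v where v: "ar v" "src v = src g" "tgt v = A" "k *. v = u *. g" using ku[of "u *. g"] x g by auto
  have "g = (q *. u) *. g" unfolding x(14) using g by simp
  also have "... = q *. k *. v" unfolding v(4) by (rule cmp_assoc) (use x g in auto)
  also have "... = (q *. k) *. v" by (rule sym, rule cmp_assoc) (use x k v in auto)
  also have "... = nl (src g) U" using x v by simp
  finally show "g = nl (src g) U" .
 qed
 obtain H j w where S': "split_pair C A U h t H j w" using idempotent_complement[OF h(1,2,3) t] .
 note y = split_pairD[OF S']
 have su: "s *. u = u +. k *. h" unfolding h(4) by (subst sN) (use N x O in simp)
 have sk: "s *. k = k" by (subst sN) (use N k O in simp)
 have ssu: "s *. (u +. k *. h) = u"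
 proof -
  have "s *. (s *. u) = (s *. s) *. u" by (rule sym, rule cmp_assoc) (use s x in auto)
  thus ?thesis unfolding su[symmetric] s(4) using x by simp
 qed
 have ru: "r *. u = nl U A" "q *. k = nl A U" "q *. u = ii U" using x by auto
 have rk': "r *. k *. g = g" if "ar g" "tgt g = A" for g
 proof -
  have "r *. k *. g = (r *. k) *. g" by (rule sym, rule cmp_assoc) (use r k that in auto)
  thus ?thesis unfolding r(4) using that by simp
 qed
 have qk': "q *. k *. g = nl (src g) U" if "ar g" "tgt g = A" for g
 proof -
  have "q *. k *. g = (q *. k) *. g" by (rule sym, rule cmp_assoc) (use x k that in auto)
  thus ?thesis unfolding ru(2) using x that by simp
 qed
 obtain Z where Z: "zero_object C Z" using zero_object_exists by blast
 hence ZO: "Z : Ob" "ii Z = nl Z Z" by (auto simp: zero_object_iff)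
 \<comment> \<open>In characteristic 2 the relation \<open>s u = u + k h\<close> gives
   \<open>k h = u + s u\<close>. This is why the coordinates along \<open>U\<close> and
   \<open>s U\<close> are \<open>q + t r\<close> and \<open>t r\<close>.\<close>
 have sum: "(k *. j) *. w *. r +. (nl Z X *. nl X Z +. (u *. (q +. t *. r) +. (u +. k *. h) *. t *. r)) = ii X"
 proof -
  note ty = k(2,3,4) h(1,2,3) t(1,2,3) r(1,2,3) x(7,8,9,10,11,12) y(7,8,9,10,11,12)
  define a1 a2 a3 a4 where "a1 = u *. q" "a2 = u *. t *. r" "a3 = k *. h *. t *. r" "a4 = k *. j *. w *. r"
  note ad = a1_a2_a3_a4_def
  have a: "ar a1" "ar a2" "ar a3" "ar a4" "src a1 = X" "src a2 = X" "src a3 = X" "src a4 = X"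
   "tgt a1 = X" "tgt a2 = X" "tgt a3 = X" "tgt a4 = X"
   unfolding ad using ty by simp_all
  have 1: "u *. (q +. t *. r) = a1 +. a2" "(u +. k *. h) *. t *. r = a2 +. a3" "(k *. j) *. w *. r = a4"
   unfolding ad using ty by simp_all
  have "h *. t *. r +. j *. w *. r = r" by (rule sym, rule split_pair_sum(1)[OF S' r(1,3)])
  hence 2: "a3 +. a4 = k *. r" unfolding ad using ty by (subst cmp_plus_right[symmetric]) simp_all
  have "a4 +. (nl X X +. ((a1 +. a2) +. (a2 +. a3))) = a4 +. (a1 +. a3)"
   using a dbl'[of a2 a3] O by simp
  also have "... = a4 +. (a3 +. a1)" by (subst plus_comm[of a1 a3]) (use a in simp_all)
  also have "... = (a4 +. a3) +. a1" by (rule sym, rule plus_assoc) (use a in simp_all)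
  also have "a4 +. a3 = a3 +. a4" by (rule plus_comm) (use a in simp_all)
  finally have "a4 +. (nl X X +. ((a1 +. a2) +. (a2 +. a3))) = k *. r +. a1" unfolding 2 .
  moreover have "nl Z X *. nl X Z = nl X X" using ZO(1) O by simp
  ultimately show ?thesis unfolding 1 using S by (simp add: split_pair_def ad)
 qed
 have "biproduct C {..<4::nat} (%n. [H, Z, U, U] ! n) X (%n. [k *. j, nl Z X, u, u +. k *. h] ! n)
   (%n. [w *. r, nl X Z, q +. t *. r, t *. r] ! n)"
  by (rule biproduct4I) (use O k(1,2,3,4) r x y t h(1,2,3) ZO sum rk' qk' dbl[of "ii U"] in "simp_all add: hom_iff")
 moreover have "s *. k *. j = k *. j"
 proof -
  have "s *. k *. j = (s *. k) *. j" by (rule sym, rule cmp_assoc) (use s k y in auto)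
  thus ?thesis unfolding sk .
 qed
 ultimately show ?thesis
  by (elim involution_split4I) (use su ssu Z s(1,2,3) x h(1,2,3) k(1,2,3,4) y t r ZO O in "simp_all add: hom_iff del: cmp_plus_right")
qed

lemma involution_split_exists:
 assumes "ar s" "src s = X" "tgt s = X" "s *. s = ii X"
 obtains M i p where "involution_split X s M i p"
 using involution_split_odd[OF _ assms] involution_split_even[OF _ assms] by blast

lemma sdim_sign:
 assumes "c = \<one>\<^sub>K & n = 1 \<or> c = \<ominus>\<^sub>K \<one>\<^sub>K & n = -1" and "M : Ob" "Z : Ob"
  and "\<one>\<^sub>K \<oplus>\<^sub>K \<one>\<^sub>K = \<zero>\<^sub>K & n = -1 ==> zero_object C M"
 shows "sdim K C Z M (c |> ii M) = n * int (dm Z M)"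
proof (cases "n = -1 & \<one>\<^sub>K \<oplus>\<^sub>K \<one>\<^sub>K = \<zero>\<^sub>K")
 case True
 hence z: "zero_object C M" using assms(4) by simp
 interpret v: vectorspace K "HomV C Z M" by (rule vectorspace_HomV) fact+
 have f: "f = nl Z M" if "ar f" "src f = Z" "tgt f = M" for f using zero_object_arr(2)[OF z, of f] that by auto
 have "hm Z M = {\<zero>\<^bsub>HomV C Z M\<^esub>}" using f assms by (auto simp: hom_iff HomV_ops)
 moreover from this have "{f : hm Z M. (c |> ii M) *. f = f} = {\<zero>\<^bsub>HomV C Z M\<^esub>}"
  using assms by (auto simp: HomV_ops)
 ultimately show ?thesis using v.subdim_zero by (simp add: sdim_def hdim_def)
next
 case False
 thus ?thesis using assms(1) sdim_ide[OF assms(2,3)] sdim_minus_ide[OF assms(2,3)] assms(2) by auto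
qed

lemma sdim_involution_split:
 assumes sp: "involution_split X s M i p" and s: "ar s" "src s = X" "tgt s = X" and Z: "Z : Ob"
 shows "sdim K C Z X s = int (dm Z (M 0)) - int (dm Z (M 1))"
proof -
 have b: "biproduct C {..<4} M X i p" using sp by (simp add: involution_split_def)
 note b' = biproductD[OF b]
 have MO: "M j : Ob" if "j < 4" for j using b'(11)[of j] that by simp
 have c: "sign1 j : carrier K" for j by (simp add: sign1_def)
 have "sdim K C Z X s = (\<Sum>j\<in>{j : {..<4}. flip23 j = j}. sdim K C Z (M j) (sign1 j |> ii (M j)))"
 proof (rule sdim_orbits[OF b _ Z])
  show "s : hm X X" using s by (simp add: hom_iff)
  fix j assume j: "j : {..<4::nat}"
  show f: "flip23 j : {..<4} & flip23 (flip23 j) = j" using j by (auto simp: flip23_def)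
  have Mf: "M (flip23 j) = M j" using sp by (auto simp: flip23_def involution_split_def)
  show "sign1 j |> ii (M j) : hm (M j) (M (flip23 j))" using Mf MO[of j] j c by (simp add: hom_iff)
  show "s *. i j = i (flip23 j) *. (sign1 j |> ii (M j))" using sp j by (auto simp: involution_split_def)
  have "sign1 j \<otimes>\<^sub>K sign1 (flip23 j) = \<one>\<^sub>K" by (auto simp: sign1_def flip23_def l_minus r_minus)
  thus "(sign1 (flip23 j) |> ii (M (flip23 j))) *. (sign1 j |> ii (M j)) = ii (M j)"
   using Mf MO[of j] j c by simp
 qed
 also have "{j : {..<4::nat}. flip23 j = j} = {0, 1}" by (auto simp: flip23_def)
 also have "(\<Sum>j\<in>{0, 1}. sdim K C Z (M j) (sign1 j |> ii (M j))) = int (dm Z (M 0)) - int (dm Z (M 1))"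
  using sdim_sign[of "sign1 0" 1 "M 0" Z] sdim_sign[of "sign1 1" "-1" "M 1" Z] MO[of 0] MO[of 1] Z sp
  by (auto simp: sign1_def involution_split_def simp del: One_nat_def)
 finally show ?thesis .
qed

end

section \<open>Tensor products of arrows\<close>

definition ten :: "('k, 'o, 'm, 'z) monoidal_cat_scheme => 'o * 'm * 'o => 'o * 'm * 'o => 'o * 'm * 'o"
  (infixr \<open>ox\<index>\<close> 75) where
 "f ox\<^bsub>C\<^esub> g = (src f ><\<^bsub>C\<^esub> src g, mor f \<boxdot>\<^bsub>C\<^esub> mor g, tgt f ><\<^bsub>C\<^esub> tgt g)"

definition asc :: "('k, 'o, 'm, 'z) monoidal_cat_scheme => 'o => 'o => 'o => 'o * 'm * 'o" where
 "asc C X Y Z = ((X ><\<^bsub>C\<^esub> Y) ><\<^bsub>C\<^esub> Z, Assoc C X Y Z, X ><\<^bsub>C\<^esub> (Y ><\<^bsub>C\<^esub> Z))"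

definition lun :: "('k, 'o, 'm, 'z) monoidal_cat_scheme => 'o => 'o * 'm * 'o" where
 "lun C X = (\<bbbI>\<^bsub>C\<^esub> ><\<^bsub>C\<^esub> X, LUnit C X, X)"

definition run :: "('k, 'o, 'm, 'z) monoidal_cat_scheme => 'o => 'o * 'm * 'o" where
 "run C X = (X ><\<^bsub>C\<^esub> \<bbbI>\<^bsub>C\<^esub>, RUnit C X, X)"

lemma ten_src_tgt [simp]:
 "src (f ox\<^bsub>C\<^esub> g) = src f ><\<^bsub>C\<^esub> src g" "tgt (f ox\<^bsub>C\<^esub> g) = tgt f ><\<^bsub>C\<^esub> tgt g"
 "src (asc C X Y Z) = (X ><\<^bsub>C\<^esub> Y) ><\<^bsub>C\<^esub> Z" "tgt (asc C X Y Z) = X ><\<^bsub>C\<^esub> (Y ><\<^bsub>C\<^esub> Z)"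
 "src (lun C X) = \<bbbI>\<^bsub>C\<^esub> ><\<^bsub>C\<^esub> X" "tgt (lun C X) = X" "src (run C X) = X ><\<^bsub>C\<^esub> \<bbbI>\<^bsub>C\<^esub>" "tgt (run C X) = X"
 by (simp_all add: ten_def asc_def lun_def run_def)

context linear_monoidal_category begin

abbreviation "az == asc C"
abbreviation "crg == class_ring C"
abbreviation "gid == grothendieck_ideal C"

lemma obj_ten [simp]: "X : Ob ==> Y : Ob ==> X >< Y : Ob"
 by (rule TensorO_closed)

lemma obj_unit [simp]: "\<bbbI> : Ob"
 by (rule Unit_closed)

lemma arr_ten [simp]: "ar f ==> ar g ==> ar (f ox g)"
 using TensorM_closed[of "src f" "tgt f" "src g" "tgt g" "mor f" "mor g"] by (simp add: arr_def ten_def del: arr_obj)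

lemma ten_ide [simp]: "X : Ob ==> Y : Ob ==> ii X ox ii Y = ii (X >< Y)"
 by (simp add: ten_def ide_def TensorM_Id)

lemma ten_cmp [simp]:
 "ar f ==> ar f' ==> ar g ==> ar g' ==> src f' = tgt f ==> src g' = tgt g
  ==> (f' ox g') *. (f ox g) = (f' *. f) ox (g' *. g)"
 using TensorM_Comp[of "src f" "tgt f" "tgt f'" "src g" "tgt g" "tgt g'" "mor f" "mor f'" "mor g" "mor g'"]
 by (simp add: arr_def ten_def cmp_def del: arr_obj)

lemma ten_cmp_tail [simp]:
 "ar f ==> ar f' ==> ar g ==> ar g' ==> src f' = tgt f ==> src g' = tgt g
  ==> ar h ==> tgt h = src f >< src g ==> (f' ox g') *. (f ox g) *. h = ((f' *. f) ox (g' *. g)) *. h"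
 by (subst cmp_assoc[symmetric]) auto

lemma cmp_tail:
 assumes "u *. v = w" "ar u" "ar v" "src u = tgt v" "ar h" "tgt h = src v"
 shows "u *. v *. h = w *. h"
 using assms(1) by (subst cmp_assoc[symmetric]) (use assms in auto)

lemma ten_plus_left [simp]:
 "ar f ==> ar f' ==> ar g ==> src f = src f' ==> tgt f = tgt f' ==> (f +. f') ox g = f ox g +. f' ox g"
 using TensorM_add_left[of "src f" "tgt f" "src g" "tgt g" "mor f" "mor f'" "mor g"]
 by (simp add: arr_def ten_def plus_arr_def HomV_simps del: arr_obj)

lemma ten_plus_right [simp]:
 "ar f ==> ar g ==> ar g' ==> src g = src g' ==> tgt g = tgt g' ==> f ox (g +. g') = f ox g +. f ox g'"
 using TensorM_add_right[of "src f" "tgt f" "src g" "tgt g" "mor f" "mor g" "mor g'"]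
 by (simp add: arr_def ten_def plus_arr_def HomV_simps del: arr_obj)

lemma ten_scale_left [simp]:
 "ar f ==> ar g ==> c : carrier K ==> (c |> f) ox g = c |> (f ox g)"
 using TensorM_smult_left[of "src f" "tgt f" "src g" "tgt g" "mor f" "mor g" c]
 by (simp add: arr_def ten_def scale_arr_def HomV_simps del: arr_obj)

lemma ten_scale_right [simp]:
 "ar f ==> ar g ==> c : carrier K ==> f ox (c |> g) = c |> (f ox g)"
 using TensorM_smult_right[of "src f" "tgt f" "src g" "tgt g" "mor f" "mor g" c]
 by (simp add: arr_def ten_def scale_arr_def HomV_simps del: arr_obj)

lemma ten_nul_left [simp]:
 "ar g ==> X : Ob ==> Y : Ob ==> nl X Y ox g = nl (X >< src g) (Y >< tgt g)"
 using ten_scale_left[of "nl X Y" g "\<zero>\<^sub>K"] by simp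

lemma ten_nul_right [simp]:
 "ar g ==> X : Ob ==> Y : Ob ==> g ox nl X Y = nl (src g >< X) (tgt g >< Y)"
 using ten_scale_right[of g "nl X Y" "\<zero>\<^sub>K"] by simp

lemma iso_ten [simp]: "isa f ==> isa g ==> isa (f ox g)"
 "isa f ==> isa g ==> iv (f ox g) = iv f ox iv g"
 using iso_arrI[of "f ox g" "iv f ox iv g"] by auto

lemma inv_ide [simp]: "X : Ob ==> iv (ii X) = ii X"
 by (rule iso_arrI(2)) auto

lemma iso_asc [simp]: "X : Ob ==> Y : Ob ==> Z : Ob ==> isa (az X Y Z)"
 using Assoc_iso[of X Y Z] by (auto simp: iso_arr_def asc_def arr_def is_iso_def inverse_arrows_def simp del: arr_obj)

lemma iso_lun [simp]: "X : Ob ==> isa (lun C X)"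
 using LUnit_iso[of X] by (auto simp: iso_arr_def lun_def arr_def is_iso_def inverse_arrows_def simp del: arr_obj)

lemma iso_run [simp]: "X : Ob ==> isa (run C X)"
 using RUnit_iso[of X] by (auto simp: iso_arr_def run_def arr_def is_iso_def inverse_arrows_def simp del: arr_obj)

lemma asc_nat:
 assumes "ar f" "ar g" "ar h" "src f = X" "src g = Y" "src h = Z" "tgt f = X'" "tgt g = Y'" "tgt h = Z'"
 shows "az X' Y' Z' *. ((f ox g) ox h) = (f ox (g ox h)) *. az X Y Z"
 using Assoc_natural[of "src f" "tgt f" "src g" "tgt g" "src h" "tgt h" "mor f" "mor g" "mor h"] assms
 by (intro arrow_eqI) (auto simp: arr_def ten_def asc_def cmp_def simp del: arr_obj)

lemma asc_inv_nat:
 assumes f: "ar f" "ar g" "ar h" "src f = X" "src g = Y" "src h = Z" "tgt f = X'" "tgt g = Y'" "tgt h = Z'"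
 shows "iv (az X' Y' Z') *. (f ox (g ox h)) = ((f ox g) ox h) *. iv (az X Y Z)"
proof -
 have O: "X : Ob" "Y : Ob" "Z : Ob" "X' : Ob" "Y' : Ob" "Z' : Ob" using f by auto
 have "iv (az X' Y' Z') *. ((f ox (g ox h)) *. az X Y Z) *. iv (az X Y Z)
   = iv (az X' Y' Z') *. (az X' Y' Z' *. ((f ox g) ox h)) *. iv (az X Y Z)"
  unfolding asc_nat[OF f] ..
 thus ?thesis using f O by simp
qed

lemma run_nat: "ar f ==> src f = X ==> tgt f = Y ==> run C Y *. (f ox ii \<bbbI>) = f *. run C X"
 using RUnit_natural[of "src f" "tgt f" "mor f"]
 by (intro arrow_eqI) (auto simp: arr_def ten_def run_def cmp_def ide_def simp del: arr_obj)

lemma pentagon_arr: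
 assumes "W : Ob" "X : Ob" "Y : Ob" "Z : Ob"
 shows "az W X (Y >< Z) *. az (W >< X) Y Z =
  (ii W ox az X Y Z) *. az W (X >< Y) Z *. (az W X Y ox ii Z)"
proof -
 have "ar (ii W ox az X Y Z)" "ar (az W (X >< Y) Z)" "ar (az W X Y ox ii Z)"
  using assms by simp_all
 hence a: "mor (ii W ox az X Y Z) : arrows C (W >< ((X >< Y) >< Z)) (W >< (X >< (Y >< Z)))"
  "mor (az W (X >< Y) Z) : arrows C ((W >< (X >< Y)) >< Z) (W >< ((X >< Y) >< Z))"
  "mor (az W X Y ox ii Z) : arrows C (((W >< X) >< Y) >< Z) ((W >< (X >< Y)) >< Z)"
  unfolding arr_def by simp_all
 show ?thesis
  using pentagon[OF assms] Comp_assoc[OF _ _ _ _ a(3,2,1)] assms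
  by (intro arrow_eqI) (auto simp: ten_def asc_def cmp_def ide_def)
qed

lemma triangle_arr:
 "X : Ob ==> Y : Ob ==> (ii X ox lun C Y) *. az X \<bbbI> Y = run C X ox ii Y"
 using triangle[of X Y] by (intro arrow_eqI) (auto simp: ten_def asc_def cmp_def ide_def lun_def run_def)

lemma iso_cancel_right:
 "isa u ==> ar f ==> ar g ==> src f = tgt u ==> src g = tgt u ==> f *. u = g *. u ==> f = g"
 by (metis cmp_assoc cmp_ide_right cmp_inv iso_arr_arr arr_inv src_tgt_simps(12))

lemma iso_cancel_left:
 "isa u ==> ar f ==> ar g ==> src u = tgt f ==> src u = tgt g ==> u *. f = u *. g ==> f = g"
 by (metis inv_cmp')

text \<open>Naturality of the invertible right unit constraint makes tensoring with the unit object
  faithful, so coherence laws may be checked after tensoring with it.\<close>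

lemma ten_unit_faithful:
 assumes "ar f" "ar g" "src f = src g" "tgt f = tgt g" "f ox ii \<bbbI> = g ox ii \<bbbI>"
 shows "f = g"
proof (rule iso_cancel_right[of "run C (src f)"])
 show "f *. run C (src f) = g *. run C (src f)"
  using run_nat[OF assms(1) refl refl] run_nat[OF assms(2) refl refl] assms(3,4,5) by simp
qed (use assms in auto)

text \<open>Kelly's argument: after tensoring with the unit, the claim follows from the pentagon for
  \<open>A\<close>, \<open>B\<close> and two units together with the triangle identities.\<close>

lemma run_ten:
 assumes O: "A : Ob" "B : Ob"
 shows "run C (A >< B) = (ii A ox run C B) *. az A B \<bbbI>"
proof (rule ten_unit_faithful)
 have 1: "az A B \<bbbI> *. (run C (A >< B) ox ii \<bbbI>)
   = (ii A ox (ii B ox lun C \<bbbI>)) *. az A B (\<bbbI> >< \<bbbI>) *. az (A >< B) \<bbbI> \<bbbI>"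
 proof -
  have "az A B \<bbbI> *. (run C (A >< B) ox ii \<bbbI>) = az A B \<bbbI> *. ((ii A ox ii B) ox lun C \<bbbI>) *. az (A >< B) \<bbbI> \<bbbI>"
   unfolding triangle_arr[OF obj_ten[OF O] obj_unit, symmetric] using O by simp
  also have "... = (ii A ox (ii B ox lun C \<bbbI>)) *. az A B (\<bbbI> >< \<bbbI>) *. az (A >< B) \<bbbI> \<bbbI>"
   by (subst cmp_tail[OF asc_nat[of "ii A" "ii B" "lun C \<bbbI>" A B "\<bbbI> >< \<bbbI>" A B \<bbbI>]]) (use O in "simp_all del: ten_ide")
  finally show ?thesis .
 qed
 have 2: "(ii A ox (ii B ox lun C \<bbbI>)) *. (ii A ox az B \<bbbI> \<bbbI>) = ii A ox (run C B ox ii \<bbbI>)"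
  using triangle_arr[OF O(2) obj_unit] O by (simp del: ten_ide)
 have "az A B \<bbbI> *. (run C (A >< B) ox ii \<bbbI>)
   = (ii A ox (run C B ox ii \<bbbI>)) *. az A (B >< \<bbbI>) \<bbbI> *. (az A B \<bbbI> ox ii \<bbbI>)"
  unfolding 1 pentagon_arr[OF O obj_unit obj_unit] by (subst cmp_tail[OF 2]) (use O in simp_all)
 also have "... = az A B \<bbbI> *. ((ii A ox run C B) ox ii \<bbbI>) *. (az A B \<bbbI> ox ii \<bbbI>)"
  by (subst cmp_tail[OF asc_nat[of "ii A" "run C B" "ii \<bbbI>" A "B >< \<bbbI>" \<bbbI> A B \<bbbI>]]) (use O in simp_all)
 also have "... = az A B \<bbbI> *. (((ii A ox run C B) *. az A B \<bbbI>) ox ii \<bbbI>)"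
  using O by simp
 finally show "run C (A >< B) ox ii \<bbbI> = ((ii A ox run C B) *. az A B \<bbbI>) ox ii \<bbbI>"
  by (rule iso_cancel_left[of "az A B \<bbbI>", rotated 5]) (use O in simp_all)
qed (use O in simp_all)

end

section \<open>The adjunction given by a dual\<close>

text \<open>The zigzag identities for \<open>D\<close> as a left dual of \<open>B\<close>.\<close>

definition dual_pair ::
  "('k, 'o, 'm, 'z) monoidal_cat_scheme => 'o => 'o => 'o * 'm * 'o => 'o * 'm * 'o => bool" where
 "dual_pair C B D ev co \<longleftrightarrow> B : Obj C & D : Obj C &
  arr C ev & src ev = D ><\<^bsub>C\<^esub> B & tgt ev = \<bbbI>\<^bsub>C\<^esub> & arr C co & src co = \<bbbI>\<^bsub>C\<^esub> & tgt co = B ><\<^bsub>C\<^esub> D &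
  run C B *.\<^bsub>C\<^esub> (ide C B ox\<^bsub>C\<^esub> ev) *.\<^bsub>C\<^esub> asc C B D B *.\<^bsub>C\<^esub> (co ox\<^bsub>C\<^esub> ide C B) *.\<^bsub>C\<^esub> inv_arr C (lun C B) = ide C B &
  lun C D *.\<^bsub>C\<^esub> (ev ox\<^bsub>C\<^esub> ide C D) *.\<^bsub>C\<^esub> inv_arr C (asc C D B D) *.\<^bsub>C\<^esub> (ide C D ox\<^bsub>C\<^esub> co) *.\<^bsub>C\<^esub> inv_arr C (run C D) = ide C D"

context linear_monoidal_category begin

lemma left_dual_pair:
 assumes "is_left_dual C B D"
 obtains ev co where "dual_pair C B D ev co"
proof -
 obtain e c where ec: "B : Ob" "D : Ob" "e : arrows C (D >< B) \<bbbI>" "c : arrows C \<bbbI> (B >< D)"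
  and z1: "RUnit C B \<cdot> (Id C B \<boxdot> e) \<cdot> Assoc C B D B \<cdot> (c \<boxdot> Id C B) \<cdot> inv_arrow C (\<bbbI> >< B) B (LUnit C B) = Id C B"
  and z2: "LUnit C D \<cdot> (e \<boxdot> Id C D) \<cdot> inv_arrow C ((D >< B) >< D) (D >< (B >< D)) (Assoc C D B D)
   \<cdot> (Id C D \<boxdot> c) \<cdot> inv_arrow C (D >< \<bbbI>) D (RUnit C D) = Id C D"
  using assms unfolding is_left_dual_def by blast
 define ev where "ev = (D >< B, e, \<bbbI>)"
 define co where "co = (\<bbbI>, c, B >< D)"
 have t: "ar ev" "src ev = D >< B" "tgt ev = \<bbbI>" "ar co" "src co = \<bbbI>" "tgt co = B >< D"
  using ec by (auto simp: ev_def co_def arr_def simp del: arr_obj)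
 have "(((run C B *. (ii B ox ev)) *. az B D B) *. (co ox ii B)) *. iv (lun C B) = ii B"
  using z1 by (intro arrow_eqI) (auto simp: cmp_def run_def ten_def ide_def ev_def co_def asc_def lun_def inv_arr_def)
 moreover have "(((lun C D *. (ev ox ii D)) *. iv (az D B D)) *. (ii D ox co)) *. iv (run C D) = ii D"
  using z2 by (intro arrow_eqI) (auto simp: cmp_def run_def ten_def ide_def ev_def co_def asc_def lun_def inv_arr_def)
 ultimately have "dual_pair C B D ev co" unfolding dual_pair_def using t ec by simp
 thus ?thesis by (rule that)
qed

definition uncurry_arr where
 "uncurry_arr D B ev g Cc = run C Cc *. (ii Cc ox ev) *. az Cc D B *. (g ox ii B)"

definition curry_arr where
 "curry_arr D B co f A = (f ox ii D) *. iv (az A B D) *. (ii A ox co) *. iv (run C A)"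

text \<open>Naturality moves \<open>f\<close> to the outside and the pentagon moves \<open>A\<close>
  to the left. What is left between them is the zigzag identity for \<open>B\<close>, tensored with
  \<open>A\<close>.\<close>

lemma uncurry_curry:
 assumes d: "dual_pair C B D ev co" and f: "ar f" "src f = A >< B" "tgt f = Z" and A: "A : Ob"
 shows "uncurry_arr D B ev (curry_arr D B co f A) Z = f"
proof -
 have O: "B : Ob" "D : Ob" "A : Ob" "Z : Ob"
  and e: "ar ev" "src ev = D >< B" "tgt ev = \<bbbI>" and c: "ar co" "src co = \<bbbI>" "tgt co = B >< D"
  and z: "run C B *. (ii B ox ev) *. az B D B *. (co ox ii B) *. iv (lun C B) = ii B"
  using d A f by (auto simp: dual_pair_def)
 note T = O e c f
 have 1: "az Z D B *. ((f ox ii D) ox ii B) = (f ox (ii D ox ii B)) *. az (A >< B) D B"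
  by (rule asc_nat) (use T in simp_all)
 have 2: "(ii Z ox ev) *. (f ox (ii D ox ii B)) = (f ox ii \<bbbI>) *. (ii (A >< B) ox ev)"
  using T by simp
 have 3: "run C Z *. (f ox ii \<bbbI>) = f *. (ii A ox run C B) *. az A B \<bbbI>"
  using run_nat[of f "A >< B" Z] run_ten[of A B] T by simp
 have 4: "az A B \<bbbI> *. (ii (A >< B) ox ev) = (ii A ox (ii B ox ev)) *. az A B (D >< B)"
  using asc_nat[of "ii A" "ii B" ev A B "D >< B" A B \<bbbI>] T by simp
 have 5: "az A (B >< D) B *. ((ii A ox co) ox ii B) = (ii A ox (co ox ii B)) *. az A \<bbbI> B"
  by (rule asc_nat) (use T in simp_all)
 \<comment> \<open>The triangle identity with both unit constraints inverted.\<close>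
 have 6: "az A \<bbbI> B *. (iv (run C A) ox ii B) = ii A ox iv (lun C B)"
 proof (rule iso_cancel_left[of "ii A ox lun C B"])
  have "(ii A ox lun C B) *. az A \<bbbI> B *. (iv (run C A) ox ii B)
    = (run C A ox ii B) *. (iv (run C A) ox ii B)"
   by (subst cmp_tail[OF triangle_arr[OF O(3,1)]]) (use T in simp_all)
  thus "(ii A ox lun C B) *. az A \<bbbI> B *. (iv (run C A) ox ii B)
   = (ii A ox lun C B) *. (ii A ox iv (lun C B))" using T by simp
 qed (use T in simp_all)
 have 7: "az A B (D >< B) *. az (A >< B) D B *. (iv (az A B D) ox ii B)
   = (ii A ox az B D B) *. az A (B >< D) B"
  by (subst cmp_tail[OF pentagon_arr[OF O(3,1,2,1)]]) (use T in simp_all)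
 let ?r = "iv (run C A) ox ii B" and ?c = "(ii A ox co) ox ii B"
  and ?a = "iv (az A B D) ox ii B"
 have 8: "curry_arr D B co f A ox ii B = ((f ox ii D) ox ii B) *. ?a *. ?c *. ?r"
  unfolding curry_arr_def using T by simp
 have "uncurry_arr D B ev (curry_arr D B co f A) Z
   = run C Z *. (ii Z ox ev) *. (f ox (ii D ox ii B)) *. az (A >< B) D B *. ?a *. ?c *. ?r"
  unfolding uncurry_arr_def 8 by (subst cmp_tail[OF 1]) (use T in "simp_all del: ten_cmp ten_cmp_tail ten_ide")
 also have "... = run C Z *. (f ox ii \<bbbI>) *. (ii (A >< B) ox ev) *. az (A >< B) D B *. ?a *. ?c *. ?r"
  by (subst cmp_tail[OF 2]) (use T in "simp_all del: ten_cmp ten_cmp_tail ten_ide")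
 also have "... = f *. (ii A ox run C B) *. az A B \<bbbI> *. (ii (A >< B) ox ev) *. az (A >< B) D B *. ?a *. ?c *. ?r"
  by (subst cmp_tail[OF 3]) (use T in "simp_all del: ten_cmp ten_cmp_tail ten_ide")
 also have "... = f *. (ii A ox run C B) *. (ii A ox (ii B ox ev)) *. az A B (D >< B) *. az (A >< B) D B *. ?a *. ?c *. ?r"
  by (subst cmp_tail[OF 4]) (use T in "simp_all del: ten_cmp ten_cmp_tail ten_ide")
 also have "az A B (D >< B) *. az (A >< B) D B *. ?a *. ?c *. ?r
   = (az A B (D >< B) *. az (A >< B) D B *. ?a) *. ?c *. ?r"
  using T by (simp del: ten_cmp ten_cmp_tail ten_ide)
 also have "... = (ii A ox az B D B) *. az A (B >< D) B *. ?c *. ?r"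
  unfolding 7 using T by (simp del: ten_cmp ten_cmp_tail ten_ide)
 also have "az A (B >< D) B *. ?c *. ?r = (ii A ox (co ox ii B)) *. az A \<bbbI> B *. ?r"
  by (subst cmp_tail[OF 5]) (use T in "simp_all del: ten_cmp ten_cmp_tail ten_ide")
 also have "... = (ii A ox (co ox ii B)) *. (ii A ox iv (lun C B))"
  unfolding 6 ..
 also have "f *. (ii A ox run C B) *. (ii A ox (ii B ox ev)) *. (ii A ox az B D B) *.
   (ii A ox (co ox ii B)) *. (ii A ox iv (lun C B))
  = f *. (ii A ox (run C B *. (ii B ox ev) *. az B D B *. (co ox ii B) *. iv (lun C B)))"
  using T by simp
 also have "... = f" unfolding z using T by simp
 finally show ?thesis .
qed

text \<open>As for the other composite, but \<open>g\<close> is moved to the right, and the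
  remaining factor is the zigzag identity for \<open>D\<close>, tensored with
  \<open>Z\<close>.\<close>

lemma curry_uncurry:
 assumes d: "dual_pair C B D ev co" and g: "ar g" "src g = A" "tgt g = Z >< D" and Z: "Z : Ob"
 shows "curry_arr D B co (uncurry_arr D B ev g Z) A = g"
proof -
 have O: "B : Ob" "D : Ob" "A : Ob" "Z : Ob"
  and e: "ar ev" "src ev = D >< B" "tgt ev = \<bbbI>" and c: "ar co" "src co = \<bbbI>" "tgt co = B >< D"
  and z: "lun C D *. (ev ox ii D) *. iv (az D B D) *. (ii D ox co) *. iv (run C D) = ii D"
  using d Z g by (auto simp: dual_pair_def)
 note T = O e c g
 let ?t = "iv (az Z D (B >< D)) *. (ii Z ox (ii D ox co)) *. (ii Z ox iv (run C D)) *. g"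
 let ?A = "az Z D B ox ii D" and ?E = "(ii Z ox ev) ox ii D" and ?R = "run C Z ox ii D"
 have 2: "((g ox ii B) ox ii D) *. iv (az A B D) = iv (az (Z >< D) B D) *. (g ox (ii B ox ii D))"
  by (rule sym, rule asc_inv_nat) (use T in simp_all)
 have 3: "(g ox (ii B ox ii D)) *. (ii A ox co) = (ii (Z >< D) ox co) *. (g ox ii \<bbbI>)"
  using T by simp
 have 4: "(g ox ii \<bbbI>) *. iv (run C A) = iv (az Z D \<bbbI>) *. (ii Z ox iv (run C D)) *. g"
 proof (rule iso_cancel_left[of "run C (Z >< D)"])
  have "run C (Z >< D) *. (g ox ii \<bbbI>) *. iv (run C A) = g"
   by (subst cmp_tail[OF run_nat[OF g]]) (use T in simp_all)
  moreover have "run C (Z >< D) *. iv (az Z D \<bbbI>) *. (ii Z ox iv (run C D)) *. g = g"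
   unfolding run_ten[OF O(4,2)] using T by simp
  ultimately show "run C (Z >< D) *. (g ox ii \<bbbI>) *. iv (run C A)
   = run C (Z >< D) *. iv (az Z D \<bbbI>) *. (ii Z ox iv (run C D)) *. g" by simp
 qed (use T in simp_all)
 have 5: "(ii (Z >< D) ox co) *. iv (az Z D \<bbbI>) = iv (az Z D (B >< D)) *. (ii Z ox (ii D ox co))"
  using asc_inv_nat[of "ii Z" "ii D" co Z D \<bbbI> Z D "B >< D"] T by simp
 have 6: "?A *. iv (az (Z >< D) B D) *. iv (az Z D (B >< D))
   = iv (az Z (D >< B) D) *. (ii Z ox iv (az D B D))"
 proof (rule iso_cancel_right[of "az Z D (B >< D) *. az (Z >< D) B D"])
  have "(?A *. iv (az (Z >< D) B D) *. iv (az Z D (B >< D))) *. az Z D (B >< D) *. az (Z >< D) B D = ?A"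
   using T by simp
  moreover have "(iv (az Z (D >< B) D) *. (ii Z ox iv (az D B D))) *. az Z D (B >< D) *. az (Z >< D) B D = ?A"
   unfolding pentagon_arr[OF O(4,2,1,2)] using T by simp
  ultimately show "(?A *. iv (az (Z >< D) B D) *. iv (az Z D (B >< D))) *. az Z D (B >< D) *. az (Z >< D) B D
   = (iv (az Z (D >< B) D) *. (ii Z ox iv (az D B D))) *. az Z D (B >< D) *. az (Z >< D) B D" by simp
 qed (use T in simp_all)
 have 7: "?E *. iv (az Z (D >< B) D) = iv (az Z \<bbbI> D) *. (ii Z ox (ev ox ii D))"
  by (rule sym, rule asc_inv_nat) (use T in simp_all)
 have 8: "?R *. iv (az Z \<bbbI> D) = ii Z ox lun C D"
  unfolding triangle_arr[OF O(4,2), symmetric] using T by simp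
 have "uncurry_arr D B ev g Z ox ii D = ?R *. ?E *. ?A *. ((g ox ii B) ox ii D)"
  unfolding uncurry_arr_def using T by simp
 hence "curry_arr D B co (uncurry_arr D B ev g Z) A
   = ?R *. ?E *. ?A *. ((g ox ii B) ox ii D) *. iv (az A B D) *. (ii A ox co) *. iv (run C A)"
  unfolding curry_arr_def using T by (simp del: ten_cmp ten_cmp_tail ten_ide)
 also have "... = ?R *. ?E *. ?A *. iv (az (Z >< D) B D) *. (g ox (ii B ox ii D)) *. (ii A ox co) *. iv (run C A)"
  by (subst cmp_tail[OF 2]) (use T in "simp_all del: ten_cmp ten_cmp_tail ten_ide")
 also have "... = ?R *. ?E *. ?A *. iv (az (Z >< D) B D) *. (ii (Z >< D) ox co) *. (g ox ii \<bbbI>) *. iv (run C A)"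
  by (subst cmp_tail[OF 3]) (use T in "simp_all del: ten_cmp ten_cmp_tail ten_ide")
 also have "... = ?R *. ?E *. ?A *. iv (az (Z >< D) B D) *. (ii (Z >< D) ox co) *. iv (az Z D \<bbbI>) *. (ii Z ox iv (run C D)) *. g"
  unfolding 4 ..
 also have "... = ?R *. ?E *. ?A *. iv (az (Z >< D) B D) *. ?t"
  by (subst cmp_tail[OF 5]) (use T in "simp_all del: ten_cmp ten_cmp_tail ten_ide")
 also have "... = ?R *. ?E *. (?A *. iv (az (Z >< D) B D) *. iv (az Z D (B >< D))) *.
   (ii Z ox (ii D ox co)) *. (ii Z ox iv (run C D)) *. g"
  using T by (simp del: ten_cmp ten_cmp_tail ten_ide)
 also have "... = ?R *. ?E *. iv (az Z (D >< B) D) *. (ii Z ox iv (az D B D)) *.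
   (ii Z ox (ii D ox co)) *. (ii Z ox iv (run C D)) *. g"
  unfolding 6 using T by (simp del: ten_cmp ten_cmp_tail ten_ide)
 also have "... = ?R *. iv (az Z \<bbbI> D) *. (ii Z ox (ev ox ii D)) *. (ii Z ox iv (az D B D)) *.
   (ii Z ox (ii D ox co)) *. (ii Z ox iv (run C D)) *. g"
  by (subst cmp_tail[OF 7]) (use T in "simp_all del: ten_cmp ten_cmp_tail ten_ide")
 also have "... = (ii Z ox lun C D) *. (ii Z ox (ev ox ii D)) *. (ii Z ox iv (az D B D)) *.
   (ii Z ox (ii D ox co)) *. (ii Z ox iv (run C D)) *. g"
  by (subst cmp_tail[OF 8]) (use T in "simp_all del: ten_cmp ten_cmp_tail ten_ide")
 also have "... = (ii Z ox (lun C D *. (ev ox ii D) *. iv (az D B D) *. (ii D ox co) *. iv (run C D))) *. g"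
  using T by simp
 also have "... = g" unfolding z using T by simp
 finally show ?thesis .
qed

end

context ac_fusion begin

lemma hdim_adjunction:
 assumes d: "dual_pair C B D ev co" and O: "A : Ob" "Z : Ob"
 shows "dm (A >< B) Z = dm A (Z >< D)"
proof -
 have O': "B : Ob" "D : Ob" using d by (auto simp: dual_pair_def)
 have e: "ar ev" "src ev = D >< B" "tgt ev = \<bbbI>" and c: "ar co" "src co = \<bbbI>" "tgt co = B >< D"
  using d by (auto simp: dual_pair_def)
 let ?T = "%f. curry_arr D B co f A"
 have cl: "?T f : hm A (Z >< D)" if "f : hm (A >< B) Z" for f
  using that O O' c by (simp add: curry_arr_def hom_iff)
 have ucl: "uncurry_arr D B ev g Z : hm (A >< B) Z" if "g : hm A (Z >< D)" for g
  using that O O' e by (simp add: uncurry_arr_def hom_iff)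
 have "?T ` hm (A >< B) Z = hm A (Z >< D)"
 proof (intro equalityI subsetI)
  fix g assume g: "g : hm A (Z >< D)"
  have "g = ?T (uncurry_arr D B ev g Z)"
   by (rule sym, rule curry_uncurry[OF d]) (use g O in "auto simp: hom_iff")
  thus "g : ?T ` hm (A >< B) Z" using ucl[OF g] by (rule image_eqI)
 qed (use cl in auto)
 moreover have "inj_on ?T (hm (A >< B) Z)"
  by (rule inj_on_inverseI[of _ "%g. uncurry_arr D B ev g Z"], rule uncurry_curry[OF d]) (use O in "auto simp: hom_iff")
 moreover have "linear_on K (HomV C (A >< B) Z) (HomV C A (Z >< D)) (hm (A >< B) Z) ?T"
  by (rule linear_on_homI) (use cl O O' c in "auto simp: hom_iff curry_arr_def")
 ultimately show ?thesis unfolding hdim_def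
  using subdim_bij[OF vectorspace_HomV[OF obj_ten[OF O(1) O'(1)] O(2)] fd_hom[OF obj_ten[OF O(1) O'(1)] O(2)]
   vectorspace_HomV[OF O(1) obj_ten[OF O(2) O'(2)]] hom_submodule[OF obj_ten[OF O(1) O'(1)] O(2)], of ?T] by simp
qed

end

section \<open>Tensor products of direct sum decompositions\<close>

lemma (in linear_monoidal_category) finsum_ten_left:
 assumes "finite J" "arr C g" "X : Obj C" "Y : Obj C" "!!j. j : J ==> F j : hom C X Y"
 shows "finsum (HomV C X Y) F J ox g = finsum (HomV C (X >< src g) (Y >< tgt g)) (%j. F j ox g) J"
 using assms
proof (induction J rule: finite_induct)
 interpret v: vectorspace K "HomV C X Y" by (rule vectorspace_HomV) fact+
 interpret w: vectorspace K "HomV C (X >< src g) (Y >< tgt g)" by (rule vectorspace_HomV) (use assms in auto)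
 {
  case empty
  thus ?case by (simp add: HomV_ops)
 next
  case (insert j J)
  have c: "F j : hom C X Y" "F : J \<rightarrow> hom C X Y" "F j ox g : hom C (X >< src g) (Y >< tgt g)"
   "(%j. F j ox g) : J \<rightarrow> hom C (X >< src g) (Y >< tgt g)"
   using insert.prems by (auto simp: hom_iff)
  have s: "finsum (HomV C X Y) F J : hom C X Y" by (rule finsum_hom) (use insert.prems in auto)
  show ?case using insert c s by (simp add: HomV_ops) (simp add: hom_iff)
 }
qed

lemma (in linear_monoidal_category) finsum_ten_right:
 assumes "finite J" "arr C g" "X : Obj C" "Y : Obj C" "!!j. j : J ==> F j : hom C X Y"
 shows "g ox finsum (HomV C X Y) F J = finsum (HomV C (src g >< X) (tgt g >< Y)) (%j. g ox F j) J"
 using assms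
proof (induction J rule: finite_induct)
 interpret v: vectorspace K "HomV C X Y" by (rule vectorspace_HomV) fact+
 interpret w: vectorspace K "HomV C (src g >< X) (tgt g >< Y)" by (rule vectorspace_HomV) (use assms in auto)
 {
  case empty
  thus ?case by (simp add: HomV_ops)
 next
  case (insert j J)
  have c: "F j : hom C X Y" "F : J \<rightarrow> hom C X Y" "g ox F j : hom C (src g >< X) (tgt g >< Y)"
   "(%j. g ox F j) : J \<rightarrow> hom C (src g >< X) (tgt g >< Y)"
   using insert.prems by (auto simp: hom_iff)
  have s: "finsum (HomV C X Y) F J : hom C X Y" by (rule finsum_hom) (use insert.prems in auto)
  show ?case using insert c s by (simp add: HomV_ops) (simp add: hom_iff)
 }
qed

lemma (in abelian_monoid) finsum_Times:
 assumes "finite A" "finite B" "!!a b. a : A ==> b : B ==> f (a, b) : carrier G"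
 shows "finsum G f (A \<times> B) = finsum G (%a. finsum G (%b. f (a, b)) B) A"
 using assms(1,3)
proof (induction A rule: finite_induct)
 case (insert a A)
 have e: "insert a A \<times> B = Pair a ` B \<union> A \<times> B" by auto
 have "finsum G f (insert a A \<times> B) = finsum G f (Pair a ` B) \<oplus> finsum G f (A \<times> B)"
  unfolding e by (rule finsum_Un_disjoint) (use insert assms in auto)
 also have "finsum G f (Pair a ` B) = finsum G (%b. f (a, b)) B"
  by (subst finsum_reindex) (use insert in "auto simp: inj_on_def")
 also have "finsum G f (A \<times> B) = finsum G (%a. finsum G (%b. f (a, b)) B) A"
  using insert by auto
 finally show ?case using insert by (subst finsum_insert) (auto intro!: finsum_closed)
qed simp

context linear_monoidal_category begin

lemma biproduct_ten:
 assumes b: "biproduct C J M X i p" and b2: "biproduct C J' M' X' i' p'"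
 shows "biproduct C (J \<times> J') (%jk. M (fst jk) >< M' (snd jk)) (X >< X')
  (%jk. i (fst jk) ox i' (snd jk)) (%jk. p (fst jk) ox p' (snd jk))"
proof -
 note d = biproductD[OF b] and d' = biproductD[OF b2]
 have O: "X >< X' : Ob" using d d' by simp
 interpret v: vectorspace K "HomV C (X >< X') (X >< X')" by (rule vectorspace_HomV) fact+
 have in1: "i j *. p j : hm X X" if "j : J" for j using d that by (simp add: hom_iff)
 have in2: "i' j *. p' j : hm X' X'" if "j : J'" for j using d' that by (simp add: hom_iff)
 have "ii (X >< X') = finsum (HomV C X X) (%j. i j *. p j) J ox finsum (HomV C X' X') (%j. i' j *. p' j) J'"
  using b b2 by (simp add: biproduct_def)
 also have "... = finsum (HomV C (X >< X') (X >< X')) (%j. (i j *. p j) ox finsum (HomV C X' X') (%j. i' j *. p' j) J') J"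
 proof -
  have s: "finsum (HomV C X' X') (%j. i' j *. p' j) J' : hm X' X'" by (rule finsum_hom) (use d' in2 in auto)
  show ?thesis using finsum_ten_left[OF d(1) _ d(2,2) in1, where g = "finsum (HomV C X' X') (%j. i' j *. p' j) J'"] s by (simp add: hom_iff)
 qed
 also have "... = finsum (HomV C (X >< X') (X >< X')) (%j. finsum (HomV C (X >< X') (X >< X')) (%k. (i j *. p j) ox (i' k *. p' k)) J') J"
 proof (rule v.M.finsum_cong')
  fix j assume j: "j : J"
  show "(i j *. p j) ox finsum (HomV C X' X') (%j. i' j *. p' j) J' = finsum (HomV C (X >< X') (X >< X')) (%k. (i j *. p j) ox (i' k *. p' k)) J'"
   using finsum_ten_right[OF d'(1) _ d'(2,2) in2, where g = "i j *. p j"] in1[OF j] by (simp add: hom_iff)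
 next
  have "finsum (HomV C (X >< X') (X >< X')) (%k. (i j *. p j) ox (i' k *. p' k)) J' : hm (X >< X') (X >< X')" if "j : J" for j
   by (rule finsum_hom) (use O in1[OF that] in2 in "auto simp: hom_iff")
  thus "(%j. finsum (HomV C (X >< X') (X >< X')) (%k. (i j *. p j) ox (i' k *. p' k)) J') : J \<rightarrow> carrier (HomV C (X >< X') (X >< X'))"
   by auto
 qed simp
 also have "... = finsum (HomV C (X >< X') (X >< X')) (%jk. (i (fst jk) *. p (fst jk)) ox (i' (snd jk) *. p' (snd jk))) (J \<times> J')"
  by (subst v.M.finsum_Times) (use d d' in1 in2 in "auto simp: hom_iff")
 also have "... = finsum (HomV C (X >< X') (X >< X')) (%jk. (i (fst jk) ox i' (snd jk)) *. (p (fst jk) ox p' (snd jk))) (J \<times> J')"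
  by (rule v.M.finsum_cong') (use d d' in "auto simp: hom_iff")
 finally have s: "finsum (HomV C (X >< X') (X >< X')) (%jk. (i (fst jk) ox i' (snd jk)) *. (p (fst jk) ox p' (snd jk))) (J \<times> J') = ii (X >< X')" ..
 have o: "(p j ox p' k) *. (i l ox i' m) = (if (j, k) = (l, m) then ii (M j >< M' k) else nl (M l >< M' m) (M j >< M' k))"
  if j: "j : J" "k : J'" "l : J" "m : J'" for j k l m
 proof -
  have "(p j ox p' k) *. (i l ox i' m) = (p j *. i l) ox (p' k *. i' m)" using d d' j by simp
  thus ?thesis using d(9,10,11) d'(9,10,11) j by (cases "j = l"; cases "k = m") auto
 qed
 show ?thesis unfolding biproduct_def
  using s o O d d' by (auto simp: hom_iff)
qed

end

section \<open>Expansion in the simple objects\<close>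

context ac_fusion begin

definition reps where
 "reps I \<longleftrightarrow> finite I & (ALL S:I. smp S) & (ALL S. smp S --> (EX T:I. isom S T)) &
  (ALL S:I. ALL T:I. isom S T --> S = T)"

lemma repsD:
 assumes "reps I"
 shows "finite I" "S : I ==> smp S" "S : I ==> S : Ob"
  "S : I ==> T : I ==> dm S T = (if S = T then 1 else 0)"
 using assms hdim_simple simple_obj iso_refl unfolding reps_def by auto

text \<open>By Schur's lemma the number of summands isomorphic to \<open>T\<close> is
  \<open>dim Hom(T, X)\<close>. Every additive invariant below is reduced to the simple objects in
  this way.\<close>

lemma sum_simples:
 fixes F :: "'c => 'r :: comm_semiring_1"
 assumes I: "reps I" and S: "!!j. j < n ==> smp (S j)" and b: "biproduct C {..<n::nat} S X i p"
  and inv: "!!S T. smp S ==> smp T ==> isom S T ==> F S = F T"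
 shows "(\<Sum>j<n. F (S j)) = (\<Sum>T\<in>I. of_nat (dm T X) * F T)"
proof -
 note r = repsD[OF I]
 have "(\<Sum>T\<in>I. of_nat (dm T X) * F T) = (\<Sum>T\<in>I. \<Sum>j<n. of_nat (dm T (S j)) * F T)"
  by (rule sum.cong) (use hdim_biproduct_right[OF b] r(3) in "auto simp: sum_distrib_right")
 also have "... = (\<Sum>j<n. \<Sum>T\<in>I. of_nat (dm T (S j)) * F T)" by (rule sum.swap)
 also have "... = (\<Sum>j<n. F (S j))"
 proof (rule sum.cong)
  fix j assume "j : {..<n}"
  hence s: "smp (S j)" using S by simp
  then obtain T where T: "T : I" "isom (S j) T" using I unfolding reps_def by blast
  have "of_nat (dm T' (S j)) * F T' = (if T' = T then F (S j) else 0)" if T': "T' : I" for T'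
  proof -
   have "isom T' (S j) \<longleftrightarrow> T' = T"
    using T T' I r(3) s simple_obj iso_sym iso_trans unfolding reps_def by metis
   thus ?thesis using hdim_simple[OF r(2)[OF T'] s] inv[OF s r(2)[OF T(1)] T(2)] by auto
  qed
  hence "(\<Sum>T'\<in>I. of_nat (dm T' (S j)) * F T') = (\<Sum>T'\<in>I. if T' = T then F (S j) else 0)"
   by (intro sum.cong) auto
  thus "(\<Sum>T\<in>I. of_nat (dm T (S j)) * F T) = F (S j)" using r(1) T(1) by simp
 qed simp
 finally show ?thesis by simp
qed

lemma iso_ten_obj:
 assumes "X : Ob" "X' : Ob" "Y : Ob" "Y' : Ob" "isom X X'" "isom Y Y'"
 shows "isom (X >< Y) (X' >< Y')"
proof -
 obtain u v where "isa u" "src u = X" "tgt u = X'" "isa v" "src v = Y" "tgt v = Y'"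
  using assms isomorphic_iff by metis
 hence "isa (u ox v)" "src (u ox v) = X >< Y" "tgt (u ox v) = X' >< Y'" by auto
 thus ?thesis unfolding isomorphic_iff[OF obj_ten[OF assms(1,3)] obj_ten[OF assms(2,4)]] by blast
qed

lemma hdim_ten_expand:
 assumes I: "reps I" and O: "X : Ob" "Y : Ob" "Z : Ob"
 shows "dm Z (X >< Y) = (\<Sum>A\<in>I. \<Sum>B\<in>I. dm A X * dm B Y * dm Z (A >< B))"
proof -
 note r = repsD[OF I]
 have step: "dm Z (X >< Y) = (\<Sum>A\<in>I. dm A X * dm Z (A >< Y))"
  if O: "X : Ob" "Y : Ob" "Z : Ob" for X Y Z
 proof -
  obtain n S i p where S: "!!j. j < n ==> smp (S j)" and b: "biproduct C {..<n::nat} S X i p"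
   by (rule semisimple_biproduct[OF O(1)]) blast
  have bY: "biproduct C {()} (%_. Y) Y (%_. ii Y) (%_. ii Y)"
  proof -
   interpret v: vectorspace K "HomV C Y Y" by (rule vectorspace_HomV) (use O in auto)
   show ?thesis using O by (simp add: biproduct_def hom_iff HomV_ops)
  qed
  have "dm Z (X >< Y) = (\<Sum>jk\<in>{..<n} \<times> {()}. dm Z (S (fst jk) >< Y))"
   by (rule hdim_biproduct_right[OF biproduct_ten[OF b bY] O(3)])
  also have "... = (\<Sum>j<n. dm Z (S j >< Y))"
   by (rule sum.reindex_bij_witness[of _ "%j. (j, ())" fst]) auto
  also have "... = (\<Sum>A\<in>I. of_nat (dm A X) * dm Z (A >< Y))"
   by (rule sum_simples[OF I S b])
    (use O in "auto intro!: hdim_iso_right iso_ten_obj iso_refl obj_ten dest: simple_obj")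
  finally show ?thesis by simp
 qed
 have step': "dm Z (X >< Y) = (\<Sum>B\<in>I. dm B Y * dm Z (X >< B))"
  if O: "X : Ob" "Y : Ob" "Z : Ob" for X Y Z
 proof -
  obtain n S i p where S: "!!j. j < n ==> smp (S j)" and b: "biproduct C {..<n::nat} S Y i p"
   by (rule semisimple_biproduct[OF O(2)]) blast
  have bX: "biproduct C {()} (%_. X) X (%_. ii X) (%_. ii X)"
  proof -
   interpret v: vectorspace K "HomV C X X" by (rule vectorspace_HomV) (use O in auto)
   show ?thesis using O by (simp add: biproduct_def hom_iff HomV_ops)
  qed
  have "dm Z (X >< Y) = (\<Sum>jk\<in>{()} \<times> {..<n}. dm Z (X >< S (snd jk)))"
   by (rule hdim_biproduct_right[OF biproduct_ten[OF bX b] O(3)])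
  also have "... = (\<Sum>j<n. dm Z (X >< S j))"
   by (rule sum.reindex_bij_witness[of _ "%j. ((), j)" snd]) auto
  also have "... = (\<Sum>B\<in>I. of_nat (dm B Y) * dm Z (X >< B))"
   by (rule sum_simples[OF I S b])
    (use O in "auto intro!: hdim_iso_right iso_ten_obj iso_refl obj_ten dest: simple_obj")
  finally show ?thesis by simp
 qed
 have "dm Z (X >< Y) = (\<Sum>A\<in>I. dm A X * (\<Sum>B\<in>I. dm B Y * dm Z (A >< B)))"
  unfolding step[OF O] by (rule sum.cong) (use step' r O in auto)
 thus ?thesis by (simp add: sum_distrib_left mult.assoc)
qed

lemma zero_object_ten: "zero_object C X ==> Y : Ob ==> zero_object C (X >< Y)" "zero_object C X ==> Y : Ob ==> zero_object C (Y >< X)"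
 using ten_ide[of X Y] ten_ide[of Y X] ten_nul_left[of "ii Y" X X] ten_nul_right[of "ii Y" X X]
 by (auto simp: zero_object_iff simp del: ten_ide ten_nul_left ten_nul_right)

text \<open>Both factors are decomposed. A product of two summands is kept in place exactly when
  both summands are, so only the trivial and sign parts survive by \<open>sdim_orbits\<close>, and
  on these the signs multiply.\<close>

lemma sdim_ten:
 assumes I: "reps I" and s: "ar s" "src s = X" "tgt s = X" "s *. s = ii X"
  and t: "ar t" "src t = Y" "tgt t = Y" "t *. t = ii Y" and Z: "Z : Ob"
 shows "sdim K C Z (X >< Y) (s ox t) = (\<Sum>A\<in>I. \<Sum>B\<in>I. sdim K C A X s * sdim K C B Y t * int (dm Z (A >< B)))"
proof -
 note r = repsD[OF I]
 obtain M i p where sp: "involution_split X s M i p" by (rule involution_split_exists[OF s])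
 obtain M' i' p' where sp': "involution_split Y t M' i' p'" by (rule involution_split_exists[OF t])
 have b: "biproduct C {..<4} M X i p" and b2: "biproduct C {..<4} M' Y i' p'"
  using sp sp' by (auto simp: involution_split_def)
 note d = biproductD[OF b] and d' = biproductD[OF b2]
 have MO: "M j : Ob" "M' j : Ob" if "j < 4" for j using d(11)[of j] d'(11)[of j] that by auto
 have c: "sign1 j : carrier K" for j by (simp add: sign1_def)
 have fl: "flip23 j < 4 & flip23 (flip23 j) = j" if "j < 4" for j using that by (auto simp: flip23_def)
 have Mf: "M (flip23 j) = M j" "M' (flip23 j) = M' j" for j using sp sp' by (auto simp: flip23_def involution_split_def)
 have si: "s *. i j = sign1 j |> i (flip23 j)" "t *. i' j = sign1 j |> i' (flip23 j)" if "j < 4" for j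
  using sp sp' that d(3,4)[of "flip23 j"] d'(3,4)[of "flip23 j"] fl[OF that] Mf[of j] c[of j] MO[OF that] by (auto simp: involution_split_def)
 let ?\<pi> = "%jk. (flip23 (fst jk), flip23 (snd jk))"
 let ?t = "%jk. (sign1 (fst jk) \<otimes>\<^sub>K sign1 (snd jk)) |> ii (M (fst jk) >< M' (snd jk))"
 have "sdim K C Z (X >< Y) (s ox t) = (\<Sum>jk\<in>{jk : {..<4} \<times> {..<4}. ?\<pi> jk = jk}. sdim K C Z (M (fst jk) >< M' (snd jk)) (?t jk))"
 proof (rule sdim_orbits[OF biproduct_ten[OF b b2] _ Z])
  show "s ox t : hm (X >< Y) (X >< Y)" using s t by (simp add: hom_iff)
  fix jk :: "nat \<times> nat" assume "jk : {..<4} \<times> {..<4}"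
  then obtain j k where jk: "jk = (j, k)" "j < 4" "k < 4" by auto
  show "?\<pi> jk : {..<4} \<times> {..<4} & ?\<pi> (?\<pi> jk) = jk" using jk fl by auto
  show "?t jk : hm (M (fst jk) >< M' (snd jk)) (M (fst (?\<pi> jk)) >< M' (snd (?\<pi> jk)))"
   using jk Mf MO c by (simp add: hom_iff)
  have a: "ar (i (flip23 j))" "ar (i' (flip23 k))" "src (i (flip23 j)) = M j" "src (i' (flip23 k)) = M' k"
   using d(3,4)[of "flip23 j"] d'(3,4)[of "flip23 k"] fl jk Mf by auto
  have "(s ox t) *. (i j ox i' k) = (s *. i j) ox (t *. i' k)"
   using s t d d' jk by simp
  also have "... = (sign1 j \<otimes>\<^sub>K sign1 k) |> (i (flip23 j) ox i' (flip23 k))"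
   unfolding si(1)[OF jk(2)] si(2)[OF jk(3)] using a c m_comm[OF c c, of k j] by simp
  also have "... = (i (flip23 j) ox i' (flip23 k)) *. ?t (j, k)"
   using a c MO jk by simp
  finally show "(s ox t) *. (i (fst jk) ox i' (snd jk)) = (i (fst (?\<pi> jk)) ox i' (snd (?\<pi> jk))) *. ?t jk"
   using jk by simp
  have q: "sign1 (flip23 j) = sign1 j" for j by (auto simp: sign1_def flip23_def)
  have q2: "sign1 j \<otimes>\<^sub>K sign1 j = \<one>\<^sub>K" for j by (auto simp: sign1_def l_minus r_minus)
  have "(sign1 j \<otimes>\<^sub>K sign1 k) \<otimes>\<^sub>K (sign1 j \<otimes>\<^sub>K sign1 k) = (sign1 j \<otimes>\<^sub>K sign1 j) \<otimes>\<^sub>K (sign1 k \<otimes>\<^sub>K sign1 k)"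
   using c by (simp add: m_ac)
  thus "?t (?\<pi> jk) *. ?t jk = ii (M (fst jk) >< M' (snd jk))"
   using jk c MO Mf q q2 by simp
 qed
 also have "{jk : {..<4::nat} \<times> {..<4::nat}. ?\<pi> jk = jk} = {(0, 0), (0, 1), (1, 0), (1, 1)}"
 proof -
  have "j < 4 & flip23 j = j \<longleftrightarrow> j = 0 \<or> j = 1" for j by (auto simp: flip23_def)
  hence e: "{jk : {..<4::nat} \<times> {..<4::nat}. ?\<pi> jk = jk} = {j. j = 0 \<or> j = 1} \<times> {k. k = 0 \<or> k = 1}"
   unfolding set_eq_iff mem_Collect_eq split_paired_All mem_Sigma_iff lessThan_iff fst_conv snd_conv prod.inject by metis
  have "{j::nat. j = 0 \<or> j = 1} = {0, 1}" by blast
  thus ?thesis unfolding e by simp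
 qed
 also have "(\<Sum>jk\<in>{(0, 0), (0, 1), (1, 0), (1, 1)}. sdim K C Z (M (fst jk) >< M' (snd jk)) (?t jk))
   = int (dm Z (M 0 >< M' 0)) - int (dm Z (M 0 >< M' 1)) - int (dm Z (M 1 >< M' 0)) + int (dm Z (M 1 >< M' 1))"
 proof -
  have z: "\<one>\<^sub>K \<oplus>\<^sub>K \<one>\<^sub>K = \<zero>\<^sub>K ==> zero_object C (M 0 >< M' 1)" "\<one>\<^sub>K \<oplus>\<^sub>K \<one>\<^sub>K = \<zero>\<^sub>K ==> zero_object C (M 1 >< M' 0)"
   using sp sp' zero_object_ten MO[of 0] by (auto simp: involution_split_def)
  have sg: "sign1 0 = \<one>\<^sub>K" "sign1 1 = \<ominus>\<^sub>K \<one>\<^sub>K" by (simp_all add: sign1_def)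
  have "sdim K C Z (M 0 >< M' 0) (?t (0, 0)) = 1 * int (dm Z (M 0 >< M' 0))"
   by (simp only: fst_conv snd_conv, rule sdim_sign) (use sg MO[of 0] Z in simp_all)
  moreover have "sdim K C Z (M 0 >< M' 1) (?t (0, 1)) = (-1) * int (dm Z (M 0 >< M' 1))"
   by (simp only: fst_conv snd_conv, rule sdim_sign) (use sg MO[of 0] MO[of 1] Z z in simp_all)
  moreover have "sdim K C Z (M 1 >< M' 0) (?t (1, 0)) = (-1) * int (dm Z (M 1 >< M' 0))"
   by (simp only: fst_conv snd_conv, rule sdim_sign) (use sg MO[of 0] MO[of 1] Z z in simp_all)
  moreover have "sdim K C Z (M 1 >< M' 1) (?t (1, 1)) = 1 * int (dm Z (M 1 >< M' 1))"
   by (simp only: fst_conv snd_conv, rule sdim_sign) (use sg MO[of 1] Z in "simp_all add: l_minus r_minus")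
  ultimately show ?thesis by simp
 qed
 also have "... = (\<Sum>A\<in>I. \<Sum>B\<in>I. (int (dm A (M 0)) - int (dm A (M 1))) * (int (dm B (M' 0)) - int (dm B (M' 1))) * int (dm Z (A >< B)))"
  using hdim_ten_expand[OF I _ _ Z] MO[of 0] MO[of 1]
  by (simp add: algebra_simps sum.distrib sum_subtractf)
 also have "... = (\<Sum>A\<in>I. \<Sum>B\<in>I. sdim K C A X s * sdim K C B Y t * int (dm Z (A >< B)))"
  by (intro sum.cong refl) (use sdim_involution_split[OF sp s(1,2,3)] sdim_involution_split[OF sp' t(1,2,3)] r in auto)
 finally show ?thesis .
qed

end

section \<open>The second Adams operation\<close>

definition brd :: "('k, 'o, 'm, 'z) braided_cat_scheme => 'o => 'o => 'o * 'm * 'o" where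
 "brd C X Y = (X ><\<^bsub>C\<^esub> Y, Braid C X Y, Y ><\<^bsub>C\<^esub> X)"

text \<open>The braiding of the first two of three factors, bracketed to the right. In terms of it
  most associators disappear from the hexagons.\<close>

definition swap12 :: "('k, 'o, 'm, 'z) braided_cat_scheme => 'o => 'o => 'o => 'o * 'm * 'o" where
 "swap12 C A B R = asc C B A R *.\<^bsub>C\<^esub> (brd C A B ox\<^bsub>C\<^esub> ide C R) *.\<^bsub>C\<^esub> inv_arr C (asc C A B R)"

lemma brd_src_tgt [simp]: "src (brd C X Y) = X ><\<^bsub>C\<^esub> Y" "tgt (brd C X Y) = Y ><\<^bsub>C\<^esub> X"
 "src (swap12 C A B R) = A ><\<^bsub>C\<^esub> (B ><\<^bsub>C\<^esub> R)" "tgt (swap12 C A B R) = B ><\<^bsub>C\<^esub> (A ><\<^bsub>C\<^esub> R)"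
 by (simp_all add: brd_def swap12_def)

locale ac_symmetric = ac_fusion K C + symmetric_fusion_category K C
 for K :: "('k, 'e) ring_scheme" and C :: "('k, 'o, 'm, 'z) braided_cat_scheme" (structure)
begin

lemma iso_brd [simp]: "X : Ob ==> Y : Ob ==> isa (brd C X Y)"
 using Braid_iso[of X Y] by (auto simp: iso_arr_def brd_def arr_def is_iso_def inverse_arrows_def simp del: arr_obj)

lemma brd_brd [simp]: "X : Ob ==> Y : Ob ==> brd C Y X *. brd C X Y = ii (X >< Y)"
 using symmetric[of X Y] by (simp add: brd_def cmp_def ide_def)

lemma brd_nat:
 assumes "ar f" "ar g" "src f = X" "src g = Y" "tgt f = X'" "tgt g = Y'"
 shows "brd C X' Y' *. (f ox g) = (g ox f) *. brd C X Y"
 using Braid_natural[of "src f" "tgt f" "src g" "tgt g" "mor f" "mor g"] assms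
 by (intro arrow_eqI) (auto simp: arr_def ten_def brd_def cmp_def simp del: arr_obj)

lemma arr_swap12 [simp]: "A : Ob ==> B : Ob ==> R : Ob ==> ar (swap12 C A B R)"
 by (simp add: swap12_def)

lemma swap12_swap12:
 assumes "A : Ob" "B : Ob" "R : Ob"
 shows "swap12 C B A R *. swap12 C A B R = ii (A >< (B >< R))"
 using assms by (simp add: swap12_def)

lemma hexagon1_arr:
 assumes O: "X : Ob" "Y : Ob" "Z : Ob"
 shows "az Y Z X *. brd C X (Y >< Z) = (ii Y ox brd C X Z) *. swap12 C X Y Z"
proof -
 have "(az Y Z X *. brd C X (Y >< Z)) *. az X Y Z = ((ii Y ox brd C X Z) *. az Y X Z) *. (brd C X Y ox ii Z)"
  using hexagon1[OF O] by (intro arrow_eqI) (auto simp: ten_def asc_def brd_def cmp_def ide_def)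
 hence "(az Y Z X *. brd C X (Y >< Z)) *. az X Y Z *. iv (az X Y Z)
  = (ii Y ox brd C X Z) *. az Y X Z *. (brd C X Y ox ii Z) *. iv (az X Y Z)"
  using O cmp_assoc[of "az Y Z X *. brd C X (Y >< Z)" "az X Y Z" "iv (az X Y Z)", symmetric]
  by (simp del: cmp_inv)
 thus ?thesis using O by (simp add: swap12_def)
qed

lemma hexagon2_arr:
 assumes O: "X : Ob" "Y : Ob" "Z : Ob"
 shows "brd C (X >< Y) Z = swap12 C X Z Y *. (ii X ox brd C Y Z) *. az X Y Z"
proof -
 have "(iv (az Z X Y) *. brd C (X >< Y) Z) *. iv (az X Y Z)
   = ((brd C X Z ox ii Y) *. iv (az X Z Y)) *. (ii X ox brd C Y Z)"
  using hexagon2[OF O] by (intro arrow_eqI) (auto simp: ten_def asc_def brd_def cmp_def ide_def inv_arr_def)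
 hence "az Z X Y *. ((iv (az Z X Y) *. brd C (X >< Y) Z) *. iv (az X Y Z)) *. az X Y Z
   = az Z X Y *. (((brd C X Z ox ii Y) *. iv (az X Z Y)) *. (ii X ox brd C Y Z)) *. az X Y Z" by simp
 thus ?thesis using O by (simp add: swap12_def)
qed

text \<open>Compatibility of the swap with one more factor on the right: a pentagon on either side
  of a naturality square of the associator.\<close>

lemma swap12_ten:
 assumes O: "A : Ob" "B : Ob" "R : Ob" "Q : Ob"
 shows "(ii B ox az A R Q) *. az B (A >< R) Q *. (swap12 C A B R ox ii Q)
  = swap12 C A B (R >< Q) *. (ii A ox az B R Q) *. az A (B >< R) Q"
proof (rule iso_cancel_right[of "az A B R ox ii Q"])
 have "((ii B ox az A R Q) *. az B (A >< R) Q *. (swap12 C A B R ox ii Q)) *. (az A B R ox ii Q)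
   = ((ii B ox az A R Q) *. az B (A >< R) Q *. (az B A R ox ii Q)) *. ((brd C A B ox ii R) ox ii Q)"
  using O by (simp add: swap12_def)
 also have "... = az B A (R >< Q) *. az (B >< A) R Q *. ((brd C A B ox ii R) ox ii Q)"
  unfolding pentagon_arr[OF O(2,1,3,4), symmetric] using O by simp
 also have "az (B >< A) R Q *. ((brd C A B ox ii R) ox ii Q) = (brd C A B ox (ii R ox ii Q)) *. az (A >< B) R Q"
  by (rule asc_nat) (use O in simp_all)
 finally have 1: "((ii B ox az A R Q) *. az B (A >< R) Q *. (swap12 C A B R ox ii Q)) *. (az A B R ox ii Q)
  = az B A (R >< Q) *. (brd C A B ox (ii R ox ii Q)) *. az (A >< B) R Q" .
 have "(swap12 C A B (R >< Q) *. (ii A ox az B R Q) *. az A (B >< R) Q) *. (az A B R ox ii Q)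
   = swap12 C A B (R >< Q) *. ((ii A ox az B R Q) *. az A (B >< R) Q *. (az A B R ox ii Q))"
  using O by simp
 also have "... = swap12 C A B (R >< Q) *. az A B (R >< Q) *. az (A >< B) R Q"
  unfolding pentagon_arr[OF O, symmetric] ..
 also have "... = az B A (R >< Q) *. (brd C A B ox (ii R ox ii Q)) *. az (A >< B) R Q"
  using O by (simp add: swap12_def)
 finally show "((ii B ox az A R Q) *. az B (A >< R) Q *. (swap12 C A B R ox ii Q)) *. (az A B R ox ii Q)
  = (swap12 C A B (R >< Q) *. (ii A ox az B R Q) *. az A (B >< R) Q) *. (az A B R ox ii Q)"
  unfolding 1 ..
qed (use O in simp_all)

text \<open>The two hexagons break the braiding of \<open>X \<otimes> Y\<close> with itself into
  four elementary exchanges, in the order \<open>Y\<close> with \<open>X\<close>, \<open>X\<close>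
  with \<open>X\<close>, \<open>Y\<close> with \<open>Y\<close>, \<open>X\<close> with
  \<open>Y\<close>.\<close>

lemma braid_square:
 assumes O: "X : Ob" "Y : Ob"
 shows "az X Y (X >< Y) *. brd C (X >< Y) (X >< Y)
  = (ii X ox swap12 C X Y Y) *. (ii X ox (ii X ox brd C Y Y)) *. swap12 C X X (Y >< Y) *. (ii X ox swap12 C Y X Y) *. az X Y (X >< Y)"
proof -
 let ?P = "X >< Y"
 have PO: "?P : Ob" using O by simp
 note T = O PO
 have s: "swap12 C ?P X Y = az X ?P Y *. ((swap12 C X X Y *. (ii X ox brd C Y X) *. az X Y X) ox ii Y) *. iv (az ?P X Y)"
  unfolding swap12_def[of C ?P] hexagon2_arr[OF O(1,2,1)] ..
 have 1: "(ii X ox az X Y Y) *. az X ?P Y *. (swap12 C X X Y ox ii Y)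
   = swap12 C X X (Y >< Y) *. (ii X ox az X Y Y) *. az X ?P Y"
  by (rule swap12_ten) (use T in auto)
 have 2: "az X ?P Y *. ((ii X ox brd C Y X) ox ii Y) = (ii X ox (brd C Y X ox ii Y)) *. az X (Y >< X) Y"
  by (rule asc_nat) (use T in simp_all)
 have 3: "az X (Y >< X) Y *. (az X Y X ox ii Y) *. iv (az ?P X Y) = (ii X ox iv (az Y X Y)) *. az X Y ?P"
 proof (rule iso_cancel_left[of "ii X ox az Y X Y"])
  have "(ii X ox az Y X Y) *. az X (Y >< X) Y *. (az X Y X ox ii Y) *. iv (az ?P X Y)
   = ((ii X ox az Y X Y) *. az X (Y >< X) Y *. (az X Y X ox ii Y)) *. iv (az ?P X Y)"
   using T by simp
  also have "... = az X Y ?P" unfolding pentagon_arr[OF O(1,2,1,2), symmetric] using T by simp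
  finally show "(ii X ox az Y X Y) *. az X (Y >< X) Y *. (az X Y X ox ii Y) *. iv (az ?P X Y)
   = (ii X ox az Y X Y) *. (ii X ox iv (az Y X Y)) *. az X Y ?P"
   using T by simp
 qed (use T in simp_all)
 let ?s = "swap12 C X X Y ox ii Y" and ?b = "(ii X ox brd C Y X) ox ii Y" and ?a = "az X Y X ox ii Y"
  and ?i = "iv (az ?P X Y)"
 have "az X Y ?P *. brd C ?P ?P = (ii X ox brd C ?P Y) *. swap12 C ?P X Y"
  by (rule hexagon1_arr) (use T in auto)
 also have "... = (ii X ox swap12 C X Y Y) *. (ii X ox (ii X ox brd C Y Y)) *. ((ii X ox az X Y Y) *. az X ?P Y *. ?s) *. ?b *. ?a *. ?i"
  unfolding s hexagon2_arr[OF O(1,2,2)] using T by simp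
 also have "... = (ii X ox swap12 C X Y Y) *. (ii X ox (ii X ox brd C Y Y)) *. swap12 C X X (Y >< Y) *. (ii X ox az X Y Y) *. az X ?P Y *. ?b *. ?a *. ?i"
  unfolding 1 using T by (simp del: ten_cmp ten_cmp_tail ten_ide)
 also have "az X ?P Y *. ?b *. ?a *. ?i = (ii X ox (brd C Y X ox ii Y)) *. az X (Y >< X) Y *. ?a *. ?i"
  by (subst cmp_tail[OF 2]) (use T in "simp_all del: ten_cmp ten_cmp_tail ten_ide")
 also have "... = (ii X ox (brd C Y X ox ii Y)) *. (ii X ox iv (az Y X Y)) *. az X Y ?P"
  unfolding 3 ..
 also have "(ii X ox az X Y Y) *. (ii X ox (brd C Y X ox ii Y)) *. (ii X ox iv (az Y X Y)) *. az X Y ?P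
  = (ii X ox swap12 C Y X Y) *. az X Y ?P"
  using T by (simp add: swap12_def)
 finally show ?thesis .
qed

text \<open>Conjugation by the exchange of the two middle factors. In \<open>braid_square\<close>
  the first and the last exchange are inverse to each other because the braiding is symmetric; this
  is what makes the Adams operation multiplicative.\<close>

lemma braid_interchange:
 assumes O: "X : Ob" "Y : Ob"
 obtains u where "isa u" "src u = (X >< X) >< (Y >< Y)" "tgt u = (X >< Y) >< (X >< Y)"
  "u *. (brd C X X ox brd C Y Y) = brd C (X >< Y) (X >< Y) *. u"
proof -
 let ?P = "X >< Y"
 have T: "X : Ob" "Y : Ob" "?P : Ob" using O by simp_all
 define u where "u = iv (az X Y ?P) *. (ii X ox swap12 C X Y Y) *. az X X (Y >< Y)"
 have isw: "isa (swap12 C A B R)" if "A : Ob" "B : Ob" "R : Ob" for A B R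
  using that by (simp add: swap12_def)
 have iu: "isa u" "src u = (X >< X) >< (Y >< Y)" "tgt u = ?P >< ?P"
  using T isw by (simp_all add: u_def)
 let ?c = "brd C X X ox brd C Y Y"
 have 1: "az X X (Y >< Y) *. ?c = (ii X ox (ii X ox brd C Y Y)) *. swap12 C X X (Y >< Y) *. az X X (Y >< Y)"
 proof -
  have "az X X (Y >< Y) *. ?c = az X X (Y >< Y) *. ((ii X ox ii X) ox brd C Y Y) *. (brd C X X ox ii (Y >< Y))"
   using T by simp
  also have "... = (ii X ox (ii X ox brd C Y Y)) *. az X X (Y >< Y) *. (brd C X X ox ii (Y >< Y))"
   by (subst cmp_tail[OF asc_nat[of "ii X" "ii X" "brd C Y Y" X X "Y >< Y" X X "Y >< Y"]]) (use T in "simp_all del: ten_ide ten_cmp ten_cmp_tail")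
  also have "az X X (Y >< Y) *. (brd C X X ox ii (Y >< Y)) = swap12 C X X (Y >< Y) *. az X X (Y >< Y)"
   using T by (simp add: swap12_def)
  finally show ?thesis .
 qed
 have inv: "(ii X ox swap12 C Y X Y) *. (ii X ox swap12 C X Y Y) = ii (X >< (X >< (Y >< Y)))"
  using T swap12_swap12[of X Y Y] by simp
 have "brd C ?P ?P *. u = iv (az X Y ?P) *. (az X Y ?P *. brd C ?P ?P) *. u"
  using T iu by simp
 also have "... = iv (az X Y ?P) *. (ii X ox swap12 C X Y Y) *. (ii X ox (ii X ox brd C Y Y)) *. swap12 C X X (Y >< Y) *.
   (ii X ox swap12 C Y X Y) *. az X Y ?P *. u"
  unfolding braid_square[OF O] using T iu by (simp del: ten_cmp ten_cmp_tail ten_ide)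
 also have "az X Y ?P *. u = (ii X ox swap12 C X Y Y) *. az X X (Y >< Y)"
  unfolding u_def using T isw by simp
 also have "(ii X ox swap12 C Y X Y) *. (ii X ox swap12 C X Y Y) *. az X X (Y >< Y) = az X X (Y >< Y)"
  by (subst cmp_tail[OF inv]) (use T in simp_all)
 also have "(ii X ox (ii X ox brd C Y Y)) *. swap12 C X X (Y >< Y) *. az X X (Y >< Y) = az X X (Y >< Y) *. ?c"
  unfolding 1 ..
 also have "iv (az X Y ?P) *. (ii X ox swap12 C X Y Y) *. az X X (Y >< Y) *. ?c = u *. ?c"
  unfolding u_def using T by (simp del: ten_cmp ten_cmp_tail ten_ide)
 finally show ?thesis using that[OF iu] by simp
qed

text \<open>The coefficient of \<open>Z\<close> in the second Adams operation on \<open>X\<close>.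
  Outside characteristic 2 it is, for simple \<open>Z\<close>, the multiplicity in the symmetric
  square minus that in the exterior square.\<close>

definition adams :: "'o => 'o => int" where
 "adams X Z = sdim K C Z (X >< X) (brd C X X)"

lemma adams_iso:
 assumes "X : Ob" "Y : Ob" "isom X Y" "Z : Ob"
 shows "adams X Z = adams Y Z"
proof -
 obtain v where v: "isa v" "src v = X" "tgt v = Y" using assms isomorphic_iff by metis
 show ?thesis unfolding adams_def
  by (rule sdim_conj[of "v ox v"]) (use v assms brd_nat[of v v X X Y Y] in "auto simp: hom_iff")
qed

text \<open>For \<open>j ~= k\<close> the braiding exchanges \<open>M j \<otimes> M k\<close> with
  \<open>M k \<otimes> M j\<close>, so these terms cancel; additivity holds although the tensor
  square is quadratic.\<close>

lemma adams_biproduct: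
 assumes b: "biproduct C J M X i p" and Z: "Z : Ob"
 shows "adams X Z = (\<Sum>j\<in>J. adams (M j) Z)"
proof -
 note d = biproductD[OF b]
 let ?\<pi> = "%jk. (snd jk, fst jk)"
 have "adams X Z = (\<Sum>jk\<in>{jk : J \<times> J. ?\<pi> jk = jk}. sdim K C Z (M (fst jk) >< M (snd jk)) (brd C (M (fst jk)) (M (snd jk))))"
  unfolding adams_def
 proof (rule sdim_orbits[OF biproduct_ten[OF b b] _ Z])
  fix jk assume jk: "jk : J \<times> J"
  thus "?\<pi> jk : J \<times> J & ?\<pi> (?\<pi> jk) = jk" by auto
  have j: "fst jk : J" "snd jk : J" using jk by auto
  show "brd C X X *. (i (fst jk) ox i (snd jk)) = (i (fst (?\<pi> jk)) ox i (snd (?\<pi> jk))) *. brd C (M (fst jk)) (M (snd jk))"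
   using brd_nat[of "i (fst jk)" "i (snd jk)" "M (fst jk)" "M (snd jk)" X X] d(3,4,5)[OF j(1)] d(3,4,5)[OF j(2)] by simp
  show "brd C (M (fst jk)) (M (snd jk)) : hm (M (fst jk) >< M (snd jk)) (M (fst (?\<pi> jk)) >< M (snd (?\<pi> jk)))"
   using d(11)[OF j(1)] d(11)[OF j(2)] by (simp add: hom_iff)
  show "brd C (M (fst (?\<pi> jk))) (M (snd (?\<pi> jk))) *. brd C (M (fst jk)) (M (snd jk)) = ii (M (fst jk) >< M (snd jk))"
   using d(11)[OF j(1)] d(11)[OF j(2)] by simp
 qed (use d in "auto simp: hom_iff")
 also have "... = (\<Sum>j\<in>J. adams (M j) Z)"
  unfolding adams_def by (rule sum.reindex_bij_witness[of _ "%j. (j, j)" fst]) auto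
 finally show ?thesis .
qed

text \<open>By additivity the left side is the operation on \<open>X \<otimes> Y\<close>. There the
  braiding is conjugate to the tensor product of the braidings of \<open>X\<close> and of
  \<open>Y\<close> with themselves, to which \<open>sdim_ten\<close> applies.\<close>

lemma adams_mult:
 assumes I: "reps I" and O: "X : Ob" "Y : Ob" "Z : Ob"
 shows "(\<Sum>T\<in>I. int (dm T (X >< Y)) * adams T Z) = (\<Sum>A\<in>I. \<Sum>B\<in>I. adams X A * adams Y B * int (dm Z (A >< B)))"
proof -
 obtain n S i p where S: "!!j. j < n ==> smp (S j)" and b: "biproduct C {..<n::nat} S (X >< Y) i p"
  by (rule semisimple_biproduct[OF obj_ten[OF O(1,2)]]) blast
 have "(\<Sum>T\<in>I. int (dm T (X >< Y)) * adams T Z) = (\<Sum>j<n. adams (S j) Z)"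
  using sum_simples[OF I S b, of "%T. adams T Z"] adams_iso simple_obj O by simp
 also have "... = adams (X >< Y) Z" by (rule adams_biproduct[OF b O(3), symmetric])
 also have "... = sdim K C Z ((X >< X) >< (Y >< Y)) (brd C X X ox brd C Y Y)"
 proof -
  obtain u where u: "isa u" "src u = (X >< X) >< (Y >< Y)" "tgt u = (X >< Y) >< (X >< Y)"
   "u *. (brd C X X ox brd C Y Y) = brd C (X >< Y) (X >< Y) *. u"
   by (rule braid_interchange[OF O(1,2)])
  show ?thesis unfolding adams_def
   by (rule sym, rule sdim_conj[OF u(1,2,3) _ _ u(4) O(3)]) (use O in "auto simp: hom_iff")
 qed
 also have "... = (\<Sum>A\<in>I. \<Sum>B\<in>I. adams X A * adams Y B * int (dm Z (A >< B)))"
  unfolding adams_def by (rule sdim_ten[OF I]) (use O in auto)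
 finally show ?thesis .
qed

text \<open>The only information used about single coefficients: a coefficient vanishes with the
  multiplicity, and it is 1 or -1 when the multiplicity is 1.\<close>

lemma adams_bound:
 assumes O: "X : Ob" "Z : Ob"
 shows "\<bar>adams X Z\<bar> <= int (dm Z (X >< X))" "odd (adams X Z) \<longleftrightarrow> odd (dm Z (X >< X))"
proof -
 have "sd (HomV C Z (X >< X)) {f : hm Z (X >< X). brd C X X *. f = f} <= dm Z (X >< X)"
  unfolding hdim_def
  by (rule subdim_mono[OF vectorspace_HomV fd_hom fixed_submodule hom_submodule]) (use O in "auto simp: hom_iff")
 thus "\<bar>adams X Z\<bar> <= int (dm Z (X >< X))" "odd (adams X Z) \<longleftrightarrow> odd (dm Z (X >< X))"
  by (auto simp: adams_def sdim_def)
qed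

end

section \<open>Fusion rules\<close>

context ac_fusion begin

lemma End_unit_scalar:
 assumes "ar f" "src f = \<bbbI>" "tgt f = \<bbbI>"
 shows "EX c:carrier K. f = c |> ii \<bbbI>"
proof -
 have "mor f : carrier (End_algebra C \<bbbI>)" using assms by (simp add: End_algebra_def arr_def del: arr_obj)
 hence "mor f : (%c. c \<odot>\<^bsub>Hom C \<bbbI> \<bbbI>\<^esub> Id C \<bbbI>) ` carrier K"
  using End_Unit by (auto simp: ring_iso_def bij_betw_def)
 then obtain c where c: "c : carrier K" "mor f = c \<odot>\<^bsub>Hom C \<bbbI> \<bbbI>\<^esub> Id C \<bbbI>" by blast
 have "f = (\<bbbI>, mor f, \<bbbI>)" using assms arrow_triple[of f] by simp
 hence "f = c |> ii \<bbbI>" using c by (simp add: scale_arr_def ide_def HomV_simps)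
 thus ?thesis using c by blast
qed

lemma unit_nonzero: "\<not> zero_object C \<bbbI>"
proof
 assume "zero_object C \<bbbI>"
 hence z: "Id C \<bbbI> = \<zero>\<^bsub>Hom C \<bbbI> \<bbbI>\<^esub>" using Id_closed[of \<bbbI>] Unit_closed by (auto simp: zero_object_def)
 interpret m: module K "Hom C \<bbbI> \<bbbI>" by (rule Hom_module) (rule Unit_closed)+
 have "inj_on (%c. c \<odot>\<^bsub>Hom C \<bbbI> \<bbbI>\<^esub> Id C \<bbbI>) (carrier K)" using End_Unit by (auto simp: ring_iso_def bij_betw_def)
 hence "\<one>\<^sub>K = \<zero>\<^sub>K" unfolding z by (rule inj_onD) simp_all
 thus False by simp
qed

text \<open>A monomorphism \<open>f\<close> into the unit splits, and with the retraction
  \<open>r\<close> the endomorphism \<open>f r\<close> is a scalar \<open>c\<close>. Then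
  \<open>f = c f\<close>: either \<open>c = 1\<close> and \<open>f\<close> is invertible, or the
  source is a zero object.\<close>

lemma unit_simple: "smp \<bbbI>"
 unfolding simple_object_def
proof (intro conjI ballI allI impI unit_nonzero)
 show U: "\<bbbI> : Ob" by simp
 fix A i assume A: "A : Ob" and m: "monic C A \<bbbI> i"
 define f where "f = (A, i, \<bbbI>)"
 have f: "ar f" "src f = A" "tgt f = \<bbbI>" and mf: "!!g h. ar g ==> ar h ==> src g = src h ==> tgt g = A ==> tgt h = A ==> f *. g = f *. h ==> g = h"
  using m monic_iff[OF A U] by (auto simp: f_def)
 obtain r where r: "ar r" "src r = \<bbbI>" "tgt r = A" "r *. f = ii A"
 proof (rule mono_split[OF f])
  fix g assume g: "ar g" "tgt g = A" "f *. g = nl (src g) \<bbbI>"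
  show "g = nl (src g) A" by (rule mf) (use g f A in simp_all)
 qed
 obtain c where c: "c : carrier K" "f *. r = c |> ii \<bbbI>"
  using End_unit_scalar[of "f *. r"] f r by auto
 have fc: "f = c |> f"
 proof -
  have "f = (f *. r) *. f" using f r by simp
  thus ?thesis unfolding c(2) using f c U by simp
 qed
 show "zero_object C A \<or> is_iso C A \<bbbI> i"
 proof (cases "c = \<one>\<^sub>K")
  case True
  hence "f *. r = ii \<bbbI>" using c U by simp
  hence "isa f" by (intro iso_arrI(1)[of f r]) (use f r in simp_all)
  thus ?thesis by (simp add: iso_arr_def f_def)
 next
  case False
  have rf: "ii A = c |> ii A"
  proof -
   have "ii A = r *. (c |> f)" using r(4) fc by simp
   also have "... = c |> (r *. f)" using f r c by simp
   finally show ?thesis unfolding r(4) .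
  qed
  interpret v: vectorspace K "HomV C A A" by (rule vectorspace_HomV) (use A in auto)
  have h: "ii A : carrier (HomV C A A)" using A by (simp add: hom_iff)
  have "c \<odot>\<^bsub>HomV C A A\<^esub> ii A = \<one>\<^sub>K \<odot>\<^bsub>HomV C A A\<^esub> ii A"
   using rf h HomV_ops(2)[of "ii A" A A c] c A by simp
  hence "ii A = \<zero>\<^bsub>HomV C A A\<^esub>"
  proof -
   assume e: "c \<odot>\<^bsub>HomV C A A\<^esub> ii A = \<one>\<^sub>K \<odot>\<^bsub>HomV C A A\<^esub> ii A"
   define w where "w = ii A"
   have w: "w : carrier (HomV C A A)" "c \<odot>\<^bsub>HomV C A A\<^esub> w = \<one>\<^sub>K \<odot>\<^bsub>HomV C A A\<^esub> w" using h e by (simp_all add: w_def)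
   have cm: "c \<ominus>\<^bsub>K\<^esub> \<one>\<^sub>K : carrier K" using c by simp
   have nz: "c \<ominus>\<^bsub>K\<^esub> \<one>\<^sub>K ~= \<zero>\<^sub>K" using False c by (simp add: r_right_minus_eq)
   have "(c \<ominus>\<^bsub>K\<^esub> \<one>\<^sub>K) \<odot>\<^bsub>HomV C A A\<^esub> w = c \<odot>\<^bsub>HomV C A A\<^esub> w \<oplus>\<^bsub>HomV C A A\<^esub> (\<ominus>\<^sub>K \<one>\<^sub>K) \<odot>\<^bsub>HomV C A A\<^esub> w"
    unfolding a_minus_def using w(1) c by (simp add: v.smult_l_distr)
   also have "... = w \<oplus>\<^bsub>HomV C A A\<^esub> \<ominus>\<^bsub>HomV C A A\<^esub> w" unfolding w(2) using w(1) by (simp add: v.smult_minus_1 v.smult_one)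
   also have "... = \<zero>\<^bsub>HomV C A A\<^esub>" using w(1) by (simp add: v.M.r_neg)
   finally have z: "(c \<ominus>\<^bsub>K\<^esub> \<one>\<^sub>K) \<odot>\<^bsub>HomV C A A\<^esub> w = \<zero>\<^bsub>HomV C A A\<^esub>" .
   have u: "c \<ominus>\<^bsub>K\<^esub> \<one>\<^sub>K : Units K" using cm nz field_Units by blast
   have "w = (inv\<^bsub>K\<^esub> (c \<ominus>\<^bsub>K\<^esub> \<one>\<^sub>K) \<otimes>\<^sub>K (c \<ominus>\<^bsub>K\<^esub> \<one>\<^sub>K)) \<odot>\<^bsub>HomV C A A\<^esub> w" using w(1) Units_l_inv[OF u] by (simp add: v.smult_one)
   also have "... = inv\<^bsub>K\<^esub> (c \<ominus>\<^bsub>K\<^esub> \<one>\<^sub>K) \<odot>\<^bsub>HomV C A A\<^esub> ((c \<ominus>\<^bsub>K\<^esub> \<one>\<^sub>K) \<odot>\<^bsub>HomV C A A\<^esub> w)"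
    by (rule v.smult_assoc1) (use w(1) cm Units_inv_closed[OF u] in auto)
   also have "... = \<zero>\<^bsub>HomV C A A\<^esub>" unfolding z using Units_inv_closed[OF u] by (simp add: v.smult_r_null)
   finally show ?thesis by (simp add: w_def)
  qed
  hence "ii A = nl A A" using A by (simp add: HomV_ops(3))
  thus ?thesis using A zero_object_iff by blast
 qed
qed

lemma isomorphicI: "isa f ==> src f = X ==> tgt f = Y ==> isom X Y"
 by (auto simp: isomorphic_def iso_arr_def)

text \<open>Summing the constant 1 over the simple summands of \<open>D\<close> counts them. There
  is exactly one, and it is isomorphic to \<open>T\<close>.\<close>

lemma iso_of_hdim:
 assumes I: "reps I" and T: "T : I" and D: "D : Ob" and h: "!!A. A : I ==> dm A D = (if A = T then 1 else 0)"
 shows "isom T D"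
proof -
 note r = repsD[OF I]
 obtain n S i p where S: "!!j. j < n ==> smp (S j)" and b: "biproduct C {..<n::nat} S D i p"
  by (rule semisimple_biproduct[OF D]) blast
 have "(\<Sum>j<n. 1::nat) = (\<Sum>A\<in>I. of_nat (dm A D) * 1)"
  by (rule sum_simples[OF I S b]) auto
 also have "... = (\<Sum>A\<in>I. if A = T then 1 else 0)" by (rule sum.cong) (use h in auto)
 finally have n: "n = 1" using r(1) T by simp
 have J: "{..<1::nat} = {0}" by auto
 note b' = b[unfolded n J] and d = biproductD[OF b[unfolded n J]]
 have S0: "smp (S 0)" using S n by simp
 interpret v: vectorspace K "HomV C D D" by (rule vectorspace_HomV) (use D in auto)
 have "finsum (HomV C D D) (%j. i j *. p j) {0} = i 0 *. p 0"
  using v.M.finsum_insert[of "{}" 0 "%j. i j *. p j"] d by (simp add: hom_iff)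
 hence ip: "i 0 *. p 0 = ii D" using b' by (simp add: biproduct_def)
 have "isa (i 0)" by (rule iso_arrI(1)[of _ "p 0"]) (use d ip b' in "simp_all add: biproduct_def")
 hence i: "isom (S 0) D" by (rule isomorphicI) (use d(4,5)[of 0] in simp_all)
 have "dm T (S 0) = dm T D" by (rule hdim_iso_right[OF r(3)[OF T] simple_obj[OF S0] D i])
 also have "... = 1" unfolding h[OF T] by simp
 finally have "(if isom T (S 0) then 1 else 0) = (1::nat)" unfolding hdim_simple[OF r(2)[OF T] S0] .
 hence "isom T (S 0)" by presburger
 thus ?thesis by (rule iso_trans[OF r(3)[OF T] simple_obj[OF S0] D _ i])
qed

lemma iso_lun_obj: "X : Ob ==> isom (\<bbbI> >< X) X"
 by (rule isomorphicI[OF iso_lun]) auto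

lemma iso_run_obj: "X : Ob ==> isom (X >< \<bbbI>) X"
 by (rule isomorphicI[OF iso_run]) auto

lemma iso_asc_obj: "X : Ob ==> Y : Ob ==> Z : Ob ==> isom ((X >< Y) >< Z) (X >< (Y >< Z))"
 by (rule isomorphicI[OF iso_asc]) auto

lemma hdim_left_dual:
 assumes "is_left_dual C B D" "A : Ob" "Z : Ob"
 shows "dm (A >< B) Z = dm A (Z >< D)"
 by (rule left_dual_pair[OF assms(1)]) (rule hdim_adjunction[OF _ assms(2,3)])

lemma left_dual_exists:
 assumes "B : Ob"
 obtains D where "is_left_dual C B D" "D : Ob"
 using rigid assms that by (auto simp: rigid_def is_left_dual_def)

lemma hdim_ten_assoc:
 assumes I: "reps I" and S: "A : I" "B : I" "D : I" "Z : I"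
 shows "(\<Sum>T\<in>I. dm T (A >< B) * dm Z (T >< D)) = (\<Sum>T\<in>I. dm T (B >< D) * dm Z (A >< T))"
proof -
 note r = repsD[OF I]
 note O = r(3)[OF S(1)] r(3)[OF S(2)] r(3)[OF S(3)] r(3)[OF S(4)]
 have "dm Z ((A >< B) >< D) = dm Z (A >< (B >< D))"
  by (rule hdim_iso_right[OF _ _ _ iso_asc_obj]) (use O in auto)
 moreover have "dm Z ((A >< B) >< D) = (\<Sum>T\<in>I. dm T (A >< B) * dm Z (T >< D))"
 proof -
  have "dm Z ((A >< B) >< D) = (\<Sum>T\<in>I. \<Sum>U\<in>I. dm T (A >< B) * dm U D * dm Z (T >< U))"
   by (rule hdim_ten_expand[OF I]) (use O in auto)
  also have "... = (\<Sum>T\<in>I. \<Sum>U\<in>I. if U = D then dm T (A >< B) * dm Z (T >< D) else 0)"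
   by (intro sum.cong refl) (use r(4) S in auto)
  finally show ?thesis using r(1) S by simp
 qed
 moreover have "dm Z (A >< (B >< D)) = (\<Sum>T\<in>I. dm T (B >< D) * dm Z (A >< T))"
 proof -
  have "dm Z (A >< (B >< D)) = (\<Sum>U\<in>I. \<Sum>T\<in>I. dm U A * dm T (B >< D) * dm Z (U >< T))"
   by (rule hdim_ten_expand[OF I]) (use O in auto)
  also have "... = (\<Sum>U\<in>I. if U = A then (\<Sum>T\<in>I. dm T (B >< D) * dm Z (A >< T)) else 0)"
   by (intro sum.cong refl) (use r(4) S in auto)
  finally show ?thesis using r(1) S by simp
 qed
 ultimately show ?thesis by simp
qed

lemma hdim_ten_unit:
 assumes I: "reps I" and S: "B : I" "Z : I"
 shows "dm Z (\<bbbI> >< B) = (if B = Z then 1 else 0)" "dm Z (B >< \<bbbI>) = (if B = Z then 1 else 0)"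
proof -
 note r = repsD[OF I]
 have O: "B : Ob" "Z : Ob" using r S by auto
 have "dm Z (\<bbbI> >< B) = dm Z B" "dm Z (B >< \<bbbI>) = dm Z B"
  by (rule hdim_iso_right[OF _ _ _ iso_lun_obj], use O in auto) (rule hdim_iso_right[OF _ _ _ iso_run_obj], use O in auto)
 thus "dm Z (\<bbbI> >< B) = (if B = Z then 1 else 0)" "dm Z (B >< \<bbbI>) = (if B = Z then 1 else 0)"
  using r(4)[OF S(2,1)] by auto
qed

lemma exists_reps: "EX I. reps I & \<bbbI> : I"
proof -
 define f where "f P = (if P = icl \<bbbI> then \<bbbI> else (SOME S. smp S & icl S = P))" for P
 have f: "smp (f P) & icl (f P) = P" if "P : simple_classes C" for P
 proof (cases "P = icl \<bbbI>")
  case False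
  have "EX S. smp S & icl S = P" using that by (auto simp: simple_classes_def)
  from someI_ex[OF this] False show ?thesis by (simp add: f_def)
 qed (simp add: f_def unit_simple)
 have "reps (f ` simple_classes C)"
  unfolding reps_def
 proof (intro conjI ballI allI impI)
  show "finite (f ` simple_classes C)" using finite_simple_classes by simp
  show "smp S" if "S : f ` simple_classes C" for S using f that by auto
  show "EX T:f ` simple_classes C. isom S T" if S: "smp S" for S
  proof -
   have c: "icl S : simple_classes C" using S by (auto simp: simple_classes_def)
   have "isom S (f (icl S))"
    using f[OF c] iso_class_eq_iff[of S "f (icl S)"] S simple_obj by metis
   thus ?thesis using c by blast
  qed
  show "S = T" if ST: "S : f ` simple_classes C" "T : f ` simple_classes C" "isom S T" for S T
  proof -
   obtain P Q where P: "P : simple_classes C" "S = f P" "Q : simple_classes C" "T = f Q" using ST(1,2) by blast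
   have "icl S = icl T" using iso_class_eq_iff[of S T] ST(3) f[OF P(1)] f[OF P(3)] P simple_obj by metis
   thus ?thesis using f P by metis
  qed
 qed
 moreover have "f (icl \<bbbI>) : f ` simple_classes C" using unit_simple by (auto simp: simple_classes_def)
 hence "\<bbbI> : f ` simple_classes C" by (simp add: f_def)
 ultimately show ?thesis by blast
qed

lemma card_iso_class_image:
 assumes I: "reps I" and P: "!!S T. smp S ==> smp T ==> isom S T ==> P S ==> P T"
 shows "card (icl ` {S. smp S & P S}) = card {S : I. P S}"
proof -
 note r = repsD[OF I]
 have "icl ` {S. smp S & P S} = icl ` {S : I. P S}"
 proof
  show "icl ` {S : I. P S} \<subseteq> icl ` {S. smp S & P S}" using r by auto
  show "icl ` {S. smp S & P S} \<subseteq> icl ` {S : I. P S}"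
  proof
   fix Q assume "Q : icl ` {S. smp S & P S}"
   then obtain S where S: "smp S" "P S" "Q = icl S" by blast
   then obtain T where T: "T : I" "isom S T" using I unfolding reps_def by blast
   have "P T" by (rule P[OF S(1) r(2)[OF T(1)] T(2) S(2)])
   moreover have "Q = icl T" using iso_class_eq_iff[of S T] S T simple_obj r(3) by metis
   ultimately show "Q : icl ` {S : I. P S}" using T by blast
  qed
 qed
 moreover have "inj_on (icl) {S : I. P S}"
  by (rule inj_onI) (use I iso_class_eq_iff r(3) in "auto simp: reps_def")
 ultimately show ?thesis by (simp add: card_image)
qed

end

section \<open>Duality on the simple objects\<close>

context ac_symmetric begin

lemma hdim_ten_comm: "A : Ob ==> B : Ob ==> Z : Ob ==> dm Z (A >< B) = dm Z (B >< A)"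
 by (rule hdim_iso_right[OF _ _ _ isomorphicI[OF iso_brd]]) auto

lemma hdim_unit_ten:
 assumes "is_left_dual C B D" "A : Ob" "B : Ob" "D : Ob"
 shows "dm \<bbbI> (A >< B) = dm A D"
proof -
 have "dm \<bbbI> (A >< B) = dm (A >< B) \<bbbI>" by (rule hdim_sym[OF unit_simple]) (use assms in auto)
 also have "... = dm A (\<bbbI> >< D)" by (rule hdim_left_dual) (use assms in auto)
 also have "... = dm A D" by (rule hdim_iso_right[OF _ _ _ iso_lun_obj]) (use assms in auto)
 finally show ?thesis .
qed

text \<open>The matrix of multiplicities of the unit in \<open>A \<otimes> B\<close> is symmetric by the braiding, and by adjunction its
 square is the identity; hence it is a permutation matrix.\<close>

lemma dual_simple:
 assumes I: "reps I" and B: "B : I"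
 shows "EX B':I. ALL A:I. dm \<bbbI> (A >< B) = (if A = B' then 1 else 0)"
proof -
 note r = repsD[OF I]
 have BO: "B : Ob" using r B by simp
 obtain D where D: "is_left_dual C B D" "D : Ob" by (rule left_dual_exists[OF BO])
 have "1 = dm (\<bbbI> >< B) B"
  using hdim_iso_left[OF _ _ _ iso_lun_obj, of B B] BO r(4)[OF B B] by simp
 also have "... = dm \<bbbI> (B >< D)" by (rule hdim_left_dual[OF D(1)]) (use BO in auto)
 also have "... = (\<Sum>U\<in>I. \<Sum>T\<in>I. dm U B * dm T D * dm \<bbbI> (U >< T))"
  by (rule hdim_ten_expand[OF I]) (use BO D in auto)
 also have "... = (\<Sum>U\<in>I. if U = B then (\<Sum>T\<in>I. dm T D * dm \<bbbI> (B >< T)) else 0)"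
  by (intro sum.cong refl) (use r(4) B in auto)
 also have "... = (\<Sum>T\<in>I. dm T D * dm \<bbbI> (B >< T))" using r(1) B by simp
 also have "... = (\<Sum>T\<in>I. dm \<bbbI> (T >< B) * dm \<bbbI> (T >< B))"
  by (intro sum.cong refl) (use hdim_unit_ten[OF D(1) _ BO D(2)] hdim_ten_comm[of B] BO r(3) in auto)
 finally have "(\<Sum>T\<in>I. dm \<bbbI> (T >< B) * dm \<bbbI> (T >< B)) = 1" ..
 then obtain B' where B': "B' : I" "dm \<bbbI> (B' >< B) * dm \<bbbI> (B' >< B) = 1"
  "!!T. T : I ==> B' ~= T ==> dm \<bbbI> (T >< B) * dm \<bbbI> (T >< B) = 0"
  unfolding sum_eq_1_iff[OF r(1)] by blast
 show ?thesis by (rule bexI[OF _ B'(1)]) (use B' in auto)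
qed

text \<open>Duals are determined only up to isomorphism. This is the induced permutation of the
  chosen representatives, described by multiplicities of the unit so that no dual has to be
  selected.\<close>

definition dl where "dl I B = (THE B'. B' : I & (ALL A:I. dm \<bbbI> (A >< B) = (if A = B' then 1 else 0)))"

lemma dl:
 assumes I: "reps I" and B: "B : I"
 shows "dl I B : I" "A : I ==> dm \<bbbI> (A >< B) = (if A = dl I B then 1 else 0)"
proof -
 obtain B' where B': "B' : I" "ALL A:I. dm \<bbbI> (A >< B) = (if A = B' then 1 else 0)" using dual_simple[OF I B] by blast
 have e: "dl I B = B'" unfolding dl_def
 proof (rule the_equality)
  fix E assume E: "E : I & (ALL A:I. dm \<bbbI> (A >< B) = (if A = E then 1 else 0))"
  have "dm \<bbbI> (B' >< B) = (if B' = E then 1 else 0)" by (rule bspec[OF conjunct2[OF E] B'(1)])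
  moreover have "dm \<bbbI> (B' >< B) = (if B' = B' then 1 else 0)" by (rule bspec[OF B'(2,1)])
  ultimately have "(if B' = E then 1 else 0) = (1::nat)" by presburger
  thus "E = B'" by (simp split: if_splits)
 qed (use B' in blast)
 show "dl I B : I" unfolding e by (rule B'(1))
 show "A : I ==> dm \<bbbI> (A >< B) = (if A = dl I B then 1 else 0)" unfolding e by (rule bspec[OF B'(2)])
qed

lemma dl_eqI:
 assumes I: "reps I" and B: "B : I" and A: "A : I" and h: "dm \<bbbI> (A >< B) ~= 0"
 shows "dl I B = A"
proof (rule ccontr)
 assume "dl I B ~= A"
 hence "dm \<bbbI> (A >< B) = 0" by (subst dl(2)[OF I B A]) auto
 thus False using h by simp
qed

lemma dl_dl:
 assumes I: "reps I" and B: "B : I"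
 shows "dl I (dl I B) = B"
proof -
 note r = repsD[OF I]
 have "dm \<bbbI> (B >< dl I B) = dm \<bbbI> (dl I B >< B)" by (rule hdim_ten_comm) (use r(3) dl(1)[OF I B] B in auto)
 also have "... = 1" using dl(2)[OF I B dl(1)[OF I B]] by simp
 finally show ?thesis by (intro dl_eqI[OF I dl(1)[OF I B] B]) simp
qed

lemma hdim_left_dual_simple:
 assumes I: "reps I" and B: "B : I" and D: "is_left_dual C B D" "D : Ob" and A: "A : I"
 shows "dm A D = (if A = dl I B then 1 else 0)"
 using hdim_unit_ten[OF D(1) _ _ D(2)] dl(2)[OF I B A] repsD(3)[OF I] A B by simp

text \<open>The adjunction for a left dual of \<open>B\<close>; by its multiplicities this dual is
  isomorphic to the representative \<open>dl I B\<close>.\<close>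

lemma frobenius:
 assumes I: "reps I" and S: "A : I" "B : I" "Z : I"
 shows "dm Z (A >< B) = dm A (Z >< dl I B)"
proof -
 note r = repsD[OF I]
 note O = r(3)[OF S(1)] r(3)[OF S(2)] r(3)[OF S(3)]
 obtain D where D: "is_left_dual C B D" "D : Ob" by (rule left_dual_exists[OF O(2)])
 have "dm Z (A >< B) = dm (A >< B) Z" by (rule hdim_sym[OF r(2)[OF S(3)]]) (use O in auto)
 also have "... = dm A (Z >< D)" by (rule hdim_left_dual[OF D(1) O(1,3)])
 also have "... = dm A (Z >< dl I B)"
 proof (rule hdim_iso_right)
  have "isom (dl I B) D" by (rule iso_of_hdim[OF I dl(1)[OF I S(2)] D(2)]) (rule hdim_left_dual_simple[OF I S(2) D])
  thus "isom (Z >< D) (Z >< dl I B)"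
   by (intro iso_ten_obj iso_refl iso_sym[of "dl I B" D]) (use O D dl(1)[OF I S(2)] r(3) in auto)
 qed (use O D dl(1)[OF I S(2)] r(3) in auto)
 finally show ?thesis .
qed

text \<open>Three applications of Frobenius reciprocity, alternating with commutativity, carry all
  three objects to the other side.\<close>

lemma hdim_ten_dl:
 assumes I: "reps I" and S: "A : I" "B : I" "Z : I"
 shows "dm Z (A >< B) = dm (dl I Z) (dl I A >< dl I B)"
proof -
 note d = dl[OF I] dl_dl[OF I]
 have O: "T : Ob" if "T : I" for T using repsD(3)[OF I that] .
 let ?A = "dl I A" and ?B = "dl I B" and ?Z = "dl I Z"
 note D = d(1)[OF S(1)] d(1)[OF S(2)] d(1)[OF S(3)]
 have "dm Z (A >< B) = dm A (Z >< ?B)" by (rule frobenius[OF I S])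
 also have "... = dm A (?B >< Z)" by (rule hdim_ten_comm) (use O S D in auto)
 also have "... = dm ?B (A >< ?Z)" by (rule frobenius[OF I]) (use S D in auto)
 also have "... = dm ?B (?Z >< A)" by (rule hdim_ten_comm) (use O S D in auto)
 also have "... = dm ?Z (?B >< ?A)" by (rule frobenius[OF I]) (use S D in auto)
 also have "... = dm ?Z (?A >< ?B)" by (rule hdim_ten_comm) (use O S D in auto)
 finally show ?thesis .
qed

lemma dl_unit: "reps I ==> \<bbbI> : I ==> dl I \<bbbI> = \<bbbI>"
 by (rule dl_eqI) (use hdim_ten_unit(1)[of I \<bbbI> \<bbbI>] in auto)

lemma self_dual_dl:
 assumes I: "reps I" and S: "smp S" and T: "T : I" "isom S T"
 shows "self_dual C S \<longleftrightarrow> dl I T = T"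
proof -
 note r = repsD[OF I]
 have O: "S : Ob" "T : Ob" using simple_obj[OF S] r(3)[OF T(1)] .
 have "isom S D \<longleftrightarrow> dl I T = T" if D: "is_left_dual C S D" "D : Ob" for D
 proof -
  have h: "dm A D = (if A = dl I T then 1 else 0)" if A: "A : I" for A
  proof -
   have AO: "A : Ob" using r(3) A by simp
   have "dm A D = dm \<bbbI> (A >< S)" by (rule hdim_unit_ten[OF D(1) AO O(1) D(2), symmetric])
   also have "... = dm \<bbbI> (A >< T)" by (rule hdim_iso_right) (use O AO iso_ten_obj iso_refl T in auto)
   finally show ?thesis using dl(2)[OF I T(1) A] by simp
  qed
  have i: "isom (dl I T) D" by (rule iso_of_hdim[OF I dl(1)[OF I T(1)] D(2) h])
  show ?thesis
  proof
   assume "isom S D"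
   hence "isom T D" using iso_trans[of T S D] iso_sym[of S T] T O D by blast
   hence "dm T D = dm T T" using hdim_iso_right[of T T D] O D by simp
   hence 1: "dm T D = 1" using r(4)[OF T(1,1)] by simp
   show "dl I T = T"
   proof (rule ccontr)
    assume "dl I T ~= T"
    hence "dm T D = 0" by (subst h[OF T(1)]) auto
    thus False using 1 by simp
   qed
  next
   assume "dl I T = T"
   thus "isom S D" using i iso_trans[of S T D] T O D by simp
  qed
 qed
 thus ?thesis unfolding self_dual_def
  by (meson left_dual_exists[OF O(1)] is_left_dual_def)
qed

text \<open>The unit is one of the two self-dual simples. The dual of a simple \<open>X\<close> that
  is not self-dual is not self-dual either and differs from \<open>X\<close>, so it is the fourth
  one.\<close>

lemma four_simples:
 assumes r4: "cat_rank C = 4" and sd: "card (icl ` {X. smp X & self_dual C X}) = 2"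
 obtains I Y X X' where "reps I" "I = {\<bbbI>, Y, X, X'}" "distinct [\<bbbI>, Y, X, X']" "dl I Y = Y" "dl I X = X'" "dl I X' = X"
proof -
 obtain I where I: "reps I" "\<bbbI> : I" using exists_reps by blast
 note r = repsD[OF I(1)]
 have sdI: "self_dual C S \<longleftrightarrow> dl I S = S" if "S : I" for S
  by (rule self_dual_dl[OF I(1) r(2)[OF that] that]) (use iso_refl r(3) that in auto)
 have "card (icl ` {S. smp S & True}) = card {S : I. True}" by (rule card_iso_class_image[OF I(1)])
 hence c4: "card I = 4" using r4 by (simp add: cat_rank_def simple_classes_def)
 have "card (icl ` {S. smp S & self_dual C S}) = card {S : I. self_dual C S}"
 proof (rule card_iso_class_image[OF I(1)])
  fix S T assume ST: "smp S" "smp T" "isom S T" "self_dual C S"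
  obtain U where U: "U : I" "isom T U" using I(1) ST(2) unfolding reps_def by blast
  have "isom S U" by (rule iso_trans[of S T U]) (use ST U simple_obj r(3) in auto)
  thus "self_dual C T" using self_dual_dl[OF I(1) ST(1) U(1)] self_dual_dl[OF I(1) ST(2) U] ST(4) by simp
 qed
 moreover have "{S : I. self_dual C S} = {S : I. dl I S = S}" using sdI by auto
 ultimately have c2: "card {S : I. dl I S = S} = 2" using sd by simp
 then obtain U V where UV: "{S : I. dl I S = S} = {U, V}" "U ~= V" by (auto simp: card_2_iff)
 have "\<bbbI> : {U, V}" unfolding UV(1)[symmetric] using dl_unit[OF I] I(2) by simp
 then obtain Y where Y: "{S : I. dl I S = S} = {\<bbbI>, Y}" "Y ~= \<bbbI>" using UV by (metis doubleton_eq_iff insert_iff singletonD)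
 have sub: "{\<bbbI>, Y} \<subseteq> I" using Y(1) by blast
 have "card (I - {\<bbbI>, Y}) = 2" using c4 sub Y(2) r(1) by (simp add: card_Diff_subset)
 then obtain X W where XW: "I - {\<bbbI>, Y} = {X, W}" "X ~= W" by (auto simp: card_2_iff)
 have X: "X : I" "dl I X ~= X" using XW Y by auto
 have "dl I X \<notin> {\<bbbI>, Y}"
 proof
  assume "dl I X : {\<bbbI>, Y}"
  hence "dl I (dl I X) = dl I X" unfolding Y(1)[symmetric] by simp
  thus False using dl_dl[OF I(1) X(1)] X(2) by simp
 qed
 hence W: "dl I X = W" using dl(1)[OF I(1) X(1)] XW X(2) by auto
 show ?thesis
 proof (rule that[OF I(1), of Y X W])
  show "I = {\<bbbI>, Y, X, W}" using XW sub by auto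
  show "distinct [\<bbbI>, Y, X, W]" using XW Y(2) by auto
  show "dl I Y = Y" using Y(1) by auto
  show "dl I X = W" "dl I W = X" using W dl_dl[OF I(1) X(1)] by auto
 qed
qed

end

section \<open>Arithmetic of the fusion rules\<close>

text \<open>\<open>rank4_char a b c d e g p u v\<close>: the values \<open>p, u, v\<close> at \<open>Y, X, X\<^sup>*\<close> of a character of the fusion ring with
 \<open>YY = 1 + aY + b(X + X\<^sup>*)\<close>, \<open>YX = bY + cX + dX\<^sup>*\<close>, \<open>XX\<^sup>* = 1 + cY + e(X + X\<^sup>*)\<close>, \<open>XX = dY + eX + gX\<^sup>*\<close>.\<close>

definition rank4_char :: "int => int => int => int => int => int => complex => complex => complex => bool" where
 "rank4_char a b c d e g p u v \<longleftrightarrow>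
  p * p = 1 + of_int a * p + of_int b * u + of_int b * v &
  p * u = of_int b * p + of_int c * u + of_int d * v &
  p * v = of_int b * p + of_int d * u + of_int c * v &
  u * v = 1 + of_int c * p + of_int e * u + of_int e * v &
  u * u = of_int d * p + of_int e * u + of_int g * v &
  v * v = of_int d * p + of_int g * u + of_int e * v"

lemma monic_cubic_rational:
 fixes x :: real and r s t :: int
 assumes "x ^ 3 + r * x\<^sup>2 + s * x + t = 0" "x : \<rat>"
 shows "x : \<int>"
proof (rule rational_algebraic_int_is_int[OF _ assms(2)])
 let ?p = "[:of_int t, of_int s, of_int r, 1:] :: real poly"
 show "algebraic_int x"
 proof (rule algebraic_int.intros)
  show "lead_coeff ?p = 1" by simp
  show "ALL i. coeff ?p i : \<int>" by (auto simp: coeff_pCons split: nat.splits)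
  show "poly ?p x = 0" using assms(1) by (simp add: algebra_simps power2_eq_square power3_eq_cube)
 qed
qed

context
 fixes a b c d e g m n :: int
 assumes mn: "m = c - d" "n = e - g"
begin

abbreviation (input) "chr == rank4_char a b c d e g"

text \<open>Subtracting equations that duality exchanges leaves multiples of \<open>u - v\<close>,
  which cancels. The last equation makes the square of \<open>u - v\<close> a negative integer:
  characters separating \<open>X\<close> from its dual are imaginary quadratic.\<close>

lemma chr_nonsym:
 assumes c: "chr p u v" and "u ~= v"
 shows "p = of_int m" "u + v = of_int n" "(u - v) * (u - v) = - 2 - 2 * of_int m * of_int m - of_int n * of_int n"
proof -
 have e: "p * u = of_int b * p + of_int c * u + of_int d * v" "p * v = of_int b * p + of_int d * u + of_int c * v"
  "u * v = 1 + of_int c * p + of_int e * u + of_int e * v"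
  "u * u = of_int d * p + of_int e * u + of_int g * v" "v * v = of_int d * p + of_int g * u + of_int e * v"
  using c by (auto simp: rank4_char_def)
 have "(u - v) * (p - of_int m) = (p * u - p * v) - of_int m * (u - v)" by (simp add: algebra_simps)
 also have "... = 0" unfolding e by (simp add: mn algebra_simps)
 finally show p: "p = of_int m" using \<open>u ~= v\<close> by simp
 have "(u - v) * (u + v - of_int n) = (u * u - v * v) - of_int n * (u - v)" by (simp add: algebra_simps)
 also have "... = 0" unfolding e by (simp add: mn algebra_simps)
 finally show uv: "u + v = of_int n" using \<open>u ~= v\<close> by (simp add: add_diff_eq)
 have "(u - v) * (u - v) = u * u + v * v - 2 * (u * v)" by (simp add: algebra_simps)
 also have "... = - 2 - 2 * of_int m * p - of_int n * (u + v)" unfolding e by (simp add: mn algebra_simps)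
 finally show "(u - v) * (u - v) = - 2 - 2 * of_int m * of_int m - of_int n * of_int n" unfolding p uv by simp
qed

text \<open>For \<open>u = v\<close> the products \<open>X X'\<close> and \<open>X X\<close> have
  the same value, and the difference of their expansions is a linear relation with integral
  coefficients.\<close>

lemma chr_sym:
 assumes "chr p u u"
 shows "1 + of_int m * p + of_int n * u = 0"
proof -
 have "1 + of_int c * p + of_int e * u + of_int e * u = of_int d * p + of_int e * u + of_int g * u"
  using assms by (auto simp: rank4_char_def)
 thus ?thesis by (simp add: mn algebra_simps)
qed

lemma chr_real:
 assumes ch: "chr (complex_of_real p) (complex_of_real u) (complex_of_real v)"
 shows "u = v"
proof (rule ccontr)
 assume "u ~= v"
 hence "(complex_of_real u - of_real v) * (of_real u - of_real v) = - 2 - 2 * of_int m * of_int m - of_int n * of_int n"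
  using chr_nonsym(3)[OF ch] by simp
 hence "complex_of_real ((u - v) * (u - v)) = complex_of_real (- 2 - 2 * m * m - n * n)" by simp
 hence "(u - v) * (u - v) = - 2 - 2 * m * m - n * n" unfolding of_real_eq_iff .
 moreover have "(u - v) * (u - v) \<ge> 0" "real_of_int m * m \<ge> 0" "real_of_int n * n \<ge> 0" by simp_all
 ultimately show False by simp
qed

section \<open>The Frobenius-Perron character against the separating characters\<close>

context
 fixes y x :: real
 assumes nonneg: "a \<ge> 0" "b \<ge> 0" "c \<ge> 0" "d \<ge> 0" "e \<ge> 0" "g \<ge> 0"
  and assoc1: "m * m = 1 + a * m + b * n"
  and assoc2: "b * m + d * n = 0"
  and assoc3: "1 + m * (c + d) + n * (e + g) = 0"
  and FP: "rank4_char a b c d e g (of_real y) (of_real x) (of_real x)" "y \<ge> 1" "x \<ge> 1"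
  and nonint: "\<not> (y : \<int> & x : \<int>)"
begin

lemma FP_line: "1 + m * y + n * x = 0"
proof -
 have "complex_of_real (1 + m * y + n * x) = 0" using chr_sym[OF FP(1)] by simp
 thus ?thesis unfolding of_real_eq_0_iff .
qed

lemma FP_eqs: "y * y = 1 + a * y + 2 * b * x" "y * x = b * y + (c + d) * x" "x * x = 1 + c * y + 2 * e * x"
proof -
 have "complex_of_real (y * y) = complex_of_real (1 + a * y + 2 * b * x)"
  "complex_of_real (y * x) = complex_of_real (b * y + (c + d) * x)"
  "complex_of_real (x * x) = complex_of_real (1 + c * y + 2 * e * x)"
  using FP(1) by (auto simp: rank4_char_def algebra_simps)
 thus "y * y = 1 + a * y + 2 * b * x" "y * x = b * y + (c + d) * x" "x * x = 1 + c * y + 2 * e * x"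
  unfolding of_real_eq_iff by auto
qed

text \<open>Elimination of the other unknown exhibits \<open>y\<close> and \<open>x\<close> as roots
  of monic integral cubics, so rational values would be integers.\<close>

lemma irrational: "\<not> (y : \<rat> & x : \<rat>)"
proof -
 have "y ^ 3 + of_int (- (c + d + a)) * y\<^sup>2 + of_int (a * (c + d) - 1 - 2 * b * b) * y + of_int (c + d) = 0"
 proof -
  have "(y * y - a * y - 1) * (y - (c + d)) = 2 * b * (y * x - (c + d) * x)" unfolding FP_eqs(1) by (simp add: algebra_simps)
  also have "... = 2 * b * b * y" unfolding FP_eqs(2) by (simp add: algebra_simps)
  finally show ?thesis by (simp add: algebra_simps power2_eq_square power3_eq_cube)
 qed
 moreover have "x ^ 3 + of_int (- (2 * e + b)) * x\<^sup>2 + of_int (2 * e * b - 1 - c * (c + d)) * x + of_int b = 0"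
 proof -
  have "(x * x - 2 * e * x - 1) * (x - b) = c * (y * x - b * y)" unfolding FP_eqs(3) by (simp add: algebra_simps)
  also have "... = c * (c + d) * x" unfolding FP_eqs(2) by (simp add: algebra_simps)
  finally show ?thesis by (simp add: algebra_simps power2_eq_square power3_eq_cube)
 qed
 ultimately show ?thesis using monic_cubic_rational nonint by blast
qed

text \<open>The tool for comparing coefficients. Up to a factor, \<open>FP_line\<close> is the only
  linear relation with integral coefficients between 1, \<open>y\<close> and \<open>x\<close>,
  because two independent relations could be solved for rational values.\<close>

lemma linear_relation:
 fixes p q r :: int
 assumes "p + q * y + r * x = 0"
 shows "q = p * m" "r = p * n"
proof -
 \<comment> \<open>Subtracting \<open>p\<close> times \<open>FP_line\<close> removes the constant
   term.\<close>
 define \<alpha> \<beta> where "\<alpha> = q - p * m" and "\<beta> = r - p * n"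
 have ab: "\<alpha> * y + \<beta> * x = 0"
 proof -
  have "\<alpha> * y + \<beta> * x = (p + q * y + r * x) - p * (1 + m * y + n * x)" by (simp add: \<alpha>_def \<beta>_def algebra_simps)
  thus ?thesis using assms FP_line by simp
 qed
 \<comment> \<open>The determinant of the homogeneous relation and \<open>FP_line\<close>. If it
   were non-zero, Cramer's rule would make \<open>y\<close> and \<open>x\<close> rational.\<close>
 have D: "\<alpha> * n - \<beta> * m = 0"
 proof (rule ccontr)
  assume D: "\<alpha> * n - \<beta> * m ~= 0"
  have "of_int (\<alpha> * n - \<beta> * m) * y = n * (\<alpha> * y + \<beta> * x) - \<beta> * (1 + m * y + n * x) + \<beta>"
   "of_int (\<alpha> * n - \<beta> * m) * x = \<alpha> * (1 + m * y + n * x) - m * (\<alpha> * y + \<beta> * x) - \<alpha>" by (simp_all add: algebra_simps)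
  hence "y = \<beta> / of_int (\<alpha> * n - \<beta> * m)" "x = - \<alpha> / of_int (\<alpha> * n - \<beta> * m)"
   using D unfolding ab FP_line by (simp_all add: field_simps del: of_int_diff of_int_mult)
  hence "y : \<rat>" "x : \<rat>" by simp_all
  thus False using irrational by blast
 qed
 have "of_int \<alpha> = - (of_int (\<alpha> * n - \<beta> * m) * x) + \<alpha> * (1 + m * y + n * x) - m * (\<alpha> * y + \<beta> * x)"
  "of_int \<beta> = of_int (\<alpha> * n - \<beta> * m) * y + \<beta> * (1 + m * y + n * x) - n * (\<alpha> * y + \<beta> * x)" by (simp_all add: algebra_simps)
 hence "real_of_int \<alpha> = 0" "real_of_int \<beta> = 0" unfolding ab FP_line D by simp_all
 hence "\<alpha> = 0" "\<beta> = 0" by (simp_all only: of_int_eq_0_iff)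
 thus "q = p * m" "r = p * n" by (simp_all add: \<alpha>_def \<beta>_def)
qed

definition root_disc where "root_disc = sqrt (2 + 2 * m * m + n * n)"
text \<open>The value at \<open>X\<close> of a character separating \<open>X\<close> from its dual,
  as found in \<open>chr_nonsym\<close>: the two values have sum \<open>n\<close>, and the square of
  their difference is minus the square of \<open>root_disc\<close>.\<close>

definition zeta where "zeta = Complex (n / 2) (root_disc / 2)"

lemma root_disc: "root_disc * root_disc = 2 + 2 * m * m + n * n" "root_disc > 0"
proof -
 have "2 + 2 * m * m + n * n > (0::real)" by (auto simp: mult.assoc intro!: add_pos_nonneg)
 thus "root_disc * root_disc = 2 + 2 * m * m + n * n" "root_disc > 0" by (simp_all add: root_disc_def)
qed

text \<open>The conjugate pair has sum \<open>n\<close> and, by \<open>assoc3\<close>, product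
  \<open>1 + c m + e n\<close>. The associativity relations turn these two facts into four of the
  equations; conjugation gives the other two.\<close>

lemma chr_z: "chr (of_int m) zeta (cnj zeta)"
proof -
 have zz: "zeta + cnj zeta = of_int n" by (simp add: zeta_def complex_eq_iff)
 have sd: "real_of_int (2 * c) = c + d + m" "real_of_int (2 * e) = e + g + n" by (simp_all add: mn)
 have a3: "1 + m * (c + d) + n * (e + g) = (0::real)" using arg_cong[OF assoc3, of real_of_int] by simp
 have "zeta * cnj zeta = of_real ((n * n + root_disc * root_disc) / 4)" by (simp add: zeta_def complex_eq_iff field_simps)
 also have "(n * n + root_disc * root_disc) / 4 = 1 + c * m + e * n"
  unfolding root_disc using a3 by (simp add: mn field_simps)
 finally have z3: "zeta * cnj zeta = 1 + of_int c * of_int m + of_int e * of_int n" by simp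
 have c1: "cnj zeta = of_int n - zeta" using zz by (simp add: algebra_simps)
 have A: "of_int b * of_int m + of_int d * of_int n = (0::complex)" using arg_cong[OF assoc2, of complex_of_int] by simp
 have B: "1 + of_int m * (of_int c + of_int d) + of_int n * (of_int e + of_int g) = (0::complex)" using arg_cong[OF assoc3, of complex_of_int] by simp
 have C: "of_int m * of_int m = (1 + of_int a * of_int m + of_int b * of_int n :: complex)" using arg_cong[OF assoc1, of complex_of_int] by simp
 have mn': "of_int m = (of_int c - of_int d :: complex)" "of_int n = (of_int e - of_int g :: complex)" by (simp_all add: mn)
 have z4: "zeta * zeta = of_int n * zeta - (1 + of_int c * of_int m + of_int e * of_int n)"
  using z3 unfolding c1 by (simp add: algebra_simps)
 have 1: "of_int m * of_int m = 1 + of_int a * of_int m + of_int b * zeta + of_int b * cnj zeta" unfolding C c1 by (simp add: algebra_simps)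
 have 2: "of_int m * zeta = of_int b * of_int m + of_int c * zeta + of_int d * cnj zeta"
 proof -
  have "of_int b * of_int m + of_int c * zeta + of_int d * cnj zeta = (of_int b * of_int m + of_int d * of_int n) + (of_int c - of_int d) * zeta"
   unfolding c1 by (simp add: algebra_simps)
  thus ?thesis unfolding A mn'(1)[symmetric] by simp
 qed
 have 5: "zeta * zeta = of_int d * of_int m + of_int e * zeta + of_int g * cnj zeta"
 proof -
  have "of_int d * of_int m + of_int e * zeta + of_int g * cnj zeta
   = of_int n * zeta - (1 + of_int c * of_int m + of_int e * of_int n) + (1 + of_int m * (of_int c + of_int d) + of_int n * (of_int e + of_int g))"
   unfolding c1 mn'(2) by (simp add: algebra_simps)
  thus ?thesis using B z4 by simp
 qed
 have 4: "zeta * cnj zeta = 1 + of_int c * of_int m + of_int e * zeta + of_int e * cnj zeta" unfolding z3 unfolding c1 by (simp add: algebra_simps)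
 have 3: "of_int m * cnj zeta = of_int b * of_int m + of_int d * zeta + of_int c * cnj zeta" using arg_cong[OF 2, of cnj] by (simp add: add_ac)
 have 6: "cnj zeta * cnj zeta = of_int d * of_int m + of_int g * zeta + of_int e * cnj zeta" using arg_cong[OF 5, of cnj] by (simp add: add_ac)
 show ?thesis unfolding rank4_char_def by (intro conjI 1 2 3 4 5 6)
qed

text \<open>If the two values agreed, they would solve the same equations as \<open>y\<close> and
  \<open>x\<close> and hence be these numbers or their conjugate roots, which are real. But the
  values are integral combinations of 1, \<open>zeta\<close> and its conjugate, and such a
  combination is an integer as soon as it is real.\<close>

lemma psi_nonsym:
 fixes p0 p1 p2 q0 q1 q2 r0 r1 r2 :: int
 assumes c: "chr (of_int p0 + of_int p1 * zeta + of_int p2 * cnj zeta) (of_int q0 + of_int q1 * zeta + of_int q2 * cnj zeta)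
  (of_int r0 + of_int r1 * zeta + of_int r2 * cnj zeta)"
 shows "of_int q0 + of_int q1 * zeta + of_int q2 * cnj zeta ~= of_int r0 + of_int r1 * zeta + of_int r2 * cnj zeta"
proof
 define \<eta> where "\<eta> = of_int p0 + of_int p1 * zeta + of_int p2 * cnj zeta"
 define \<xi> where "\<xi> = of_int q0 + of_int q1 * zeta + of_int q2 * cnj zeta"
 assume "of_int q0 + of_int q1 * zeta + of_int q2 * cnj zeta = of_int r0 + of_int r1 * zeta + of_int r2 * cnj zeta"
 hence ch: "chr \<eta> \<xi> \<xi>" using c by (simp add: \<eta>_def \<xi>_def)
 have line: "1 + of_int m * \<eta> + of_int n * \<xi> = 0" by (rule chr_sym[OF ch])
 have line': "1 + of_int m * complex_of_real y + of_int n * complex_of_real x = 0" by (rule chr_sym[OF FP(1)])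
 have e: "\<eta> * \<eta> = 1 + of_int a * \<eta> + 2 * of_int b * \<xi>" "\<xi> * \<xi> = 1 + of_int c * \<eta> + 2 * of_int e * \<xi>"
  using ch by (auto simp: rank4_char_def algebra_simps)
 have e': "complex_of_real y * y = 1 + of_int a * complex_of_real y + 2 * of_int b * complex_of_real x"
  "complex_of_real x * x = 1 + of_int c * complex_of_real y + 2 * of_int e * complex_of_real x"
  using FP(1) by (auto simp: rank4_char_def algebra_simps)
 \<comment> \<open>A vanishing imaginary part forces \<open>k1 = k2\<close>, and
   \<open>zeta + cnj zeta\<close> is the integer \<open>n\<close>.\<close>
 have int: "w : \<int>" if "of_int k0 + of_int k1 * zeta + of_int k2 * cnj zeta = complex_of_real w" for k0 k1 k2 :: int and w
 proof -
  have "Im (of_int k0 + of_int k1 * zeta + of_int k2 * cnj zeta) = 0" unfolding that by simp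
  hence "k1 = k2" using root_disc(2) by (simp add: zeta_def algebra_simps)
  hence "of_int k0 + of_int k1 * zeta + of_int k2 * cnj zeta = complex_of_real (of_int (k0 + k1 * n))"
   by (simp add: zeta_def complex_eq_iff algebra_simps)
  thus ?thesis unfolding that of_real_eq_iff by simp
 qed
 show False
 \<comment> \<open>For \<open>n = 0\<close> the line determines the first value, and
   \<open>x\<close> is only known through its quadratic equation. For \<open>n ~= 0\<close> the line
   eliminates the second value, and a quadratic equation for the first one remains.\<close>
 proof (cases "n = 0")
  case True
  hence m: "m ~= 0" using line' by auto
  have "of_int m * (\<eta> - y) = (1 + of_int m * \<eta> + of_int n * \<xi>) - (1 + of_int m * complex_of_real y + of_int n * complex_of_real x)"
   using True by (simp add: algebra_simps)
  hence ny: "of_int m * (\<eta> - y) = 0" unfolding line line' by simp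
  hence \<eta>: "\<eta> = y" using m by simp
  have "(\<xi> - x) * (\<xi> + x - 2 * of_int e) = (\<xi> * \<xi> - 2 * of_int e * \<xi>) - (complex_of_real x * x - 2 * of_int e * x)"
   by (simp add: algebra_simps)
  also have "... = 0" unfolding e e' \<eta> by (simp add: algebra_simps)
  finally consider "\<xi> = complex_of_real x" | "\<xi> = complex_of_real (2 * e - x)" unfolding mult_eq_0_iff by (auto simp: algebra_simps eq_diff_eq)
  hence "x : \<int>"
  proof cases
   case 1 thus ?thesis using int unfolding \<xi>_def by blast
  next
   case 2 hence "2 * e - x : \<int>" using int unfolding \<xi>_def by blast
   hence "2 * e - (2 * e - x) : \<int>" by (intro Ints_diff) simp_all
   thus ?thesis by simp
  qed
  thus False using int[of p0 p1 p2 y] \<eta> nonint unfolding \<eta>_def by blast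
 next
  case False
  define k where "k = a * n - 2 * b * m"
  have q: "of_int n * w * w = of_int n + of_int k * w - 2 * of_int b"
   if w: "w * w = 1 + of_int a * w + 2 * of_int b * v" "1 + of_int m * w + of_int n * v = 0" for w v :: complex
  proof -
   have "of_int n * w * w = of_int n * (w * w)" by simp
   also have "... = of_int n + of_int k * w - 2 * of_int b + 2 * of_int b * (1 + of_int m * w + of_int n * v)"
    unfolding w(1) by (simp add: algebra_simps k_def)
   finally show ?thesis unfolding w(2) by simp
  qed
  have "(\<eta> - y) * (of_int n * (\<eta> + y) - of_int k) = (of_int n * \<eta> * \<eta> - of_int k * \<eta>) - (of_int n * complex_of_real y * y - of_int k * y)"
   by (simp add: algebra_simps)
  also have "... = 0" unfolding q[OF e(1) line] q[OF e'(1) line'] by simp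
  finally consider "\<eta> = complex_of_real y" | "of_int n * (\<eta> + y) = of_int k" by auto
  hence "y : \<rat>"
  proof cases
   case 1
   hence "y : \<int>" using int unfolding \<eta>_def by blast
   thus ?thesis using Ints_subset_Rats by blast
  next
   case 2
   hence "\<eta> = complex_of_real (k / n - y)" using False by (simp add: field_simps)
   hence i: "k / n - y : \<int>" using int unfolding \<eta>_def by blast
   have "k / n - (k / n - y) : \<rat>" by (rule Rats_diff) (use i Ints_subset_Rats in auto)
   thus ?thesis by simp
  qed
  moreover have "x = - (1 + m * y) / n" using FP_line False by (simp add: field_simps)
  ultimately have "x : \<rat>" using \<open>y : \<rat>\<close> by simp
  thus False using irrational \<open>y : \<rat>\<close> by blast
 qed
qed

text \<open>The numbers \<open>\<epsilon>, a', b1, ...\<close> are the coefficients of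
  \<open>\<psi>\<close>. It takes the Perron character to a real and hence symmetric one, where
  \<open>linear_relation\<close> compares coefficients. It takes the character of
  \<open>zeta\<close> to a separating one by \<open>psi_nonsym\<close>, whose values are known from
  \<open>chr_nonsym\<close>. Both comparisons are linear in the coefficients.\<close>

lemma near_group:
 fixes \<epsilon> a' b1 b2 d1 e1 g1 d2 e2 g2 :: int
 assumes psi: "!!p u v. chr p u v ==> chr (of_int \<epsilon> + of_int a' * p + of_int b1 * u + of_int b2 * v)
   (of_int d1 * p + of_int e1 * u + of_int g1 * v) (of_int d2 * p + of_int e2 * u + of_int g2 * v)"
  and eps: "\<epsilon> * \<epsilon> = 1"
 shows "a = 3 & b = 1 & c = 0 & d = 0 & e = 0 & g = 1"
proof -
 have realI: "(1 + m * (\<epsilon> + a' * y + b1 * x + b2 * x) + n * (d1 * y + e1 * x + g1 * x) = (0::real)) &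
  d1 * y + e1 * x + g1 * x = d2 * y + e2 * x + g2 * x"
 proof -
  define P U V where "P = \<epsilon> + a' * y + b1 * x + b2 * x" and "U = d1 * y + e1 * x + g1 * x" and "V = d2 * y + e2 * x + g2 * x"
  have ch: "chr (of_real P) (of_real U) (of_real V)" using psi[OF FP(1)] by (simp add: P_def U_def V_def)
  have UV: "U = V" by (rule chr_real[OF ch])
  have "complex_of_real (1 + m * P + n * U) = 0" using chr_sym[of "of_real P" "of_real U"] ch UV by simp
  hence "1 + m * P + n * U = 0" unfolding of_real_eq_0_iff .
  thus ?thesis using UV by (simp add: P_def U_def V_def)
 qed
 have "of_int 0 + of_int (d1 - d2) * y + of_int (e1 + g1 - e2 - g2) * x = 0" using realI by (simp add: algebra_simps)
 from linear_relation[OF this] have dh: "d2 = d1" "e2 + g2 = e1 + g1" by simp_all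
 define h where "h = e1 + g1"
 have "of_int (1 + m * \<epsilon>) + of_int (m * a' + n * d1) * y + of_int (m * (b1 + b2) + n * h) * x = 0"
  using realI by (simp add: algebra_simps h_def)
 from linear_relation[OF this] have P1: "m * a' + n * d1 = (1 + m * \<epsilon>) * m" "m * (b1 + b2) + n * h = (1 + m * \<epsilon>) * n" .
 let ?p = "of_int \<epsilon> + of_int a' * of_int m + of_int b1 * zeta + of_int b2 * cnj zeta"
 let ?u = "of_int d1 * of_int m + of_int e1 * zeta + of_int g1 * cnj zeta" and ?v = "of_int d2 * of_int m + of_int e2 * zeta + of_int g2 * cnj zeta"
 have ch: "chr ?p ?u ?v" by (rule psi[OF chr_z])
 have ne: "?u ~= ?v" using psi_nonsym[of "\<epsilon> + a' * m" b1 b2 "d1 * m" e1 g1 "d2 * m" e2 g2] ch by simp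
 note P = chr_nonsym[OF ch ne]
 have b12: "b2 = b1"
 proof -
  have "Im ?p = 0" unfolding P(1) by simp
  thus ?thesis using root_disc(2) by (simp add: zeta_def algebra_simps)
 qed
 have "Re ?p = m" unfolding P(1) by simp
 hence "real_of_int (\<epsilon> + a' * m + b1 * n) = real_of_int m" by (simp add: zeta_def b12 algebra_simps)
 hence P2: "\<epsilon> + a' * m + b1 * n = m" unfolding of_int_eq_iff .
 have "Re (?u + ?v) = n" unfolding P(2) by simp
 hence "real_of_int (4 * d1 * m + (e1 + e2 + g1 + g2) * n) = real_of_int (2 * n)" by (simp add: zeta_def dh algebra_simps)
 hence "4 * d1 * m + (e1 + e2 + g1 + g2) * n = 2 * n" unfolding of_int_eq_iff .
 moreover have "e1 + e2 + g1 + g2 = 2 * h" using dh h_def by simp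
 ultimately have "4 * d1 * m + (2 * h) * n = 2 * n" by (simp only:)
 hence P3: "2 * d1 * m + h * n = n" by linarith
 \<comment> \<open>Here \<open>a'\<close> is eliminated from the first equation of \<open>P1\<close>
   and \<open>P2\<close>; in the next line \<open>h\<close> is eliminated from the second equation
   of \<open>P1\<close> and \<open>P3\<close>.\<close>
 have k1: "n * (d1 - b1) = \<epsilon> * (1 + m * m)" using P1(1) P2 by (simp add: algebra_simps)
 have k2: "m * (2 * (b1 - d1) - n * \<epsilon>) = 0" using P1(2) P3 b12 by (simp add: algebra_simps)
 \<comment> \<open>For non-zero \<open>m\<close>, the two equations combine to
   \<open>2 (1 + m^2) + n^2 = 0\<close>.\<close>
 have m0: "m = 0"
 proof (rule ccontr)
  assume "m ~= 0"
  hence "2 * (b1 - d1) = n * \<epsilon>" using k2 by simp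
  hence "n * (2 * (b1 - d1)) = n * (n * \<epsilon>)" by simp
  hence "2 * (n * (d1 - b1)) = - (n * n) * \<epsilon>" by (simp add: algebra_simps)
  hence "\<epsilon> * (2 * (\<epsilon> * (1 + m * m))) = \<epsilon> * (- (n * n) * \<epsilon>)" unfolding k1 by (rule arg_cong)
  hence "(2 * (1 + m * m) + n * n) * (\<epsilon> * \<epsilon>) = 0" by (simp add: algebra_simps)
  moreover have "m * m \<ge> 0" "n * n \<ge> 0" by simp_all
  ultimately show False using eps by simp
 qed
 have nx: "n * x = - 1" using FP_line m0 by simp
 hence "n < 0" using FP(3) by (smt (verit) mult_nonneg_nonneg of_int_0_le_iff)
 \<comment> \<open>With \<open>m = 0\<close> this product is a unit, so \<open>n\<close> is one as
   well; its sign comes from \<open>n x = -1\<close>.\<close>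
 have "n * (d1 - b1) = \<epsilon>" using k1 m0 by simp
 hence "n * n * ((d1 - b1) * (d1 - b1)) = 1" using eps by (metis mult.assoc mult.left_commute)
 hence "n dvd 1" by (metis dvd_triv_left mult.assoc)
 hence n1: "n = - 1" using \<open>n < 0\<close> by auto
 have x1: "x = 1" using nx n1 by simp
 have b: "b = 1" using assoc1 m0 n1 by simp
 have d0: "d1 = 0" using P1(1) m0 n1 by simp
 have beta: "b1 = \<epsilon>" using k1 m0 n1 d0 by simp
 have h1: "h = 1" using P3 n1 m0 by simp
 have cd: "c = d" using m0 mn by simp
 have dn: "d = 0" using assoc2 m0 n1 by simp
 have "1 = 1 + c * y + 2 * e * x" using FP_eqs(3) x1 by simp
 hence e0: "e = 0" using cd dn x1 by simp
 hence g1: "g = 1" using n1 mn by simp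
 have yy: "y * y = 3 + a * y" using FP_eqs(1) b x1 by simp
 \<comment> \<open>The value of \<open>\<psi>\<close> of \<open>Y\<close> at the Perron character,
   now that \<open>x = 1\<close> and \<open>b1 = b2 = \<epsilon>\<close>. It satisfies the same
   quadratic equation as \<open>y\<close>.\<close>
 define P where "P = 3 * \<epsilon> + a' * y"
 have "chr (of_real P) (of_real 1) (of_real 1)"
 proof -
  have "of_int e1 + of_int g1 = (1::complex)" "of_int e2 + of_int g2 = (1::complex)"
   using arg_cong[OF h1, of complex_of_int] arg_cong[OF dh(2), of complex_of_int] by (simp_all add: h_def)
  thus ?thesis using psi[OF FP(1)] by (simp add: x1 d0 dh(1) beta b12 P_def algebra_simps)
 qed
 hence "complex_of_real (P * P) = complex_of_real (3 + a * P)" by (simp add: rank4_char_def b)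
 hence "P * P = 3 + a * P" unfolding of_real_eq_iff .
 moreover have "P * P = 9 * of_int (\<epsilon> * \<epsilon>) + 6 * \<epsilon> * a' * y + a' * a' * (y * y)" by (simp add: P_def algebra_simps)
 ultimately have "of_int (6 + 3 * a' * a' - 3 * a * \<epsilon>) + of_int (6 * \<epsilon> * a' + a' * a' * a - a * a') * y + of_int 0 * x = 0"
  unfolding yy eps by (simp add: P_def algebra_simps)
 from linear_relation[OF this] have q: "6 * \<epsilon> * a' + a' * a' * a - a * a' = 0" "2 + a' * a' = a * \<epsilon>"
  using m0 n1 by simp_all
 have "\<epsilon> = 1 \<or> \<epsilon> = - 1" using eps by (simp add: zmult_eq_1_iff)
 moreover have "\<epsilon> ~= - 1"
 proof
  assume "\<epsilon> = - 1"
  hence "2 + a' * a' = - a" using q(2) by simp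
  moreover have "a' * a' \<ge> 0" by simp
  ultimately show False using nonneg(1) by linarith
 qed
 ultimately have e1: "\<epsilon> = 1" by simp
 have a: "a = 2 + a' * a'" using q(2) e1 by simp
 \<comment> \<open>For \<open>a' = 0\<close> the equation for \<open>y\<close> becomes
   \<open>y^2 = 3 + 2 y\<close> with the integral positive root 3.\<close>
 have "a' ~= 0"
 proof
  assume "a' = 0"
  hence "(y - 3) * (y + 1) = 0" using yy a by (simp add: algebra_simps)
  hence "y = 3" using FP(2) by auto
  thus False using nonint x1 by simp
 qed
 moreover have "a' * (6 + a' * a - a) = 0" using q(1) e1 by (simp add: algebra_simps)
 ultimately have "6 + a' * a - a = 0" unfolding mult_eq_0_iff by blast
 \<comment> \<open>The only integral solution is \<open>a' = -1\<close>: the left side is not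
   positive for \<open>a' \<ge> 1\<close>, it is 2 for \<open>a' = 0\<close>, and at least 18 for
   \<open>a' \<le> -2\<close>. The value \<open>a = 3\<close> follows.\<close>
 hence k: "(2 + a' * a') * (1 - a') = 6" unfolding a by (simp add: algebra_simps)
 have "a' < 1"
 proof (rule ccontr)
  assume "\<not> a' < 1"
  hence "(2 + a' * a') * (1 - a') <= 0" by (intro mult_nonneg_nonpos) auto
  thus False using k by simp
 qed
 moreover have "a' > - 2"
 proof (rule ccontr)
  assume "\<not> a' > - 2"
  hence "3 <= 1 - a'" "4 <= a' * a'" using mult_mono[of 2 "- a'" 2 "- a'"] by auto
  hence "6 * 3 <= (2 + a' * a') * (1 - a')" by (intro mult_mono) auto
  thus False using k by simp
 qed
 ultimately have "a' = - 1" using \<open>a' ~= 0\<close> by simp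
 thus ?thesis using a b cd dn e0 g1 by simp
qed

end

end

section \<open>Characters of the fusion ring\<close>

context ac_symmetric begin

definition fus_char where
 "fus_char I \<theta> \<longleftrightarrow> \<theta> \<bbbI> = (1::complex) & (ALL A:I. ALL B:I. \<theta> A * \<theta> B = (\<Sum>Z\<in>I. of_nat (dm Z (A >< B)) * \<theta> Z))"

text \<open>Multiplicativity makes the coefficient at the unit idempotent, and it is odd because the
  multiplicity is 1.\<close>

lemma adams_unit:
 assumes I: "reps I" "\<bbbI> : I" and Z: "Z : I"
 shows "adams \<bbbI> Z = (if Z = \<bbbI> then 1 else 0)"
proof -
 note r = repsD[OF I(1)]
 note O = r(3)[OF I(2)] r(3)[OF Z]
 have z: "adams \<bbbI> A = 0" if "A : I" "A ~= \<bbbI>" for A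
  using adams_bound(1)[OF O(1) r(3)[OF that(1)]] hdim_ten_unit(1)[OF I that(1)] that(2) by auto
 have o: "odd (adams \<bbbI> \<bbbI>)" using adams_bound(2)[OF O(1,1)] hdim_ten_unit(1)[OF I I(2)] by simp
 have "(\<Sum>T\<in>I. int (dm T (\<bbbI> >< \<bbbI>)) * adams T \<bbbI>) = (\<Sum>A\<in>I. \<Sum>B\<in>I. adams \<bbbI> A * adams \<bbbI> B * int (dm \<bbbI> (A >< B)))"
  by (rule adams_mult[OF I(1) O(1,1,1)])
 also have "(\<Sum>T\<in>I. int (dm T (\<bbbI> >< \<bbbI>)) * adams T \<bbbI>) = (\<Sum>T\<in>I. if T = \<bbbI> then adams \<bbbI> \<bbbI> else 0)"
  by (intro sum.cong refl) (use hdim_ten_unit(1)[OF I] in auto)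
 also have "... = adams \<bbbI> \<bbbI>" using r(1) I(2) by simp
 also have "(\<Sum>A\<in>I. \<Sum>B\<in>I. adams \<bbbI> A * adams \<bbbI> B * int (dm \<bbbI> (A >< B))) = (\<Sum>A\<in>I. \<Sum>B\<in>I. if B = \<bbbI> then (if A = \<bbbI> then adams \<bbbI> \<bbbI> * adams \<bbbI> \<bbbI> else 0) else 0)"
  by (intro sum.cong refl) (use z hdim_ten_unit(1)[OF I I(2)] in auto)
 also have "... = adams \<bbbI> \<bbbI> * adams \<bbbI> \<bbbI>" using r(1) I(2) by simp
 finally have "adams \<bbbI> \<bbbI> = 1" using o by (cases "adams \<bbbI> \<bbbI> = 0") auto
 thus ?thesis using z[OF Z] by auto
qed

lemma adams_char:
 assumes I: "reps I" "\<bbbI> : I" and \<theta>: "fus_char I \<theta>"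
 shows "fus_char I (%S. \<Sum>Z\<in>I. of_int (adams S Z) * \<theta> Z)"
 unfolding fus_char_def
proof (intro conjI ballI)
 note r = repsD[OF I(1)]
 have "(\<Sum>Z\<in>I. of_int (adams \<bbbI> Z) * \<theta> Z) = (\<Sum>Z\<in>I. if Z = \<bbbI> then 1 else 0)"
  by (intro sum.cong refl) (use adams_unit[OF I] \<theta> in "auto simp: fus_char_def")
 thus "(\<Sum>Z\<in>I. of_int (adams \<bbbI> Z) * \<theta> Z) = 1" using r(1) I(2) by simp
 fix S T assume ST: "S : I" "T : I"
 have "(\<Sum>Z\<in>I. of_int (adams S Z) * \<theta> Z) * (\<Sum>Z\<in>I. of_int (adams T Z) * \<theta> Z)
  = (\<Sum>A\<in>I. \<Sum>B\<in>I. of_int (adams S A * adams T B) * (\<theta> A * \<theta> B))"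
  by (simp add: sum_product mult_ac)
 also have "... = (\<Sum>A\<in>I. \<Sum>B\<in>I. \<Sum>Z\<in>I. of_int (adams S A * adams T B * int (dm Z (A >< B))) * \<theta> Z)"
 proof (intro sum.cong refl)
  fix A B assume AB: "A : I" "B : I"
  have e: "\<theta> A * \<theta> B = (\<Sum>Z\<in>I. of_nat (dm Z (A >< B)) * \<theta> Z)" using \<theta> AB by (simp add: fus_char_def)
  show "of_int (adams S A * adams T B) * (\<theta> A * \<theta> B) = (\<Sum>Z\<in>I. of_int (adams S A * adams T B * int (dm Z (A >< B))) * \<theta> Z)"
   unfolding e by (simp add: sum_distrib_left mult_ac)
 qed
 also have "... = (\<Sum>Z\<in>I. \<Sum>A\<in>I. \<Sum>B\<in>I. of_int (adams S A * adams T B * int (dm Z (A >< B))) * \<theta> Z)"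
  by (subst sum.swap[of _ I I], subst (2) sum.swap) simp
 also have "... = (\<Sum>Z\<in>I. of_int (\<Sum>A\<in>I. \<Sum>B\<in>I. adams S A * adams T B * int (dm Z (A >< B))) * \<theta> Z)"
  by (simp add: sum_distrib_right)
 also have "... = (\<Sum>Z\<in>I. of_int (\<Sum>U\<in>I. int (dm U (S >< T)) * adams U Z) * \<theta> Z)"
  by (intro sum.cong refl) (use adams_mult[OF I(1)] r(3) ST in simp)
 also have "... = (\<Sum>Z\<in>I. \<Sum>U\<in>I. of_nat (dm U (S >< T)) * (of_int (adams U Z) * \<theta> Z))"
  by (simp add: sum_distrib_right mult.assoc)
 also have "... = (\<Sum>U\<in>I. \<Sum>Z\<in>I. of_nat (dm U (S >< T)) * (of_int (adams U Z) * \<theta> Z))" by (rule sum.swap)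
 also have "... = (\<Sum>U\<in>I. of_nat (dm U (S >< T)) * (\<Sum>Z\<in>I. of_int (adams U Z) * \<theta> Z))"
  by (simp add: sum_distrib_left)
 finally show "(\<Sum>Z\<in>I. of_int (adams S Z) * \<theta> Z) * (\<Sum>Z\<in>I. of_int (adams T Z) * \<theta> Z)
  = (\<Sum>U\<in>I. of_nat (dm U (S >< T)) * (\<Sum>Z\<in>I. of_int (adams U Z) * \<theta> Z))" .
qed

section \<open>Fusion rules for four simple objects, two of them self-dual\<close>

context
 fixes I Y X X'
 assumes I: "reps I" and Ie: "I = {\<bbbI>, Y, X, X'}" and dist: "distinct [\<bbbI>, Y, X, X']"
  and dls: "dl I Y = Y" "dl I X = X'" "dl I X' = X"
begin

abbreviation (input) N where "N A B Z == dm Z (A >< B)"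

lemma inI: "\<bbbI> : I" "Y : I" "X : I" "X' : I"
 using Ie by auto

lemma objI: "Y : Ob" "X : Ob" "X' : Ob"
 using inI repsD(3)[OF I] by auto

lemma sum_four: "(\<Sum>Z\<in>I. f Z) = f \<bbbI> + f Y + f X + f X'" for f :: "'o => 'r :: comm_monoid_add"
 unfolding Ie using dist by (simp add: add.assoc)

text \<open>Frobenius reciprocity, commutativity and duality leave six free multiplicities. In the
  order \<open>N Y Y Y\<close>, \<open>N Y Y X\<close>, \<open>N Y X X\<close>,
  \<open>N Y X X'\<close>, \<open>N X X X\<close>, \<open>N X X X'\<close> they are the parameters
  \<open>a, b, c, d, e, g\<close> of \<open>rank4_char\<close>.\<close>

lemma fusion_rules:
 "N Y Y \<bbbI> = 1" "N Y Y X' = N Y Y X"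
 "N Y X \<bbbI> = 0" "N Y X Y = N Y Y X"
 "N Y X' \<bbbI> = 0" "N Y X' Y = N Y Y X" "N Y X' X = N Y X X'" "N Y X' X' = N Y X X"
 "N X X' \<bbbI> = 1" "N X X' Y = N Y X X" "N X X' X = N X X X" "N X X' X' = N X X X"
 "N X X \<bbbI> = 0" "N X X Y = N Y X X'"
 "N X' X' \<bbbI> = 0" "N X' X' Y = N Y X X'" "N X' X' X = N X X X'" "N X' X' X' = N X X X"
proof -
 note d = dl(2)[OF I] and f = frobenius[OF I] and s = hdim_ten_dl[OF I]
 have cm: "N A B Z = N B A Z" if "A : I" "B : I" "Z : I" for A B Z
  by (rule hdim_ten_comm) (use that repsD(3)[OF I] in auto)
 show "N Y Y \<bbbI> = 1" "N Y X \<bbbI> = 0" "N Y X' \<bbbI> = 0" "N X X' \<bbbI> = 1" "N X X \<bbbI> = 0" "N X' X' \<bbbI> = 0"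
  using d[of Y Y] d[of X Y] d[of X' Y] d[of X' X] d[of X X] d[of X' X'] inI dls dist by auto
 show 1: "N Y Y X' = N Y Y X" using s[of Y Y X'] inI dls by simp
 have "N Y X Y = N X Y Y" by (rule cm) (use inI in auto)
 also have "... = N Y Y X" using f[of X Y Y] inI dls by simp
 finally show 2: "N Y X Y = N Y Y X" .
 have "N Y X' Y = N Y X Y" using s[of Y X' Y] inI dls by simp
 thus "N Y X' Y = N Y Y X" using 2 by simp
 show 3: "N Y X' X = N Y X X'" using s[of Y X' X] inI dls by simp
 show "N Y X' X' = N Y X X" using s[of Y X' X'] inI dls by simp
 show "N X X' Y = N Y X X" using f[of X X' Y] inI dls by simp
 show 4: "N X X' X = N X X X" using f[of X X' X] inI dls by simp
 have "N X X' X' = N X' X X" using s[of X X' X'] inI dls by simp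
 also have "... = N X X' X" by (rule cm) (use inI in auto)
 finally show "N X X' X' = N X X X" using 4 by simp
 show 5: "N X X Y = N Y X X'" using f[of X X Y] inI dls 3 by simp
 show "N X' X' Y = N Y X X'" using s[of X' X' Y] inI dls 5 by simp
 show "N X' X' X = N X X X'" using s[of X' X' X] inI dls by simp
 show "N X' X' X' = N X X X" using s[of X' X' X'] inI dls by simp
qed

text \<open>In terms of \<open>m = c - d\<close> and \<open>n = e - g\<close>, the difference of the
  first two equations is the relation \<open>assoc1\<close>, and the last two are
  \<open>assoc2\<close> and \<open>assoc3\<close>.\<close>

lemma fusion_assoc:
 "1 + N Y Y Y * N Y X X + 2 * N Y Y X * N X X X = N Y Y X * N Y Y X + N Y X X * N Y X X + N Y X X' * N Y X X'"
 "N Y Y Y * N Y X X' + N Y Y X * N X X X' + N Y Y X * N X X X = N Y Y X * N Y Y X + 2 * N Y X X * N Y X X'"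
 "N Y Y X * N Y X X + N Y X X' * N X X X = N Y X X' * N Y Y X + N X X X' * N Y X X'"
 "N Y X X' * N Y X X' + N X X X' * N X X X' = 1 + N Y X X * N Y X X + N X X X * N X X X"
proof -
 note r = repsD[OF I] and u = hdim_ten_unit[OF I]
 have cm: "N X Y Z = N Y X Z" "N X' Y Z = N Y X' Z" "N X' X Z = N X X' Z" if "Z : I" for Z
  by (rule hdim_ten_comm; use that r(3) inI in blast)+
 note a = hdim_ten_assoc[OF I, unfolded sum_four]
 note R = fusion_rules cm[OF inI(1)] cm[OF inI(2)] cm[OF inI(3)] cm[OF inI(4)]
 have d: "\<bbbI> ~= Y" "\<bbbI> ~= X" "\<bbbI> ~= X'" "Y ~= X" "Y ~= X'" "X ~= X'" using dist by auto
 have un: "N \<bbbI> A Z = (if A = Z then 1 else 0)" "N A \<bbbI> Z = (if A = Z then 1 else 0)" if "A : I" "Z : I" for A Z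
  using u[OF that] by auto
 note UN = un[OF inI(1) inI(1)] un[OF inI(1) inI(2)] un[OF inI(1) inI(3)] un[OF inI(1) inI(4)]
  un[OF inI(2) inI(1)] un[OF inI(2) inI(2)] un[OF inI(2) inI(3)] un[OF inI(2) inI(4)]
  un[OF inI(3) inI(1)] un[OF inI(3) inI(2)] un[OF inI(3) inI(3)] un[OF inI(3) inI(4)]
  un[OF inI(4) inI(1)] un[OF inI(4) inI(2)] un[OF inI(4) inI(3)] un[OF inI(4) inI(4)]
 show "1 + N Y Y Y * N Y X X + 2 * N Y Y X * N X X X = N Y Y X * N Y Y X + N Y X X * N Y X X + N Y X X' * N Y X X'"
  using a[of Y Y X X] inI d by (simp add: R UN mult_ac)
 show "N Y Y Y * N Y X X' + N Y Y X * N X X X' + N Y Y X * N X X X = N Y Y X * N Y Y X + 2 * N Y X X * N Y X X'"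
  using a[of Y Y X X'] inI d by (simp add: R UN mult_ac)
 show "N Y Y X * N Y X X + N Y X X' * N X X X = N Y X X' * N Y Y X + N X X X' * N Y X X'"
  using a[of Y X X X] inI d by (simp add: R UN mult_ac)
 show "N Y X X' * N Y X X' + N X X X' * N X X X' = 1 + N Y X X * N Y X X + N X X X * N X X X"
  using a[of X X X' X] inI d by (simp add: R UN mult_ac)
qed

lemma fus_char_iff:
 "fus_char I \<theta> \<longleftrightarrow> \<theta> \<bbbI> = 1 & rank4_char (int (N Y Y Y)) (int (N Y Y X)) (int (N Y X X)) (int (N Y X X')) (int (N X X X)) (int (N X X X')) (\<theta> Y) (\<theta> X) (\<theta> X')"
proof -
 note r = repsD[OF I]
 have cm: "N X Y Z = N Y X Z" "N X' Y Z = N Y X' Z" "N X' X Z = N X X' Z" if "Z : I" for Z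
  by (rule hdim_ten_comm; use that r(3) inI in blast)+
 have un: "(\<Sum>Z\<in>I. of_nat (N \<bbbI> A Z) * \<theta> Z) = \<theta> A" "(\<Sum>Z\<in>I. of_nat (N A \<bbbI> Z) * \<theta> Z) = \<theta> A" if "A : I" for A
 proof -
  have "(\<Sum>Z\<in>I. of_nat (N \<bbbI> A Z) * \<theta> Z) = (\<Sum>Z\<in>I. if A = Z then \<theta> Z else 0)"
   "(\<Sum>Z\<in>I. of_nat (N A \<bbbI> Z) * \<theta> Z) = (\<Sum>Z\<in>I. if A = Z then \<theta> Z else 0)"
   by (intro sum.cong refl; use hdim_ten_unit[OF I that] in simp)+
  thus "(\<Sum>Z\<in>I. of_nat (N \<bbbI> A Z) * \<theta> Z) = \<theta> A" "(\<Sum>Z\<in>I. of_nat (N A \<bbbI> Z) * \<theta> Z) = \<theta> A" using r(1) that by simp_all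
 qed
 have cs: "(\<Sum>Z\<in>I. of_nat (N X Y Z) * \<theta> Z) = (\<Sum>Z\<in>I. of_nat (N Y X Z) * \<theta> Z)"
  "(\<Sum>Z\<in>I. of_nat (N X' Y Z) * \<theta> Z) = (\<Sum>Z\<in>I. of_nat (N Y X' Z) * \<theta> Z)"
  "(\<Sum>Z\<in>I. of_nat (N X' X Z) * \<theta> Z) = (\<Sum>Z\<in>I. of_nat (N X X' Z) * \<theta> Z)"
  by (intro sum.cong refl; use cm in simp)+
 let ?P = "%A B. \<theta> A * \<theta> B = (\<Sum>Z\<in>I. of_nat (N A B Z) * \<theta> Z)"
 have q: "(ALL A:I. ALL B:I. Q A B) \<longleftrightarrow> (Q \<bbbI> \<bbbI> & Q \<bbbI> Y & Q \<bbbI> X & Q \<bbbI> X') & (Q Y \<bbbI> & Q Y Y & Q Y X & Q Y X')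
   & (Q X \<bbbI> & Q X Y & Q X X & Q X X') & (Q X' \<bbbI> & Q X' Y & Q X' X & Q X' X')" for Q
  unfolding Ie by blast
 have "(ALL A:I. ALL B:I. ?P A B) \<longleftrightarrow> ?P Y Y & ?P Y X & ?P Y X' & ?P X X' & ?P X X & ?P X' X'" if "\<theta> \<bbbI> = 1"
  unfolding q un[OF inI(1)] un[OF inI(2)] un[OF inI(3)] un[OF inI(4)] cs that
  by (auto simp: mult.commute)
 moreover have "(?P Y Y & ?P Y X & ?P Y X' & ?P X X' & ?P X X & ?P X' X') \<longleftrightarrow>
  rank4_char (int (N Y Y Y)) (int (N Y Y X)) (int (N Y X X)) (int (N Y X X')) (int (N X X X)) (int (N X X X')) (\<theta> Y) (\<theta> X) (\<theta> X')" if "\<theta> \<bbbI> = 1"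
  unfolding rank4_char_def sum_four that fusion_rules by (simp add: add_ac)
 ultimately show ?thesis unfolding fus_char_def by blast
qed

lemma nonintegral_near_group:
 assumes D: "fus_char I (%S. complex_of_real (D S))" "!!S. S : I ==> D S \<ge> 1" and ni: "\<not> (ALL S:I. D S : \<int>)"
 shows "N Y Y Y = 3 & N Y Y X = 1 & N Y X X = 0 & N Y X X' = 0 & N X X X = 0 & N X X X' = 1"
proof -
 note FP = D(1)[unfolded fus_char_iff]
 have D1: "D \<bbbI> = 1" using FP by (metis of_real_eq_1_iff)
 have XX: "D X' = D X" by (rule chr_real[OF refl refl conjunct2[OF FP], symmetric])
 define \<psi> where "\<psi> \<theta> = (%S. \<Sum>Z\<in>I. of_int (adams S Z) * \<theta> Z)" for \<theta> :: "'o => complex"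
 have ze: "adams X \<bbbI> = 0" "adams X' \<bbbI> = 0" and o: "odd (adams Y \<bbbI>)" "\<bar>adams Y \<bbbI>\<bar> <= 1"
  using adams_bound[OF objI(2) obj_unit] adams_bound[OF objI(3) obj_unit] adams_bound[OF objI(1) obj_unit] by (auto simp: fusion_rules)
 \<comment> \<open>The unit occurs once in \<open>Y \<otimes> Y\<close>, so this coefficient is odd
   and at most 1 in absolute value.\<close>
 have eps: "adams Y \<bbbI> * adams Y \<bbbI> = 1"
 proof -
  have "adams Y \<bbbI> = 1 \<or> adams Y \<bbbI> = - 1" using o by presburger
  thus ?thesis by auto
 qed
 have psi: "rank4_char (int (N Y Y Y)) (int (N Y Y X)) (int (N Y X X)) (int (N Y X X')) (int (N X X X)) (int (N X X X'))
   (of_int (adams Y \<bbbI>) + of_int (adams Y Y) * p + of_int (adams Y X) * u + of_int (adams Y X') * v)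
   (of_int (adams X Y) * p + of_int (adams X X) * u + of_int (adams X X') * v)
   (of_int (adams X' Y) * p + of_int (adams X' X) * u + of_int (adams X' X') * v)"
  if ch: "rank4_char (int (N Y Y Y)) (int (N Y Y X)) (int (N Y X X)) (int (N Y X X')) (int (N X X X)) (int (N X X X')) p u v" for p u v
 proof -
  define \<theta> where "\<theta> S = (if S = \<bbbI> then 1 else if S = Y then p else if S = X then u else v)" for S
  have v: "\<theta> \<bbbI> = 1" "\<theta> Y = p" "\<theta> X = u" "\<theta> X' = v" using dist by (auto simp: \<theta>_def)
  have "fus_char I \<theta>" unfolding fus_char_iff v using ch by simp
  from adams_char[OF I inI(1) this] show ?thesis unfolding fus_char_iff sum_four v ze by simp
 qed
 have as: "(int (N Y X X) - int (N Y X X')) * (int (N Y X X) - int (N Y X X')) = 1 + int (N Y Y Y) * (int (N Y X X) - int (N Y X X')) + int (N Y Y X) * (int (N X X X) - int (N X X X'))"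
  "int (N Y Y X) * (int (N Y X X) - int (N Y X X')) + int (N Y X X') * (int (N X X X) - int (N X X X')) = 0"
  "1 + (int (N Y X X) - int (N Y X X')) * (int (N Y X X) + int (N Y X X')) + (int (N X X X) - int (N X X X')) * (int (N X X X) + int (N X X X')) = 0"
  using arg_cong[OF fusion_assoc(1), of int] arg_cong[OF fusion_assoc(2), of int] arg_cong[OF fusion_assoc(3), of int] arg_cong[OF fusion_assoc(4), of int]
  by (simp_all add: algebra_simps)
 have "int (N Y Y Y) = 3 & int (N Y Y X) = 1 & int (N Y X X) = 0 & int (N Y X X') = 0 & int (N X X X) = 0 & int (N X X X') = 1"
 proof (rule near_group[OF refl refl])
  show "rank4_char (int (N Y Y Y)) (int (N Y Y X)) (int (N Y X X)) (int (N Y X X')) (int (N X X X)) (int (N X X X')) (of_real (D Y)) (of_real (D X)) (of_real (D X))"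
   using FP XX by simp
  show "\<not> (D Y : \<int> & D X : \<int>)"
  proof
   assume "D Y : \<int> & D X : \<int>"
   hence "ALL S:I. D S : \<int>" unfolding Ie using D1 XX by auto
   thus False using ni by simp
  qed
  show "1 <= D Y" "1 <= D X" using D(2) inI by auto
 qed (use as psi eps in simp_all)
 thus ?thesis by simp
qed

end

end

section \<open>Objects with an isomorphism \<open>X \<otimes> P \<cong> P\<close>\<close>

context linear_monoidal_category begin

lemma inv_arr_cmp [simp]:
 "isa g ==> isa f ==> src g = tgt f ==> iv (g *. f) = iv f *. iv g"
 by (rule iso_arrI(2)) auto

text \<open>An arbitrary isomorphism \<open>X \<otimes> P \<cong> P\<close>. It is not an action in
  the usual sense: \<open>X\<close> carries no multiplication, and no coherence is imposed on
  \<open>\<psi>\<close>.\<close>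

definition xmod where
 "xmod X P \<psi> \<longleftrightarrow> X : Ob & P : Ob & isa \<psi> & src \<psi> = X >< P & tgt \<psi> = P"

definition xact where
 "xact X \<psi> P M = (\<psi> ox ii M) *. iv (az X P M)"

text \<open>Tensoring a morphism with \<open>X\<close>, read through the isomorphisms at source and
  target. This is functorial in the pairs \<open>(P, \<psi>)\<close> and compatible with right
  tensor factors, with the associator and with the adjunction.\<close>

definition tw where
 "tw X \<psi> \<psi>' G = \<psi>' *. (ii X ox G) *. iv \<psi>"

lemma xmodD: "xmod X P \<psi> ==> X : Ob" "xmod X P \<psi> ==> P : Ob" "xmod X P \<psi> ==> isa \<psi>"
 "xmod X P \<psi> ==> src \<psi> = X >< P" "xmod X P \<psi> ==> tgt \<psi> = P"
 by (auto simp: xmod_def)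

lemma xmod_xact: "xmod X P \<psi> ==> M : Ob ==> xmod X (P >< M) (xact X \<psi> P M)"
 by (simp add: xmod_def xact_def)

lemma inv_xact: "xmod X P \<psi> ==> M : Ob ==> iv (xact X \<psi> P M) = az X P M *. (iv \<psi> ox ii M)"
 by (simp add: xmod_def xact_def)

lemma tw_arr:
 "xmod X P \<psi> ==> xmod X P' \<psi>' ==> ar G ==> src G = P ==> tgt G = P'
  ==> ar (tw X \<psi> \<psi>' G) & src (tw X \<psi> \<psi>' G) = P & tgt (tw X \<psi> \<psi>' G) = P'"
 by (simp add: tw_def xmod_def)

lemma tw_cmp:
 assumes "xmod X P \<psi>" "xmod X P' \<psi>'" "xmod X P'' \<psi>''" "ar F" "src F = P" "tgt F = P'" "ar G" "src G = P'" "tgt G = P''"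
 shows "tw X \<psi> \<psi>'' (G *. F) = tw X \<psi>' \<psi>'' G *. tw X \<psi> \<psi>' F"
 using assms by (simp add: tw_def xmod_def)

lemma tw_ide: "xmod X P \<psi> ==> tw X \<psi> \<psi> (ii P) = ii P"
 by (simp add: tw_def xmod_def)

lemma tw_plus:
 assumes "xmod X P \<psi>" "xmod X P' \<psi>'" "ar F" "src F = P" "tgt F = P'" "ar G" "src G = P" "tgt G = P'"
 shows "tw X \<psi> \<psi>' (F +. G) = tw X \<psi> \<psi>' F +. tw X \<psi> \<psi>' G"
 using assms by (simp add: tw_def xmod_def)

lemma tw_scale:
 assumes "xmod X P \<psi>" "xmod X P' \<psi>'" "ar F" "src F = P" "tgt F = P'" "c : carrier K"
 shows "tw X \<psi> \<psi>' (c |> F) = c |> tw X \<psi> \<psi>' F"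
 using assms by (simp add: tw_def xmod_def)

lemma tw_nul: "xmod X P \<psi> ==> xmod X P' \<psi>' ==> tw X \<psi> \<psi>' (nl P P') = nl P P'"
 by (simp add: tw_def xmod_def)

lemma tw_ten:
 assumes m: "xmod X P \<psi>" "xmod X P' \<psi>'" and G: "ar G" "src G = P" "tgt G = P'" and w: "ar w" "src w = M" "tgt w = M'"
 shows "tw X (xact X \<psi> P M) (xact X \<psi>' P' M') (G ox w) = tw X \<psi> \<psi>' G ox w"
proof -
 have O: "M : Ob" "M' : Ob" using w by auto
 note m' = xmodD[OF m(1)] xmodD[OF m(2)]
 have "tw X (xact X \<psi> P M) (xact X \<psi>' P' M') (G ox w)
  = (\<psi>' ox ii M') *. iv (az X P' M') *. (ii X ox (G ox w)) *. az X P M *. (iv \<psi> ox ii M)"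
  unfolding tw_def inv_xact[OF m(1) O(1)] unfolding xact_def using m' G w O by simp
 also have "... = (\<psi>' ox ii M') *. ((ii X ox G) ox w) *. iv (az X P M) *. az X P M *. (iv \<psi> ox ii M)"
  by (subst cmp_tail[OF asc_inv_nat[of "ii X" G w X P M X P' M']]) (use m' G w O in "simp_all del: ten_ide ten_cmp ten_cmp_tail")
 also have "... = tw X \<psi> \<psi>' G ox w" unfolding tw_def using m' G w O by simp
 finally show ?thesis .
qed

text \<open>The pentagon identity says precisely that the associator respects the isomorphisms
  induced on its two bracketings.\<close>

lemma tw_asc:
 assumes m: "xmod X P \<psi>" and O: "M : Ob" "N : Ob"
 shows "tw X (xact X (xact X \<psi> P M) (P >< M) N) (xact X \<psi> P (M >< N)) (az P M N) = az P M N"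
proof -
 note m' = xmodD[OF m]
 note T = m' O
 have "tw X (xact X (xact X \<psi> P M) (P >< M) N) (xact X \<psi> P (M >< N)) (az P M N)
  = (\<psi> ox ii (M >< N)) *. iv (az X P (M >< N)) *. ((ii X ox az P M N) *. az X (P >< M) N *. (az X P M ox ii N))
   *. ((iv \<psi> ox ii M) ox ii N)"
  unfolding tw_def inv_xact[OF xmod_xact[OF m O(1)] O(2)] inv_xact[OF m O(1)] unfolding xact_def[of X \<psi> P "M >< N"]
  using T by simp
 also have "... = (\<psi> ox ii (M >< N)) *. az (X >< P) M N *. ((iv \<psi> ox ii M) ox ii N)"
  unfolding pentagon_arr[OF m'(1,2) O, symmetric] using T by simp
 also have "az (X >< P) M N *. ((iv \<psi> ox ii M) ox ii N) = (iv \<psi> ox (ii M ox ii N)) *. az P M N"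
  by (rule asc_nat) (use T in simp_all)
 also have "(\<psi> ox ii (M >< N)) *. ... = az P M N" using T by simp
 finally show ?thesis .
qed

lemma tw_asc_inv:
 assumes m: "xmod X P \<psi>" and O: "M : Ob" "N : Ob"
 shows "tw X (xact X \<psi> P (M >< N)) (xact X (xact X \<psi> P M) (P >< M) N) (iv (az P M N)) = iv (az P M N)"
proof (rule iso_cancel_right[of "az P M N"])
 note m' = xmodD[OF m]
 have ms: "xmod X ((P >< M) >< N) (xact X (xact X \<psi> P M) (P >< M) N)" "xmod X (P >< (M >< N)) (xact X \<psi> P (M >< N))"
  using m O by (auto intro!: xmod_xact)
 let ?i = "iv (az P M N)"
 have t: "ar (tw X (xact X \<psi> P (M >< N)) (xact X (xact X \<psi> P M) (P >< M) N) ?i)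
  & src (tw X (xact X \<psi> P (M >< N)) (xact X (xact X \<psi> P M) (P >< M) N) ?i) = P >< (M >< N)
  & tgt (tw X (xact X \<psi> P (M >< N)) (xact X (xact X \<psi> P M) (P >< M) N) ?i) = (P >< M) >< N"
  by (rule tw_arr[OF ms(2,1)]) (use m' O in auto)
 show "ar (tw X (xact X \<psi> P (M >< N)) (xact X (xact X \<psi> P M) (P >< M) N) ?i)"
  "src (tw X (xact X \<psi> P (M >< N)) (xact X (xact X \<psi> P M) (P >< M) N) ?i) = tgt (az P M N)" using t by auto
 have "ii ((P >< M) >< N) = tw X (xact X (xact X \<psi> P M) (P >< M) N) (xact X (xact X \<psi> P M) (P >< M) N) (?i *. az P M N)"
  using tw_ide[OF ms(1)] m' O by simp
 also have "... = tw X (xact X \<psi> P (M >< N)) (xact X (xact X \<psi> P M) (P >< M) N) ?i *. az P M N"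
  by (subst tw_cmp[OF ms(1,2,1)]) (use m' O tw_asc[OF m O] in auto)
 finally show "tw X (xact X \<psi> P (M >< N)) (xact X (xact X \<psi> P M) (P >< M) N) ?i *. az P M N = ?i *. az P M N"
  using m' O by simp
qed (use xmodD[OF m] O in auto)

lemma tw_run:
 assumes m: "xmod X P \<psi>"
 shows "tw X (xact X \<psi> P \<bbbI>) \<psi> (run C P) = run C P"
proof -
 note m' = xmodD[OF m]
 have "tw X (xact X \<psi> P \<bbbI>) \<psi> (run C P) = \<psi> *. ((ii X ox run C P) *. az X P \<bbbI>) *. (iv \<psi> ox ii \<bbbI>)"
  unfolding tw_def inv_xact[OF m obj_unit] using m' by simp
 also have "... = \<psi> *. run C (X >< P) *. (iv \<psi> ox ii \<bbbI>)" unfolding run_ten[OF m'(1,2), symmetric] ..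
 also have "run C (X >< P) *. (iv \<psi> ox ii \<bbbI>) = iv \<psi> *. run C P" by (rule run_nat) (use m' in auto)
 also have "\<psi> *. iv \<psi> *. run C P = run C P" using m' by simp
 finally show ?thesis .
qed

text \<open>All structure maps in \<open>uncurry_arr\<close> are fixed by the twist: the evaluation
  sits in a right tensor factor, the associator and the unit constraint respect the induced
  isomorphisms. So only \<open>F\<close> is twisted.\<close>

lemma tw_uncurry:
 assumes d: "dual_pair C B D ev co" and P: "xmod X P \<psi>" and Z: "xmod X Z \<psi>'" and F: "ar F" "src F = P" "tgt F = Z >< D"
 shows "tw X (xact X \<psi> P B) \<psi>' (uncurry_arr D B ev F Z) = uncurry_arr D B ev (tw X \<psi> (xact X \<psi>' Z D) F) Z"
proof -
 have O: "B : Ob" "D : Ob" and e: "ar ev" "src ev = D >< B" "tgt ev = \<bbbI>" using d by (auto simp: dual_pair_def)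
 note p = xmodD[OF P] and z = xmodD[OF Z]
 have ZD: "xmod X (Z >< D) (xact X \<psi>' Z D)" by (rule xmod_xact[OF Z O(2)])
 have t: "ar (tw X \<psi> (xact X \<psi>' Z D) F) & src (tw X \<psi> (xact X \<psi>' Z D) F) = P & tgt (tw X \<psi> (xact X \<psi>' Z D) F) = Z >< D"
  by (rule tw_arr[OF P ZD F])
 have 1: "tw X (xact X \<psi> P B) (xact X (xact X \<psi>' Z D) (Z >< D) B) (F ox ii B) = tw X \<psi> (xact X \<psi>' Z D) F ox ii B"
  by (rule tw_ten[OF P ZD F]) (use O in auto)
 have 2: "tw X (xact X \<psi>' Z (D >< B)) (xact X \<psi>' Z \<bbbI>) (ii Z ox ev) = ii Z ox ev"
  by (subst tw_ten[OF Z Z _ _ _ e]) (use z tw_ide[OF Z] in auto)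
 have m: "xmod X (P >< B) (xact X \<psi> P B)" "xmod X ((Z >< D) >< B) (xact X (xact X \<psi>' Z D) (Z >< D) B)"
  "xmod X (Z >< (D >< B)) (xact X \<psi>' Z (D >< B))" "xmod X (Z >< \<bbbI>) (xact X \<psi>' Z \<bbbI>)"
  using P Z ZD O by (auto intro!: xmod_xact)
 have "tw X (xact X \<psi> P B) \<psi>' (uncurry_arr D B ev F Z)
   = tw X (xact X \<psi>' Z \<bbbI>) \<psi>' (run C Z) *. tw X (xact X \<psi> P B) (xact X \<psi>' Z \<bbbI>) ((ii Z ox ev) *. az Z D B *. (F ox ii B))"
  unfolding uncurry_arr_def by (rule tw_cmp[OF m(1,4) Z]) (use O e z F in auto)
 also have "tw X (xact X \<psi> P B) (xact X \<psi>' Z \<bbbI>) ((ii Z ox ev) *. az Z D B *. (F ox ii B))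
  = tw X (xact X \<psi>' Z (D >< B)) (xact X \<psi>' Z \<bbbI>) (ii Z ox ev) *. tw X (xact X \<psi> P B) (xact X \<psi>' Z (D >< B)) (az Z D B *. (F ox ii B))"
  by (rule tw_cmp[OF m(1,3,4)]) (use O e z F in auto)
 also have "tw X (xact X \<psi> P B) (xact X \<psi>' Z (D >< B)) (az Z D B *. (F ox ii B))
  = tw X (xact X (xact X \<psi>' Z D) (Z >< D) B) (xact X \<psi>' Z (D >< B)) (az Z D B) *. tw X (xact X \<psi> P B) (xact X (xact X \<psi>' Z D) (Z >< D) B) (F ox ii B)"
  by (rule tw_cmp[OF m(1,2,3)]) (use O e z F in auto)
 finally show ?thesis unfolding 1 2 tw_run[OF Z] tw_asc[OF Z O(2,1)] uncurry_arr_def .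
qed

definition eig where
 "eig X P \<psi> P' \<psi>' \<mu> = {G : hm P P'. tw X \<psi> \<psi>' G = \<mu> |> G}"

lemma eig_submodule:
 assumes "xmod X P \<psi>" "xmod X P' \<psi>'" "\<mu> : carrier K"
 shows "submodule K (eig X P \<psi> P' \<psi>' \<mu>) (HomV C P P')"
proof (rule submodule_homI)
 show "P : Ob" "P' : Ob" using xmodD assms by auto
 show "nl P P' : eig X P \<psi> P' \<psi>' \<mu>" using tw_nul[OF assms(1,2)] xmodD(2)[OF assms(1)] xmodD(2)[OF assms(2)] assms(3)
  by (simp add: eig_def hom_iff)
 show "f +. g : eig X P \<psi> P' \<psi>' \<mu>" if "f : eig X P \<psi> P' \<psi>' \<mu>" "g : eig X P \<psi> P' \<psi>' \<mu>" for f g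
  using that tw_plus[OF assms(1,2), of f g] assms(3) by (auto simp: eig_def hom_iff)
 show "c |> f : eig X P \<psi> P' \<psi>' \<mu>" if "c : carrier K" "f : eig X P \<psi> P' \<psi>' \<mu>" for c f
  using that tw_scale[OF assms(1,2), of f c] assms(3) m_comm[of c \<mu>] by (auto simp: eig_def hom_iff)
qed (auto simp: eig_def)

end

section \<open>Eigenspaces of the twist\<close>

context ac_fusion begin

lemma subdim_pos:
 assumes "X : Ob" "Y : Ob" "submodule K W (HomV C X Y)" "w : W" "w ~= nl X Y"
 shows "sd (HomV C X Y) W \<ge> 1"
proof -
 interpret v: vectorspace K "HomV C X Y" by (rule vectorspace_HomV) fact+
 have "sd (HomV C X Y) W ~= 0"
  using v.subdim_eq_0[OF fd_hom[OF assms(1,2)] assms(3)] assms(4,5) by (auto simp: HomV_ops)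
 thus ?thesis by simp
qed

lemma subdim_inj_le:
 assumes O: "X : Ob" "Y : Ob" "X' : Ob" "Y' : Ob"
  and W: "submodule K W (HomV C X Y)" and W': "submodule K W' (HomV C X' Y')"
  and T: "linear_on K (HomV C X Y) (HomV C X' Y') W T" "inj_on T W" "T ` W \<subseteq> W'"
 shows "sd (HomV C X Y) W <= sd (HomV C X' Y') W'"
proof -
 note v = vectorspace_HomV[OF O(1,2)] fd_hom[OF O(1,2)] vectorspace_HomV[OF O(3,4)]
 have "sd (HomV C X Y) W = sd (HomV C X' Y') (T ` W)" by (rule subdim_bij[OF v W T(1,2)])
 also have "... <= sd (HomV C X' Y') W'"
  by (rule subdim_mono[OF v(3) fd_hom[OF O(3,4)] rank_nullity_on(2)[OF v W T(1)] W' T(3)])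
 finally show ?thesis .
qed

lemma linear_inj_on:
 assumes O: "X : Ob" "Y : Ob" and W: "submodule K W (HomV C X Y)"
  and T: "linear_on K (HomV C X Y) (HomV C X' Y') W T" and O': "X' : Ob" "Y' : Ob"
  and z: "!!f. f : W ==> T f = nl X' Y' ==> f = nl X Y"
 shows "inj_on T W"
proof (rule inj_onI)
 interpret v: vectorspace K "HomV C X Y" by (rule vectorspace_HomV) fact+
 interpret W: submodule K W "HomV C X Y" by fact
 fix f g assume fg: "f : W" "g : W" "T f = T g"
 have h: "f : hm X Y" "g : hm X Y" using fg W.subset by auto
 have mg: "(\<ominus>\<^sub>K \<one>\<^sub>K) |> g : W" using W.smult_closed[of "\<ominus>\<^sub>K \<one>\<^sub>K" g] fg h by (simp add: HomV_ops)
 have d: "f +. (\<ominus>\<^sub>K \<one>\<^sub>K) |> g : W" using W.m_closed[OF fg(1) mg] h by (simp add: HomV_ops)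
 have Th: "T f : hm X' Y'" "T g : hm X' Y'" using T fg by (auto simp: linear_on_def)
 have "T (f +. (\<ominus>\<^sub>K \<one>\<^sub>K) |> g) = T f +. T ((\<ominus>\<^sub>K \<one>\<^sub>K) |> g)"
  using T fg mg h Th by (auto simp: linear_on_def HomV_ops)
 also have "T ((\<ominus>\<^sub>K \<one>\<^sub>K) |> g) = (\<ominus>\<^sub>K \<one>\<^sub>K) |> T g"
 proof -
  have c: "\<ominus>\<^sub>K \<one>\<^sub>K : carrier K" by simp
  have "T ((\<ominus>\<^sub>K \<one>\<^sub>K) \<odot>\<^bsub>HomV C X Y\<^esub> g) = (\<ominus>\<^sub>K \<one>\<^sub>K) \<odot>\<^bsub>HomV C X' Y'\<^esub> T g"
   using T fg(2) c unfolding linear_on_def by blast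
  thus ?thesis unfolding HomV_ops(2)[OF h(2)] HomV_ops(2)[OF Th(2)] .
 qed
 also have "T f +. (\<ominus>\<^sub>K \<one>\<^sub>K) |> T g = nl X' Y'" unfolding fg(3) using Th by (simp add: hom_iff)
 finally have n: "f +. (\<ominus>\<^sub>K \<one>\<^sub>K) |> g = nl X Y" by (rule z[OF d])
 show "f = g" by (rule diff_eq_nul) (use n h in "auto simp: hom_iff")
qed

text \<open>A geometric multiplicity; the twist is not assumed to be diagonalizable.\<close>

definition eigdim where
 "eigdim X Y \<phi> N \<mu> = sd (HomV C (Y >< N) Y) (eig X (Y >< N) (xact X \<phi> Y N) Y \<phi> \<mu>)"

text \<open>The twist acts through the left factor and leaves \<open>id \<otimes> w\<close>
  unchanged, so the eigenspaces are functorial in \<open>N\<close>. Their additivity rests on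
  this.\<close>

lemma eig_precomp:
 assumes m: "xmod X Y \<phi>" and \<mu>: "\<mu> : carrier K" and w: "ar w" "src w = N" "tgt w = N'"
  and f: "f : eig X (Y >< N') (xact X \<phi> Y N') Y \<phi> \<mu>"
 shows "f *. (ii Y ox w) : eig X (Y >< N) (xact X \<phi> Y N) Y \<phi> \<mu>"
proof -
 have O: "N : Ob" "N' : Ob" using w by auto
 note m' = xmodD[OF m]
 have fa: "ar f" "src f = Y >< N'" "tgt f = Y" "tw X (xact X \<phi> Y N') \<phi> f = \<mu> |> f" using f by (auto simp: eig_def hom_iff)
 have "tw X (xact X \<phi> Y N) \<phi> (f *. (ii Y ox w)) = tw X (xact X \<phi> Y N') \<phi> f *. tw X (xact X \<phi> Y N) (xact X \<phi> Y N') (ii Y ox w)"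
  by (rule tw_cmp[OF xmod_xact[OF m O(1)] xmod_xact[OF m O(2)] m]) (use fa w m' in auto)
 also have "tw X (xact X \<phi> Y N) (xact X \<phi> Y N') (ii Y ox w) = ii Y ox w"
  by (subst tw_ten[OF m m _ _ _ w]) (use m' tw_ide[OF m] in auto)
 finally show ?thesis using fa w m' \<mu> by (auto simp: eig_def hom_iff)
qed

lemma eigdim_biproduct:
 assumes m: "xmod X Y \<phi>" and \<mu>: "\<mu> : carrier K" and b: "biproduct C J M N i p"
 shows "eigdim X Y \<phi> N \<mu> = (\<Sum>j\<in>J. eigdim X Y \<phi> (M j) \<mu>)"
 unfolding eigdim_def
proof (rule subdim_decompose[where p = "%j f. f *. (ii Y ox i j)" and q = "%j f. f *. (ii Y ox p j)"])
 note b' = biproductD[OF b] and m' = xmodD[OF m]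
 let ?E = "%N. eig X (Y >< N) (xact X \<phi> Y N) Y \<phi> \<mu>"
 have E: "f : ?E A ==> ar f & src f = Y >< A & tgt f = Y" for f A by (auto simp: eig_def hom_iff)
 show "finite J" by (rule b')
 show "vectorspace K (HomV C (Y >< N) Y)" "vectorspace.fin_dim K (HomV C (Y >< N) Y)"
  using vectorspace_HomV[OF obj_ten[OF m'(2) b'(2)] m'(2)] fd_hom[OF obj_ten[OF m'(2) b'(2)] m'(2)] by simp_all
 show "submodule K (?E N) (HomV C (Y >< N) Y)" by (rule eig_submodule[OF xmod_xact[OF m b'(2)] m \<mu>])
 show "vectorspace K (HomV C (Y >< M j) Y)" if "j : J" for j using vectorspace_HomV m' b'(11)[OF that] by auto
 show "linear_on K (HomV C (Y >< N) Y) (HomV C (Y >< M j) Y) (?E N) (%f. f *. (ii Y ox i j))" if j: "j : J" for j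
 proof (rule linear_on_homI)
  show "?E N \<subseteq> hm (Y >< N) Y" by (auto simp: eig_def)
  show "f *. (ii Y ox i j) : hm (Y >< M j) Y" if "f : ?E N" for f
   using E[OF that] b'(3,4,5)[OF j] m' by (simp add: hom_iff)
  show "(f +. g) *. (ii Y ox i j) = f *. (ii Y ox i j) +. g *. (ii Y ox i j)" if "f : ?E N" "g : ?E N" for f g
   using E[OF that(1)] E[OF that(2)] b'(3,4,5)[OF j] m' by simp
  show "(c |> f) *. (ii Y ox i j) = c |> (f *. (ii Y ox i j))" if "c : carrier K" "f : ?E N" for c f
   using that(1) E[OF that(2)] b'(3,4,5)[OF j] m' by simp
 qed
 show "f *. (ii Y ox i j) : ?E (M j)" if "j : J" "f : ?E N" for j f
  by (rule eig_precomp[OF m \<mu> b'(3,4,5)]) (use that in auto)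
 show "f *. (ii Y ox p j) : ?E N" if "j : J" "f : ?E (M j)" for j f
  by (rule eig_precomp[OF m \<mu> b'(6,8,7)]) (use that in auto)
 show "(f *. (ii Y ox p j)) *. (ii Y ox i j) = f" if "j : J" "f : ?E (M j)" for j f
  using E[OF that(2)] b' that(1) m' by simp
 show "(f *. (ii Y ox p j)) *. (ii Y ox i k) = \<zero>\<^bsub>HomV C (Y >< M k) Y\<^esub>" if "k : J" "j : J" "k ~= j" "f : ?E (M j)" for j k f
  using E[OF that(4)] b' that(1,2,3) m' by (simp add: HomV_ops)
 show "f = \<zero>\<^bsub>HomV C (Y >< N) Y\<^esub>" if f: "f : ?E N" "!!j. j : J ==> f *. (ii Y ox i j) = \<zero>\<^bsub>HomV C (Y >< M j) Y\<^esub>" for f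
 proof -
  have bY: "biproduct C {()} (%_. Y) Y (%_. ii Y) (%_. ii Y)"
  proof -
   interpret v: vectorspace K "HomV C Y Y" by (rule vectorspace_HomV) (use m' in auto)
   show ?thesis using m' by (simp add: biproduct_def hom_iff HomV_ops)
  qed
  have "f = nl (Y >< N) Y"
   by (rule biproduct_jointly_epic[OF biproduct_ten[OF bY b]]) (use f E[OF f(1)] b' m' in "auto simp: hom_iff HomV_ops")
  thus ?thesis by (simp add: HomV_ops)
 qed
qed

lemma eigdim_iso_le:
 assumes m: "xmod X Y \<phi>" and \<mu>: "\<mu> : carrier K" and u: "isa u" "src u = N" "tgt u = N'"
 shows "eigdim X Y \<phi> N' \<mu> <= eigdim X Y \<phi> N \<mu>"
 unfolding eigdim_def
proof (rule subdim_inj_le)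
 have O: "N : Ob" "N' : Ob" using u arr_obj[of u] by auto
 note m' = xmodD[OF m]
 let ?E = "%N. eig X (Y >< N) (xact X \<phi> Y N) Y \<phi> \<mu>"
 have E: "f : ?E A ==> ar f & src f = Y >< A & tgt f = Y" for f A by (auto simp: eig_def hom_iff)
 show "Y >< N : Ob" "Y : Ob" "Y >< N' : Ob" "Y : Ob" using O m' by auto
 show "submodule K (?E N) (HomV C (Y >< N) Y)" "submodule K (?E N') (HomV C (Y >< N') Y)"
  by (rule eig_submodule[OF xmod_xact[OF m O(1)] m \<mu>]) (rule eig_submodule[OF xmod_xact[OF m O(2)] m \<mu>])
 show "linear_on K (HomV C (Y >< N') Y) (HomV C (Y >< N) Y) (?E N') (%f. f *. (ii Y ox u))"
 proof (rule linear_on_homI)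
  show "?E N' \<subseteq> hm (Y >< N') Y" by (auto simp: eig_def)
  show "f *. (ii Y ox u) : hm (Y >< N) Y" if "f : ?E N'" for f
   using E[OF that] u m' by (simp add: hom_iff)
  show "(f +. g) *. (ii Y ox u) = f *. (ii Y ox u) +. g *. (ii Y ox u)" if "f : ?E N'" "g : ?E N'" for f g
   using E[OF that(1)] E[OF that(2)] u m' by simp
  show "(c |> f) *. (ii Y ox u) = c |> (f *. (ii Y ox u))" if "c : carrier K" "f : ?E N'" for c f
   using that(1) E[OF that(2)] u m' by simp
 qed
 show "inj_on (%f. f *. (ii Y ox u)) (?E N')"
 proof (rule inj_onI)
  fix f g assume fg: "f : ?E N'" "g : ?E N'" "f *. (ii Y ox u) = g *. (ii Y ox u)"
  show "f = g" by (rule iso_cancel_right[OF _ _ _ _ _ fg(3)]) (use u m' E[OF fg(1)] E[OF fg(2)] in auto)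
 qed
 show "(%f. f *. (ii Y ox u)) ` ?E N' \<subseteq> ?E N" using eig_precomp[OF m \<mu> _ u(2,3)] u(1) by auto
qed

lemma eigdim_iso:
 assumes m: "xmod X Y \<phi>" and \<mu>: "\<mu> : carrier K" and N: "N : Ob" "N' : Ob" "isom N N'"
 shows "eigdim X Y \<phi> N \<mu> = eigdim X Y \<phi> N' \<mu>"
proof -
 obtain u where u: "isa u" "src u = N" "tgt u = N'" using isomorphic_iff[OF N(1,2)] N(3) by blast
 show ?thesis using eigdim_iso_le[OF m \<mu> u] eigdim_iso_le[OF m \<mu>, of "iv u" N' N] u by simp
qed

lemma eigdim_sum:
 assumes I: "reps I" and m: "xmod X Y \<phi>" and \<mu>: "\<mu> : carrier K" and N: "N : Ob"
 shows "eigdim X Y \<phi> N \<mu> = (\<Sum>T\<in>I. dm T N * eigdim X Y \<phi> T \<mu>)"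
proof -
 obtain n S i p where S: "!!j. j < n ==> smp (S j)" and b: "biproduct C {..<n::nat} S N i p"
  by (rule semisimple_biproduct[OF N]) blast
 have "eigdim X Y \<phi> N \<mu> = (\<Sum>j<n. eigdim X Y \<phi> (S j) \<mu>)" by (rule eigdim_biproduct[OF m \<mu> b])
 also have "... = (\<Sum>T\<in>I. of_nat (dm T N) * eigdim X Y \<phi> T \<mu>)"
  by (rule sum_simples[OF I S b]) (use eigdim_iso[OF m \<mu>] simple_obj in auto)
 finally show ?thesis by simp
qed

text \<open>The right unit constraint of \<open>Y\<close> is fixed by the twist and is a non-zero
  vector.\<close>

lemma eigdim_unit:
 assumes m: "xmod X Y \<phi>" and Y: "\<not> zero_object C Y"
 shows "eigdim X Y \<phi> \<bbbI> \<one>\<^sub>K \<ge> 1"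
 unfolding eigdim_def
proof (rule subdim_pos)
 note m' = xmodD[OF m]
 show "Y >< \<bbbI> : Ob" "Y : Ob" using m' by auto
 show "submodule K (eig X (Y >< \<bbbI>) (xact X \<phi> Y \<bbbI>) Y \<phi> \<one>\<^sub>K) (HomV C (Y >< \<bbbI>) Y)"
  by (rule eig_submodule[OF xmod_xact[OF m obj_unit] m]) simp
 show "run C Y : eig X (Y >< \<bbbI>) (xact X \<phi> Y \<bbbI>) Y \<phi> \<one>\<^sub>K" using tw_run[OF m] m' by (simp add: eig_def hom_iff)
 show "run C Y ~= nl (Y >< \<bbbI>) Y"
 proof
  assume e: "run C Y = nl (Y >< \<bbbI>) Y"
  have "ii Y = run C Y *. iv (run C Y)" using m' by simp
  also have "... = nl Y Y" by (subst e) (use m' in auto)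
  finally show False using Y zero_object_iff m' by blast
 qed
qed

text \<open>Here \<open>Y\<close> is a left dual of \<open>B\<close>, so currying takes maps from
  \<open>(Y \<otimes> Y) \<otimes> B\<close> to \<open>Y\<close> injectively to endomorphisms of
  \<open>Y \<otimes> Y\<close>. It commutes with the twist by \<open>tw_uncurry\<close> and
  preserves eigenvalues.\<close>

lemma eigdim_dual_le:
 assumes m: "xmod X Y \<phi>" and \<mu>: "\<mu> : carrier K" and d: "dual_pair C B Y ev co"
 shows "eigdim X Y \<phi> (Y >< B) \<mu> <= sd (HomV C (Y >< Y) (Y >< Y)) (eig X (Y >< Y) (xact X \<phi> Y Y) (Y >< Y) (xact X \<phi> Y Y) \<mu>)"
 unfolding eigdim_def
proof (rule subdim_inj_le)
 note m' = xmodD[OF m]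
 have B: "B : Ob" and co: "ar co" "src co = \<bbbI>" "tgt co = B >< Y" and ev: "ar ev" "src ev = Y >< B" "tgt ev = \<bbbI>"
  using d by (auto simp: dual_pair_def)
 note T = m' B co
 let ?H = "eig X (Y >< (Y >< B)) (xact X \<phi> Y (Y >< B)) Y \<phi> \<mu>"
 let ?E = "eig X (Y >< Y) (xact X \<phi> Y Y) (Y >< Y) (xact X \<phi> Y Y) \<mu>"
 let ?S = "%f. curry_arr Y B co (f *. az Y Y B) (Y >< Y)"
 have H: "f : ?H ==> ar f & src f = Y >< (Y >< B) & tgt f = Y" for f by (auto simp: eig_def hom_iff)
 show "Y >< (Y >< B) : Ob" "Y : Ob" "Y >< Y : Ob" "Y >< Y : Ob" using T by auto
 have mYB: "xmod X (Y >< (Y >< B)) (xact X \<phi> Y (Y >< B))" and mYY: "xmod X (Y >< Y) (xact X \<phi> Y Y)"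
  and mYYB: "xmod X ((Y >< Y) >< B) (xact X (xact X \<phi> Y Y) (Y >< Y) B)"
  using m T by (auto intro!: xmod_xact)
 show "submodule K ?H (HomV C (Y >< (Y >< B)) Y)" by (rule eig_submodule[OF mYB m \<mu>])
 show "submodule K ?E (HomV C (Y >< Y) (Y >< Y))" by (rule eig_submodule[OF mYY mYY \<mu>])
 have S: "ar (?S f) & src (?S f) = Y >< Y & tgt (?S f) = Y >< Y" if "ar f" "src f = Y >< (Y >< B)" "tgt f = Y" for f
  using that T by (simp add: curry_arr_def)
 show "linear_on K (HomV C (Y >< (Y >< B)) Y) (HomV C (Y >< Y) (Y >< Y)) ?H ?S"
 proof (rule linear_on_homI)
  show "?H \<subseteq> hm (Y >< (Y >< B)) Y" by (auto simp: eig_def)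
  show "?S f : hm (Y >< Y) (Y >< Y)" if "f : ?H" for f using S[of f] H[OF that] by (simp add: hom_iff)
  show "?S (f +. g) = ?S f +. ?S g" if "f : ?H" "g : ?H" for f g
   using H[OF that(1)] H[OF that(2)] T by (simp add: curry_arr_def)
  show "?S (c |> f) = c |> ?S f" if "c : carrier K" "f : ?H" for c f
   using that(1) H[OF that(2)] T by (simp add: curry_arr_def)
 qed
 have U: "uncurry_arr Y B ev (?S f) Y = f *. az Y Y B" if "f : ?H" for f
  by (rule uncurry_curry[OF d]) (use H[OF that] T in auto)
 show "inj_on ?S ?H"
 proof (rule inj_onI)
  fix f g assume fg: "f : ?H" "g : ?H" "?S f = ?S g"
  have "f *. az Y Y B = g *. az Y Y B"
   by (rule trans[OF sym[OF U[OF fg(1)]] trans[OF arg_cong[OF fg(3), of "%F. uncurry_arr Y B ev F Y"] U[OF fg(2)]]])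
  thus "f = g"
   by (rule iso_cancel_right[of "az Y Y B", rotated 5]) (use H[OF fg(1)] H[OF fg(2)] T in simp_all)
 qed
 show "?S ` ?H \<subseteq> ?E"
 proof
  fix F assume "F : ?S ` ?H"
  then obtain f where f: "f : ?H" "F = ?S f" by blast
  note fa = H[OF f(1)]
  have UF: "uncurry_arr Y B ev F Y = f *. az Y Y B" unfolding f(2) by (rule U[OF f(1)])
  have Fa: "ar F" "src F = Y >< Y" "tgt F = Y >< Y" unfolding f(2) using S[of f] fa by blast+
  have t: "ar (tw X (xact X \<phi> Y Y) (xact X \<phi> Y Y) F) & src (tw X (xact X \<phi> Y Y) (xact X \<phi> Y Y) F) = Y >< Y & tgt (tw X (xact X \<phi> Y Y) (xact X \<phi> Y Y) F) = Y >< Y"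
   by (rule tw_arr[OF mYY mYY Fa])
  have "uncurry_arr Y B ev (tw X (xact X \<phi> Y Y) (xact X \<phi> Y Y) F) Y = tw X (xact X (xact X \<phi> Y Y) (Y >< Y) B) \<phi> (uncurry_arr Y B ev F Y)"
   by (rule tw_uncurry[OF d mYY m Fa, symmetric])
  also have "... = tw X (xact X (xact X \<phi> Y Y) (Y >< Y) B) \<phi> (f *. az Y Y B)" unfolding UF ..
  also have "... = tw X (xact X \<phi> Y (Y >< B)) \<phi> f *. tw X (xact X (xact X \<phi> Y Y) (Y >< Y) B) (xact X \<phi> Y (Y >< B)) (az Y Y B)"
   by (rule tw_cmp[OF mYYB mYB m]) (use fa T in auto)
  also have "... = (\<mu> |> f) *. az Y Y B" using f(1) tw_asc[OF m m'(2) B] by (simp add: eig_def)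
  also have "... = \<mu> |> uncurry_arr Y B ev F Y" unfolding UF using fa \<mu> T by simp
  also have "... = uncurry_arr Y B ev (\<mu> |> F) Y" unfolding uncurry_arr_def using Fa \<mu> T ev by simp
  finally have e: "uncurry_arr Y B ev (tw X (xact X \<phi> Y Y) (xact X \<phi> Y Y) F) Y = uncurry_arr Y B ev (\<mu> |> F) Y" .
  have "tw X (xact X \<phi> Y Y) (xact X \<phi> Y Y) F = curry_arr Y B co (uncurry_arr Y B ev (tw X (xact X \<phi> Y Y) (xact X \<phi> Y Y) F) Y) (Y >< Y)"
   by (rule curry_uncurry[OF d, symmetric]) (use t T in auto)
  also have "... = \<mu> |> F" unfolding e
   by (rule curry_uncurry[OF d]) (use Fa T \<mu> in auto)
  finally show "F : ?E" using Fa by (simp add: eig_def hom_iff)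
 qed
qed

end

section \<open>Triangularizing the twist\<close>

lemma submodule_Int:
 assumes "submodule K U V" "submodule K W V"
 shows "submodule K (U \<inter> W) V"
 using assms by (auto simp: submodule_def)

context vectorspace begin

lemma submodule_zero: "submodule K {\<zero>\<^sub>V} V"
 by (rule submoduleI') auto

lemma line_coeff_unique:
 assumes W: "submodule K W V" and v: "v : carrier V" "v \<notin> W"
  and w: "w : W" "w' : W" "c : carrier K" "c' : carrier K" "w \<oplus>\<^sub>V c \<odot>\<^sub>V v = w' \<oplus>\<^sub>V c' \<odot>\<^sub>V v"
 shows "c = c'"
proof (rule ccontr)
 assume ne: "c ~= c'"
 interpret W: submodule K W V by fact
 have wc: "w : carrier V" "w' : carrier V" using w W.subset by auto
 have mw: "\<ominus>\<^sub>V w : W" using W.smult_closed[of "\<ominus>\<^sub>K \<one>\<^sub>K" w] w(1) smult_minus_1[OF wc(1)] by simp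
 have "c \<odot>\<^sub>V v = \<ominus>\<^sub>V w \<oplus>\<^sub>V (w \<oplus>\<^sub>V c \<odot>\<^sub>V v)" using wc v w(3) by (simp add: M.r_neg1)
 hence cv: "c \<odot>\<^sub>V v = (\<ominus>\<^sub>V w \<oplus>\<^sub>V w') \<oplus>\<^sub>V c' \<odot>\<^sub>V v" unfolding w(5) using wc v w(4) by (simp add: M.a_assoc)
 define d where "d = c \<oplus>\<^sub>K \<ominus>\<^bsub>K\<^esub> c'"
 have dc: "d : carrier K" using w by (simp add: d_def)
 have "d \<odot>\<^sub>V v = c \<odot>\<^sub>V v \<oplus>\<^sub>V \<ominus>\<^bsub>V\<^esub> (c' \<odot>\<^sub>V v)"
  unfolding d_def using w v by (simp add: smult_l_distr smult_l_minus)
 also have "... = \<ominus>\<^sub>V w \<oplus>\<^sub>V w'" unfolding cv using wc v w(4) by (simp add: M.a_assoc M.r_neg)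
 finally have dv: "d \<odot>\<^sub>V v : W" using W.m_closed[OF mw w(2)] by simp
 have "d ~= \<zero>\<^sub>K"
 proof
  assume "d = \<zero>\<^sub>K"
  hence "c \<oplus>\<^sub>K \<ominus>\<^bsub>K\<^esub> c' \<oplus>\<^sub>K c' = c'" using w by (simp add: d_def)
  thus False using ne w by (simp add: R.a_assoc R.l_neg)
 qed
 hence u: "d : Units K" using dc field_Units by blast
 have "v = (inv\<^bsub>K\<^esub> d \<otimes>\<^sub>K d) \<odot>\<^sub>V v" using R.Units_l_inv[OF u] v by (simp add: smult_one)
 also have "... = inv\<^bsub>K\<^esub> d \<odot>\<^sub>V (d \<odot>\<^sub>V v)" by (rule smult_assoc1) (use R.Units_inv_closed[OF u] dc v in auto)
 finally have "v : W" using W.smult_closed[OF R.Units_inv_closed[OF u] dv] by simp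
 thus False using v by simp
qed

lemma scale_unique:
 assumes v: "v : carrier V" and c: "c : carrier K" "c' : carrier K" and e: "c \<odot>\<^sub>V v = c' \<odot>\<^sub>V v" "c ~= c'"
 shows "v = \<zero>\<^sub>V"
proof (rule ccontr)
 assume nz: "v ~= \<zero>\<^sub>V"
 from line_coeff_unique[OF submodule_zero v _ _ _ c, of "\<zero>\<^sub>V" "\<zero>\<^sub>V"] show False using nz e by simp
qed

text \<open>The projection of \<open>W + K v\<close> to the line of \<open>v\<close> along
  \<open>W\<close>. It has no values outside this sum and is fed into
  \<open>rank_nullity_on\<close>.\<close>

lemma line_extension:
 assumes W: "submodule K W V" and v: "v : carrier V" "v \<notin> W"
 defines "W' == {w \<oplus>\<^sub>V c \<odot>\<^sub>V v | w c. w : W & c : carrier K}"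
 obtains \<pi> where "submodule K W' V" "linear_on K V V W' \<pi>" "ALL w:W. ALL c:carrier K. \<pi> (w \<oplus>\<^sub>V c \<odot>\<^sub>V v) = c \<odot>\<^sub>V v"
  "\<pi> ` W' = {c \<odot>\<^sub>V v | c. c : carrier K}" "{u : W'. \<pi> u = \<zero>\<^sub>V} = W" "W \<subseteq> W'" "v : W'"
proof -
 interpret W: submodule K W V by fact
 have wc: "w : carrier V" if "w : W" for w using that W.subset by auto
 define \<pi> where "\<pi> u = (SOME c. c : carrier K & (EX w:W. u = w \<oplus>\<^sub>V c \<odot>\<^sub>V v)) \<odot>\<^sub>V v" for u
 have p: "\<pi> (w \<oplus>\<^sub>V c \<odot>\<^sub>V v) = c \<odot>\<^sub>V v" if w: "w : W" "c : carrier K" for w c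
 proof -
  have "(SOME c'. c' : carrier K & (EX w':W. w \<oplus>\<^sub>V c \<odot>\<^sub>V v = w' \<oplus>\<^sub>V c' \<odot>\<^sub>V v)) = c"
  proof (rule some_equality)
   show "c : carrier K & (EX w':W. w \<oplus>\<^sub>V c \<odot>\<^sub>V v = w' \<oplus>\<^sub>V c \<odot>\<^sub>V v)" using w by blast
   fix c' assume "c' : carrier K & (EX w':W. w \<oplus>\<^sub>V c \<odot>\<^sub>V v = w' \<oplus>\<^sub>V c' \<odot>\<^sub>V v)"
   then obtain w' where "c' : carrier K" "w' : W" "w \<oplus>\<^sub>V c \<odot>\<^sub>V v = w' \<oplus>\<^sub>V c' \<odot>\<^sub>V v" by blast
   thus "c' = c" using line_coeff_unique[OF W v w(1) _ w(2)] by metis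
  qed
  thus ?thesis by (simp add: \<pi>_def)
 qed
 have add: "(w \<oplus>\<^sub>V c \<odot>\<^sub>V v) \<oplus>\<^sub>V (w' \<oplus>\<^sub>V c' \<odot>\<^sub>V v) = (w \<oplus>\<^sub>V w') \<oplus>\<^sub>V (c \<oplus>\<^sub>K c') \<odot>\<^sub>V v"
  if "w : W" "w' : W" "c : carrier K" "c' : carrier K" for w w' c c'
  using that wc v by (simp add: smult_l_distr M.a_ac)
 have sc: "d \<odot>\<^sub>V (w \<oplus>\<^sub>V c \<odot>\<^sub>V v) = d \<odot>\<^sub>V w \<oplus>\<^sub>V (d \<otimes>\<^sub>K c) \<odot>\<^sub>V v"
  if "w : W" "d : carrier K" "c : carrier K" for w c d
  using that wc v by (simp add: smult_r_distr smult_assoc1)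
 have W0: "w : W'" "\<pi> w = \<zero>\<^sub>V" if "w : W" for w
 proof -
  have e: "w = w \<oplus>\<^sub>V \<zero>\<^sub>K \<odot>\<^sub>V v" using that wc v by (simp add: lmult_0)
  show "w : W'" unfolding W'_def using e that by blast
  show "\<pi> w = \<zero>\<^sub>V" using p[OF that, of "\<zero>\<^sub>K"] e[symmetric] v by (simp add: lmult_0)
 qed
 have v0: "v : W'"
 proof -
  have "v = \<zero>\<^sub>V \<oplus>\<^sub>V \<one>\<^sub>K \<odot>\<^sub>V v" using v by (simp add: smult_one)
  thus ?thesis unfolding W'_def using W.zero_closed by blast
 qed
 have s: "submodule K W' V"
 proof (rule submoduleI')
  show "W' \<subseteq> carrier V" using wc v by (auto simp: W'_def)
  show "\<zero>\<^sub>V : W'" by (rule W0(1)) simp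
  fix x y assume "x : W'" "y : W'"
  then obtain w c w' c' where "w : W" "c : carrier K" "x = w \<oplus>\<^sub>V c \<odot>\<^sub>V v" "w' : W" "c' : carrier K" "y = w' \<oplus>\<^sub>V c' \<odot>\<^sub>V v"
   unfolding W'_def by blast
  thus "x \<oplus>\<^sub>V y : W'" using add[of w w' c c'] W.m_closed[of w w'] unfolding W'_def by auto
 next
  fix d x assume d: "d : carrier K" and "x : W'"
  then obtain w c where "w : W" "c : carrier K" "x = w \<oplus>\<^sub>V c \<odot>\<^sub>V v" unfolding W'_def by blast
  thus "d \<odot>\<^sub>V x : W'" using sc[of w d c] d W.smult_closed[of d w] unfolding W'_def by auto
 qed
 have im: "\<pi> ` W' = {c \<odot>\<^sub>V v | c. c : carrier K}"
 proof
  show "\<pi> ` W' \<subseteq> {c \<odot>\<^sub>V v | c. c : carrier K}" using p unfolding W'_def by auto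
  show "{c \<odot>\<^sub>V v | c. c : carrier K} \<subseteq> \<pi> ` W'"
  proof
   fix x assume "x : {c \<odot>\<^sub>V v | c. c : carrier K}"
   then obtain c where c: "c : carrier K" "x = c \<odot>\<^sub>V v" by blast
   have "\<pi> (\<zero>\<^bsub>V\<^esub> \<oplus>\<^sub>V c \<odot>\<^sub>V v) = x" using p[OF W.zero_closed c(1)] c(2) by simp
   moreover have "\<zero>\<^sub>V \<oplus>\<^sub>V c \<odot>\<^sub>V v : W'" unfolding W'_def using W.zero_closed c(1) by blast
   ultimately show "x : \<pi> ` W'" by blast
  qed
 qed
 have l: "linear_on K V V W' \<pi>"
  unfolding linear_on_def
 proof (intro conjI ballI)
  show "\<pi> ` W' \<subseteq> carrier V" unfolding im using v by auto
  fix x y assume "x : W'" "y : W'"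
  then obtain w c w' c' where x: "w : W" "c : carrier K" "x = w \<oplus>\<^sub>V c \<odot>\<^sub>V v" "w' : W" "c' : carrier K" "y = w' \<oplus>\<^sub>V c' \<odot>\<^sub>V v"
   unfolding W'_def by blast
  show "\<pi> (x \<oplus>\<^sub>V y) = \<pi> x \<oplus>\<^sub>V \<pi> y"
   unfolding x(3,6) add[OF x(1,4,2,5)] p[OF x(1,2)] p[OF x(4,5)] using p[of "w \<oplus>\<^sub>V w'" "c \<oplus>\<^sub>K c'"] x v by (simp add: smult_l_distr)
 next
  fix d x assume d: "d : carrier K" and "x : W'"
  then obtain w c where x: "w : W" "c : carrier K" "x = w \<oplus>\<^sub>V c \<odot>\<^sub>V v" unfolding W'_def by blast
  show "\<pi> (d \<odot>\<^sub>V x) = d \<odot>\<^sub>V \<pi> x"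
   unfolding x(3) sc[OF x(1) d x(2)] p[OF x(1,2)] using p[of "d \<odot>\<^sub>V w" "d \<otimes>\<^sub>K c"] x v d by (simp add: smult_assoc1)
 qed
 have k: "{u : W'. \<pi> u = \<zero>\<^sub>V} = W"
 proof
  show "W \<subseteq> {u : W'. \<pi> u = \<zero>\<^sub>V}" using W0 by auto
  show "{u : W'. \<pi> u = \<zero>\<^sub>V} \<subseteq> W"
  proof
   fix u assume "u : {u : W'. \<pi> u = \<zero>\<^sub>V}"
   then obtain w c where u: "w : W" "c : carrier K" "u = w \<oplus>\<^sub>V c \<odot>\<^sub>V v" "\<pi> u = \<zero>\<^sub>V" unfolding W'_def by blast
   hence "c \<odot>\<^sub>V v = \<zero>\<^sub>V" using p[OF u(1,2)] by simp
   thus "u : W" using u wc by simp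
  qed
 qed
 show ?thesis by (rule that[OF s l _ im k _ v0]) (use W0 p in auto)
qed

text \<open>On the quotient of \<open>W'\<close> by \<open>W\<close> the map \<open>T\<close> is
  multiplication by \<open>a\<close>, so an eigenvector in \<open>W'\<close> for another value lies
  in \<open>W\<close> already; this bounds the growth of the eigenspaces. Moreover
  \<open>T - a\<close> maps \<open>W'\<close> into the smaller space \<open>W\<close> and has a
  kernel, so \<open>a\<close> is an eigenvalue and not only a diagonal entry.\<close>

lemma flag_extension:
 assumes fd: fin_dim and Th: "!!f. f : carrier V ==> T f : carrier V"
  and Tp: "!!f g. f : carrier V ==> g : carrier V ==> T (f \<oplus>\<^sub>V g) = T f \<oplus>\<^sub>V T g"
  and Ts: "!!f c. f : carrier V ==> c : carrier K ==> T (c \<odot>\<^sub>V f) = c \<odot>\<^sub>V T f"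
  and W: "submodule K W V" and TW: "!!w. w : W ==> T w : W"
  and v: "v : carrier V" "v \<notin> W" "a : carrier K" "T v \<ominus>\<^bsub>V\<^esub> a \<odot>\<^sub>V v : W"
 defines "Eig == %\<nu>. {x : carrier V. T x = \<nu> \<odot>\<^sub>V x}"
 obtains w0 W' where "w0 : W" "T v = w0 \<oplus>\<^sub>V a \<odot>\<^sub>V v" "W' = {w \<oplus>\<^sub>V c \<odot>\<^sub>V v | w c. w : W & c : carrier K}"
  "submodule K W' V" "ALL w:W'. T w : W'" "W \<subseteq> W'" "v : W'" "subdim K V W' = Suc (subdim K V W)" "subdim K V (Eig a) \<ge> 1"
  "ALL \<nu>:carrier K. subdim K V (Eig \<nu> \<inter> W') <= (if \<nu> = a then 1 else 0) + subdim K V (Eig \<nu> \<inter> W)"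
proof -
 interpret W: submodule K W V by fact
 have Wh: "w : W ==> w : carrier V" for w using W.subset by auto
 have Es: "submodule K (Eig \<nu>) V" if \<nu>: "\<nu> : carrier K" for \<nu>
 proof (rule submoduleI')
  have "T \<zero>\<^sub>V = \<zero>\<^sub>K \<odot>\<^sub>V T \<zero>\<^sub>V" using Ts[of "\<zero>\<^sub>V" "\<zero>\<^sub>K"] by (simp add: lmult_0)
  thus "\<zero>\<^sub>V : Eig \<nu>" using Th[of "\<zero>\<^sub>V"] \<nu> by (simp add: Eig_def lmult_0 smult_r_null)
  show "x \<oplus>\<^sub>V y : Eig \<nu>" if "x : Eig \<nu>" "y : Eig \<nu>" for x y using that \<nu> Tp by (simp add: Eig_def smult_r_distr)
  show "c \<odot>\<^sub>V x : Eig \<nu>" if "c : carrier K" "x : Eig \<nu>" for c x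
   using that \<nu> Ts smult_assoc1[of c \<nu> x] smult_assoc1[of \<nu> c x] m_comm[of c \<nu>] by (simp add: Eig_def)
 qed (auto simp: Eig_def)
 obtain w0 where w0: "w0 : W" "T v = w0 \<oplus>\<^sub>V a \<odot>\<^sub>V v"
 proof (rule that[OF v(4)])
  show "T v = (T v \<ominus>\<^bsub>V\<^esub> a \<odot>\<^sub>V v) \<oplus>\<^sub>V a \<odot>\<^sub>V v"
   using Th[OF v(1)] v(1,3) by (simp add: a_minus_def M.a_assoc M.l_neg)
 qed
 define W' where "W' = {w \<oplus>\<^sub>V c \<odot>\<^sub>V v | w c. w : W & c : carrier K}"
 have vc: "v : carrier V" by (rule v(1))
 obtain \<pi> where W': "submodule K W' V" and \<pi>: "linear_on K V V W' \<pi>"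
  "ALL w:W. ALL c:carrier K. \<pi> (w \<oplus>\<^sub>V c \<odot>\<^sub>V v) = c \<odot>\<^sub>V v"
  "\<pi> ` W' = {c \<odot>\<^sub>V v | c. c : carrier K}" "{u : W'. \<pi> u = \<zero>\<^sub>V} = W" "W \<subseteq> W'" "v : W'"
  by (rule line_extension[OF W vc v(2), folded W'_def]) blast
 interpret W': submodule K W' V by fact
 have W'h: "w : W' ==> w : carrier V" for w using W'.subset by auto
 have TW'': "T (w \<oplus>\<^sub>V c \<odot>\<^sub>V v) = (T w \<oplus>\<^sub>V c \<odot>\<^sub>V w0) \<oplus>\<^sub>V (a \<otimes>\<^sub>K c) \<odot>\<^sub>V v" if w: "w : W" "c : carrier K" for w c
 proof -
  have cv: "c \<odot>\<^sub>V v : carrier V" using smult_closed[OF w(2) vc] by simp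
  have "T (w \<oplus>\<^sub>V c \<odot>\<^sub>V v) = T w \<oplus>\<^sub>V c \<odot>\<^sub>V (w0 \<oplus>\<^sub>V a \<odot>\<^sub>V v)"
   unfolding Tp[OF Wh[OF w(1)] cv] Ts[OF v(1) w(2)] w0(2) ..
  also have "... = (T w \<oplus>\<^sub>V c \<odot>\<^sub>V w0) \<oplus>\<^sub>V (c \<otimes>\<^sub>K a) \<odot>\<^sub>V v"
   using Wh[OF TW[OF w(1)]] Wh[OF w0(1)] w(2) v(3) vc by (simp add: smult_r_distr smult_assoc1 M.a_assoc)
  finally show ?thesis using m_comm[OF w(2) v(3)] by simp
 qed
 have TW': "T x : W'" "\<pi> (T x) = a \<odot>\<^sub>V \<pi> x" if x: "x : W'" for x
 proof -
  obtain w c where w: "w : W" "c : carrier K" "x = w \<oplus>\<^sub>V c \<odot>\<^sub>V v" using x unfolding W'_def by blast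
  have i: "T w \<oplus>\<^sub>V c \<odot>\<^sub>V w0 : W" "a \<otimes>\<^sub>K c : carrier K" using TW[OF w(1)] w0(1) w(2) v(3) by auto
  show "T x : W'" unfolding w(3) TW''[OF w(1,2)] W'_def using i by blast
  show "\<pi> (T x) = a \<odot>\<^sub>V \<pi> x"
   unfolding w(3) TW''[OF w(1,2)] \<pi>(2)[rule_format, OF i] \<pi>(2)[rule_format, OF w(1,2)] using v(3) w(2) vc by (simp add: smult_assoc1)
 qed
 have vnz: "v ~= \<zero>\<^sub>V" using v(2) W.zero_closed by auto
 have V2: "vectorspace K V" "vectorspace.fin_dim K V" "vectorspace K V" using vectorspace_axioms fd by auto
 have d': "subdim K V W' = Suc (subdim K V W)"
 proof -
  have "subdim K V W' = 1 + subdim K V W"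
   using rank_nullity_on(1)[OF V2 W' \<pi>(1)] unfolding \<pi>(3,4) subdim_line[OF vc vnz] .
  thus ?thesis by simp
 qed
 have ea: "subdim K V (Eig a) \<ge> 1"
 proof -
  define S where "S f = T f \<oplus>\<^sub>V (\<ominus>\<^sub>K a) \<odot>\<^sub>V f" for f
  have Sh: "S f : carrier V" if "f : carrier V" for f
   using M.a_closed[of "T f" "(\<ominus>\<^sub>K a) \<odot>\<^sub>V f"] Th[OF that] smult_closed[of "\<ominus>\<^sub>K a" f] that v(3) by (simp add: S_def)
  have Sp: "S (f \<oplus>\<^sub>V g) = S f \<oplus>\<^sub>V S g" if "f : carrier V" "g : carrier V" for f g
   unfolding S_def Tp[OF that] using that Th[OF that(1)] Th[OF that(2)] v(3) by (simp add: smult_r_distr M.a_ac)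
  have Ss: "S (c \<odot>\<^sub>V f) = c \<odot>\<^sub>V S f" if "f : carrier V" "c : carrier K" for f c
   unfolding S_def Ts[OF that] using that Th[OF that(1)] v(3) m_comm[of c "\<ominus>\<^sub>K a"] smult_assoc1[of c "\<ominus>\<^sub>K a" f] smult_assoc1[of "\<ominus>\<^sub>K a" c f]
   by (simp add: smult_r_distr)
  have Slin: "linear_on K V V W' S" unfolding linear_on_def using Sh Sp Ss W'h by auto
  have Sv: "S v = w0" unfolding S_def w0(2) using Wh[OF w0(1)] v(3) vc by (simp add: M.a_assoc smult_l_minus M.r_neg)
  have SW: "S ` W' \<subseteq> W"
  proof
   fix y assume "y : S ` W'"
   then obtain w c where w: "w : W" "c : carrier K" "y = S (w \<oplus>\<^sub>V c \<odot>\<^sub>V v)" unfolding W'_def by blast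
   have cv: "c \<odot>\<^sub>V v : carrier V" using smult_closed[OF w(2) vc] by simp
   have "S w : W" unfolding S_def using TW[OF w(1)] w(1) v(3) by auto
   thus "y : W" unfolding w(3) Sp[OF Wh[OF w(1)] cv] Ss[OF v(1) w(2)] Sv using w0(1) w(2) by auto
  qed
  have "subdim K V (S ` W') <= subdim K V W" by (rule subdim_mono[OF V2(1,2) rank_nullity_on(2)[OF V2 W' Slin] W SW])
  hence k1: "subdim K V {x : W'. S x = \<zero>\<^sub>V} \<ge> 1"
   using rank_nullity_on(1)[OF V2 W' Slin] d' by simp
  have "subdim K V {x : W'. S x = \<zero>\<^sub>V} <= subdim K V (Eig a)"
  proof (rule subdim_mono[OF V2(1,2) rank_nullity_on(3)[OF V2 W' Slin] Es[OF v(3)]])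
   show "{x : W'. S x = \<zero>\<^sub>V} \<subseteq> Eig a"
   proof
    fix x assume "x : {x : W'. S x = \<zero>\<^sub>V}"
    hence x: "x : carrier V" "S x = \<zero>\<^sub>V" using W'h by auto
    have "T x = (T x \<oplus>\<^sub>V (\<ominus>\<^sub>K a) \<odot>\<^sub>V x) \<oplus>\<^sub>V a \<odot>\<^sub>V x"
     using Th[OF x(1)] x(1) v(3) by (simp add: M.a_assoc smult_l_minus M.l_neg)
    also have "... = a \<odot>\<^sub>V x" using x v(3) by (simp add: S_def)
    finally show "x : Eig a" using x(1) by (simp add: Eig_def)
   qed
  qed
  thus ?thesis using k1 by simp
 qed
 have cnt: "subdim K V (Eig \<nu> \<inter> W') <= (if \<nu> = a then 1 else 0) + subdim K V (Eig \<nu> \<inter> W)" if \<nu>: "\<nu> : carrier K" for \<nu>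
 proof -
  define U where "U = Eig \<nu> \<inter> W'"
  have U: "submodule K U V" unfolding U_def by (rule submodule_Int[OF Es[OF \<nu>] W'])
  have Ul: "linear_on K V V U \<pi>" using \<pi>(1) by (auto simp: U_def linear_on_def)
  have k: "{x : U. \<pi> x = \<zero>\<^sub>V} = Eig \<nu> \<inter> W" using \<pi>(4) by (auto simp: U_def)
  have r: "subdim K V U = subdim K V (\<pi> ` U) + subdim K V (Eig \<nu> \<inter> W)"
   using rank_nullity_on(1)[OF V2 U Ul] unfolding k .
  have i: "subdim K V (\<pi> ` U) <= (if \<nu> = a then 1 else 0)"
  proof (cases "\<nu> = a")
   case True
   have "subdim K V (\<pi> ` U) <= subdim K V {c \<odot>\<^sub>V v | c. c : carrier K}"
    by (rule subdim_mono[OF V2(1,2) rank_nullity_on(2)[OF V2 U Ul] submodule_line[OF vc]]) (unfold \<pi>(3)[symmetric], auto simp: U_def)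
   thus ?thesis using subdim_line[OF vc vnz] True by simp
  next
   case False
   have "\<pi> x = \<zero>\<^sub>V" if x: "x : U" for x
   proof (rule scale_unique[OF _ v(3) \<nu>])
    have xW: "x : W'" and xe: "T x = \<nu> \<odot>\<^sub>V x" using x W'h by (auto simp: U_def Eig_def)
    show "\<pi> x : carrier V" using \<pi>(1) xW by (auto simp: linear_on_def)
    have "\<nu> \<odot>\<^sub>V \<pi> x = \<pi> (\<nu> \<odot>\<^sub>V x)" using \<pi>(1) xW \<nu> unfolding linear_on_def by metis
    thus "a \<odot>\<^sub>V \<pi> x = \<nu> \<odot>\<^sub>V \<pi> x" using TW'(2)[OF xW] xe by simp
    show "a ~= \<nu>" using False by simp
   qed
   hence "\<pi> ` U \<subseteq> {\<zero>\<^sub>V}" by auto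
   hence "subdim K V (\<pi> ` U) <= subdim K V {\<zero>\<^sub>V}"
    by (rule subdim_mono[OF V2(1,2) rank_nullity_on(2)[OF V2 U Ul] submodule_zero])
   thus ?thesis using subdim_zero False by simp
  qed
  thus ?thesis using r i unfolding U_def by auto
 qed
 show ?thesis
  by (rule that[OF w0 W'_def W' _ \<pi>(5,6) d' ea]) (use TW'(1) cnt in auto)
qed

end

context ac_fusion begin

text \<open>This interpolates between the whole eigenspace in \<open>End(Y \<otimes> Y)\<close>, for
  \<open>W\<close> zero, and its part with image in the complement of the \<open>Y\<close>-summands,
  for \<open>W\<close> the whole of \<open>Hom(Y \<otimes> Y, Y)\<close>.\<close>

definition kills where
 "kills X Y \<phi> \<mu> W = {F : eig X (Y >< Y) (xact X \<phi> Y Y) (Y >< Y) (xact X \<phi> Y Y) \<mu>. ALL w:W. w *. F = nl (Y >< Y) Y}"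

lemma kills_submodule:
 assumes m: "xmod X Y \<phi>" and \<mu>: "\<mu> : carrier K" and W: "W \<subseteq> hm (Y >< Y) Y"
 shows "submodule K (kills X Y \<phi> \<mu> W) (HomV C (Y >< Y) (Y >< Y))"
proof (rule submodule_homI)
 note m' = xmodD[OF m]
 have mYY: "xmod X (Y >< Y) (xact X \<phi> Y Y)" by (rule xmod_xact[OF m m'(2)])
 interpret E: submodule K "eig X (Y >< Y) (xact X \<phi> Y Y) (Y >< Y) (xact X \<phi> Y Y) \<mu>" "HomV C (Y >< Y) (Y >< Y)"
  by (rule eig_submodule[OF mYY mYY \<mu>])
 show "Y >< Y : Ob" "Y >< Y : Ob" using m' by auto
 have k: "F : eig X (Y >< Y) (xact X \<phi> Y Y) (Y >< Y) (xact X \<phi> Y Y) \<mu>" "F : hm (Y >< Y) (Y >< Y)" "w : W ==> w *. F = nl (Y >< Y) Y"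
  if "F : kills X Y \<phi> \<mu> W" for F w using that by (auto simp: kills_def eig_def)
 have w: "ar w" "src w = Y >< Y" "tgt w = Y" if "w : W" for w using W that by (auto simp: hom_iff)
 show "kills X Y \<phi> \<mu> W \<subseteq> hm (Y >< Y) (Y >< Y)" using k by auto
 show "nl (Y >< Y) (Y >< Y) : kills X Y \<phi> \<mu> W" using E.zero_closed w m' by (auto simp: kills_def HomV_ops)
 show "f +. g : kills X Y \<phi> \<mu> W" if fg: "f : kills X Y \<phi> \<mu> W" "g : kills X Y \<phi> \<mu> W" for f g
 proof -
  have "f +. g : eig X (Y >< Y) (xact X \<phi> Y Y) (Y >< Y) (xact X \<phi> Y Y) \<mu>"
   using E.m_closed[OF k(1)[OF fg(1)] k(1)[OF fg(2)]] k(2)[OF fg(1)] by (simp add: HomV_ops)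
  moreover have "w *. (f +. g) = nl (Y >< Y) Y" if "w : W" for w
   using k(2)[OF fg(1)] k(2)[OF fg(2)] k(3)[OF fg(1) that] k(3)[OF fg(2) that] w[OF that] m' by (simp add: hom_iff)
  ultimately show ?thesis by (simp add: kills_def)
 qed
 show "c |> f : kills X Y \<phi> \<mu> W" if fg: "c : carrier K" "f : kills X Y \<phi> \<mu> W" for c f
 proof -
  have "c |> f : eig X (Y >< Y) (xact X \<phi> Y Y) (Y >< Y) (xact X \<phi> Y Y) \<mu>"
   using E.smult_closed[OF fg(1) k(1)[OF fg(2)]] k(2)[OF fg(2)] by (simp add: HomV_ops)
  moreover have "w *. (c |> f) = nl (Y >< Y) Y" if "w : W" for w
   using k(2)[OF fg(2)] k(3)[OF fg(2) that] w[OF that] m' fg(1) by (simp add: hom_iff)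
  ultimately show ?thesis by (simp add: kills_def)
 qed
qed

text \<open>\<open>W\<close> is the top of an invariant flag with diagonal entries
  \<open>\<alpha>s\<close>. The last clause is the purpose: each entry \<open>\<alpha>\<close>
  accounts for at most one eigenspace of \<open>Hom(Y \<otimes> Y, Y)\<close>, that of
  \<open>\<mu> \<alpha>\<close>, and what is not accounted for is killed by
  \<open>W\<close>.\<close>

definition flagged where
 "flagged X Y \<phi> W \<alpha>s \<longleftrightarrow> submodule K W (HomV C (Y >< Y) Y) & (ALL w:W. tw X (xact X \<phi> Y Y) \<phi> w : W) &
  sd (HomV C (Y >< Y) Y) W = length \<alpha>s & (ALL \<alpha>:set \<alpha>s. \<alpha> : carrier K & eigdim X Y \<phi> Y \<alpha> \<ge> 1) &
  (ALL \<nu>:carrier K. sd (HomV C (Y >< Y) Y) (eig X (Y >< Y) (xact X \<phi> Y Y) Y \<phi> \<nu> \<inter> W) <= count_list \<alpha>s \<nu>) &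
  (ALL \<mu>:carrier K. sd (HomV C (Y >< Y) (Y >< Y)) (eig X (Y >< Y) (xact X \<phi> Y Y) (Y >< Y) (xact X \<phi> Y Y) \<mu>)
   <= sd (HomV C (Y >< Y) (Y >< Y)) (kills X Y \<phi> \<mu> W) + (\<Sum>\<alpha>\<leftarrow>\<alpha>s. eigdim X Y \<phi> Y (\<mu> \<otimes>\<^sub>K \<alpha>)))"

text \<open>Let \<open>F\<close> be an eigenvector for \<open>\<mu>\<close> that is killed by
  \<open>W\<close>, and let \<open>T v = w0 + a v\<close> with \<open>w0\<close> in
  \<open>W\<close>. Then \<open>T (v F) = (w0 + a v) (\<mu> F) = \<mu> a v F\<close>. So composition
  with \<open>v\<close> lands in the eigenspace of \<open>\<mu> a\<close>, and its kernel is the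
  part killed by the larger subspace.\<close>

lemma flagged_step:
 assumes m: "xmod X Y \<phi>" and fl: "flagged X Y \<phi> W \<alpha>s" and u: "u : hm (Y >< Y) Y" "u \<notin> W"
 shows "EX W' \<alpha>. flagged X Y \<phi> W' (\<alpha> # \<alpha>s)"
proof -
 note m' = xmodD[OF m]
 let ?P = "Y >< Y" and ?\<psi> = "xact X \<phi> Y Y"
 have P: "?P : Ob" using m' by simp
 have mP: "xmod X ?P ?\<psi>" by (rule xmod_xact[OF m m'(2)])
 let ?V = "HomV C ?P Y" and ?T = "tw X ?\<psi> \<phi>"
 interpret v: vectorspace K ?V by (rule vectorspace_HomV[OF P m'(2)])
 have fd: "vectorspace.fin_dim K ?V" by (rule fd_hom[OF P m'(2)])
 have Th: "?T f : hm ?P Y" if "f : hm ?P Y" for f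
  using tw_arr[OF mP m, of f] that by (simp add: hom_iff)
 have Tp: "?T (f \<oplus>\<^sub>?V g) = ?T f \<oplus>\<^sub>?V ?T g" if "f : hm ?P Y" "g : hm ?P Y" for f g
  using tw_plus[OF mP m, of f g] that Th[OF that(1)] by (simp add: hom_iff HomV_ops)
 have Ts: "?T (c \<odot>\<^sub>?V f) = c \<odot>\<^sub>?V ?T f" if "f : hm ?P Y" "c : carrier K" for f c
  using tw_scale[OF mP m, of f c] that Th[OF that(1)] by (simp add: hom_iff HomV_ops)
 have W: "submodule K W ?V" and TW: "!!w. w : W ==> ?T w : W" using fl by (auto simp: flagged_def)
 interpret W: submodule K W ?V by fact
 have Wh: "w : W ==> w : hm ?P Y" for w using W.subset by auto
 interpret t: triangularization K ?V ?T
 proof (intro triangularization.intro linear_map.intro mod_hom.intro mod_hom_axioms.intro triangularization_axioms.intro)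
  show "algebraically_closed K" by (rule ac)
  show "vectorspace K ?V" "module K ?V" by unfold_locales
  show "?T : module_hom K ?V ?V" using Th Tp Ts by (auto simp: module_hom_def)
 qed (rule v.vectorspace_axioms v.module_axioms fd)+
 have vu: "u : carrier ?V" using u by simp
 obtain v a where v: "v : hm ?P Y" "v \<notin> W" "a : carrier K" "?T v \<ominus>\<^bsub>?V\<^esub> a \<odot>\<^sub>?V v : W"
  using t.triangular_step[OF W vu u(2)] unfolding HomV_simps(1) by blast
 have eigE: "eig X ?P ?\<psi> Y \<phi> \<nu> = {x : carrier ?V. ?T x = \<nu> \<odot>\<^sub>?V x}" for \<nu>
  by (auto simp: eig_def HomV_ops)
 have Thc: "!!f. f : carrier ?V ==> ?T f : carrier ?V" using Th by simp
 have Tpc: "!!f g. f : carrier ?V ==> g : carrier ?V ==> ?T (f \<oplus>\<^sub>?V g) = ?T f \<oplus>\<^sub>?V ?T g" using Tp by simp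
 have Tsc: "!!f c. f : carrier ?V ==> c : carrier K ==> ?T (c \<odot>\<^sub>?V f) = c \<odot>\<^sub>?V ?T f" using Ts by simp
 have vc: "v : carrier ?V" using v(1) by simp
 obtain w0 W' where w0: "w0 : W" "?T v = w0 \<oplus>\<^sub>?V a \<odot>\<^sub>?V v" and W'_def: "W' = {w \<oplus>\<^sub>?V c \<odot>\<^sub>?V v | w c. w : W & c : carrier K}"
  and W': "submodule K W' ?V" and TW': "ALL w:W'. ?T w : W'" and sub: "W \<subseteq> W'" "v : W'"
  and d: "sd ?V W' = Suc (sd ?V W)" and ea: "sd ?V (eig X ?P ?\<psi> Y \<phi> a) \<ge> 1"
  and cn: "ALL \<nu>:carrier K. sd ?V (eig X ?P ?\<psi> Y \<phi> \<nu> \<inter> W') <= (if \<nu> = a then 1 else 0) + sd ?V (eig X ?P ?\<psi> Y \<phi> \<nu> \<inter> W)"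
  by (rule v.flag_extension[OF fd Thc Tpc Tsc W TW vc v(2,3,4), folded eigE]) blast
 interpret W': submodule K W' ?V by fact
 have W'h: "w : W' ==> w : hm ?P Y" for w using W'.subset by auto
 have V2: "vectorspace K ?V" "vectorspace.fin_dim K ?V" "vectorspace K ?V" using v.vectorspace_axioms fd by auto
 have d': "sd ?V W' = length (a # \<alpha>s)" using d fl by (simp add: flagged_def)
 have cnt: "sd ?V (eig X ?P ?\<psi> Y \<phi> \<nu> \<inter> W') <= count_list (a # \<alpha>s) \<nu>" if \<nu>: "\<nu> : carrier K" for \<nu>
 proof -
  have "sd ?V (eig X ?P ?\<psi> Y \<phi> \<nu> \<inter> W) <= count_list \<alpha>s \<nu>" using fl \<nu> by (simp add: flagged_def)
  thus ?thesis using cn[rule_format, OF \<nu>] by auto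
 qed
 have kil: "sd (HomV C ?P ?P) (eig X ?P ?\<psi> ?P ?\<psi> \<mu>) <= sd (HomV C ?P ?P) (kills X Y \<phi> \<mu> W') + (\<Sum>\<alpha>\<leftarrow>a # \<alpha>s. eigdim X Y \<phi> Y (\<mu> \<otimes>\<^sub>K \<alpha>))"
  if \<mu>: "\<mu> : carrier K" for \<mu>
 proof -
  have VV: "vectorspace K (HomV C ?P ?P)" "vectorspace.fin_dim K (HomV C ?P ?P)" by (rule vectorspace_HomV[OF P P]) (rule fd_hom[OF P P])
  have Ws: "W \<subseteq> hm ?P Y" "W' \<subseteq> hm ?P Y" using Wh W'h by auto
  have ks: "submodule K (kills X Y \<phi> \<mu> W) (HomV C ?P ?P)" by (rule kills_submodule[OF m \<mu> Ws(1)])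
  have va: "ar v" "src v = ?P" "tgt v = Y" using v(1) by (auto simp: hom_iff)
  have Fk: "ar F" "src F = ?P" "tgt F = ?P" "tw X ?\<psi> ?\<psi> F = \<mu> |> F" "w : W ==> w *. F = nl ?P Y" if "F : kills X Y \<phi> \<mu> W" for F w
   using that by (auto simp: kills_def eig_def hom_iff)
  have L: "linear_on K (HomV C ?P ?P) ?V (kills X Y \<phi> \<mu> W) (%F. v *. F)"
  proof (rule linear_on_homI)
   show "kills X Y \<phi> \<mu> W \<subseteq> hm ?P ?P" by (auto simp: kills_def eig_def)
   show "v *. F : hm ?P Y" if "F : kills X Y \<phi> \<mu> W" for F using Fk(1,2,3)[OF that] va by (simp add: hom_iff)
   show "v *. (F +. G) = v *. F +. v *. G" if "F : kills X Y \<phi> \<mu> W" "G : kills X Y \<phi> \<mu> W" for F G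
    using Fk(1,2,3)[OF that(1)] Fk(1,2,3)[OF that(2)] va by simp
   show "v *. (c |> F) = c |> (v *. F)" if "c : carrier K" "F : kills X Y \<phi> \<mu> W" for F c
    using that(1) Fk(1,2,3)[OF that(2)] va by simp
  qed
  have k: "{F : kills X Y \<phi> \<mu> W. v *. F = \<zero>\<^sub>?V} = kills X Y \<phi> \<mu> W'"
  proof
   show "kills X Y \<phi> \<mu> W' \<subseteq> {F : kills X Y \<phi> \<mu> W. v *. F = \<zero>\<^sub>?V}" using sub by (auto simp: kills_def HomV_ops)
   show "{F : kills X Y \<phi> \<mu> W. v *. F = \<zero>\<^sub>?V} \<subseteq> kills X Y \<phi> \<mu> W'"
   proof
    fix F assume "F : {F : kills X Y \<phi> \<mu> W. v *. F = \<zero>\<^sub>?V}"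
    hence F: "F : kills X Y \<phi> \<mu> W" "v *. F = nl ?P Y" by (auto simp: HomV_ops)
    note Fa = Fk[OF F(1)]
    have "x *. F = nl ?P Y" if "x : W'" for x
    proof -
     obtain w c where w: "w : W" "c : carrier K" "x = w \<oplus>\<^sub>?V c \<odot>\<^sub>?V v" using \<open>x : W'\<close> unfolding W'_def by blast
     have wa: "ar w" "src w = ?P" "tgt w = Y" using Wh[OF w(1)] by (auto simp: hom_iff)
     have "x = w +. c |> v" unfolding w(3) HomV_ops(2)[OF v(1)] HomV_ops(1)[OF Wh[OF w(1)]] ..
     thus ?thesis using wa va Fa(1,2,3) Fa(5)[OF w(1)] F(2) w(2) m' P by simp
    qed
    thus "F : kills X Y \<phi> \<mu> W'" using F(1) by (simp add: kills_def)
   qed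
  qed
  have r: "sd (HomV C ?P ?P) (kills X Y \<phi> \<mu> W) = sd ?V ((%F. v *. F) ` kills X Y \<phi> \<mu> W) + sd (HomV C ?P ?P) (kills X Y \<phi> \<mu> W')"
   using rank_nullity_on(1)[OF VV V2(1) ks L] unfolding k .
  have ma: "\<mu> \<otimes>\<^sub>K a : carrier K" using \<mu> v(3) by simp
  have "sd ?V ((%F. v *. F) ` kills X Y \<phi> \<mu> W) <= eigdim X Y \<phi> Y (\<mu> \<otimes>\<^sub>K a)"
   unfolding eigdim_def
  proof (rule subdim_mono[OF V2(1,2) rank_nullity_on(2)[OF VV V2(1) ks L] eig_submodule[OF mP m ma]])
   show "(%F. v *. F) ` kills X Y \<phi> \<mu> W \<subseteq> eig X ?P ?\<psi> Y \<phi> (\<mu> \<otimes>\<^sub>K a)"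
   proof
    fix G assume "G : (%F. v *. F) ` kills X Y \<phi> \<mu> W"
    then obtain F where F: "F : kills X Y \<phi> \<mu> W" "G = v *. F" by blast
    note Fa = Fk[OF F(1)]
    have wa: "ar w0" "src w0 = ?P" "tgt w0 = Y" using Wh[OF w0(1)] by (auto simp: hom_iff)
    have "?T G = ?T v *. tw X ?\<psi> ?\<psi> F" unfolding F(2) by (rule tw_cmp[OF mP mP m Fa(1,2,3) va])
    also have "?T v = w0 +. a |> v" unfolding w0(2) HomV_ops(2)[OF v(1)] HomV_ops(1)[OF Wh[OF w0(1)]] ..
    also have "(w0 +. a |> v) *. tw X ?\<psi> ?\<psi> F = (\<mu> \<otimes>\<^sub>K a) |> G"
     unfolding Fa(4) F(2) using wa va Fa(1,2,3) Fa(5)[OF w0(1)] v(3) \<mu> m' P by simp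
    finally show "G : eig X ?P ?\<psi> Y \<phi> (\<mu> \<otimes>\<^sub>K a)" using Fa(1,2,3) va F(2) by (simp add: eig_def hom_iff)
   qed
  qed
  moreover have "sd (HomV C ?P ?P) (eig X ?P ?\<psi> ?P ?\<psi> \<mu>) <= sd (HomV C ?P ?P) (kills X Y \<phi> \<mu> W) + (\<Sum>\<alpha>\<leftarrow>\<alpha>s. eigdim X Y \<phi> Y (\<mu> \<otimes>\<^sub>K \<alpha>))"
   using fl \<mu> by (simp add: flagged_def)
  ultimately show ?thesis using r by simp
 qed
 have "flagged X Y \<phi> W' (a # \<alpha>s)"
  unfolding flagged_def
 proof (intro conjI ballI)
  show "submodule K W' ?V" by fact
  show "?T w : W'" if "w : W'" for w using TW' that by blast
  show "sd ?V W' = length (a # \<alpha>s)" by fact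
  show "\<alpha> : carrier K" "eigdim X Y \<phi> Y \<alpha> \<ge> 1" if "\<alpha> : set (a # \<alpha>s)" for \<alpha> using that fl v(3) ea by (auto simp: flagged_def eigdim_def)
 qed (use cnt kil in auto)
 thus ?thesis by blast
qed

lemma flagged_full:
 assumes m: "xmod X Y \<phi>"
 shows "EX \<alpha>s. flagged X Y \<phi> (hm (Y >< Y) Y) \<alpha>s"
proof -
 note m' = xmodD[OF m]
 let ?P = "Y >< Y" and ?\<psi> = "xact X \<phi> Y Y"
 have P: "?P : Ob" using m' by simp
 have mP: "xmod X ?P ?\<psi>" by (rule xmod_xact[OF m m'(2)])
 let ?V = "HomV C ?P Y"
 interpret v: vectorspace K ?V by (rule vectorspace_HomV[OF P m'(2)])
 have fd: "vectorspace.fin_dim K ?V" by (rule fd_hom[OF P m'(2)])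
 have s0: "submodule K {\<zero>\<^sub>?V} ?V" by (rule v.submodule_zero)
 have "flagged X Y \<phi> {\<zero>\<^sub>?V} []"
  unfolding flagged_def
 proof (intro conjI ballI)
  show "tw X ?\<psi> \<phi> w : {\<zero>\<^sub>?V}" if "w : {\<zero>\<^sub>?V}" for w using that tw_nul[OF mP m] by (simp add: HomV_ops)
  show "sd ?V (eig X ?P ?\<psi> Y \<phi> \<nu> \<inter> {\<zero>\<^sub>?V}) <= count_list [] \<nu>" if "\<nu> : carrier K" for \<nu>
  proof -
   have "sd ?V (eig X ?P ?\<psi> Y \<phi> \<nu> \<inter> {\<zero>\<^sub>?V}) <= sd ?V {\<zero>\<^sub>?V}"
    by (rule subdim_mono[OF v.vectorspace_axioms fd submodule_Int[OF eig_submodule[OF mP m that] s0] s0]) auto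
   thus ?thesis using v.subdim_zero by simp
  qed
  fix \<mu> assume \<mu>: "\<mu> : carrier K"
  have "kills X Y \<phi> \<mu> {\<zero>\<^sub>?V} = eig X ?P ?\<psi> ?P ?\<psi> \<mu>"
   using m' by (auto simp: kills_def HomV_ops eig_def hom_iff)
  thus "sd (HomV C ?P ?P) (eig X ?P ?\<psi> ?P ?\<psi> \<mu>) <= sd (HomV C ?P ?P) (kills X Y \<phi> \<mu> {\<zero>\<^sub>?V}) + (\<Sum>\<alpha>\<leftarrow>[]. eigdim X Y \<phi> Y (\<mu> \<otimes>\<^sub>K \<alpha>))"
   by simp
 qed (use s0 v.subdim_zero in auto)
 moreover have "EX \<alpha>s. flagged X Y \<phi> (hm ?P Y) \<alpha>s" if "flagged X Y \<phi> W \<alpha>s" for W \<alpha>s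
  using that
 proof (induction "dm ?P Y - length \<alpha>s" arbitrary: W \<alpha>s rule: less_induct)
  case less
  have W: "submodule K W ?V" "sd ?V W = length \<alpha>s" using less.prems by (auto simp: flagged_def)
  hence sub: "W \<subseteq> hm ?P Y" by (auto simp: submodule_def)
  show ?case
  proof (cases "W = hm ?P Y")
   case True thus ?thesis using less.prems by blast
  next
   case False
   then obtain u where u: "u : hm ?P Y" "u \<notin> W" using sub by blast
   obtain W' \<alpha> where f: "flagged X Y \<phi> W' (\<alpha> # \<alpha>s)" using flagged_step[OF m less.prems u] by blast
   have W': "submodule K W' ?V" "sd ?V W' = Suc (length \<alpha>s)" using f by (auto simp: flagged_def)
   hence sub': "W' \<subseteq> hm ?P Y" by (auto simp: submodule_def)
   have "sd ?V W' <= dm ?P Y" unfolding hdim_def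
    by (rule subdim_mono[OF v.vectorspace_axioms fd W'(1) hom_submodule[OF P m'(2)] sub'])
   thus ?thesis using less.hyps[OF _ f] W'(2) by auto
  qed
 qed
 ultimately show ?thesis by blast
qed

end

section \<open>Excluding the near-group fusion rules\<close>

context field begin

lemma mult_eq_self: "x : carrier R ==> y : carrier R ==> x ~= \<zero> ==> x \<otimes> y = x \<longleftrightarrow> y = \<one>"
 using m_lcancel[of x y \<one>] by simp

text \<open>In \<open>main\<close> the left side counts eigenvectors supplied by the unit, by
  \<open>X'\<close> and by the three copies of \<open>Y\<close>; the right side is the bound
  obtained from the flag. This is the case of a double diagonal entry. The inequality is tested at 1
  and at the eigenvalues, where by cancellation a product of two of them is rarely an eigenvalue
  again.\<close>

lemma spectrum_two:
 fixes e :: "'a => nat"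
 assumes K: "\<alpha> : carrier R" "\<gamma> : carrier R" "\<alpha> ~= \<zero>" "\<gamma> ~= \<zero>" "\<alpha> ~= \<gamma>"
  and cnt: "!!\<nu>. \<nu> : carrier R ==> e \<nu> <= (if \<nu> = \<alpha> then 2 else 0) + (if \<nu> = \<gamma> then 1 else 0)"
  and pos: "e \<alpha> \<ge> 1" "e \<gamma> \<ge> 1"
  and main: "!!\<mu>. \<mu> : carrier R ==> (if \<mu> = \<one> then 2 else 0) + 3 * e \<mu> <= (if \<mu> \<otimes> (\<mu> \<otimes> \<mu>) = \<one> then 1 else 0) + 2 * e (\<mu> \<otimes> \<alpha>) + e (\<mu> \<otimes> \<gamma>)"
 shows False
proof -
 have c: "\<alpha> \<otimes> \<gamma> : carrier R" "\<alpha> \<otimes> \<alpha> : carrier R" "\<gamma> \<otimes> \<gamma> : carrier R" "\<gamma> \<otimes> \<alpha> = \<alpha> \<otimes> \<gamma>" using K m_comm by auto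
 have ge: "e \<gamma> = 1" using cnt[OF K(2)] pos(2) K(5) by simp
 consider (1) "\<alpha> = \<one>" | (2) "\<gamma> = \<one>" | (3) "\<alpha> ~= \<one>" "\<gamma> ~= \<one>" by blast
 thus False
 proof cases
  case 1
  thus False using main[of \<one>] ge pos K by simp
 next
  case 2
  \<comment> \<open>At 1 the inequality reads \<open>5 \<le> 2 + 2 e \<alpha>\<close> and forces the
    value 2; at \<open>\<alpha>\<close> it then demands \<open>6 \<le> 5\<close>.\<close>
  have "e \<alpha> = 2" using main[of \<one>] ge 2 K cnt[OF K(1)] by simp
  moreover have "e (\<alpha> \<otimes> \<alpha>) <= 1" using cnt[OF c(2)] mult_eq_self[of \<alpha> \<alpha>] K 2 by (auto split: if_splits)
  ultimately show False using main[OF K(1)] 2 K by (auto split: if_splits)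
 next
  case 3
  have z: "e (\<alpha> \<otimes> \<gamma>) = 0" using cnt[OF c(1)] mult_eq_self[of \<alpha> \<gamma>] mult_eq_self[of \<gamma> \<alpha>] K 3 c(4) by (auto split: if_splits)
  have a: "e (\<alpha> \<otimes> \<alpha>) <= (if \<alpha> \<otimes> \<alpha> = \<gamma> then 1 else 0)" using cnt[OF c(2)] mult_eq_self[of \<alpha> \<alpha>] K 3 by (auto split: if_splits)
  have 1: "3 * e \<alpha> <= (if \<alpha> \<otimes> (\<alpha> \<otimes> \<alpha>) = \<one> then 1 else 0) + 2 * e (\<alpha> \<otimes> \<alpha>)" using main[OF K(1)] z 3 by simp
  hence "e \<alpha> = 1" using a pos(1) by (auto split: if_splits)
  moreover have "e (\<gamma> \<otimes> \<gamma>) <= e \<alpha>" using cnt[OF c(3)] mult_eq_self[of \<gamma> \<gamma>] K 3 by (auto split: if_splits)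
  ultimately show False using main[OF K(2)] z c(4) ge 3 by (auto split: if_splits)
 qed
qed

text \<open>Each eigenvalue has multiplicity one, and none is 1. At \<open>\<alpha>\<close> at least
  three of the four terms on the right, each at most 1, must be non-zero. If both mixed products are
  eigenvalues, they force \<open>\<alpha>^2 = 1\<close> and the other two terms vanish; otherwise
  two eigenvalues coincide.\<close>

lemma spectrum_distinct:
 fixes e :: "'a => nat"
 assumes K: "\<alpha> : carrier R" "\<beta> : carrier R" "\<gamma> : carrier R" "\<alpha> ~= \<zero>" "\<beta> ~= \<zero>" "\<gamma> ~= \<zero>" and ne: "\<alpha> ~= \<beta>" "\<alpha> ~= \<gamma>" "\<beta> ~= \<gamma>"
  and cnt: "!!\<nu>. \<nu> : carrier R ==> e \<nu> <= (if \<nu> = \<alpha> \<or> \<nu> = \<beta> \<or> \<nu> = \<gamma> then 1 else 0)"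
  and pos: "e \<alpha> \<ge> 1" "e \<beta> \<ge> 1" "e \<gamma> \<ge> 1"
  and main: "!!\<mu>. \<mu> : carrier R ==> (if \<mu> = \<one> then 2 else 0) + 3 * e \<mu> <= (if \<mu> \<otimes> (\<mu> \<otimes> \<mu>) = \<one> then 1 else 0) + e (\<mu> \<otimes> \<alpha>) + e (\<mu> \<otimes> \<beta>) + e (\<mu> \<otimes> \<gamma>)"
 shows False
proof -
 have e1: "e \<alpha> = 1" "e \<beta> = 1" "e \<gamma> = 1" using cnt[OF K(1)] cnt[OF K(2)] cnt[OF K(3)] pos by auto
 have n1: "\<alpha> ~= \<one>" "\<beta> ~= \<one>" "\<gamma> ~= \<one>" using main[of \<one>] e1 K by auto
 have c: "\<alpha> \<otimes> \<alpha> : carrier R" "\<alpha> \<otimes> \<beta> : carrier R" "\<alpha> \<otimes> \<gamma> : carrier R" using K by auto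
 have z1: "e \<one> = 0" using cnt[of \<one>] n1 by auto
 have aa: "e (\<alpha> \<otimes> \<alpha>) <= (if \<alpha> \<otimes> \<alpha> = \<beta> \<or> \<alpha> \<otimes> \<alpha> = \<gamma> then 1 else 0)"
  using cnt[OF c(1)] mult_eq_self[of \<alpha> \<alpha>] K n1 by (auto split: if_splits)
 have ab: "e (\<alpha> \<otimes> \<beta>) <= (if \<alpha> \<otimes> \<beta> = \<gamma> then 1 else 0)"
  using cnt[OF c(2)] mult_eq_self[of \<alpha> \<beta>] mult_eq_self[of \<beta> \<alpha>] m_comm[of \<alpha> \<beta>] K n1 by (auto split: if_splits)
 have ag: "e (\<alpha> \<otimes> \<gamma>) <= (if \<alpha> \<otimes> \<gamma> = \<beta> then 1 else 0)"
  using cnt[OF c(3)] mult_eq_self[of \<alpha> \<gamma>] mult_eq_self[of \<gamma> \<alpha>] m_comm[of \<alpha> \<gamma>] K n1 by (auto split: if_splits)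
 have 3: "3 <= (if \<alpha> \<otimes> (\<alpha> \<otimes> \<alpha>) = \<one> then 1 else 0) + e (\<alpha> \<otimes> \<alpha>) + e (\<alpha> \<otimes> \<beta>) + e (\<alpha> \<otimes> \<gamma>)"
  using main[OF K(1)] e1 n1 by simp
 have lc: "\<alpha> \<otimes> x = \<alpha> \<otimes> y \<longleftrightarrow> x = y" if "x : carrier R" "y : carrier R" for x y using m_lcancel[of \<alpha> x y] K that by simp
 show False
 proof (cases "\<alpha> \<otimes> \<beta> = \<gamma> & \<alpha> \<otimes> \<gamma> = \<beta>")
  case True
  hence "\<alpha> \<otimes> \<alpha> \<otimes> \<beta> = \<one> \<otimes> \<beta>" using K by (simp add: m_assoc)
  hence q: "\<alpha> \<otimes> \<alpha> = \<one>" using m_rcancel[of \<beta> "\<alpha> \<otimes> \<alpha>" \<one>] K c by simp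
  hence "\<alpha> \<otimes> (\<alpha> \<otimes> \<alpha>) ~= \<one>" using n1 K by simp
  thus False using 3 ab ag z1 q by (auto split: if_splits)
 next
  case False
  hence q: "\<alpha> \<otimes> (\<alpha> \<otimes> \<alpha>) = \<one>" "\<alpha> \<otimes> \<alpha> = \<beta> \<or> \<alpha> \<otimes> \<alpha> = \<gamma>" "e (\<alpha> \<otimes> \<beta>) = 1 \<or> e (\<alpha> \<otimes> \<gamma>) = 1"
   using 3 aa ab ag by (auto split: if_splits)
  show False
  proof (cases "\<alpha> \<otimes> \<alpha> = \<beta>")
   case True
   hence "\<alpha> \<otimes> \<beta> = \<one>" using q(1) by simp
   hence "e (\<alpha> \<otimes> \<gamma>) = 1" using q(3) z1 by simp
   hence "\<alpha> \<otimes> \<gamma> = \<alpha> \<otimes> \<alpha>" using ag True by (simp split: if_splits)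
   thus False using lc K ne by auto
  next
   case False
   hence g: "\<alpha> \<otimes> \<alpha> = \<gamma>" using q(2) by simp
   hence "\<alpha> \<otimes> \<gamma> = \<one>" using q(1) by simp
   hence "e (\<alpha> \<otimes> \<beta>) = 1" using q(3) z1 by simp
   hence "\<alpha> \<otimes> \<beta> = \<alpha> \<otimes> \<alpha>" using ab g by (simp split: if_splits)
   thus False using lc K ne by auto
  qed
 qed
qed

text \<open>Only the coincidences among the three entries matter. If all agree, the inequality fails
  at 1 for \<open>\<alpha> = 1\<close>, and otherwise at \<open>\<alpha>\<close>, since
  \<open>\<alpha>^2\<close> is then no eigenvalue.\<close>

lemma spectrum_contradiction:
 fixes e :: "'a => nat"
 assumes K: "\<alpha> : carrier R" "\<beta> : carrier R" "\<gamma> : carrier R" "\<alpha> ~= \<zero>" "\<beta> ~= \<zero>" "\<gamma> ~= \<zero>"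
  and cnt: "!!\<nu>. \<nu> : carrier R ==> e \<nu> <= count_list [\<alpha>, \<beta>, \<gamma>] \<nu>"
  and pos: "e \<alpha> \<ge> 1" "e \<beta> \<ge> 1" "e \<gamma> \<ge> 1"
  and main: "!!\<mu>. \<mu> : carrier R ==> (if \<mu> = \<one> then 2 else 0) + 3 * e \<mu> <= (if \<mu> \<otimes> (\<mu> \<otimes> \<mu>) = \<one> then 1 else 0) + e (\<mu> \<otimes> \<alpha>) + e (\<mu> \<otimes> \<beta>) + e (\<mu> \<otimes> \<gamma>)"
 shows False
proof -
 consider (1) "\<alpha> = \<beta>" "\<beta> = \<gamma>" | (2) "\<alpha> = \<beta>" "\<alpha> ~= \<gamma>" | (3) "\<alpha> = \<gamma>" "\<alpha> ~= \<beta>" | (4) "\<beta> = \<gamma>" "\<beta> ~= \<alpha>" | (5) "\<alpha> ~= \<beta>" "\<alpha> ~= \<gamma>" "\<beta> ~= \<gamma>" by blast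
 thus False
 proof cases
  case 1
  show False
  proof (cases "\<alpha> = \<one>")
   case True
   thus False using main[of \<one>] 1 by simp
  next
   case False
   hence "\<alpha> \<otimes> \<alpha> ~= \<alpha>" using mult_eq_self[of \<alpha> \<alpha>] K by simp
   hence "e (\<alpha> \<otimes> \<alpha>) = 0" using cnt[of "\<alpha> \<otimes> \<alpha>"] K 1 by auto
   thus False using main[OF K(1)] 1 pos False by (auto split: if_splits)
  qed
 next
  case 2
  show False
  proof (rule spectrum_two[of \<alpha> \<gamma> e])
   show "e \<nu> <= (if \<nu> = \<alpha> then 2 else 0) + (if \<nu> = \<gamma> then 1 else 0)" if "\<nu> : carrier R" for \<nu> using cnt[OF that] 2 by (auto split: if_splits)
   show "(if \<mu> = \<one> then 2 else 0) + 3 * e \<mu> <= (if \<mu> \<otimes> (\<mu> \<otimes> \<mu>) = \<one> then 1 else 0) + 2 * e (\<mu> \<otimes> \<alpha>) + e (\<mu> \<otimes> \<gamma>)" if "\<mu> : carrier R" for \<mu>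
    using main[OF that] 2 by simp
  qed (use 2 K pos in auto)
 next
  case 3
  show False
  proof (rule spectrum_two[of \<alpha> \<beta> e])
   show "e \<nu> <= (if \<nu> = \<alpha> then 2 else 0) + (if \<nu> = \<beta> then 1 else 0)" if "\<nu> : carrier R" for \<nu> using cnt[OF that] 3 by (auto split: if_splits)
   show "(if \<mu> = \<one> then 2 else 0) + 3 * e \<mu> <= (if \<mu> \<otimes> (\<mu> \<otimes> \<mu>) = \<one> then 1 else 0) + 2 * e (\<mu> \<otimes> \<alpha>) + e (\<mu> \<otimes> \<beta>)" if "\<mu> : carrier R" for \<mu>
    using main[OF that] 3 by simp
  qed (use 3 K pos in auto)
 next
  case 4
  show False
  proof (rule spectrum_two[of \<beta> \<alpha> e])
   show "e \<nu> <= (if \<nu> = \<beta> then 2 else 0) + (if \<nu> = \<alpha> then 1 else 0)" if "\<nu> : carrier R" for \<nu> using cnt[OF that] 4 by (auto split: if_splits)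
   show "(if \<mu> = \<one> then 2 else 0) + 3 * e \<mu> <= (if \<mu> \<otimes> (\<mu> \<otimes> \<mu>) = \<one> then 1 else 0) + 2 * e (\<mu> \<otimes> \<beta>) + e (\<mu> \<otimes> \<alpha>)" if "\<mu> : carrier R" for \<mu>
    using main[OF that] 4 by simp
  qed (use 4 K pos in auto)
 next
  case 5
  have "e \<nu> <= (if \<nu> = \<alpha> \<or> \<nu> = \<beta> \<or> \<nu> = \<gamma> then 1 else 0)" if "\<nu> : carrier R" for \<nu> using cnt[OF that] 5 by auto
  thus False by (rule spectrum_distinct[OF K 5 _ pos main])
 qed
qed

end

section \<open>Endomorphisms of Y \<otimes> Y killed by all maps to Y\<close>

context ac_fusion begin

lemma epi_split:
 assumes S: "smp S" and v: "ar v" "src v = P" "tgt v = S" "v ~= nl P S"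
 obtains s where "ar s" "src s = S" "tgt s = P" "v *. s = ii S"
proof -
 have O: "P : Ob" "S : Ob" using v by auto
 obtain n M i p where M: "!!j. j < n ==> smp (M j)" and b: "biproduct C {..<n::nat} M P i p"
  by (rule semisimple_biproduct[OF O(1)]) blast
 note d = biproductD[OF b]
 have "EX j<n. v *. i j ~= nl (M j) S"
 proof (rule ccontr)
  assume "\<not> (EX j<n. v *. i j ~= nl (M j) S)"
  hence "v *. i j = nl P S *. i j" if "j : {..<n}" for j using that d O by auto
  hence "v = nl P S" by (rule biproduct_jointly_epic[OF b, rotated 2]) (use v O in "auto simp: hom_iff")
  thus False using v by simp
 qed
 then obtain j where j: "j < n" "v *. i j ~= nl (M j) S" by blast
 have dj: "ar (i j)" "src (i j) = M j" "tgt (i j) = P" using d j by auto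
 have iso: "isa (v *. i j)" by (rule simple_arr_iso[OF M[OF j(1)] S _ _ _ j(2)]) (use dj v in auto)
 have iv: "ar (iv (v *. i j))" "src (iv (v *. i j)) = S" "tgt (iv (v *. i j)) = M j" using iso dj v by auto
 have "v *. (i j *. iv (v *. i j)) = (v *. i j) *. iv (v *. i j)" using dj v iv by simp
 also have "... = ii S" using iso v by (simp del: cmp_assoc)
 finally show ?thesis by (intro that[of "i j *. iv (v *. i j)"]) (use dj iv in simp_all)
qed

text \<open>Composition with \<open>p\<close> maps \<open>Hom(S, P)\<close> onto the line
  \<open>End(S)\<close>, and equality of dimensions makes it injective; likewise composition with
  \<open>i\<close> on \<open>Hom(P, S)\<close>.\<close>

lemma hom_one:
 assumes S: "smp S" and P: "P : Ob" "dm S P = 1"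
  and i: "ar i" "src i = S" "tgt i = P" and p: "ar p" "src p = P" "tgt p = S" and pi: "p *. i = ii S"
 shows "g : hm S P ==> g = i *. p *. g" "g : hm P S ==> g = g *. i *. p"
proof -
 note O = simple_obj[OF S] P(1)
 have SS: "dm S S = 1" using hdim_simple[OF S S] iso_refl[OF O(1)] by simp
 note v = vectorspace_HomV[OF O] fd_hom[OF O] vectorspace_HomV[OF O(1,1)] and v' = vectorspace_HomV[OF O(2,1)] fd_hom[OF O(2,1)] vectorspace_HomV[OF O(1,1)]
 have tail: "p *. i *. h = h" if "ar h" "tgt h = S" for h
  by (subst cmp_tail[OF pi]) (use i p that in auto)
 show "g = i *. p *. g" if g: "g : hm S P"
 proof -
  have L: "linear_on K (HomV C S P) (HomV C S S) (hm S P) (%g. p *. g)"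
   by (rule linear_on_homI) (use p in "auto simp: hom_iff")
  have im: "(%g. p *. g) ` hm S P = hm S S"
  proof
   show "(%g. p *. g) ` hm S P \<subseteq> hm S S" using p by (auto simp: hom_iff)
   show "hm S S \<subseteq> (%g. p *. g) ` hm S P"
   proof
    fix h assume h: "h : hm S S"
    show "h : (%g. p *. g) ` hm S P"
     by (rule image_eqI[of _ _ "i *. h"]) (use h i tail[of h] in "auto simp: hom_iff")
   qed
  qed
  have "sd (HomV C S P) {g : hm S P. p *. g = \<zero>\<^bsub>HomV C S S\<^esub>} = 0"
   using rank_nullity_on(1)[OF v hom_submodule[OF O] L] P(2) SS unfolding im by (simp add: hdim_def)
  hence k: "{g : hm S P. p *. g = \<zero>\<^bsub>HomV C S S\<^esub>} = {\<zero>\<^bsub>HomV C S P\<^esub>}"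
   by (rule vectorspace.subdim_eq_0[OF v(1,2) rank_nullity_on(3)[OF v hom_submodule[OF O] L]])
  have ga: "ar g" "src g = S" "tgt g = P" using g by (auto simp: hom_iff)
  have "g +. (\<ominus>\<^sub>K \<one>\<^sub>K) |> (i *. p *. g) : {g : hm S P. p *. g = \<zero>\<^bsub>HomV C S S\<^esub>}"
   using ga i p tail[of "p *. g"] by (simp add: hom_iff HomV_ops)
  hence n: "g +. (\<ominus>\<^sub>K \<one>\<^sub>K) |> (i *. p *. g) = nl S P" unfolding k by (simp add: HomV_ops)
  show ?thesis by (rule diff_eq_nul) (use n ga i p in auto)
 qed
 show "g = g *. i *. p" if g: "g : hm P S"
 proof -
  have L: "linear_on K (HomV C P S) (HomV C S S) (hm P S) (%g. g *. i)"
   by (rule linear_on_homI) (use i in "auto simp: hom_iff")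
  have im: "(%g. g *. i) ` hm P S = hm S S"
  proof
   show "(%g. g *. i) ` hm P S \<subseteq> hm S S" using i by (auto simp: hom_iff)
   show "hm S S \<subseteq> (%g. g *. i) ` hm P S"
   proof
    fix h assume h: "h : hm S S"
    show "h : (%g. g *. i) ` hm P S"
     by (rule image_eqI[of _ _ "h *. p"]) (use h i p pi in "auto simp: hom_iff")
   qed
  qed
  have "dm P S = 1" using hdim_sym[OF S P(1)] P(2) by simp
  hence "sd (HomV C P S) {g : hm P S. g *. i = \<zero>\<^bsub>HomV C S S\<^esub>} = 0"
   using rank_nullity_on(1)[OF v' hom_submodule[OF O(2,1)] L] SS unfolding im by (simp add: hdim_def)
  hence k: "{g : hm P S. g *. i = \<zero>\<^bsub>HomV C S S\<^esub>} = {\<zero>\<^bsub>HomV C P S\<^esub>}"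
   by (rule vectorspace.subdim_eq_0[OF v'(1,2) rank_nullity_on(3)[OF v' hom_submodule[OF O(2,1)] L]])
  have ga: "ar g" "src g = P" "tgt g = S" using g by (auto simp: hom_iff)
  have "g +. (\<ominus>\<^sub>K \<one>\<^sub>K) |> (g *. i *. p) : {g : hm P S. g *. i = \<zero>\<^bsub>HomV C S S\<^esub>}"
   using ga i p pi by (simp add: hom_iff HomV_ops)
  hence n: "g +. (\<ominus>\<^sub>K \<one>\<^sub>K) |> (g *. i *. p) = nl P S" unfolding k by (simp add: HomV_ops)
  show ?thesis by (rule diff_eq_nul) (use n ga i p in auto)
 qed
qed

text \<open>With multiplicity one the projection to the \<open>S\<close>-part is canonical: passing
  to other inclusions and projections, even through an isomorphic object, introduces two scalars
  that are inverse to each other. This identifies the twist of one projection with the next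
  one.\<close>

lemma idem_unique:
 assumes S: "smp S" and P: "P : Ob" "dm S P = 1"
  and i: "ar i" "src i = S" "tgt i = P" and p: "ar p" "src p = P" "tgt p = S" and pi: "p *. i = ii S"
  and i': "ar i'" "src i' = S'" "tgt i' = P" and p': "ar p'" "src p' = P" "tgt p' = S'" and pi': "p' *. i' = ii S'"
  and u: "isa u" "src u = S'" "tgt u = S"
 shows "i' *. p' = i *. p"
proof -
 note O = simple_obj[OF S] P(1)
 have ua: "ar u" "ar (iv u)" using u by auto
 define a b where "a = p *. i' *. iv u" and "b = u *. p' *. i"
 have ab: "ar a" "src a = S" "tgt a = S" "ar b" "src b = S" "tgt b = S" using i p i' p' u ua by (auto simp: a_def b_def)
 obtain \<alpha> where \<alpha>: "\<alpha> : carrier K" "a = \<alpha> |> ii S" using schur_End[OF S ab(1,2,3)] by blast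
 obtain \<beta> where \<beta>: "\<beta> : carrier K" "b = \<beta> |> ii S" using schur_End[OF S ab(4,5,6)] by blast
 have g1: "i' *. iv u = i *. a" unfolding a_def by (rule hom_one(1)[OF S P i p pi]) (use i' u ua in "auto simp: hom_iff")
 have g2: "u *. p' = b *. p"
 proof -
  have "u *. p' = (u *. p') *. i *. p" by (rule hom_one(2)[OF S P i p pi]) (use p' u ua in "auto simp: hom_iff")
  thus ?thesis unfolding b_def using i p p' u ua by simp
 qed
 have ba: "b *. a = ii S"
 proof -
  have "b *. a = u *. p' *. (i *. a)" unfolding b_def using ab i p' u ua by simp
  also have "... = u *. (p' *. i') *. iv u" unfolding g1[symmetric] using i' p' u ua by simp
  also have "... = ii S" unfolding pi' using u ua by simp
  finally show ?thesis .
 qed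
 have "b *. a = a *. b" unfolding \<alpha>(2) \<beta>(2) using O \<alpha>(1) \<beta>(1) m_comm[of \<alpha> \<beta>] by simp
 hence abi: "a *. b = ii S" using ba by simp
 have "i' *. p' = (i' *. iv u) *. (u *. p')" using i' p' u ua by simp
 also have "... = i *. (a *. b) *. p" unfolding g1 g2 using ab i p by simp
 also have "... = i *. p" unfolding abi using i p by simp
 finally show ?thesis .
qed

lemma scale_eqD:
 assumes f: "ar f" "f ~= nl (src f) (tgt f)" and c: "c : carrier K" "d : carrier K" "c |> f = d |> f"
 shows "c = d"
proof (rule ccontr)
 interpret v: vectorspace K "HomV C (src f) (tgt f)" by (rule vectorspace_HomV) (use f in "auto intro: arr_obj")
 assume "c ~= d"
 hence "f = \<zero>\<^bsub>HomV C (src f) (tgt f)\<^esub>"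
  using v.scale_unique[of f c d] f c by (auto simp: hom_iff scale_arr_def)
 thus False using f by (simp add: HomV_ops)
qed

lemma ide_nonzero: "smp S ==> ii S ~= nl S S"
 using zero_object_iff by (auto simp: simple_object_def)

text \<open>Such an \<open>F\<close> is determined by its scalars \<open>a k\<close> on the three
  simple objects of multiplicity one. The twist permutes their projections cyclically, so the
  eigenvalue equation becomes \<open>a k = \<mu> a (k + 1)\<close>: one scalar determines the
  others, and it vanishes unless \<open>\<mu>^3 = 1\<close>.\<close>

lemma kills_bound:
 assumes m: "xmod X Y \<phi>" and \<mu>: "\<mu> : carrier K" and Y: "smp Y"
  and S: "!!k. k < 3 ==> smp (S k)" "!!k. k < 3 ==> dm (S k) (Y >< Y) = 1"
  and cyc: "!!k. k < 3 ==> isom (X >< S k) (S ((k + 1) mod 3))"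
  and all: "!!T. smp T ==> isom T Y \<or> (EX k<3::nat. isom T (S k))"
 shows "sd (HomV C (Y >< Y) (Y >< Y)) (kills X Y \<phi> \<mu> (hm (Y >< Y) Y)) <= (if \<mu> \<otimes>\<^sub>K (\<mu> \<otimes>\<^sub>K \<mu>) = \<one>\<^sub>K then 1 else 0)"
proof -
 note m' = xmodD[OF m]
 let ?P = "Y >< Y" and ?\<psi> = "xact X \<phi> Y Y"
 have P: "?P : Ob" using m' by simp
 have mP: "xmod X ?P ?\<psi>" by (rule xmod_xact[OF m m'(2)])
 note mp = xmodD[OF mP]
 have SO: "S k : Ob" if "k < 3" for k using simple_obj[OF S(1)[OF that]] .
 have "EX q. k < 3 --> ar (fst q) & src (fst q) = S k & tgt (fst q) = ?P & ar (snd q) & src (snd q) = ?P & tgt (snd q) = S k & snd q *. fst q = ii (S k)" for k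
 proof (cases "k < 3")
  case True
  interpret v: vectorspace K "HomV C (S k) ?P" by (rule vectorspace_HomV[OF SO[OF True] P])
  have "EX f:hm (S k) ?P. f ~= nl (S k) ?P"
  proof (rule ccontr)
   assume "\<not> (EX f:hm (S k) ?P. f ~= nl (S k) ?P)"
   hence "hm (S k) ?P = {\<zero>\<^bsub>HomV C (S k) ?P\<^esub>}" using SO[OF True] P by (auto simp: HomV_ops hom_iff)
   thus False using S(2)[OF True] v.subdim_zero by (simp add: hdim_def)
  qed
  then obtain f where f: "ar f" "src f = S k" "tgt f = ?P" "f ~= nl (S k) ?P" by (auto simp: hom_iff)
  obtain r where r: "ar r" "src r = ?P" "tgt r = S k" "r *. f = ii (S k)" by (rule simple_mono_split[OF S(1)[OF True] f])
  show ?thesis by (rule exI[of _ "(f, r)"]) (use f r in simp)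
 qed simp
 hence "ALL k. EX q. k < 3 --> ar (fst q) & src (fst q) = S k & tgt (fst q) = ?P & ar (snd q) & src (snd q) = ?P & tgt (snd q) = S k & snd q *. fst q = ii (S k)" by blast
 from choice[OF this] obtain q where q: "!!k. k < 3 ==> ar (fst (q k)) & src (fst (q k)) = S k & tgt (fst (q k)) = ?P & ar (snd (q k)) & src (snd (q k)) = ?P & tgt (snd (q k)) = S k & snd (q k) *. fst (q k) = ii (S k)" by blast
 define i p where "i k = fst (q k)" and "p k = snd (q k)" for k
 have ip: "ar (i k)" "src (i k) = S k" "tgt (i k) = ?P" "ar (p k)" "src (p k) = ?P" "tgt (p k) = S k" "p k *. i k = ii (S k)" if "k < 3" for k
  using q[OF that] by (auto simp: i_def p_def)
 define e where "e k = i k *. p k" for k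
 have ea: "ar (e k)" "src (e k) = ?P" "tgt (e k) = ?P" if "k < 3" for k using ip[OF that] by (auto simp: e_def)
 have pie: "p k *. i k *. h = h" if "k < 3" "ar h" "tgt h = S k" for k h
  by (subst cmp_tail[OF ip(7)[OF that(1)]]) (use ip[OF that(1)] that in auto)
 have pnz: "p k ~= nl ?P (S k)" if "k < 3" for k
 proof
  assume "p k = nl ?P (S k)"
  hence "p k *. i k = nl (S k) (S k)" using ip[OF that] SO[OF that] P by simp
  thus False using ip(7)[OF that] ide_nonzero[OF S(1)[OF that]] by simp
 qed
 have enz: "e k ~= nl ?P ?P" if "k < 3" for k
 proof
  assume "e k = nl ?P ?P"
  hence "p k *. e k = nl ?P (S k)" using ip[OF that] SO[OF that] P by simp
  moreover have "p k *. e k = p k" unfolding e_def by (rule pie[OF that]) (use ip[OF that] in auto)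
  ultimately show False using pnz[OF that] by simp
 qed
 have twe: "tw X ?\<psi> ?\<psi> (e k) = e ((k + 1) mod 3)" if k: "k < 3" for k
 proof -
  let ?l = "(k + 1) mod 3"
  have l: "?l < 3" by simp
  obtain u where u: "isa u" "src u = X >< S k" "tgt u = S ?l" using isomorphic_iff[OF obj_ten[OF m'(1) SO[OF k]] SO[OF l]] cyc[OF k] by blast
  note ik = ip[OF k]
  \<comment> \<open>The twisted projection factors through \<open>X \<otimes> S k\<close>, which is
    isomorphic to the next simple object, and is therefore the projection of that one.\<close>
  have "(?\<psi> *. (ii X ox i k)) *. ((ii X ox p k) *. iv ?\<psi>) = e ?l"
   unfolding e_def
   by (rule idem_unique[OF S(1)[OF l] P S(2)[OF l] ip(1-7)[OF l] _ _ _ _ _ _ _ u]) (use ik mp SO[OF k] in simp_all)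
  thus ?thesis unfolding tw_def e_def using ik mp by simp
 qed
 have coefs: "EX a. (ALL k<3. a k : carrier K & p k *. F = a k |> p k) & (ALL k<3. a k = \<mu> \<otimes>\<^sub>K a ((k + 1) mod 3))"
  if F: "F : kills X Y \<phi> \<mu> (hm ?P Y)" for F
 proof -
  have Fa: "ar F" "src F = ?P" "tgt F = ?P" "tw X ?\<psi> ?\<psi> F = \<mu> |> F" using F by (auto simp: kills_def eig_def hom_iff)
  have "EX a. k < 3 --> a : carrier K & p k *. F = a |> p k" for k
  proof (cases "k < 3")
   case True
   note ik = ip[OF True]
   have s: "ar (p k *. F *. i k)" "src (p k *. F *. i k) = S k" "tgt (p k *. F *. i k) = S k" using ik Fa by auto
   obtain a where a: "a : carrier K" "p k *. F *. i k = a |> ii (S k)" using schur_End[OF S(1)[OF True] s] by blast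
   have "p k *. F = (p k *. F) *. i k *. p k" by (rule hom_one(2)[OF S(1)[OF True] P S(2)[OF True] ik]) (use ik Fa in "auto simp: hom_iff")
   also have "... = (p k *. F *. i k) *. p k" using ik Fa by simp
   also have "... = a |> p k" unfolding a(2) using ik a(1) SO[OF True] by simp
   finally show ?thesis using a(1) by blast
  qed simp
  hence "ALL k. EX a. k < 3 --> a : carrier K & p k *. F = a |> p k" by blast
  from choice[OF this] obtain a where a: "!!k. k < 3 ==> a k : carrier K & p k *. F = a k |> p k" by blast
  have eF: "e k *. F = a k |> e k" if k: "k < 3" for k
  proof -
   have "e k *. F = i k *. (p k *. F)" unfolding e_def using ip[OF k] Fa by simp
   thus ?thesis using a[OF k] ip[OF k] by (simp add: e_def)
  qed
  have "a k = \<mu> \<otimes>\<^sub>K a ((k + 1) mod 3)" if k: "k < 3" for k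
  proof -
   let ?l = "(k + 1) mod 3"
   have l: "?l < 3" by simp
   have "a k |> e ?l = a k |> tw X ?\<psi> ?\<psi> (e k)" unfolding twe[OF k] ..
   also have "... = tw X ?\<psi> ?\<psi> (e k *. F)" unfolding eF[OF k] by (rule tw_scale[OF mP mP, symmetric]) (use ea[OF k] a[OF k] in auto)
   also have "... = e ?l *. (\<mu> |> F)" unfolding tw_cmp[OF mP mP mP Fa(1,2,3) ea[OF k]] twe[OF k] Fa(4) ..
   also have "... = \<mu> |> (e ?l *. F)" using ea[OF l] Fa \<mu> by simp
   also have "... = (\<mu> \<otimes>\<^sub>K a ?l) |> e ?l" unfolding eF[OF l] using ea[OF l] a[OF l] \<mu> by simp
   finally have eq: "a k |> e ?l = (\<mu> \<otimes>\<^sub>K a ?l) |> e ?l" .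
   show ?thesis by (rule scale_eqD[OF _ _ _ _ eq]) (use ea[OF l] enz[OF l] a[OF k] a[OF l] \<mu> in auto)
  qed
  thus ?thesis using a by blast
 qed
 have zero: "F = nl ?P ?P" if F: "F : kills X Y \<phi> \<mu> (hm ?P Y)" and pF: "!!k. k < 3 ==> p k *. F = nl ?P (S k)" for F
 proof -
  have Fa: "ar F" "src F = ?P" "tgt F = ?P" and kil: "!!w. w : hm ?P Y ==> w *. F = nl ?P Y" using F by (auto simp: kills_def eig_def hom_iff)
  obtain n M j r where M: "!!k. k < n ==> smp (M k)" and b: "biproduct C {..<n::nat} M ?P j r"
   by (rule semisimple_biproduct[OF P]) blast
  note d = biproductD[OF b]
  show ?thesis
  proof (rule biproduct_jointly_monic[OF b])
   show "F : hm ?P ?P" "nl ?P ?P : hm ?P ?P" using Fa P by (auto simp: hom_iff)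
   fix k assume k: "k : {..<n}"
   hence rk: "ar (r k)" "src (r k) = ?P" "tgt (r k) = M k" and Mk: "smp (M k)" using d M by auto
   have MO: "M k : Ob" by (rule simple_obj[OF Mk])
   have uz: "r k *. F = nl ?P (M k)" if u: "isa u" "src u = M k" "u *. r k *. F = nl ?P (tgt u)" for u
    by (rule iso_cancel_left[OF u(1)]) (use u rk Fa P MO arr_obj(2)[of u] in auto)
   have "r k *. F = nl ?P (M k)"
    using all[OF Mk]
   proof
    assume "isom (M k) Y"
    then obtain u where u: "isa u" "src u = M k" "tgt u = Y" using isomorphic_iff[OF MO m'(2)] by blast
    have "(u *. r k) *. F = nl ?P Y" by (rule kil) (use u rk in "auto simp: hom_iff")
    hence "u *. r k *. F = nl ?P (tgt u)" using u rk Fa by simp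
    thus ?thesis by (rule uz[OF u(1,2)])
   next
    assume "EX l<3. isom (M k) (S l)"
    then obtain l where l: "l < 3" "isom (M k) (S l)" by blast
    then obtain u where u: "isa u" "src u = M k" "tgt u = S l" using isomorphic_iff[OF MO SO[OF l(1)]] by blast
    note il = ip[OF l(1)]
    have "u *. r k = (u *. r k) *. i l *. p l" by (rule hom_one(2)[OF S(1)[OF l(1)] P S(2)[OF l(1)] il]) (use u rk in "auto simp: hom_iff")
    hence "(u *. r k) *. F = ((u *. r k) *. i l *. p l) *. F" by (rule arg_cong)
    also have "... = u *. r k *. i l *. (p l *. F)" using u rk il Fa by simp
    also have "... = nl ?P (S l)" unfolding pF[OF l(1)] using u rk il P SO[OF l(1)] by simp
    finally have "u *. r k *. F = nl ?P (tgt u)" using u rk Fa by simp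
    thus ?thesis by (rule uz[OF u(1,2)])
   qed
   thus "r k *. F = r k *. nl ?P ?P" using rk P by simp
  qed
 qed
 have zero0: "F = nl ?P ?P" if F: "F : kills X Y \<phi> \<mu> (hm ?P Y)" and h: "p 0 *. F = nl ?P (S 0) \<or> \<mu> \<otimes>\<^sub>K (\<mu> \<otimes>\<^sub>K \<mu>) ~= \<one>\<^sub>K" for F
 proof -
  obtain a where a: "ALL k<3. a k : carrier K & p k *. F = a k |> p k" "ALL k<3. a k = \<mu> \<otimes>\<^sub>K a ((k + 1) mod 3)" using coefs[OF F] by blast
  have ac: "a 0 : carrier K" "a 1 : carrier K" "a 2 : carrier K" using a(1) by auto
  have r: "a 0 = \<mu> \<otimes>\<^sub>K a 1" "a 1 = \<mu> \<otimes>\<^sub>K a 2" "a 2 = \<mu> \<otimes>\<^sub>K a 0"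
   using a(2)[rule_format, of 0] a(2)[rule_format, of 1] a(2)[rule_format, of 2] by (simp_all add: numeral_2_eq_2)
  have a0: "a 0 = \<zero>\<^sub>K"
   using h
  proof
   assume e: "p 0 *. F = nl ?P (S 0)"
   show ?thesis
   proof (rule scale_eqD[of "p 0"])
    have "a 0 |> p 0 = nl ?P (S 0)" using a(1) e by simp
    thus "a 0 |> p 0 = \<zero>\<^sub>K |> p 0" using ip[of 0] by simp
   qed (use ip[of 0] pnz[of 0] ac in auto)
  next
   assume ne: "\<mu> \<otimes>\<^sub>K (\<mu> \<otimes>\<^sub>K \<mu>) ~= \<one>\<^sub>K"
   have "a 0 = \<mu> \<otimes>\<^sub>K (\<mu> \<otimes>\<^sub>K (\<mu> \<otimes>\<^sub>K a 0))" using r by metis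
   hence "a 0 \<otimes>\<^sub>K (\<mu> \<otimes>\<^sub>K (\<mu> \<otimes>\<^sub>K \<mu>)) = a 0" using ac(1) \<mu> by (simp add: m_ac)
   thus ?thesis using mult_eq_self[of "a 0" "\<mu> \<otimes>\<^sub>K (\<mu> \<otimes>\<^sub>K \<mu>)"] ac(1) \<mu> ne by auto
  qed
  hence a2: "a 2 = \<zero>\<^sub>K" using r(3) \<mu> by simp
  hence a1: "a 1 = \<zero>\<^sub>K" using r(2) \<mu> by simp
  show ?thesis
  proof (rule zero[OF F])
   fix k :: nat assume k: "k < 3"
   then consider "k = 0" | "k = 1" | "k = 2" by linarith
   hence "a k = \<zero>\<^sub>K" using a0 a1 a2 by cases simp_all
   thus "p k *. F = nl ?P (S k)" using a(1) k ip[OF k] by simp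
  qed
 qed
 have Wh: "hm ?P Y \<subseteq> hm ?P Y" by simp
 note ks = kills_submodule[OF m \<mu> Wh]
 have Fa: "ar F" "src F = ?P" "tgt F = ?P" if "F : kills X Y \<phi> \<mu> (hm ?P Y)" for F using that by (auto simp: kills_def eig_def hom_iff)
 have p0: "ar (p 0)" "src (p 0) = ?P" "tgt (p 0) = S 0" and S0: "S 0 : Ob" using ip[of 0] SO[of 0] by auto
 show ?thesis
 proof (cases "\<mu> \<otimes>\<^sub>K (\<mu> \<otimes>\<^sub>K \<mu>) = \<one>\<^sub>K")
  case True
  have "sd (HomV C ?P ?P) (kills X Y \<phi> \<mu> (hm ?P Y)) <= sd (HomV C ?P (S 0)) (hm ?P (S 0))"
  proof (rule subdim_inj_le[OF P P P S0 ks hom_submodule[OF P S0]])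
   show L: "linear_on K (HomV C ?P ?P) (HomV C ?P (S 0)) (kills X Y \<phi> \<mu> (hm ?P Y)) (%F. p 0 *. F)"
   proof (rule linear_on_homI)
    show "kills X Y \<phi> \<mu> (hm ?P Y) \<subseteq> hm ?P ?P" using Fa by (auto simp: hom_iff)
    show "p 0 *. F : hm ?P (S 0)" if "F : kills X Y \<phi> \<mu> (hm ?P Y)" for F using Fa[OF that] p0 by (simp add: hom_iff)
    show "p 0 *. (F +. G) = p 0 *. F +. p 0 *. G" if "F : kills X Y \<phi> \<mu> (hm ?P Y)" "G : kills X Y \<phi> \<mu> (hm ?P Y)" for F G
     using Fa[OF that(1)] Fa[OF that(2)] p0 by simp
    show "p 0 *. (c |> F) = c |> (p 0 *. F)" if "c : carrier K" "F : kills X Y \<phi> \<mu> (hm ?P Y)" for F c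
     using that(1) Fa[OF that(2)] p0 by simp
   qed
   show "inj_on (%F. p 0 *. F) (kills X Y \<phi> \<mu> (hm ?P Y))"
    by (rule linear_inj_on[OF P P ks L P S0]) (rule zero0, auto)
   show "(%F. p 0 *. F) ` kills X Y \<phi> \<mu> (hm ?P Y) \<subseteq> hm ?P (S 0)" by (rule image_subsetI) (use Fa p0 in "simp add: hom_iff")
  qed
  also have "... = 1" using hdim_sym[OF S(1)[of 0] P] S(2)[of 0] by (simp add: hdim_def)
  finally show ?thesis using True by simp
 next
  case False
  interpret v: vectorspace K "HomV C ?P ?P" by (rule vectorspace_HomV[OF P P])
  have "kills X Y \<phi> \<mu> (hm ?P Y) = {\<zero>\<^bsub>HomV C ?P ?P\<^esub>}"
   using zero0 False ks by (auto simp: HomV_ops submodule_def)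
  thus ?thesis using v.subdim_zero by simp
 qed
qed

end

context ac_symmetric begin

lemma scalar_End_iso:
 assumes S: "smp S" and u: "isa u" "src u = S" "tgt u = Q" and f: "ar f" "src f = Q" "tgt f = Q"
 shows "EX c:carrier K. f = c |> ii Q"
proof -
 have SO: "S : Ob" by (rule simple_obj[OF S])
 obtain c where c: "c : carrier K" "iv u *. f *. u = c |> ii S"
  using schur_End[OF S, of "iv u *. f *. u"] u f by auto
 have "f = u *. (iv u *. f *. u) *. iv u" using u f by simp
 also have "... = c |> ii Q" unfolding c(2) using u c(1) SO by simp
 finally show ?thesis using c(1) by blast
qed

text \<open>\<open>X \<otimes> X\<close> is simple, so the braiding on it is a scalar
  \<open>c\<close>, and \<open>c^2 = 1\<close> by symmetry. The braiding
  \<open>Y \<otimes> X \<rightarrow> X \<otimes> Y\<close> followed by \<open>\<phi>\<close> is an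
  eigenvector \<open>\<rho>\<close> for \<open>c\<close>: naturality and the hexagon produce one
  exchange of two copies of \<open>X\<close>. Applying \<open>\<rho>\<close> twice gives an
  eigenvector on \<open>X \<otimes> X\<close> for \<open>c^2\<close>.\<close>

lemma eigdim_square:
 assumes m: "xmod X Y \<phi>" and X': "smp X'" "isom X' (X >< X)" and Y: "\<not> zero_object C Y"
 shows "eigdim X Y \<phi> X' \<one>\<^sub>K \<ge> 1"
proof -
 note m' = xmodD[OF m]
 have XX: "X >< X : Ob" and X'O: "X' : Ob" using m' simple_obj[OF X'(1)] by auto
 obtain u where u: "isa u" "src u = X'" "tgt u = X >< X" using isomorphic_iff[OF X'O XX] X'(2) by blast
 obtain c where c: "c : carrier K" "brd C X X = c |> ii (X >< X)"
  using scalar_End_iso[OF X'(1) u, of "brd C X X"] m' by auto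
 have nzX: "ii (X >< X) ~= nl (X >< X) (X >< X)"
 proof
  assume z: "ii (X >< X) = nl (X >< X) (X >< X)"
  have "ii X' = iv u *. ii (X >< X) *. u" using u by simp
  also have "... = nl X' X'" unfolding z using u XX X'O by simp
  finally show False using ide_nonzero[OF X'(1)] by simp
 qed
 have cc: "c \<otimes>\<^sub>K c = \<one>\<^sub>K"
 proof (rule scale_eqD[of "ii (X >< X)"])
  have "(c |> ii (X >< X)) *. (c |> ii (X >< X)) = ii (X >< X)" using brd_brd[OF m'(1,1)] unfolding c(2) .
  thus "(c \<otimes>\<^sub>K c) |> ii (X >< X) = \<one>\<^sub>K |> ii (X >< X)" using c(1) XX by simp
 qed (use XX c nzX in auto)
 define \<rho> where "\<rho> = \<phi> *. brd C Y X"
 have \<rho>: "isa \<rho>" "src \<rho> = Y >< X" "tgt \<rho> = Y" using m' by (auto simp: \<rho>_def)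
 have ra: "ar \<rho>" using \<rho> by simp
 have mX: "xmod X (Y >< X) (xact X \<phi> Y X)" by (rule xmod_xact[OF m m'(1)])
 have mXX: "xmod X (Y >< (X >< X)) (xact X \<phi> Y (X >< X))" "xmod X ((Y >< X) >< X) (xact X (xact X \<phi> Y X) (Y >< X) X)"
  using m mX m' by (auto intro!: xmod_xact)
 have sw: "swap12 C X X Y = c |> ii (X >< (X >< Y))"
  unfolding swap12_def c(2) using m' c(1) by simp
 have nat: "brd C Y X *. (\<phi> ox ii X) = (ii X ox \<phi>) *. brd C (X >< Y) X" by (rule brd_nat) (use m' in auto)
 have tX: "ar (tw X (xact X \<phi> Y X) \<phi> \<rho>) & src (tw X (xact X \<phi> Y X) \<phi> \<rho>) = Y >< X & tgt (tw X (xact X \<phi> Y X) \<phi> \<rho>) = Y"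
  by (rule tw_arr[OF mX m ra \<rho>(2,3)])
 have "\<rho> *. xact X \<phi> Y X = \<phi> *. (brd C Y X *. (\<phi> ox ii X)) *. iv (az X Y X)"
  unfolding \<rho>_def xact_def using m' by simp
 also have "... = \<phi> *. (ii X ox \<phi>) *. (c |> ii (X >< (X >< Y))) *. (ii X ox brd C Y X)"
  unfolding nat hexagon2_arr[OF m'(1,2,1)] sw using m' c(1) by simp
 also have "... = c |> (\<phi> *. (ii X ox \<rho>))" unfolding \<rho>_def using m' c(1) by simp
 finally have ax: "\<rho> *. xact X \<phi> Y X = c |> (\<phi> *. (ii X ox \<rho>))" .
 have "\<rho> = (\<rho> *. xact X \<phi> Y X) *. iv (xact X \<phi> Y X)" using xmodD[OF mX] ra \<rho> by simp
 also have "... = c |> tw X (xact X \<phi> Y X) \<phi> \<rho>" unfolding ax tw_def using xmodD[OF mX] m' ra \<rho> c(1) by simp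
 finally have r1: "\<rho> = c |> tw X (xact X \<phi> Y X) \<phi> \<rho>" .
 have "c |> \<rho> = c |> (c |> tw X (xact X \<phi> Y X) \<phi> \<rho>)" using r1 by (rule arg_cong)
 hence tr: "tw X (xact X \<phi> Y X) \<phi> \<rho> = c |> \<rho>" using c(1) cc tX by simp
 define g where "g = \<rho> *. (\<rho> ox ii X) *. iv (az Y X X)"
 have g: "isa g" "src g = Y >< (X >< X)" "tgt g = Y" using \<rho> m' by (auto simp: g_def)
 have "tw X (xact X \<phi> Y (X >< X)) \<phi> g = tw X (xact X \<phi> Y X) \<phi> \<rho> *. tw X (xact X \<phi> Y (X >< X)) (xact X \<phi> Y X) ((\<rho> ox ii X) *. iv (az Y X X))"
  unfolding g_def by (rule tw_cmp[OF mXX(1) mX m]) (use \<rho> ra m' in auto)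
 also have "tw X (xact X \<phi> Y (X >< X)) (xact X \<phi> Y X) ((\<rho> ox ii X) *. iv (az Y X X))
  = tw X (xact X (xact X \<phi> Y X) (Y >< X) X) (xact X \<phi> Y X) (\<rho> ox ii X) *. tw X (xact X \<phi> Y (X >< X)) (xact X (xact X \<phi> Y X) (Y >< X) X) (iv (az Y X X))"
  by (rule tw_cmp[OF mXX(1,2) mX]) (use \<rho> ra m' in auto)
 also have "tw X (xact X (xact X \<phi> Y X) (Y >< X) X) (xact X \<phi> Y X) (\<rho> ox ii X) = (c |> \<rho>) ox ii X"
  by (subst tw_ten[OF mX m ra \<rho>(2,3)]) (use m' tr in auto)
 also have "tw X (xact X \<phi> Y (X >< X)) (xact X (xact X \<phi> Y X) (Y >< X) X) (iv (az Y X X)) = iv (az Y X X)"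
  by (rule tw_asc_inv[OF m m'(1,1)])
 also have "tw X (xact X \<phi> Y X) \<phi> \<rho> *. ((c |> \<rho>) ox ii X) *. iv (az Y X X) = g"
  unfolding tr g_def using ra \<rho> m' c(1) cc by simp
 finally have tg: "tw X (xact X \<phi> Y (X >< X)) \<phi> g = g" .
 have "eigdim X Y \<phi> (X >< X) \<one>\<^sub>K \<ge> 1"
  unfolding eigdim_def
 proof (rule subdim_pos)
  show "Y >< (X >< X) : Ob" "Y : Ob" using m' by auto
  show "submodule K (eig X (Y >< (X >< X)) (xact X \<phi> Y (X >< X)) Y \<phi> \<one>\<^sub>K) (HomV C (Y >< (X >< X)) Y)"
   by (rule eig_submodule[OF mXX(1) m]) simp
  show "g : eig X (Y >< (X >< X)) (xact X \<phi> Y (X >< X)) Y \<phi> \<one>\<^sub>K" using tg g by (simp add: eig_def hom_iff)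
  show "g ~= nl (Y >< (X >< X)) Y"
  proof
   assume z: "g = nl (Y >< (X >< X)) Y"
   have "ii Y = g *. iv g" using g by simp
   also have "... = nl Y Y" by (subst z) (use g m' in auto)
   finally show False using Y zero_object_iff m' by blast
  qed
 qed
 thus ?thesis using eigdim_iso[OF m _ X'O XX X'(2), of "\<one>\<^sub>K"] by simp
qed

lemma near_group_impossible:
 assumes I: "reps I" and Ie: "I = {\<bbbI>, Y, X, X'}" and dist: "distinct [\<bbbI>, Y, X, X']" and dls: "dl I Y = Y" "dl I X = X'" "dl I X' = X"
  and N: "dm Y (Y >< Y) = 3" "dm X (Y >< Y) = 1" "dm X (Y >< X) = 0" "dm X' (Y >< X) = 0"
   "dm X (X >< X) = 0" "dm X' (X >< X) = 1"
 shows False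
proof -
 note r = repsD[OF I]
 note fr = fusion_rules[OF I Ie dist dls] and f4 = sum_four[OF I Ie dist dls]
 have iI: "\<bbbI> : I" "Y : I" "X : I" "X' : I" using Ie by auto
 note O = r(3)[OF iI(2)] r(3)[OF iI(3)] r(3)[OF iI(4)]
 have cases: "Q A" if "A : I" "Q \<bbbI>" "Q Y" "Q X" "Q X'" for Q A using that Ie by blast
 have dn: "\<bbbI> ~= Y" "\<bbbI> ~= X" "\<bbbI> ~= X'" "Y ~= X" "Y ~= X'" "X ~= X'" using dist by auto
 let ?P = "Y >< Y"
 have P: "?P : Ob" using O by simp
 have "isom Y (X >< Y)"
 proof (rule iso_of_hdim[OF I iI(2)])
  fix A assume A: "A : I"
  have "dm A (X >< Y) = dm A (Y >< X)" by (rule hdim_ten_comm) (use O r(3)[OF A] in auto)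
  also have "... = (if A = Y then 1 else 0)" by (rule cases[OF A]) (use fr N dn in auto)
  finally show "dm A (X >< Y) = (if A = Y then 1 else 0)" .
 qed (use O in auto)
 then obtain \<theta> where \<theta>: "isa \<theta>" "src \<theta> = Y" "tgt \<theta> = X >< Y" using isomorphic_iff[of Y "X >< Y"] O by auto
 define \<phi> where "\<phi> = iv \<theta>"
 have m: "xmod X Y \<phi>" using \<theta> O by (simp add: xmod_def \<phi>_def)
 have XX: "isom X' (X >< X)"
 proof (rule iso_of_hdim[OF I iI(4)])
  fix A assume A: "A : I"
  show "dm A (X >< X) = (if A = X' then 1 else 0)" by (rule cases[OF A]) (use fr N dn in auto)
 qed (use O in auto)
 have XX': "isom \<bbbI> (X >< X')"
 proof (rule iso_of_hdim[OF I iI(1)])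
  fix A assume A: "A : I"
  show "dm A (X >< X') = (if A = \<bbbI> then 1 else 0)" by (rule cases[OF A]) (use fr N dn in auto)
 qed (use O in auto)
 have sY: "smp Y" by (rule r(2)[OF iI(2)])
 have Ynz: "\<not> zero_object C Y" using sY by (simp add: simple_object_def)
 \<comment> \<open>The adjunction needs \<open>Y\<close> itself in the role of the left dual. So
   \<open>B\<close> is an object that has \<open>Y\<close> as its dual; as \<open>Y\<close> is
   self-dual, \<open>B\<close> is isomorphic to \<open>Y\<close>.\<close>
 obtain B where B: "is_left_dual C B Y" "B : Ob" using rigid O(1) unfolding rigid_def is_left_dual_def by blast
 obtain ev co where d: "dual_pair C B Y ev co" by (rule left_dual_pair[OF B(1)])
 have hB: "dm T B = (if T = Y then 1 else 0)" if T: "T : I" for T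
 proof -
  let ?A = "dl I T"
  have A: "?A : I" by (rule dl(1)[OF I T])
  have "dm \<bbbI> (?A >< B) = dm ?A Y" by (rule hdim_unit_ten[OF B(1) r(3)[OF A] B(2) O(1)])
  also have "... = (if ?A = Y then 1 else 0)" by (rule r(4)[OF A iI(2)])
  also have "?A = Y \<longleftrightarrow> T = Y" using dl_dl[OF I T] dls(1) by metis
  finally have 1: "dm \<bbbI> (?A >< B) = (if T = Y then 1 else 0)" .
  have "dm \<bbbI> (?A >< B) = (\<Sum>U\<in>I. \<Sum>S\<in>I. dm U ?A * dm S B * dm \<bbbI> (U >< S))"
   by (rule hdim_ten_expand[OF I]) (use r(3)[OF A] B in auto)
  also have "... = (\<Sum>U\<in>I. if U = ?A then (\<Sum>S\<in>I. dm S B * dm \<bbbI> (?A >< S)) else 0)"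
   by (intro sum.cong refl) (use r(4) A in auto)
  also have "... = (\<Sum>S\<in>I. dm S B * dm \<bbbI> (?A >< S))" using r(1) A by simp
  also have "... = (\<Sum>S\<in>I. if S = T then dm T B else 0)"
  proof (intro sum.cong refl)
   fix S assume S: "S : I"
   have e: "?A = dl I S \<longleftrightarrow> S = T" using dl_dl[OF I T] dl_dl[OF I S] by metis
   show "dm S B * dm \<bbbI> (?A >< S) = (if S = T then dm T B else 0)"
    unfolding dl(2)[OF I S A] e by simp
  qed
  also have "... = dm T B" using r(1) T by simp
  finally show ?thesis using 1 by simp
 qed
 have YB: "isom Y B" by (rule iso_of_hdim[OF I iI(2) B(2) hB])
 define e where "e \<nu> = eigdim X Y \<phi> Y \<nu>" for \<nu>
 let ?\<psi> = "xact X \<phi> Y Y"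
 have mP: "xmod X ?P ?\<psi>" by (rule xmod_xact[OF m O(1)])
 obtain \<alpha>s where fl: "flagged X Y \<phi> (hm ?P Y) \<alpha>s" using flagged_full[OF m] by blast
 have "length \<alpha>s = dm ?P Y" using fl by (simp add: flagged_def hdim_def)
 also have "... = 3" using hdim_sym[OF sY P] N(1) by simp
 finally obtain \<alpha> \<beta> \<gamma> where \<alpha>s: "\<alpha>s = [\<alpha>, \<beta>, \<gamma>]" by (auto simp: length_Suc_conv numeral_eq_Suc)
 have K: "\<alpha> : carrier K" "\<beta> : carrier K" "\<gamma> : carrier K" and pos: "e \<alpha> \<ge> 1" "e \<beta> \<ge> 1" "e \<gamma> \<ge> 1"
  using fl by (auto simp: flagged_def \<alpha>s e_def)
 have cnt: "e \<nu> <= count_list [\<alpha>, \<beta>, \<gamma>] \<nu>" if "\<nu> : carrier K" for \<nu>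
 proof -
  have "eig X ?P ?\<psi> Y \<phi> \<nu> \<inter> hm ?P Y = eig X ?P ?\<psi> Y \<phi> \<nu>" by (auto simp: eig_def)
  thus ?thesis using fl that unfolding flagged_def \<alpha>s e_def eigdim_def by metis
 qed
 \<comment> \<open>A non-zero eigenvector \<open>v\<close> for 0 would have a section
   \<open>s\<close>, and functoriality of the twist would give
   \<open>id = tw (v s) = tw v tw s = 0\<close>.\<close>
 have "e \<zero>\<^sub>K = 0"
 proof (rule ccontr)
  assume ne: "e \<zero>\<^sub>K ~= 0"
  interpret v: vectorspace K "HomV C ?P Y" by (rule vectorspace_HomV[OF P O(1)])
  have "EX v:eig X ?P ?\<psi> Y \<phi> \<zero>\<^sub>K. v ~= nl ?P Y"
  proof (rule ccontr)
   assume "\<not> (EX v:eig X ?P ?\<psi> Y \<phi> \<zero>\<^sub>K. v ~= nl ?P Y)"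
   hence "eig X ?P ?\<psi> Y \<phi> \<zero>\<^sub>K = {\<zero>\<^bsub>HomV C ?P Y\<^esub>}"
    using eig_submodule[OF mP m, of "\<zero>\<^sub>K"] by (auto simp: HomV_ops submodule_def)
   thus False using ne v.subdim_zero by (simp add: e_def eigdim_def)
  qed
  then obtain v where v: "ar v" "src v = ?P" "tgt v = Y" "tw X ?\<psi> \<phi> v = \<zero>\<^sub>K |> v" "v ~= nl ?P Y"
   by (auto simp: eig_def hom_iff)
  obtain s where s: "ar s" "src s = Y" "tgt s = ?P" "v *. s = ii Y" by (rule epi_split[OF sY v(1,2,3,5)])
  have t: "ar (tw X \<phi> ?\<psi> s) & src (tw X \<phi> ?\<psi> s) = Y & tgt (tw X \<phi> ?\<psi> s) = ?P" by (rule tw_arr[OF m mP s(1,2,3)])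
  have "ii Y = tw X \<phi> \<phi> (v *. s)" unfolding s(4) by (rule tw_ide[OF m, symmetric])
  also have "... = tw X ?\<psi> \<phi> v *. tw X \<phi> ?\<psi> s" by (rule tw_cmp[OF m mP m s(1,2,3) v(1,2,3)])
  also have "... = nl Y Y" unfolding v(4) using v t O P by simp
  finally show False using ide_nonzero[OF sY] by simp
 qed
 hence nz: "\<alpha> ~= \<zero>\<^sub>K" "\<beta> ~= \<zero>\<^sub>K" "\<gamma> ~= \<zero>\<^sub>K" using pos by auto
 \<comment> \<open>Tensoring with \<open>X\<close> moves the unit to \<open>X\<close>,
   \<open>X\<close> to \<open>X'\<close> and \<open>X'\<close> back to the unit.\<close>
 define S where "S k = (if k = 0 then \<bbbI> else if k = 1 then X else X')" for k :: nat
 have Sv: "S 0 = \<bbbI>" "S 1 = X" "S 2 = X'" by (simp_all add: S_def)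
 have S3: "smp (S 0) & dm (S 0) ?P = 1 & isom (X >< S 0) (S 1)"
  "smp (S 1) & dm (S 1) ?P = 1 & isom (X >< S 1) (S 2)"
  "smp (S 2) & dm (S 2) ?P = 1 & isom (X >< S 2) (S 0)"
  unfolding Sv using r(2)[OF iI(1)] r(2)[OF iI(3)] r(2)[OF iI(4)] fr(1,2) N(2) iso_run_obj[OF O(2)]
   iso_sym[OF O(3) obj_ten[OF O(2,2)] XX] iso_sym[OF obj_unit obj_ten[OF O(2,3)] XX'] by simp_all
 have Sk: "smp (S k) & dm (S k) ?P = 1 & isom (X >< S k) (S ((k + 1) mod 3))" if k3: "k < 3" for k
 proof -
  consider "k = 0" | "k = 1" | "k = 2" using k3 by linarith
  thus ?thesis
  proof cases
   case 1
   have "(0 + 1) mod 3 = (1::nat)" by simp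
   thus ?thesis unfolding 1 using S3(1) by presburger
  next
   case 2
   have "(1 + 1) mod 3 = (2::nat)" by simp
   thus ?thesis unfolding 2 using S3(2) by presburger
  next
   case 3
   have "(2 + 1) mod 3 = (0::nat)" by simp
   hence e: "(2 + 1) mod 3 = (0::nat)" .
   show ?thesis unfolding 3 e by (rule S3(3))
  qed
 qed
 show False
 proof (rule spectrum_contradiction[OF K nz cnt pos])
  fix \<mu> assume \<mu>: "\<mu> : carrier K"
  \<comment> \<open>The summand 2 comes from the unit and from \<open>X'\<close>, each with an
    eigenvector for 1; the contribution of \<open>X\<close> is estimated by zero.\<close>
  have "(if \<mu> = \<one>\<^sub>K then 2 else 0) + 3 * e \<mu> <= eigdim X Y \<phi> \<bbbI> \<mu> + 3 * e \<mu> + eigdim X Y \<phi> X \<mu> + eigdim X Y \<phi> X' \<mu>"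
   using eigdim_unit[OF m Ynz] eigdim_square[OF m r(2)[OF iI(4)] XX Ynz] by auto
  also have "... = (\<Sum>T\<in>I. dm T ?P * eigdim X Y \<phi> T \<mu>)" unfolding f4 using fr N by (simp add: e_def)
  also have "... = (\<Sum>T\<in>I. dm T (Y >< B) * eigdim X Y \<phi> T \<mu>)"
  proof (intro sum.cong refl arg_cong2[of _ _ _ _ "(*)"])
   fix T assume "T : I"
   hence "T : Ob" by (rule r(3))
   thus "dm T ?P = dm T (Y >< B)"
    by (rule hdim_iso_right[OF _ _ _ iso_ten_obj[OF _ _ _ _ iso_refl YB]]) (use O B in auto)
  qed
  also have "... = eigdim X Y \<phi> (Y >< B) \<mu>" by (rule eigdim_sum[OF I m \<mu>, symmetric]) (use O B in auto)
  also have "... <= sd (HomV C ?P ?P) (eig X ?P ?\<psi> ?P ?\<psi> \<mu>)" by (rule eigdim_dual_le[OF m \<mu> d])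
  also have "... <= sd (HomV C ?P ?P) (kills X Y \<phi> \<mu> (hm ?P Y)) + (\<Sum>\<alpha>\<leftarrow>\<alpha>s. eigdim X Y \<phi> Y (\<mu> \<otimes>\<^sub>K \<alpha>))"
   using fl \<mu> unfolding flagged_def by blast
  also have "sd (HomV C ?P ?P) (kills X Y \<phi> \<mu> (hm ?P Y)) <= (if \<mu> \<otimes>\<^sub>K (\<mu> \<otimes>\<^sub>K \<mu>) = \<one>\<^sub>K then 1 else 0)"
  proof (rule kills_bound[OF m \<mu> sY, of S])
   fix k :: nat assume "k < 3"
   thus "smp (S k)" "dm (S k) ?P = 1" "isom (X >< S k) (S ((k + 1) mod 3))"
    using Sk by blast+
  next
   fix T assume T: "smp T"
   obtain A where A: "A : I" "isom T A" using I T unfolding reps_def by blast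
   show "isom T Y \<or> (EX k<3. isom T (S k))"
   proof (cases "A = Y")
    case False
    hence "A = S 0 \<or> A = S 1 \<or> A = S 2" using A Ie by (auto simp: S_def)
    moreover have "(0::nat) < 3" "(1::nat) < 3" "(2::nat) < 3" by simp_all
    ultimately show ?thesis using A(2) by metis
   qed (use A in simp)
  qed
  finally show "(if \<mu> = \<one>\<^sub>K then 2 else 0) + 3 * e \<mu> <= (if \<mu> \<otimes>\<^sub>K (\<mu> \<otimes>\<^sub>K \<mu>) = \<one>\<^sub>K then 1 else 0) + e (\<mu> \<otimes>\<^sub>K \<alpha>) + e (\<mu> \<otimes>\<^sub>K \<beta>) + e (\<mu> \<otimes>\<^sub>K \<gamma>)"
   by (simp add: \<alpha>s e_def add.assoc)
 qed
qed

end

section \<open>Positive matrices\<close>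

text \<open>Brouwer's theorem for the normalized map on the simplex. A positive matrix takes each
  point of the simplex to a strictly positive vector, so normalization is possible and the fixed
  point is positive.\<close>

lemma perron:
 fixes M :: "'n::finite => 'n => real"
 assumes pos: "!!i j. M i j > 0"
 obtains v r where "!!i. v i > 0" "!!i. (\<Sum>j\<in>UNIV. M i j * v j) = r * v i"
proof -
 define S where "S = {x :: real ^ 'n. (ALL i. 0 <= x $ i) & (\<Sum>i\<in>UNIV. x $ i) = 1}"
 define s where "s x = (\<Sum>i\<in>UNIV. \<Sum>j\<in>UNIV. M i j * x $ j)" for x :: "real ^ 'n"
 define f where "f x = (\<chi> i. (\<Sum>j\<in>UNIV. M i j * x $ j) / s x)" for x :: "real ^ 'n"
 have row: "(\<Sum>j\<in>UNIV. M i j * x $ j) > 0" if x: "x : S" for x i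
 proof -
  have "EX j. x $ j > 0"
  proof (rule ccontr)
   assume "\<not> (EX j. x $ j > 0)"
   hence "x $ j = 0" for j using x by (auto simp: S_def intro: antisym simp: not_less)
   thus False using x by (simp add: S_def)
  qed
  then obtain j where "x $ j > 0" by blast
  thus ?thesis using x pos by (intro sum_pos2[of _ j]) (auto simp: S_def intro!: mult_nonneg_nonneg less_imp_le[OF pos])
 qed
 have spos: "s x > 0" if "x : S" for x unfolding s_def by (rule sum_pos) (use row[OF that] in auto)
 have cl: "closed S"
 proof -
  have "S = (\<Inter>i. {x. 0 <= x $ i}) \<inter> {x. (\<Sum>i\<in>UNIV. x $ i) = 1}" by (auto simp: S_def)
  moreover have "closed ..."
   by (intro closed_Int closed_INT ballI closed_Collect_le closed_Collect_eq continuous_intros linear_continuous_on[OF bounded_linear_vec_nth])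
  ultimately show ?thesis by simp
 qed
 have bd: "bounded S"
 proof (rule boundedI)
  fix x assume x: "x : S"
  have "norm x <= (\<Sum>i\<in>UNIV. \<bar>x $ i\<bar>)" by (rule norm_le_l1_cart)
  also have "... = (\<Sum>i\<in>UNIV. x $ i)" by (intro sum.cong refl) (use x in "simp add: S_def")
  also have "... = 1" using x by (simp add: S_def)
  finally show "norm x <= 1" .
 qed
 have cv: "convex S"
  unfolding convex_def by (auto simp: S_def sum.distrib simp flip: sum_distrib_left)
 have ne: "S ~= {}"
 proof -
  have "(\<chi> i. 1 / real CARD('n)) : S" by (simp add: S_def)
  thus ?thesis by blast
 qed
 have cont: "continuous_on S f"
  unfolding f_def s_def
 proof (rule continuous_on_vec_lambda)
  fix i
  have c: "continuous_on S (%x. x $ j)" for j by (rule linear_continuous_on[OF bounded_linear_vec_nth])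
  show "continuous_on S (%x. (\<Sum>j\<in>UNIV. M i j * x $ j) / (\<Sum>i\<in>UNIV. \<Sum>j\<in>UNIV. M i j * x $ j))"
   by (intro continuous_on_divide continuous_on_sum continuous_on_mult_left c) (use spos in "auto simp: s_def less_le")
 qed
 have im: "f ` S \<subseteq> S"
 proof (clarsimp simp: S_def f_def)
  fix x :: "real ^ 'n" assume "ALL i. 0 <= x $ i" "(\<Sum>i\<in>UNIV. x $ i) = 1"
  hence x: "x : S" by (simp add: S_def)
  show "(ALL i. 0 <= (\<Sum>j\<in>UNIV. M i j * x $ j) / s x) & (\<Sum>i\<in>UNIV. (\<Sum>j\<in>UNIV. M i j * x $ j) / s x) = 1"
   using spos[OF x] row[OF x] by (auto simp: less_imp_le s_def simp flip: sum_divide_distrib)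
 qed
 obtain x where x: "x : S" "f x = x"
  using brouwer[of S f] cl bd cv ne cont im by (auto simp: compact_eq_bounded_closed)
 have e: "(\<Sum>j\<in>UNIV. M i j * x $ j) = s x * x $ i" for i
 proof -
  have "x $ i = (\<Sum>j\<in>UNIV. M i j * x $ j) / s x" using arg_cong[OF x(2), of "%y. y $ i"] by (simp add: f_def)
  thus ?thesis using spos[OF x(1)] by (simp add: field_simps)
 qed
 have "x $ i > 0" for i using row[OF x(1), of i] spos[OF x(1)] unfolding e by (simp add: zero_less_mult_iff)
 thus ?thesis using that[of "%i. x $ i" "s x"] e by blast
qed

text \<open>Brouwer's theorem is applied in \<open>real ^ 'n\<close>, so the index set enters
  through a bijection with a finite type.\<close>

lemma perron_on:
 fixes M :: "'b => 'b => real"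
 assumes h: "bij_betw h (UNIV :: 'n::finite set) I" and pos: "!!i j. i : I ==> j : I ==> M i j > 0"
 obtains v r where "ALL i:I. v i > 0" "ALL i:I. (\<Sum>j\<in>I. M i j * v j) = r * v i"
proof -
 have hI: "h i : I" for i using h by (auto simp: bij_betw_def)
 obtain w r where w: "!!i. w i > 0" "!!i. (\<Sum>j\<in>UNIV. M (h i) (h j) * w j) = r * w i"
  by (rule perron[of "%i j. M (h i) (h j)"]) (use pos hI in auto)
 define v where "v = w \<circ> the_inv_into UNIV h"
 have vh: "v (h i) = w i" for i using h by (simp add: v_def bij_betw_def the_inv_into_f_f)
 have "v i > 0 & (\<Sum>j\<in>I. M i j * v j) = r * v i" if "i : I" for i
 proof
  have "i : I" by fact
  then obtain k where k: "i = h k" using h by (auto simp: bij_betw_def)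
  show "v i > 0" unfolding k vh by (rule w(1))
  have "(\<Sum>j\<in>I. M i j * v j) = (\<Sum>j\<in>UNIV. M i (h j) * v (h j))"
   by (rule sum.reindex_bij_betw[OF h, symmetric])
  thus "(\<Sum>j\<in>I. M i j * v j) = r * v i" unfolding vh k w(2) .
 qed
 thus ?thesis by (intro that[of v r]) auto
qed

text \<open>Subtract from \<open>w\<close> the largest multiple of \<open>v\<close> below it: the difference is a nonnegative eigenvector
 with a vanishing entry.\<close>

lemma perron_unique:
 fixes M :: "'b => 'b => real"
 assumes I: "finite I" "I ~= {}" and pos: "!!i j. i : I ==> j : I ==> M i j > 0"
  and v: "!!i. i : I ==> v i > 0" "!!i. i : I ==> (\<Sum>j\<in>I. M i j * v j) = r * v i"
  and w: "!!i. i : I ==> (\<Sum>j\<in>I. M i j * w j) = r * w i"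
 shows "EX t. ALL i:I. w i = t * v i"
proof -
 define t where "t = Min ((%i. w i / v i) ` I)"
 have "t : (%i. w i / v i) ` I" unfolding t_def by (rule Min_in) (use I in auto)
 then obtain k where k: "k : I" "t = w k / v k" by blast
 have le: "t <= w i / v i" if "i : I" for i unfolding t_def by (rule Min_le) (use I that in auto)
 define u where "u i = w i - t * v i" for i
 have u0: "u i \<ge> 0" if "i : I" for i using le[OF that] v(1)[OF that] by (simp add: u_def field_simps)
 have uk: "u k = 0" using k v(1)[OF k(1)] by (simp add: u_def)
 have "(\<Sum>j\<in>I. M k j * u j) = (\<Sum>j\<in>I. M k j * w j) - t * (\<Sum>j\<in>I. M k j * v j)"
  by (simp add: u_def algebra_simps sum_subtractf sum_distrib_left)
 also have "... = r * u k" unfolding v(2)[OF k(1)] w[OF k(1)] by (simp add: u_def algebra_simps)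
 finally have "(\<Sum>j\<in>I. M k j * u j) = 0" unfolding uk by simp
 hence "ALL j:I. M k j * u j = 0"
  by (subst (asm) sum_nonneg_eq_0_iff) (use I u0 pos[OF k(1)] in "auto intro: less_imp_le mult_nonneg_nonneg")
 hence "u j = 0" if "j : I" for j using pos[OF k(1) that] that by auto
 thus ?thesis by (auto simp: u_def)
qed

section \<open>The ring of isomorphism classes\<close>

context linear_monoidal_category begin

lemma isomorphic_ten:
 assumes O: "X : Ob" "X' : Ob" "Y : Ob" "Y' : Ob" and i: "isom X X'" "isom Y Y'"
 shows "isom (X >< Y) (X' >< Y')"
proof -
 obtain u v where u: "isa u" "src u = X" "tgt u = X'" and v: "isa v" "src v = Y" "tgt v = Y'"
  using isomorphic_iff[OF O(1,2)] isomorphic_iff[OF O(3,4)] i by blast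
 have "isa (u ox v)" "src (u ox v) = X >< Y" "tgt (u ox v) = X' >< Y'" using u v by auto
 thus ?thesis unfolding isomorphic_iff[OF obj_ten[OF O(1,3)] obj_ten[OF O(2,4)]] by blast
qed

lemma class_tensor_iso_class:
 assumes O: "X : Ob" "Y : Ob"
 shows "class_tensor C (icl X) (icl Y) = icl (X >< Y)"
proof
 show "class_tensor C (icl X) (icl Y) \<subseteq> icl (X >< Y)"
 proof
  fix Z assume "Z : class_tensor C (icl X) (icl Y)"
  then obtain A B where A: "Z : Ob" "A : Ob" "B : Ob" "isom X A" "isom Y B" "isom (A >< B) Z"
   by (auto simp: class_tensor_def iso_class_def)
  have "isom (X >< Y) Z" by (rule iso_trans[OF obj_ten[OF O] obj_ten[OF A(2,3)] A(1) isomorphic_ten[OF O(1) A(2) O(2) A(3,4,5)] A(6)])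
  thus "Z : icl (X >< Y)" using A(1) by (simp add: iso_class_def)
 qed
 show "icl (X >< Y) \<subseteq> class_tensor C (icl X) (icl Y)"
  using iso_refl O by (auto simp: class_tensor_def iso_class_def)
qed

abbreviation (input) cmul where "cmul == monoid.mult (crg)"

lemma class_ring_simps:
 "carrier (crg) = {c. Poly_Mapping.keys c \<subseteq> iso_classes C}" "\<zero>\<^bsub>crg\<^esub> = 0"
 "a \<oplus>\<^bsub>crg\<^esub> b = a + b" "\<one>\<^bsub>crg\<^esub> = frag_of (icl \<bbbI>)"
 by (simp_all add: class_ring_def free_Abelian_group_def)

text \<open>A common index set for \<open>a\<close>, \<open>b\<close> and \<open>a + b\<close>
  reduces distributivity to that of finite sums.\<close>

lemma cmul_superset:
 assumes "finite A" "Poly_Mapping.keys a \<subseteq> A" "finite B" "Poly_Mapping.keys b \<subseteq> B"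
 shows "cmul a b = (\<Sum>P\<in>A. \<Sum>Q\<in>B. Poly_Mapping.single (class_tensor C P Q) (Poly_Mapping.lookup a P * Poly_Mapping.lookup b Q))"
proof -
 have "cmul a b = (\<Sum>P\<in>Poly_Mapping.keys a. \<Sum>Q\<in>Poly_Mapping.keys b. Poly_Mapping.single (class_tensor C P Q) (Poly_Mapping.lookup a P * Poly_Mapping.lookup b Q))"
  by (simp add: class_ring_def)
 also have "... = (\<Sum>P\<in>Poly_Mapping.keys a. \<Sum>Q\<in>B. Poly_Mapping.single (class_tensor C P Q) (Poly_Mapping.lookup a P * Poly_Mapping.lookup b Q))"
  by (intro sum.cong refl sum.mono_neutral_left) (use assms in "auto simp: in_keys_iff")
 also have "... = (\<Sum>P\<in>A. \<Sum>Q\<in>B. Poly_Mapping.single (class_tensor C P Q) (Poly_Mapping.lookup a P * Poly_Mapping.lookup b Q))"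
  by (intro sum.mono_neutral_left) (use assms in "auto simp: in_keys_iff")
 finally show ?thesis .
qed

lemma cmul_add: "cmul (a + b) c = cmul a c + cmul b c" "cmul c (a + b) = cmul c a + cmul c b"
proof -
 define A where "A = Poly_Mapping.keys a \<union> Poly_Mapping.keys b \<union> Poly_Mapping.keys (a + b)"
 have A: "finite A" "Poly_Mapping.keys a \<subseteq> A" "Poly_Mapping.keys b \<subseteq> A" "Poly_Mapping.keys (a + b) \<subseteq> A" by (auto simp: A_def)
 note S = cmul_superset[OF A(1) _ finite_keys order_refl] cmul_superset[OF finite_keys order_refl A(1)]
 show "cmul (a + b) c = cmul a c + cmul b c"
  unfolding S(1)[OF A(2)] S(1)[OF A(3)] S(1)[OF A(4)] by (simp add: lookup_add distrib_right single_add sum.distrib)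
 show "cmul c (a + b) = cmul c a + cmul c b"
  unfolding S(2)[OF A(2)] S(2)[OF A(3)] S(2)[OF A(4)] by (simp add: lookup_add distrib_left single_add sum.distrib)
qed

lemma cmul_zero: "cmul 0 c = 0" "cmul c 0 = 0"
 using cmul_add(1)[of 0 0 c] cmul_add(2)[of c 0 0] by simp_all

lemma cmul_diff: "cmul (a - b) c = cmul a c - cmul b c" "cmul c (a - b) = cmul c a - cmul c b"
 using cmul_add(1)[of "a - b" b c] cmul_add(2)[of c "a - b" b] by (simp_all add: algebra_simps)

lemma cmul_frag_of: "cmul (frag_of P) (frag_of Q) = frag_of (class_tensor C P Q)"
 by (simp add: class_ring_def)

lemma keys_diff_subset: "Poly_Mapping.keys a \<subseteq> S ==> Poly_Mapping.keys b \<subseteq> S ==> Poly_Mapping.keys (a - b :: 'x \<Rightarrow>\<^sub>0 int) \<subseteq> S"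
 using keys_diff[of a b] by blast

lemma class_tensor_closed: "P : iso_classes C ==> Q : iso_classes C ==> class_tensor C P Q : iso_classes C"
 using class_tensor_iso_class by (auto simp: iso_classes_def)

lemma class_tensor_assoc:
 assumes "P : iso_classes C" "Q : iso_classes C" "R : iso_classes C"
 shows "class_tensor C (class_tensor C P Q) R = class_tensor C P (class_tensor C Q R)"
proof -
 obtain X Y Z where O: "X : Ob" "Y : Ob" "Z : Ob" and e: "P = icl X" "Q = icl Y" "R = icl Z"
  using assms by (auto simp: iso_classes_def)
 have "isom ((X >< Y) >< Z) (X >< (Y >< Z))"
  using iso_asc[OF O] isomorphic_iff[of "(X >< Y) >< Z" "X >< (Y >< Z)"] O ten_src_tgt(3,4) obj_ten by metis
 hence "icl ((X >< Y) >< Z) = icl (X >< (Y >< Z))" using iso_class_eq_iff O by simp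
 thus ?thesis unfolding e using O by (simp add: class_tensor_iso_class)
qed

lemma class_tensor_unit:
 assumes "P : iso_classes C"
 shows "class_tensor C (icl \<bbbI>) P = P" "class_tensor C P (icl \<bbbI>) = P"
proof -
 obtain X where O: "X : Ob" and e: "P = icl X" using assms by (auto simp: iso_classes_def)
 have "isom (\<bbbI> >< X) X" "isom (X >< \<bbbI>) X"
  using iso_lun[OF O] iso_run[OF O] isomorphic_iff[of "\<bbbI> >< X" X] isomorphic_iff[of "X >< \<bbbI>" X] O ten_src_tgt(5-8) obj_ten obj_unit by metis+
 thus "class_tensor C (icl \<bbbI>) P = P" "class_tensor C P (icl \<bbbI>) = P"
  unfolding e using O iso_class_eq_iff by (simp_all add: class_tensor_iso_class)
qed

lemma cmul_closed:
 assumes "Poly_Mapping.keys a \<subseteq> iso_classes C" "Poly_Mapping.keys b \<subseteq> iso_classes C"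
 shows "Poly_Mapping.keys (cmul a b) \<subseteq> iso_classes C"
 using assms(1)
proof (induction a rule: frag_induction)
 case (one x)
 show ?case using assms(2)
  by (induction b rule: frag_induction) (use one class_tensor_closed in "simp_all add: cmul_zero cmul_frag_of cmul_diff keys_diff_subset")
qed (simp_all add: cmul_zero cmul_diff keys_diff_subset)

lemma cmul_assoc:
 assumes "Poly_Mapping.keys a \<subseteq> iso_classes C" "Poly_Mapping.keys b \<subseteq> iso_classes C" "Poly_Mapping.keys c \<subseteq> iso_classes C"
 shows "cmul (cmul a b) c = cmul a (cmul b c)"
 using assms(1)
proof (induction a rule: frag_induction)
 case (one x)
 show ?case using assms(2)
 proof (induction b rule: frag_induction)
  case (one y)
  show ?case using assms(3)
   by (induction c rule: frag_induction) (use one \<open>x : iso_classes C\<close> in "auto simp: cmul_zero cmul_frag_of cmul_diff class_tensor_assoc")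
 qed (auto simp: cmul_zero cmul_diff)
qed (auto simp: cmul_zero cmul_diff)

lemma cmul_one:
 assumes "Poly_Mapping.keys a \<subseteq> iso_classes C"
 shows "cmul (frag_of (icl \<bbbI>)) a = a" "cmul a (frag_of (icl \<bbbI>)) = a"
proof -
 show "cmul (frag_of (icl \<bbbI>)) a = a" using assms
  by (induction a rule: frag_induction) (auto simp: cmul_zero cmul_frag_of cmul_diff class_tensor_unit)
 show "cmul a (frag_of (icl \<bbbI>)) = a" using assms
  by (induction a rule: frag_induction) (auto simp: cmul_zero cmul_frag_of cmul_diff class_tensor_unit)
qed

lemma ring_class_ring: "ring (crg)"
proof (rule ringI)
 have ka: "Poly_Mapping.keys (a + b) \<subseteq> iso_classes C" if "Poly_Mapping.keys a \<subseteq> iso_classes C" "Poly_Mapping.keys b \<subseteq> iso_classes C" for a b :: "'o set \<Rightarrow>\<^sub>0 int"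
  using keys_add[of a b] that by blast
 show "abelian_group (crg)"
 proof (rule abelian_groupI)
  show "EX y:carrier (crg). y \<oplus>\<^bsub>crg\<^esub> x = \<zero>\<^bsub>crg\<^esub>" if "x : carrier (crg)" for x
   by (rule bexI[of _ "- x"]) (use that in "auto simp: class_ring_simps keys_minus")
  show "x \<oplus>\<^bsub>crg\<^esub> y : carrier (crg)" if "x : carrier (crg)" "y : carrier (crg)" for x y
   using that keys_add[of x y] by (auto simp: class_ring_simps)
 qed (auto simp: class_ring_simps add_ac)
 show "Group.monoid (crg)"
  by (rule monoidI) (use cmul_closed cmul_assoc cmul_one in "auto simp: class_ring_simps iso_classes_def")
qed (simp_all add: class_ring_simps(3) cmul_add)

end

section \<open>Frobenius-Perron dimensions\<close>

context ac_symmetric begin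

definition pchar where
 "pchar I v \<longleftrightarrow> v \<bbbI> = (1::real) & (ALL A:I. v A > 0) &
  (ALL A:I. ALL B:I. v A * v B = (\<Sum>Z\<in>I. real (dm Z (A >< B)) * v Z))"

text \<open>Chosen instead of multiplication by one simple object because it is strictly positive
  and symmetric; Perron's theorem needs the first property, the comparison of eigenvalues the
  second.\<close>

definition total_mult where
 "total_mult I B Z = (\<Sum>A\<in>I. real (dm Z (A >< B)))"

context
 fixes I
 assumes I: "reps I" "\<bbbI> : I"
begin

lemma hdim_comm_I: "A : I ==> B : I ==> Z : I ==> dm Z (A >< B) = dm Z (B >< A)"
 by (rule hdim_ten_comm) (use repsD(3)[OF I(1)] in auto)

text \<open>\<open>Z \<otimes> dl I B\<close> has a simple constituent, since tensoring with
  \<open>B\<close> turns it into an object containing \<open>Z\<close>. By Frobenius reciprocity a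
  constituent \<open>A\<close> has \<open>Z\<close> in \<open>A \<otimes> B\<close>.\<close>

lemma total_mult_pos:
 assumes B: "B : I" and Z: "Z : I"
 shows "total_mult I B Z > 0"
proof -
 note r = repsD[OF I(1)]
 let ?B = "dl I B"
 have D: "?B : I" by (rule dl(1)[OF I(1) B])
 have "EX A:I. dm A (Z >< ?B) ~= 0"
 proof (rule ccontr)
  assume "\<not> (EX A:I. dm A (Z >< ?B) ~= 0)"
  hence "(\<Sum>T\<in>I. dm T (Z >< ?B) * dm Z (T >< B)) = 0" by simp
  hence "(\<Sum>T\<in>I. dm T (?B >< B) * dm Z (Z >< T)) = 0" unfolding hdim_ten_assoc[OF I(1) Z D B Z] .
  hence "dm \<bbbI> (?B >< B) * dm Z (Z >< \<bbbI>) = 0" using r(1) I(2) by simp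
  moreover have "dm \<bbbI> (?B >< B) = 1" using dl(2)[OF I(1) B D] by simp
  moreover have "dm Z (Z >< \<bbbI>) = 1" using hdim_ten_unit(2)[OF I(1) Z Z] by simp
  ultimately show False by simp
 qed
 then obtain A where A: "A : I" "dm A (Z >< ?B) ~= 0" by blast
 have "real (dm Z (A >< B)) > 0" using A(2) unfolding frobenius[OF I(1) A(1) B Z] by simp
 thus ?thesis unfolding total_mult_def by (intro sum_pos2[OF r(1) A(1)]) auto
qed

text \<open>Reindexing by duality: what \<open>A\<close> contributes on one side is contributed by
  its dual on the other.\<close>

lemma total_mult_sym:
 assumes B: "B : I" and Z: "Z : I"
 shows "total_mult I B Z = total_mult I Z B"
 unfolding total_mult_def
proof (rule sum.reindex_bij_witness[of _ "dl I" "dl I"])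
 fix A assume A: "A : I"
 have D: "dl I A : I" by (rule dl(1)[OF I(1) A])
 show "dl I A : I" "dl I (dl I A) = A" by (rule D) (rule dl_dl[OF I(1) A])
 have "dm Z (A >< B) = dm Z (B >< A)" by (rule hdim_comm_I[OF A B Z])
 also have "... = dm B (Z >< dl I A)" by (rule frobenius[OF I(1) B A Z])
 also have "... = dm B (dl I A >< Z)" by (rule hdim_comm_I[OF Z D B])
 finally show "real (dm B (dl I A >< Z)) = real (dm Z (A >< B))" by simp
qed (use dl(1)[OF I(1)] dl_dl[OF I(1)] in auto)

text \<open>Multiplications by \<open>A\<close> and by \<open>A'\<close> commute, by associativity
  and commutativity.\<close>

lemma ten_exchange:
 assumes S: "A : I" "A' : I" "B : I" "W : I"
 shows "(\<Sum>Z\<in>I. real (dm Z (A' >< B)) * real (dm W (A >< Z))) = (\<Sum>Z\<in>I. real (dm Z (A >< B)) * real (dm W (A' >< Z)))"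
proof -
 have "(\<Sum>Z\<in>I. dm Z (A' >< B) * dm W (A >< Z)) = (\<Sum>T\<in>I. dm T (A >< A') * dm W (T >< B))"
  by (rule hdim_ten_assoc[OF I(1) S(1,2,3,4), symmetric])
 also have "... = (\<Sum>T\<in>I. dm T (A' >< A) * dm W (T >< B))"
  by (intro sum.cong refl) (use hdim_comm_I[OF S(1,2)] in simp)
 also have "... = (\<Sum>Z\<in>I. dm Z (A >< B) * dm W (A' >< Z))"
  by (rule hdim_ten_assoc[OF I(1) S(2,1,3,4)])
 finally show ?thesis by (simp flip: of_nat_mult of_nat_sum)
qed

text \<open>Multiplication by \<open>A\<close> commutes with the positive matrix, so it takes the
  Perron vector to another eigenvector for the same value, which is a multiple by uniqueness. With
  the vector normalized at the unit, the factor is its value at \<open>A\<close>.\<close>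

lemma pchar_exists:
 assumes h: "bij_betw h (UNIV :: 'n::finite set) I"
 shows "EX v. pchar I v"
proof -
 note r = repsD[OF I(1)]
 obtain w q where w': "ALL i:I. w i > 0" "ALL i:I. (\<Sum>j\<in>I. total_mult I i j * w j) = q * w i"
  by (rule perron_on[of h I "total_mult I", OF h total_mult_pos]) blast
 have w: "w i > 0" "(\<Sum>j\<in>I. total_mult I i j * w j) = q * w i" if "i : I" for i using w' that by blast+
 define v where "v A = w A / w \<bbbI>" for A
 have v1: "v \<bbbI> = 1" using w(1)[OF I(2)] by (simp add: v_def)
 have vp: "v A > 0" if "A : I" for A using w(1)[OF that] w(1)[OF I(2)] by (simp add: v_def)
 have ve: "(\<Sum>j\<in>I. total_mult I i j * v j) = q * v i" if "i : I" for i
  using w(2)[OF that] by (simp add: v_def flip: sum_divide_distrib)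
 have "v A * v B = (\<Sum>Z\<in>I. real (dm Z (A >< B)) * v Z)" if A: "A : I" and B: "B : I" for A B
 proof -
  define u where "u B = (\<Sum>Z\<in>I. real (dm Z (A >< B)) * v Z)" for B
  have ue: "(\<Sum>Z\<in>I. total_mult I B Z * u Z) = q * u B" if B: "B : I" for B
  proof -
   have "(\<Sum>Z\<in>I. total_mult I B Z * u Z) = (\<Sum>Z\<in>I. \<Sum>A'\<in>I. \<Sum>W\<in>I. real (dm Z (A' >< B)) * real (dm W (A >< Z)) * v W)"
    by (simp add: total_mult_def u_def sum_product mult.assoc)
   also have "... = (\<Sum>A'\<in>I. \<Sum>Z\<in>I. \<Sum>W\<in>I. real (dm Z (A' >< B)) * real (dm W (A >< Z)) * v W)"
    by (rule sum.swap)
   also have "... = (\<Sum>A'\<in>I. \<Sum>W\<in>I. \<Sum>Z\<in>I. real (dm Z (A' >< B)) * real (dm W (A >< Z)) * v W)"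
    by (rule sum.cong[OF refl]) (rule sum.swap)
   also have "... = (\<Sum>A'\<in>I. \<Sum>W\<in>I. (\<Sum>Z\<in>I. real (dm Z (A' >< B)) * real (dm W (A >< Z))) * v W)"
    by (simp add: sum_distrib_right)
   also have "... = (\<Sum>A'\<in>I. \<Sum>W\<in>I. (\<Sum>Z\<in>I. real (dm Z (A >< B)) * real (dm W (A' >< Z))) * v W)"
    by (intro sum.cong refl) (use ten_exchange[OF A _ B] in simp)
   also have "... = (\<Sum>A'\<in>I. \<Sum>W\<in>I. \<Sum>Z\<in>I. real (dm Z (A >< B)) * real (dm W (A' >< Z)) * v W)"
    by (simp add: sum_distrib_right)
   also have "... = (\<Sum>A'\<in>I. \<Sum>Z\<in>I. \<Sum>W\<in>I. real (dm Z (A >< B)) * real (dm W (A' >< Z)) * v W)"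
    by (rule sum.cong[OF refl]) (rule sum.swap)
   also have "... = (\<Sum>Z\<in>I. \<Sum>A'\<in>I. \<Sum>W\<in>I. real (dm Z (A >< B)) * real (dm W (A' >< Z)) * v W)"
    by (rule sum.swap)
   also have "... = (\<Sum>Z\<in>I. real (dm Z (A >< B)) * (\<Sum>W\<in>I. total_mult I Z W * v W))"
    by (intro sum.cong refl) (subst sum.swap, simp add: total_mult_def sum_distrib_left sum_distrib_right mult.assoc)
   also have "... = (\<Sum>Z\<in>I. real (dm Z (A >< B)) * (q * v Z))"
    by (intro sum.cong refl) (use ve in simp)
   also have "... = q * u B" by (simp add: u_def sum_distrib_left mult_ac)
   finally show ?thesis .
  qed
  obtain t where t: "!!B. B : I ==> u B = t * v B"
   using perron_unique[of I "total_mult I" v q u, OF r(1) _ total_mult_pos vp ve ue] I(2) by blast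
  have "u \<bbbI> = (\<Sum>Z\<in>I. if A = Z then v Z else 0)" unfolding u_def
   by (intro sum.cong refl) (use hdim_ten_unit(2)[OF I(1) A] in auto)
  hence "t = v A" using t[OF I(2)] v1 r(1) A by simp
  thus ?thesis using t[OF B] by (simp add: u_def)
 qed
 hence "pchar I v" using v1 vp by (simp add: pchar_def)
 thus ?thesis by blast
qed

lemma pchar_eigen:
 assumes v: "pchar I v" and B: "B : I"
 shows "(\<Sum>Z\<in>I. total_mult I B Z * v Z) = (\<Sum>A\<in>I. v A) * v B"
proof -
 have "(\<Sum>Z\<in>I. total_mult I B Z * v Z) = (\<Sum>A\<in>I. \<Sum>Z\<in>I. real (dm Z (A >< B)) * v Z)"
  unfolding total_mult_def sum_distrib_right by (rule sum.swap)
 also have "... = (\<Sum>A\<in>I. v A * v B)" by (intro sum.cong refl) (use v B in "simp add: pchar_def")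
 finally show ?thesis by (simp add: sum_distrib_right)
qed

text \<open>Positive characters are eigenvectors of the symmetric matrix \<open>total_mult\<close>.
  Pairing two of them shows that their eigenvalues agree, so they are proportional, and both are 1
  at the unit.\<close>

lemma pchar_unique:
 assumes v: "pchar I v" and w: "pchar I w" and A: "A : I"
 shows "v A = w A"
proof -
 note r = repsD[OF I(1)]
 have vp: "v i > 0" "w i > 0" if "i : I" for i using v w that by (auto simp: pchar_def)
 have "(\<Sum>A\<in>I. w A) * (\<Sum>B\<in>I. v B * w B) = (\<Sum>B\<in>I. v B * ((\<Sum>A\<in>I. w A) * w B))"
  by (simp add: sum_distrib_left[of "\<Sum>A\<in>I. w A"] mult_ac)
 also have "... = (\<Sum>B\<in>I. v B * (\<Sum>Z\<in>I. total_mult I B Z * w Z))"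
  by (intro sum.cong refl) (use pchar_eigen[OF w] in simp)
 also have "... = (\<Sum>B\<in>I. \<Sum>Z\<in>I. v B * total_mult I B Z * w Z)" by (simp add: sum_distrib_left mult.assoc)
 also have "... = (\<Sum>Z\<in>I. \<Sum>B\<in>I. v B * total_mult I B Z * w Z)" by (rule sum.swap)
 also have "... = (\<Sum>Z\<in>I. w Z * (\<Sum>B\<in>I. total_mult I Z B * v B))"
  by (intro sum.cong refl) (simp add: sum_distrib_left total_mult_sym mult_ac)
 also have "... = (\<Sum>Z\<in>I. w Z * ((\<Sum>A\<in>I. v A) * v Z))"
  by (intro sum.cong refl) (use pchar_eigen[OF v] in simp)
 also have "... = (\<Sum>A\<in>I. v A) * (\<Sum>B\<in>I. v B * w B)" by (simp add: sum_distrib_left[of "\<Sum>A\<in>I. v A"] mult_ac)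
 finally have e: "(\<Sum>A\<in>I. w A) * (\<Sum>B\<in>I. v B * w B) = (\<Sum>A\<in>I. v A) * (\<Sum>B\<in>I. v B * w B)" .
 have "(\<Sum>B\<in>I. v B * w B) > 0" by (rule sum_pos) (use r(1) I(2) vp in auto)
 hence "(\<Sum>A\<in>I. w A) = (\<Sum>A\<in>I. v A)" using e by simp
 hence we: "(\<Sum>j\<in>I. total_mult I i j * w j) = (\<Sum>A\<in>I. v A) * w i" if "i : I" for i using pchar_eigen[OF w that] by simp
 obtain t where t: "!!i. i : I ==> w i = t * v i"
  using perron_unique[of I "total_mult I" v "\<Sum>A\<in>I. v A" w, OF r(1) _ total_mult_pos vp(1) pchar_eigen[OF v] we] I(2) by blast
 have "t = 1" using t[OF I(2)] v w by (simp add: pchar_def)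
 thus ?thesis using t[OF A] by simp
qed

text \<open>Composition with duality is again a positive character, so by uniqueness
  \<open>v\<close> has the same value at \<open>A\<close> and at its dual. The unit in their product
  gives \<open>1 \<le> v A * v A\<close>.\<close>

lemma pchar_ge_1:
 assumes v: "pchar I v" and A: "A : I"
 shows "v A \<ge> 1"
proof -
 note r = repsD[OF I(1)]
 have dI: "dl I B : I" if "B : I" for B by (rule dl(1)[OF I(1) that])
 have "pchar I (v \<circ> dl I)"
  unfolding pchar_def
 proof (intro conjI ballI)
  show "(v \<circ> dl I) \<bbbI> = 1" using v dl_unit[OF I] by (simp add: pchar_def)
  show "0 < (v \<circ> dl I) A" if "A : I" for A using v dI[OF that] by (simp add: pchar_def)
  fix A B assume AB: "A : I" "B : I"
  have "(v \<circ> dl I) A * (v \<circ> dl I) B = (\<Sum>Z\<in>I. real (dm Z (dl I A >< dl I B)) * v Z)"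
   using v dI[OF AB(1)] dI[OF AB(2)] by (simp add: pchar_def)
  also have "... = (\<Sum>Z\<in>I. real (dm Z (A >< B)) * (v \<circ> dl I) Z)"
   by (rule sum.reindex_bij_witness[of _ "dl I" "dl I"]) (use dI dl_dl[OF I(1)] hdim_ten_dl[OF I(1) AB dI] in auto)
  finally show "(v \<circ> dl I) A * (v \<circ> dl I) B = (\<Sum>Z\<in>I. real (dm Z (A >< B)) * (v \<circ> dl I) Z)" .
 qed
 hence d: "v (dl I A) = v A" using pchar_unique[OF v _ A, of "v \<circ> dl I"] by simp
 have vp: "v B > 0" if "B : I" for B using v that by (simp add: pchar_def)
 have h1: "dm \<bbbI> (A >< dl I A) = 1" using dl(2)[OF I(1) dI[OF A] A] dl_dl[OF I(1) A] by simp
 have "1 = real (dm \<bbbI> (A >< dl I A)) * v \<bbbI>" using h1 v by (simp add: pchar_def)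
 also have "... <= (\<Sum>Z\<in>I. real (dm Z (A >< dl I A)) * v Z)"
  by (rule member_le_sum[OF I(2)]) (use r(1) in "auto intro!: mult_nonneg_nonneg less_imp_le[OF vp]")
 also have "... = v A * v A" using v A dI[OF A] d unfolding pchar_def by metis
 finally show ?thesis using vp[OF A] by (metis mult_le_one less_imp_le linorder_not_le mult_strict_mono' mult_1_left less_eq_real_def order_less_le_trans zero_less_one)
qed

definition fdim where
 "fdim v X = (\<Sum>S\<in>I. real (dm S X) * v S)"

lemma fdim_rep: "A : I ==> fdim v A = v A"
proof -
 note r = repsD[OF I(1)]
 assume A: "A : I"
 have "fdim v A = (\<Sum>S\<in>I. if S = A then v S else 0)"
  unfolding fdim_def by (intro sum.cong refl) (use r(4) A in auto)
 thus ?thesis using r(1) A by simp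
qed

lemma fdim_iso: "X : Ob ==> Y : Ob ==> isom X Y ==> fdim v X = fdim v Y"
 unfolding fdim_def by (intro sum.cong refl) (use hdim_iso_right repsD(3)[OF I(1)] in metis)

lemma fdim_ten:
 assumes v: "pchar I v" and O: "X : Ob" "Y : Ob"
 shows "fdim v (X >< Y) = fdim v X * fdim v Y"
proof -
 note r = repsD[OF I(1)]
 have "fdim v (X >< Y) = (\<Sum>S\<in>I. \<Sum>A\<in>I. \<Sum>B\<in>I. real (dm A X) * real (dm B Y) * (real (dm S (A >< B)) * v S))"
  unfolding fdim_def
 proof (intro sum.cong refl)
  fix S assume "S : I"
  thus "real (dm S (X >< Y)) * v S = (\<Sum>A\<in>I. \<Sum>B\<in>I. real (dm A X) * real (dm B Y) * (real (dm S (A >< B)) * v S))"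
   using hdim_ten_expand[OF I(1) O r(3)] by (simp add: sum_distrib_right mult.assoc)
 qed
 also have "... = (\<Sum>A\<in>I. \<Sum>B\<in>I. \<Sum>S\<in>I. real (dm A X) * real (dm B Y) * (real (dm S (A >< B)) * v S))"
  by (subst sum.swap, subst (2) sum.swap) simp
 also have "... = (\<Sum>A\<in>I. \<Sum>B\<in>I. real (dm A X) * real (dm B Y) * (v A * v B))"
  by (intro sum.cong refl) (use v in "simp add: pchar_def sum_distrib_left")
 also have "... = fdim v X * fdim v Y" by (simp add: fdim_def sum_product mult_ac)
 finally show ?thesis .
qed

lemma fdim_exact:
 assumes e: "short_exact C X Y Z f g" and O: "X : Ob" "Y : Ob" "Z : Ob"
 shows "fdim v Y = fdim v X + fdim v Z"
proof -
 obtain F q s G where sp: "split_pair C Y X F q Z s G" by (rule short_exact_split[OF e O])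
 show ?thesis unfolding fdim_def
  by (simp add: split_pair_hdim(1)[OF sp] repsD(3)[OF I(1)] sum.distrib distrib_right flip: sum.distrib cong: sum.cong)
qed

lemma fdim_ge_1:
 assumes v: "pchar I v" and X: "X : Ob" "\<not> zero_object C X"
 shows "fdim v X \<ge> 1"
proof -
 note r = repsD[OF I(1)]
 have "ii X ~= nl X X" using X zero_object_iff by auto
 then obtain W i p where W: "smp W" "ar i" "src i = W" "tgt i = X" "ar p" "src p = X" "tgt p = W" "p *. i = ii W"
  by (rule nonzero_simple_summand[OF X(1)])
 obtain B k q where sp: "split_pair C X W i p B k q" by (rule idempotent_complement[OF W(2-8)])
 obtain S where S: "S : I" "isom W S" using I(1) W(1) unfolding reps_def by blast
 have "isom S W" by (rule iso_sym[OF simple_obj[OF W(1)] r(3)[OF S(1)] S(2)])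
 hence "dm S W = 1" using hdim_simple[OF r(2)[OF S(1)] W(1)] by simp
 hence h: "dm S X \<ge> 1" using split_pair_hdim(1)[OF sp r(3)[OF S(1)]] by simp
 have vp: "v B > 0" if "B : I" for B using v that by (simp add: pchar_def)
 have "1 <= v S" by (rule pchar_ge_1[OF v S(1)])
 also have "... <= real (dm S X) * v S" using h vp[OF S(1)] by simp
 also have "... <= fdim v X" unfolding fdim_def
  by (rule member_le_sum[OF S(1)]) (use r(1) in "auto intro!: mult_nonneg_nonneg less_imp_le[OF vp]")
 finally show ?thesis .
qed

end

end

section \<open>From the fusion ring to the Grothendieck ring\<close>

lemma (in ac_fusion) split_pair_short_exact:
 assumes s: "split_pair C Y A f r B k q"
 shows "short_exact C A Y B (mor f) (mor q)"
proof -
 note d = split_pairD[OF s]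
 have t: "f = (A, mor f, Y)" "q = (Y, mor q, B)" using arrow_triple[of f] arrow_triple[of q] d by auto
 have fa: "mor f : arrows C A Y" "mor q : arrows C Y B" using d(1-3,10-12) by (auto simp: arr_def simp del: arr_obj)
 have qf: "mor q \<cdot> mor f = \<zero>\<^bsub>Hom C A B\<^esub>"
  using arg_cong[OF d(16), of mor] by (simp add: cmp_def nul_def HomV_simps)
 have ar: "arr C (W, g, Z)" if "W : Obj C" "Z : Obj C" "g : arrows C W Z" for W Z g using that by (simp add: arr_def del: arr_obj)
 have "is_kernel C A Y B (mor f) (mor q)"
  unfolding is_kernel_def
 proof (intro conjI ballI impI fa qf)
  fix W g assume W: "W : Obj C" and g: "g : arrows C W Y" and z: "mor q \<cdot> g = \<zero>\<^bsub>Hom C W B\<^esub>"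
  let ?g = "(W, g, Y)"
  have ga: "arr C ?g" by (rule ar[OF W d(19) g])
  have "q *. ?g = nul C W B" using z d by (simp add: cmp_def nul_def HomV_simps)
  hence "f *. r *. ?g = ?g" using split_pair_sum(1)[OF s ga] d ga W by simp
  hence u: "mor f \<cdot> mor (r *. ?g) = g" using arg_cong[of "f *. r *. ?g" ?g mor] by (simp add: cmp_def)
  show "EX! u. u : arrows C W A & mor f \<cdot> u = g"
  proof (rule ex1I[of _ "mor (r *. ?g)"])
   have "arr C (r *. ?g)" "src (r *. ?g) = W" "tgt (r *. ?g) = A" using d ga by auto
   thus "mor (r *. ?g) : arrows C W A & mor f \<cdot> mor (r *. ?g) = g" using u by (auto simp: arr_def simp del: arr_obj)
   fix x assume x: "x : arrows C W A & mor f \<cdot> x = g"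
   hence xa: "arr C (W, x, A)" using ar[OF W d(17)] by blast
   have "f *. (W, x, A) = ?g" using x d by (simp add: cmp_def)
   hence "r *. ?g = r *. f *. (W, x, A)" by simp
   also have "... = (W, x, A)" by (subst cmp_tail[OF d(13)]) (use d xa in auto)
   finally show "x = mor (r *. ?g)" by simp
  qed
 qed
 moreover have "is_cokernel C A Y B (mor f) (mor q)"
  unfolding is_cokernel_def
 proof (intro conjI ballI impI fa qf)
  fix Z g assume Z: "Z : Obj C" and g: "g : arrows C Y Z" and z: "g \<cdot> mor f = \<zero>\<^bsub>Hom C A Z\<^esub>"
  let ?g = "(Y, g, Z)"
  have ga: "arr C ?g" by (rule ar[OF d(19) Z g])
  have "?g *. f = nul C A Z" using z d by (simp add: cmp_def nul_def HomV_simps)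
  hence gf: "?g *. f *. r = nul C Y Z" by (subst cmp_tail[of ?g f]) (use d ga Z in auto)
  have "?g = (?g *. k) *. q" using split_pair_sum(2)[OF s ga] gf d ga Z by simp
  hence u: "mor (?g *. k) \<cdot> mor q = g" using arg_cong[of "(?g *. k) *. q" ?g mor] by (simp add: cmp_def)
  show "EX! u. u : arrows C B Z & u \<cdot> mor q = g"
  proof (rule ex1I[of _ "mor (?g *. k)"])
   have "arr C (?g *. k)" "src (?g *. k) = B" "tgt (?g *. k) = Z" using d ga by auto
   thus "mor (?g *. k) : arrows C B Z & mor (?g *. k) \<cdot> mor q = g" using u by (auto simp: arr_def simp del: arr_obj)
   fix x assume x: "x : arrows C B Z & x \<cdot> mor q = g"
   hence xa: "arr C (B, x, Z)" using ar[OF d(18) Z] by blast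
   have "(B, x, Z) *. q = ?g" using x d by (simp add: cmp_def)
   hence "?g *. k = ((B, x, Z) *. q) *. k" by simp
   also have "... = (B, x, Z) *. q *. k" using d xa by simp
   also have "... = (B, x, Z)" unfolding d(14) using xa d by simp
   finally show "x = mor (?g *. k)" by simp
  qed
 qed
 ultimately show ?thesis by (simp add: short_exact_def)
qed

context ac_symmetric begin

lemma obj_gen_carrier: "X : Ob ==> obj_gen C X : carrier (crg)"
 by (auto simp: class_ring_simps iso_classes_def)

lemma exact_relations_subset: "exact_relations C \<subseteq> carrier (crg)"
proof
 fix r assume "r : exact_relations C"
 then obtain X Y Z where "X : Ob" "Y : Ob" "Z : Ob" and r: "r = obj_gen C Y - obj_gen C X - obj_gen C Z"
  unfolding exact_relations_def by blast
 hence "obj_gen C X : carrier (crg)" "obj_gen C Y : carrier (crg)" "obj_gen C Z : carrier (crg)"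
  by (simp_all only: obj_gen_carrier)
 thus "r : carrier (crg)" unfolding r class_ring_simps mem_Collect_eq by (intro keys_diff_subset)
qed

lemma grothendieck_ideal: "ideal (gid) (crg)"
 unfolding grothendieck_ideal_def by (rule ring.genideal_ideal[OF ring_class_ring exact_relations_subset])

lemma exact_in_ideal:
 assumes "short_exact C X Y Z f g" "X : Ob" "Y : Ob" "Z : Ob"
 shows "obj_gen C Y - obj_gen C X - obj_gen C Z : gid"
proof -
 have "obj_gen C Y - obj_gen C X - obj_gen C Z : exact_relations C" using assms unfolding exact_relations_def by blast
 thus ?thesis using ring.genideal_self[OF ring_class_ring exact_relations_subset] unfolding grothendieck_ideal_def by blast
qed

lemma real_ring_simps: "carrier (ring_of_type_algebra :: real ring) = UNIV"
 "x \<otimes>\<^bsub>(ring_of_type_algebra :: real ring)\<^esub> y = x * y" "x \<oplus>\<^bsub>(ring_of_type_algebra :: real ring)\<^esub> y = x + y"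
 "\<one>\<^bsub>(ring_of_type_algebra :: real ring)\<^esub> = 1" "\<zero>\<^bsub>(ring_of_type_algebra :: real ring)\<^esub> = 0"
 by (simp_all add: ring_of_type_algebra_def)

lemma carrier_grothendieck: "carrier (grothendieck_ring C) = (%a. gid +>\<^bsub>crg\<^esub> a) ` carrier (crg)"
 by (auto simp: grothendieck_ring_def FactRing_def A_RCOSETS_def')

lemma coset_hom: "(%a. gid +>\<^bsub>crg\<^esub> a) : ring_hom (crg) (grothendieck_ring C)"
 unfolding grothendieck_ring_def by (rule ideal.rcos_ring_hom[OF grothendieck_ideal])

lemma coset_eqD:
 assumes "a : carrier (crg)" "gid +>\<^bsub>crg\<^esub> a = gid +>\<^bsub>crg\<^esub> b"
 shows "EX h:gid. a = h + b"
proof -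
 have "a = 0 + a" by simp
 moreover have "0 : gid" using additive_subgroup.zero_closed[OF ideal.axioms(1)[OF grothendieck_ideal]] unfolding class_ring_simps .
 ultimately have "a : gid +>\<^bsub>crg\<^esub> a" unfolding a_r_coset_def' class_ring_simps by blast
 hence "a : gid +>\<^bsub>crg\<^esub> b" by (simp only: assms(2))
 thus ?thesis unfolding a_r_coset_def' class_ring_simps by blast
qed

lemma coset_ideal:
 assumes "a : gid"
 shows "gid +>\<^bsub>crg\<^esub> a = gid"
 using abelian_subgroup.a_rcos_const[OF abelian_subgroupI3[OF ideal.axioms(1)[OF grothendieck_ideal] ring.is_abelian_group[OF ring_class_ring]] assms] .

definition clsdim where
 "clsdim f a = (\<Sum>P\<in>Poly_Mapping.keys a. real_of_int (Poly_Mapping.lookup a P) * f P)"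

lemma clsdim_add: "clsdim f (a + b) = clsdim f a + clsdim f b"
proof -
 define A where "A = Poly_Mapping.keys a \<union> Poly_Mapping.keys b \<union> Poly_Mapping.keys (a + b)"
 have e: "clsdim f c = (\<Sum>P\<in>A. real_of_int (Poly_Mapping.lookup c P) * f P)" if "Poly_Mapping.keys c \<subseteq> A" for c
  unfolding clsdim_def by (rule sum.mono_neutral_left) (use that in "auto simp: A_def in_keys_iff")
 have "Poly_Mapping.keys a \<subseteq> A" "Poly_Mapping.keys b \<subseteq> A" "Poly_Mapping.keys (a + b) \<subseteq> A" by (auto simp: A_def)
 thus ?thesis by (simp add: e lookup_add distrib_right sum.distrib)
qed

lemma clsdim_zero: "clsdim f 0 = 0"
 by (simp add: clsdim_def)

lemma clsdim_diff: "clsdim f (a - b) = clsdim f a - clsdim f b"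
 using clsdim_add[of f "a - b" b] by simp

lemma clsdim_frag: "clsdim f (frag_of P) = f P"
 by (simp add: clsdim_def)

lemma split_pair_zero:
 assumes "zero_object C Z"
 shows "split_pair C Z Z (ii Z) (ii Z) Z (ii Z) (ii Z)"
proof -
 have "Z : Ob" "ii Z = nl Z Z" using assms zero_object_iff by auto
 thus ?thesis by (simp add: split_pair_def hom_iff)
qed

context
 fixes I v
 assumes I: "reps I" "\<bbbI> : I" and v: "pchar I v"
begin

definition cval where
 "cval P = fdim I v (SOME X. X : Ob & icl X = P)"

lemma cval: "X : Ob ==> cval (icl X) = fdim I v X"
proof -
 assume X: "X : Ob"
 define Y where "Y = (SOME Y. Y : Ob & icl Y = icl X)"
 have "Y : Ob & icl Y = icl X" unfolding Y_def by (rule someI[of _ X]) (use X in simp)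
 hence "Y : Ob" "isom Y X" using iso_class_eq_iff X by auto
 hence "fdim I v Y = fdim I v X" by (intro fdim_iso[OF I]) (use X in auto)
 thus ?thesis by (simp add: cval_def Y_def)
qed

lemma cval_tensor: "P : iso_classes C ==> Q : iso_classes C ==> cval (class_tensor C P Q) = cval P * cval Q"
 using fdim_ten[OF I v] by (auto simp: iso_classes_def class_tensor_iso_class cval)

lemma clsdim_cmul:
 assumes "Poly_Mapping.keys a \<subseteq> iso_classes C" "Poly_Mapping.keys b \<subseteq> iso_classes C"
 shows "clsdim cval (cmul a b) = clsdim cval a * clsdim cval b"
 using assms(1)
proof (induction a rule: frag_induction)
 case (one x)
 show ?case using assms(2)
  by (induction b rule: frag_induction) (use one in "simp_all add: cmul_zero clsdim_zero cmul_frag_of clsdim_frag cval_tensor cmul_diff clsdim_diff algebra_simps")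
qed (simp_all add: cmul_zero clsdim_zero cmul_diff clsdim_diff algebra_simps)

lemma clsdim_hom: "clsdim cval : ring_hom (crg) (ring_of_type_algebra :: real ring)"
proof (rule ring_hom_memI)
 have "fdim I v \<bbbI> = 1" using fdim_rep[OF I I(2)] v by (simp add: pchar_def)
 thus "clsdim cval \<one>\<^bsub>crg\<^esub> = \<one>\<^bsub>ring_of_type_algebra\<^esub>"
  by (simp add: class_ring_simps real_ring_simps clsdim_frag cval)
qed (use clsdim_cmul in "simp_all add: class_ring_simps(1,3) real_ring_simps clsdim_add")

lemma clsdim_exact: "r : exact_relations C ==> clsdim cval r = 0"
proof -
 assume "r : exact_relations C"
 then obtain X Y Z f g where X: "X : Ob" "Y : Ob" "Z : Ob" "short_exact C X Y Z f g" and e: "r = obj_gen C Y - obj_gen C X - obj_gen C Z"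
  unfolding exact_relations_def by blast
 have "clsdim cval r = fdim I v Y - fdim I v X - fdim I v Z"
  unfolding e clsdim_diff clsdim_frag cval[OF X(1)] cval[OF X(2)] cval[OF X(3)] ..
 also have "... = 0" unfolding fdim_exact[OF I X(4,1,2,3), of v] by linarith
 finally show ?thesis .
qed

text \<open>The kernel of a ring homomorphism is an ideal, and it contains the generators because
  exact sequences split.\<close>

lemma clsdim_ideal: "a : gid ==> clsdim cval a = 0"
proof -
 assume a: "a : gid"
 let ?k = "a_kernel (crg) (ring_of_type_algebra :: real ring) (clsdim cval)"
 have k: "ideal ?k (crg)"
  by (rule ring_hom_ring.kernel_is_ideal[OF ring_hom_ringI2[OF ring_class_ring ring_from_type_algebra clsdim_hom]])
 have "exact_relations C \<subseteq> ?k"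
  unfolding a_kernel_def' real_ring_simps using exact_relations_subset clsdim_exact by blast
 hence "gid \<subseteq> ?k"
  unfolding grothendieck_ideal_def by (rule ring.genideal_minimal[OF ring_class_ring k])
 thus ?thesis using a unfolding a_kernel_def' real_ring_simps by blast
qed

text \<open>The value at a coset is read off at some representative; \<open>clsdim_ideal\<close>
  makes the choice immaterial. Outside the carrier the value is \<open>undefined\<close>, as
  \<open>extensional\<close> demands.\<close>

definition gdim where
 "gdim c = (if c : carrier (grothendieck_ring C)
  then clsdim cval (SOME a. a : carrier (crg) & c = gid +>\<^bsub>crg\<^esub> a) else undefined)"

lemma gdim_coset:
 assumes a: "a : carrier (crg)"
 shows "gdim (gid +>\<^bsub>crg\<^esub> a) = clsdim cval a"
proof -
 define b where "b = (SOME b. b : carrier (crg) & gid +>\<^bsub>crg\<^esub> a = gid +>\<^bsub>crg\<^esub> b)"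
 have b: "b : carrier (crg) & gid +>\<^bsub>crg\<^esub> a = gid +>\<^bsub>crg\<^esub> b"
  unfolding b_def by (rule someI[of _ a]) (use a in simp)
 then obtain h where h: "h : gid" "a = h + b" using coset_eqD[OF a] by blast
 have "clsdim cval a = clsdim cval b" unfolding h(2) clsdim_add clsdim_ideal[OF h(1)] by simp
 moreover have "gdim (gid +>\<^bsub>crg\<^esub> a) = clsdim cval b"
  unfolding gdim_def b_def using a by (auto simp: carrier_grothendieck)
 ultimately show ?thesis by simp
qed

lemma gdim_obj: "X : Ob ==> gdim (obj_class C X) = fdim I v X"
 unfolding obj_class_def by (simp add: gdim_coset[OF obj_gen_carrier] clsdim_frag cval)

lemma gdim_hom: "gdim : ring_hom (grothendieck_ring C) (ring_of_type_algebra :: real ring)"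
proof (rule ring_hom_memI)
 interpret R: ring "crg" by (rule ring_class_ring)
 note h = coset_hom and F = clsdim_hom
 show "gdim \<one>\<^bsub>grothendieck_ring C\<^esub> = \<one>\<^bsub>ring_of_type_algebra\<^esub>"
  unfolding ring_hom_one[OF h, symmetric] gdim_coset[OF R.one_closed] by (rule ring_hom_one[OF F])
 fix x y assume "x : carrier (grothendieck_ring C)" "y : carrier (grothendieck_ring C)"
 then obtain a b where ab: "a : carrier (crg)" "x = gid +>\<^bsub>crg\<^esub> a"
  "b : carrier (crg)" "y = gid +>\<^bsub>crg\<^esub> b" by (auto simp: carrier_grothendieck)
 show "gdim (x \<otimes>\<^bsub>grothendieck_ring C\<^esub> y) = gdim x \<otimes>\<^bsub>ring_of_type_algebra\<^esub> gdim y"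
  unfolding ab(2,4) ring_hom_mult[OF h ab(1,3), symmetric] gdim_coset[OF R.m_closed[OF ab(1,3)]] gdim_coset[OF ab(1)] gdim_coset[OF ab(3)]
  by (rule ring_hom_mult[OF F ab(1,3)])
 show "gdim (x \<oplus>\<^bsub>grothendieck_ring C\<^esub> y) = gdim x \<oplus>\<^bsub>ring_of_type_algebra\<^esub> gdim y"
  unfolding ab(2,4) ring_hom_add[OF h ab(1,3), symmetric] gdim_coset[OF R.a_closed[OF ab(1,3)]] gdim_coset[OF ab(1)] gdim_coset[OF ab(3)]
  by (rule ring_hom_add[OF F ab(1,3)])
qed (simp add: real_ring_simps)

text \<open>A competitor is additive on split sequences, so on objects it is determined by the
  simple constituents. Restricted to the simple objects it is a positive character and therefore
  equals \<open>v\<close>; the classes of objects generate the ring.\<close>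

lemma gdim_unique:
 assumes d: "d : ring_hom (grothendieck_ring C) (ring_of_type_algebra :: real ring)"
  and ext: "d : extensional (carrier (grothendieck_ring C))"
  and ge: "ALL X:Ob. \<not> zero_object C X --> d (obj_class C X) \<ge> 1"
 shows "d = gdim"
proof -
 interpret R: ring "crg" by (rule ring_class_ring)
 note h = coset_hom and r = repsD[OF I(1)]
 define D where "D a = d (gid +>\<^bsub>crg\<^esub> a)" for a
 have cl: "gid +>\<^bsub>crg\<^esub> a : carrier (grothendieck_ring C)" if "a : carrier (crg)" for a
  using that by (auto simp: carrier_grothendieck)
 have Dadd: "D (a + b) = D a + D b" if "a : carrier (crg)" "b : carrier (crg)" for a b
  using ring_hom_add[OF h that] ring_hom_add[OF d cl[OF that(1)] cl[OF that(2)]] by (simp add: D_def class_ring_simps(3) real_ring_simps)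
 have Dmul: "D (cmul a b) = D a * D b" if "a : carrier (crg)" "b : carrier (crg)" for a b
  using ring_hom_mult[OF h that] ring_hom_mult[OF d cl[OF that(1)] cl[OF that(2)]] by (simp add: D_def real_ring_simps)
 have D1: "D (frag_of (icl \<bbbI>)) = 1"
  using ring_hom_one[OF h] ring_hom_one[OF d] by (simp add: D_def class_ring_simps(4) real_ring_simps)
 have z: "0 : carrier (crg)" by (simp add: class_ring_simps)
 have D0: "D 0 = 0" using Dadd[OF z z] by simp
 have cd: "a - b : carrier (crg)" if "a : carrier (crg)" "b : carrier (crg)" for a b
  using that unfolding class_ring_simps mem_Collect_eq by (rule keys_diff_subset)
 have Ddiff: "D (a - b) = D a - D b" if "a : carrier (crg)" "b : carrier (crg)" for a b
  using Dadd[OF cd[OF that] that(2)] by simp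
 define g where "g X = D (obj_gen C X)" for X
 have g1: "g X \<ge> 1" if "X : Ob" "\<not> zero_object C X" for X using ge that by (simp add: g_def D_def obj_class_def)
 have gx: "g Y = g X + g Z" if e: "short_exact C X Y Z f q" and O: "X : Ob" "Y : Ob" "Z : Ob" for X Y Z f q
 proof -
  note o = obj_gen_carrier[OF O(1)] obj_gen_carrier[OF O(2)] obj_gen_carrier[OF O(3)]
  have "g Y - g X - g Z = D (obj_gen C Y - obj_gen C X - obj_gen C Z)"
   unfolding g_def Ddiff[OF cd[OF o(2,1)] o(3)] Ddiff[OF o(2,1)] ..
  also have "... = D 0" unfolding D_def coset_ideal[OF exact_in_ideal[OF e O]]
   using coset_ideal[of 0] additive_subgroup.zero_closed[OF ideal.axioms(1)[OF grothendieck_ideal]] by (simp add: class_ring_simps)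
  finally show ?thesis using D0 by simp
 qed
 have gs: "g X = g A + g B" if "split_pair C X A f q B k t" for X A B f q k t
  using gx[OF split_pair_short_exact[OF that]] split_pairD(17,18,19)[OF that] by simp
 have gi: "g X = g Y" if "X : Ob" "Y : Ob" "isom X Y" for X Y
  using iso_class_eq_iff[OF that(1,2)] that(3) by (simp add: g_def)
 \<comment> \<open>Induction on \<open>dim End(X)\<close>, removing one simple summand at a
   time.\<close>
 have gsum: "g X = (\<Sum>S\<in>I. real (dm S X) * g S)" if "X : Ob" for X
  using that
 proof (induction "dm X X" arbitrary: X rule: less_induct)
  case less
  show ?case
  proof (cases "zero_object C X")
   case True
   have z2: "dm S X = 0" if "S : I" for S
    using split_pair_hdim(1)[OF split_pair_zero[OF True] r(3)[OF that]] by simp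
   have "g X = 0" using gs[OF split_pair_zero[OF True]] by simp
   thus ?thesis using z2 by simp
  next
   case False
   hence "ii X ~= nl X X" using less.prems zero_object_iff by auto
   then obtain W i p where W: "smp W" "ar i" "src i = W" "tgt i = X" "ar p" "src p = X" "tgt p = W" "p *. i = ii W"
    by (rule nonzero_simple_summand[OF less.prems])
   obtain B k q where sp: "split_pair C X W i p B k q" by (rule idempotent_complement[OF W(2-8)])
   have O: "W : Ob" "B : Ob" using split_pairD[OF sp] by auto
   have "dm W W = 1" using hdim_simple[OF W(1,1)] iso_refl[OF O(1)] by simp
   hence "dm B B < dm X X"
    using split_pair_hdim(2)[OF sp less.prems] split_pair_hdim(1)[OF sp O(1)] split_pair_hdim(1)[OF sp O(2)] by simp
   hence gB: "g B = (\<Sum>S\<in>I. real (dm S B) * g S)" by (rule less.hyps[OF _ O(2)])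
   obtain T where T: "T : I" "isom W T" using I(1) W(1) unfolding reps_def by blast
   have hW: "dm S W = (if S = T then 1 else 0)" if "S : I" for S
    using hdim_iso_right[OF r(3)[OF that] O(1) r(3)[OF T(1)] T(2)] r(4)[OF that T(1)] by simp
   have "(\<Sum>S\<in>I. real (dm S W) * g S) = (\<Sum>S\<in>I. if S = T then g S else 0)"
    by (intro sum.cong refl) (use hW in auto)
   also have "... = g T" using r(1) T(1) by simp
   finally have gW: "g W = (\<Sum>S\<in>I. real (dm S W) * g S)" using gi[OF O(1) r(3)[OF T(1)] T(2)] by simp
   have "g X = (\<Sum>S\<in>I. real (dm S W) * g S) + (\<Sum>S\<in>I. real (dm S B) * g S)"
    using gs[OF sp] gW gB by simp
   also have "... = (\<Sum>S\<in>I. real (dm S X) * g S)"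
    unfolding sum.distrib[symmetric] by (intro sum.cong refl) (use split_pair_hdim(1)[OF sp] r(3) in "simp add: distrib_right")
   finally show ?thesis .
  qed
 qed
 have "pchar I g"
  unfolding pchar_def
 proof (intro conjI ballI)
  show "g \<bbbI> = 1" using D1 by (simp add: g_def)
  show "0 < g A" if "A : I" for A using g1[OF r(3)[OF that]] r(2)[OF that] by (force simp: simple_object_def)
  fix A B assume AB: "A : I" "B : I"
  note O = r(3)[OF AB(1)] r(3)[OF AB(2)]
  have "g A * g B = g (A >< B)"
   using Dmul[OF obj_gen_carrier[OF O(1)] obj_gen_carrier[OF O(2)]] by (simp add: g_def cmul_frag_of class_tensor_iso_class[OF O])
  thus "g A * g B = (\<Sum>Z\<in>I. real (dm Z (A >< B)) * g Z)" using gsum[of "A >< B"] O by simp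
 qed
 hence gv: "g A = v A" if "A : I" for A using pchar_unique[OF I _ v that] by blast
 have gf: "g X = fdim I v X" if "X : Ob" for X
  unfolding fdim_def[OF I] gsum[OF that] by (intro sum.cong refl) (use gv in simp)
 have DF: "D a = clsdim cval a" if "Poly_Mapping.keys a \<subseteq> iso_classes C" for a
 proof -
  have "Poly_Mapping.keys a \<subseteq> iso_classes C & D a = clsdim cval a" using that
  proof (induction a rule: frag_induction)
   case (one P)
   then obtain X where X: "X : Ob" "P = icl X" by (auto simp: iso_classes_def)
   thus ?case using gf[OF X(1)] one by (simp add: clsdim_frag cval g_def)
  next
   case (diff a b)
   thus ?case using Ddiff[of a b] keys_diff_subset[of a "iso_classes C" b] by (simp add: class_ring_simps clsdim_diff)
  qed (simp add: D0 clsdim_zero)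
  thus ?thesis by blast
 qed
 show ?thesis
 proof (rule extensionalityI[OF ext])
  show "gdim : extensional (carrier (grothendieck_ring C))" by (simp add: extensional_def gdim_def)
  fix c assume "c : carrier (grothendieck_ring C)"
  then obtain a where a: "a : carrier (crg)" "c = gid +>\<^bsub>crg\<^esub> a" by (auto simp: carrier_grothendieck)
  show "d c = gdim c" using DF[of a] a gdim_coset[OF a(1)] by (simp add: D_def class_ring_simps)
 qed
qed

lemma FPdim_obj: "X : Ob ==> FPdim C (obj_class C X) = fdim I v X"
proof -
 assume X: "X : Ob"
 have "FPdim C = gdim"
  unfolding FPdim_def
 proof (rule the_equality)
  show "gdim : ring_hom (grothendieck_ring C) (ring_of_type_algebra :: real ring) & gdim : extensional (carrier (grothendieck_ring C)) &
   (ALL X:Ob. \<not> zero_object C X --> gdim (obj_class C X) \<ge> 1)"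
   using gdim_hom gdim_obj fdim_ge_1[OF I v] by (simp add: extensional_def gdim_def)
 qed (use gdim_unique in blast)
 thus ?thesis using gdim_obj[OF X] by simp
qed

end

end

theorem theorem6p6:
  fixes K :: "'k ring" and p :: nat and C :: "('k, 'o, 'm) braided_cat"
  assumes "algebraically_closed K" and "has_characteristic K p"
    and "symmetric_fusion_category K C"
    and "cat_rank C = 4"
    and "card (iso_class C ` {X. simple_object C X \<and> self_dual C X}) = 2"
  shows "integral_category C"
proof -
  interpret S: symmetric_fusion_category K C by fact
  interpret ac_symmetric K C
    by (intro ac_symmetric.intro ac_fusion.intro ac_fusion_axioms.intro assms(1) S.symmetric_fusion_category_axioms S.fusion_category_axioms)
  obtain I Y X X' where I: "reps I" "I = {\<bbbI>\<^bsub>C\<^esub>, Y, X, X'}" "distinct [\<bbbI>\<^bsub>C\<^esub>, Y, X, X']" "dl I Y = Y" "dl I X = X'" "dl I X' = X"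
    by (rule four_simples[OF assms(4,5)])
  have u: "\<bbbI>\<^bsub>C\<^esub> \<in> I" using I(2) by simp
  note r = repsD[OF I(1)]
  \<comment> \<open>\<open>bool \<times> bool\<close> serves as the index type with four elements
    for the Perron theorem.\<close>
  have "card (UNIV :: (bool \<times> bool) set) = card I" using I(3) by (simp add: I(2) card_UNIV_bool flip: UNIV_Times_UNIV)
  then obtain h :: "bool \<times> bool \<Rightarrow> 'o" where "bij_betw h UNIV I" using finite_same_card_bij[OF finite r(1)] by blast
  then obtain v where v: "pchar I v" using pchar_exists[OF I(1) u] by blast
  have "fus_char I (\<lambda>S. complex_of_real (v S))"
    unfolding fus_char_def
  proof (intro conjI ballI)
    show "complex_of_real (v \<bbbI>\<^bsub>C\<^esub>) = 1" using v by (simp add: pchar_def)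
    fix A B assume "A \<in> I" "B \<in> I"
    then have "v A * v B = (\<Sum>Z\<in>I. real (hdim K C Z (A \<boxtimes>\<^bsub>C\<^esub> B)) * v Z)" using v by (simp add: pchar_def)
    from arg_cong[OF this, of complex_of_real]
    show "complex_of_real (v A) * complex_of_real (v B) = (\<Sum>Z\<in>I. of_nat (hdim K C Z (A \<boxtimes>\<^bsub>C\<^esub> B)) * complex_of_real (v Z))"
      by simp
  qed
  note ng = nonintegral_near_group[OF I this pchar_ge_1[OF I(1) u v]]
  have vZ: "\<forall>S\<in>I. v S \<in> \<int>"
  proof (rule ccontr)
    assume "\<not> (\<forall>S\<in>I. v S \<in> \<int>)"
    from ng[OF _ this] show False using near_group_impossible[OF I] by blast
  qed
  show ?thesis
    unfolding integral_category_def
  proof (intro allI impI)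
    fix S assume S: "simple_object C S"
    then obtain T where T: "T \<in> I" "isomorphic C S T" using I(1) unfolding reps_def by blast
    have "FPdim C (obj_class C S) = fdim I v S" by (rule FPdim_obj[OF I(1) u v simple_obj[OF S]])
    also have "\<dots> = fdim I v T" by (rule fdim_iso[OF I(1) u simple_obj[OF S] r(3)[OF T(1)] T(2)])
    also have "\<dots> = v T" by (rule fdim_rep[OF I(1) u T(1)])
    finally show "FPdim C (obj_class C S) \<in> \<int>" using vZ T(1) by simp
  qed
qed

end
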